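(* There is an explicit algorithm that computes the binary expansion of an absolutely normal real number $z\in[0,1)$ in nearly linear time: the $n$th bit of $z$ is output after $O(n\log^{c}n)$ computation steps, for some constant $c$.
   Context: A real $\alpha$ is normal in base $b\ge2$ if for every $m\ge1$ and every string $w$ of $m$ base-$b$ digits, the asymptotic frequency of occurrences of $w$ in the base-$b$ expansion of $\alpha$ is $b^{-m}$; it is absolutely normal if it is normal in every base $b\ge2$. Computation steps are measured on a log-cost RAM. *)

theory Defs
  imports Complex_Main
begin

definition digit :: "nat \<Rightarrow> real \<Rightarrow> nat \<Rightarrow> nat" where
  "digit b x k = nat (\<lfloor>x * real b ^ (k + 1)\<rfloor> mod int b)"

definition occ :: "nat \<Rightarrow> real \<Rightarrow> nat list \<Rightarrow> nat \<Rightarrow> nat" where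
  "occ b x w N = card {i. i < N \<and> (\<forall>j < length w. digit b x (i + j) = w ! j)}"

definition normal_in_base :: "nat \<Rightarrow> real \<Rightarrow> bool" where
  "normal_in_base b x \<longleftrightarrow>
     (\<forall>w. w \<noteq> [] \<and> (\<forall>d \<in> set w. d < b) \<longrightarrow>
        (\<lambda>N. real (occ b x w N) / real N) \<longlonglongrightarrow> 1 / real b ^ length w)"

definition absolutely_normal :: "real \<Rightarrow> bool" where
  "absolutely_normal x \<longleftrightarrow> (\<forall>b \<ge> 2. normal_in_base b x)"

datatype instr = Const nat nat | Add nat nat nat | Sub nat nat nat | Load nat nat | Store nat nat
  | Jz nat nat | Out nat

record config =
  pc :: nat
  regs :: "nat \<Rightarrow> nat"
  outp :: "bool list"

fun blen :: "nat \<Rightarrow> nat" where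
  "blen n = (if n < 2 then 1 else 1 + blen (n div 2))"

definition exec :: "instr \<Rightarrow> config \<Rightarrow> config" where
  "exec ins c = (let R = regs c; p = pc c in case ins of
      Const i k \<Rightarrow> c\<lparr>pc := p + 1, regs := R(i := k)\<rparr>
    | Add i j k \<Rightarrow> c\<lparr>pc := p + 1, regs := R(i := R j + R k)\<rparr>
    | Sub i j k \<Rightarrow> c\<lparr>pc := p + 1, regs := R(i := R j - R k)\<rparr>
    | Load i j \<Rightarrow> c\<lparr>pc := p + 1, regs := R(i := R (R j))\<rparr>
    | Store i j \<Rightarrow> c\<lparr>pc := p + 1, regs := R(R i := R j)\<rparr>
    | Jz i l \<Rightarrow> c\<lparr>pc := (if R i = 0 then l else p + 1)\<rparr>
    | Out i \<Rightarrow> c\<lparr>pc := p + 1, outp := outp c @ [R i \<noteq> 0]\<rparr>)"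

definition icost :: "instr \<Rightarrow> config \<Rightarrow> nat" where
  "icost ins c = (let R = regs c in case ins of
      Const i k \<Rightarrow> blen i + blen k
    | Add i j k \<Rightarrow> blen i + blen j + blen k + blen (R j) + blen (R k)
    | Sub i j k \<Rightarrow> blen i + blen j + blen k + blen (R j) + blen (R k)
    | Load i j \<Rightarrow> blen i + blen j + blen (R j) + blen (R (R j))
    | Store i j \<Rightarrow> blen i + blen (R i) + blen j + blen (R j)
    | Jz i l \<Rightarrow> blen i + blen (R i) + blen l
    | Out i \<Rightarrow> blen i + blen (R i))"

definition step :: "instr list \<Rightarrow> config \<Rightarrow> config" where
  "step P c = (if pc c < length P then exec (P ! pc c) c else c)"

definition step_cost :: "instr list \<Rightarrow> config \<Rightarrow> nat" where
  "step_cost P c = (if pc c < length P then icost (P ! pc c) c else 0)"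

definition init :: config where
  "init = \<lparr>pc = 0, regs = (\<lambda>_. 0), outp = []\<rparr>"

definition run :: "instr list \<Rightarrow> nat \<Rightarrow> config" where
  "run P t = (step P ^^ t) init"

definition cost :: "instr list \<Rightarrow> nat \<Rightarrow> nat" where
  "cost P t = (\<Sum>s<t. step_cost P (run P s))"

end

theory Submission
  imports Defs "HOL-Computational_Algebra.Polynomial"
begin

text \<open>
  The number is produced in stages; stage k doubles the number of bits from 2^k to 2^(k + 1). Within
  a stage the new bits are chosen in blocks of about 8 log k bits by exhaustive search: a
  variance estimate shows that for some choice of the block the next digits in each of the bases
  2, ..., log log k + O(1) contain every digit with almost the right frequency. Since only upper
  bounds on digit frequencies are needed, this makes the number simply normal in every base, hence
  absolutely normal.

  To run the search one needs, for every base b and every prefix p of n bits, the fractional part of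
  b^m p/2^n and the slope b^m/2^n to a precision proportional to the length of the block. These
  are propagated down a binary tree of blocks: the left half truncates the state of its parent, the
  right half multiplies it by a power of b. The numbers at a node have length proportional to the number of
  bits below it, so with a quasi-linear multiplication of binary numbers (Nussbaumer's polynomial transform)
  every level of the tree costs 2^k times a power of k.

  The algorithm is written as a functional program on binary trees, run by a small stack machine
  which is in turn compiled to the random access machine.
\<close>

section \<open>Decision trees on binary trees and their compilation to the RAM\<close>

text \<open>Everything is tuned to k, which is about log n: a cost of any fixed power of k per bit
  is affordable. With blocks of 2^j <= 8 log k bits, exhaustive search runs through 2^(2^j)
  candidates, a fixed power of k. It succeeds because Chebyshev leaves a bad fraction that is a
  polynomial in j divided by the number of tested digits, and that number is at least of order 2^j /
  j; so j bases can be served by one block. As j tends to infinity with k, every base is eventually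
  included and the tolerance 1/j vanishes. Two obstacles shape the details. The states are
  truncated, so the digits of a block are known only up to one unit in the last place; the search
  therefore demands that both neighbouring strings be good. And powers of b do not line up with
  powers of 2, so up to five digits between consecutive blocks stay uncontrolled; they are
  negligible against the length of a block. On the machine side, the time bounds cover recursion
  with one or two calls, and other call patterns are rearranged to fit.\<close>

datatype tree = Lf | Nd tree tree

primrec tcar :: "tree => tree" where
 "tcar Lf = Lf" | "tcar (Nd a b) = a"

primrec tcdr :: "tree => tree" where
 "tcdr Lf = Lf" | "tcdr (Nd a b) = b"

primrec sub_at :: "bool list => tree => tree" where
 "sub_at [] t = t"
| "sub_at (b # p) t = sub_at p (if b then tcdr t else tcar t)"

text \<open>An expression builds a new tree from subtrees of the old one. On the RAM a subtree is a
  shared pointer and is never copied, so evaluation allocates exactly two words per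
  \<open>Nx\<close>.\<close>

datatype ex = Px "bool list" | Lx | Nx ex ex

primrec evx :: "ex => tree => tree" where
 "evx (Px p) t = sub_at p t"
| "evx Lx t = Lf"
| "evx (Nx a b) t = Nd (evx a t) (evx b t)"

primrec xdepth :: "ex => nat" where
 "xdepth (Px p) = 0" | "xdepth Lx = 0"
| "xdepth (Nx a b) = Suc (max (xdepth a) (xdepth b))"

primrec xcells :: "ex => nat" where
 "xcells (Px p) = 0" | "xcells Lx = 0"
| "xcells (Nx a b) = xcells a + xcells b + 2"

text \<open>A fixed decision tree is the whole transition function of a machine. Its size does not
  depend on the data, so one transition is a bounded number of RAM instructions.\<close>

datatype dt = Test "bool list" dt dt | Do "bool list option" ex

primrec evd :: "dt => tree => tree \<times> bool list" where
 "evd (Test p a b) t = (if sub_at p t = Lf then evd a t else evd b t)"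
| "evd (Do q e) t = (evx e t, case q of None => [] | Some p => [sub_at p t \<noteq> Lf])"

primrec ddepth :: "dt => nat" where
 "ddepth (Test p a b) = max (ddepth a) (ddepth b)"
| "ddepth (Do q e) = xdepth e"

primrec dcells :: "dt => nat" where
 "dcells (Test p a b) = max (dcells a) (dcells b)"
| "dcells (Do q e) = xcells e"

text \<open>Register conventions: 0 and 1 always hold 0, so that both projections of the null
 pointer 0 are again 0; 2 holds the constant 1, 3 the first free heap cell, 4 the root.\<close>

primrec cwalk :: "nat => bool list => instr list" where
 "cwalk d [] = []"
| "cwalk d (b # p) = (if b then [Add d d 2] else []) @ Load d d # cwalk d p"

definition cpath :: "nat => bool list => instr list" where
 "cpath d p = Add d 4 0 # cwalk d p"

text \<open>Register \<open>d\<close> receives the result and the registers above it form the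
  evaluation stack. A new cell is written at the heap top held in register 3. Cells are never
  overwritten or freed, so trees that exist stay represented.\<close>

primrec cex :: "nat => ex => instr list" where
 "cex d (Px p) = cpath d p"
| "cex d Lx = [Const d 0]"
| "cex d (Nx a b) = cex d a @ cex (d + 1) b @
  [Store 3 d, Add 3 3 2, Store 3 (d + 1), Add 3 3 2, Sub d 3 2, Sub d d 2]"

text \<open>Jump targets are absolute, hence the parameter \<open>i\<close> for the current address;
  \<open>l0\<close> is the entry of the main loop. Register 0 holds 0, so \<open>Jz 0 l0\<close>
  jumps unconditionally and \<open>Add 4 5 0\<close> is a copy into the root register.\<close>

primrec cdt :: "nat => nat => dt => instr list" where
 "cdt l0 i (Test p a b) =
  (let i' = i + length (cpath 5 p) + 1; cb = cdt l0 i' b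
   in cpath 5 p @ Jz 5 (i' + length cb) # cb @ cdt l0 (i' + length cb) a)"
| "cdt l0 i (Do q e) = (case q of None => [] | Some p => cpath 5 p @ [Out 5])
  @ cex 5 e @ [Add 4 5 0, Jz 0 l0]"

definition reach :: "instr list => config => nat => nat => config => bool" where
 "reach P c n k c' \<longleftrightarrow> (step P ^^ n) c = c' \<and> (\<Sum>s<n. step_cost P ((step P ^^ s) c)) <= k"

lemma reach_refl: "reach P c 0 k c"
 by (simp add: reach_def)

lemma reach_trans:
 assumes "reach P c n k c'" "reach P c' n' k' c''"
 shows "reach P c (n + n') (k + k') c''"
proof -
 have *: "(step P ^^ (n + s)) c = (step P ^^ s) c'" for s
  using assms(1) by (simp add: reach_def add.commute[of n] funpow_add)
 have "(\<Sum>s<n + n'. step_cost P ((step P ^^ s) c))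
  = (\<Sum>s<n. step_cost P ((step P ^^ s) c)) + (\<Sum>s<n'. step_cost P ((step P ^^ (n + s)) c))"
  by (induction n') auto
 then show ?thesis using assms * by (auto simp: reach_def)
qed

lemma reach_step:
 assumes "pc c < length P" "icost (P ! pc c) c <= k"
 shows "reach P c 1 k (exec (P ! pc c) c)"
 using assms by (simp add: reach_def step_def step_cost_def)

primrec execs :: "instr list => config => config" where
 "execs [] c = c" | "execs (i # is) c = execs is (exec i c)"

primrec costs :: "instr list => config => nat" where
 "costs [] c = 0" | "costs (i # is) c = icost i c + costs is (exec i c)"

lemma execs_append: "execs (a @ b) c = execs b (execs a c)"
 by (induction a arbitrary: c) auto

lemma costs_append: "costs (a @ b) c = costs a c + costs b (execs a c)"
 by (induction a arbitrary: c) auto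

definition frag :: "instr list => nat => instr list => bool" where
 "frag P i c \<longleftrightarrow> (\<exists>u v. P = u @ c @ v \<and> length u = i)"

lemma frag_append: "frag P i (a @ b) \<longleftrightarrow> frag P i a \<and> frag P (i + length a) b"
proof
 assume "frag P i (a @ b)"
 then obtain u v where uv: "P = u @ (a @ b) @ v" "length u = i" unfolding frag_def by blast
 then have "P = u @ a @ (b @ v)" "P = (u @ a) @ b @ v" "length (u @ a) = i + length a" by auto
 with uv(2) show "frag P i a \<and> frag P (i + length a) b" unfolding frag_def by blast
next
 assume "frag P i a \<and> frag P (i + length a) b"
 then obtain u v u' v' where uv: "P = u @ a @ v" "length u = i"
  "P = u' @ b @ v'" "length u' = i + length a" unfolding frag_def by blast
 then have "(u @ a) @ v = u' @ (b @ v')" "length (u @ a) = length u'" by auto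
 then have "u @ a = u'" "v = b @ v'" by (metis append_eq_append_conv)+
 then have "P = u @ (a @ b) @ v'" using uv by simp
 then show "frag P i (a @ b)" using uv(2) unfolding frag_def by blast
qed

lemma frag_Cons: "frag P i (x # b) \<longleftrightarrow> frag P i [x] \<and> frag P (Suc i) b"
 using frag_append[of P i "[x]" b] by simp

lemma frag_nth: "frag P i [x] ==> i < length P \<and> P ! i = x"
 by (auto simp: frag_def nth_append)

primrec jfree :: "instr => bool" where
 "jfree (Const i k) = True" | "jfree (Add i j k) = True" | "jfree (Sub i j k) = True"
| "jfree (Load i j) = True" | "jfree (Store i j) = True" | "jfree (Jz i l) = False"
| "jfree (Out i) = True"

lemma pc_exec: "jfree i ==> pc (exec i c) = Suc (pc c)"
 by (cases i) (auto simp: exec_def Let_def)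

lemma reach_straight:
 "frag P (pc c) is ==> list_all jfree is ==> reach P c (length is) (costs is c) (execs is c)"
proof (induction "is" arbitrary: c)
 case Nil
 then show ?case by (simp add: reach_refl)
next
 case (Cons i "is")
 from Cons.prems(1) have f: "frag P (pc c) [i]" "frag P (Suc (pc c)) is"
  by (simp_all add: frag_Cons[of P "pc c" i "is"])
 have 1: "reach P c 1 (icost i c) (exec i c)"
  using reach_step[of c P] frag_nth[OF f(1)] by simp
 have 2: "reach P (exec i c) (length is) (costs is (exec i c)) (execs is (exec i c))"
  using Cons f(2) pc_exec[of i c] by simp
 show ?case using reach_trans[OF 1 2] by simp
qed

lemma blen_mono: "m <= n ==> blen m <= blen n"
proof (induction n arbitrary: m rule: blen.induct)
 case (1 n)
 show ?case
 proof (cases "m < 2")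
  case True then show ?thesis by (subst (1 2) blen.simps) auto
 next
  case False
  then have "\<not> n < 2" "m div 2 <= n div 2" using 1(2) by auto
  then have "blen (m div 2) <= blen (n div 2)" using 1(1) by blast
  then show ?thesis using False \<open>\<not> n < 2\<close> by (subst (1 2) blen.simps) auto
 qed
qed

declare blen.simps[simp del]

primrec nums :: "instr => nat set" where
 "nums (Const i k) = {i, k}" | "nums (Add i j k) = {i, j, k}" | "nums (Sub i j k) = {i, j, k}"
| "nums (Load i j) = {i, j}" | "nums (Store i j) = {i, j}" | "nums (Jz i l) = {i, l}"
| "nums (Out i) = {i}"

text \<open>An instruction is charged at most five binary lengths (five for \<open>Add\<close> and
  \<open>Sub\<close>), each of an operand or of the contents of a memory word.\<close>

lemma icost_le:
 assumes "\<forall>a. regs c a <= V" "\<forall>x\<in>nums i. x <= V"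
 shows "icost i c <= 5 * blen V"
proof -
 have r: "blen (regs c a) <= blen V" for a using assms(1) blen_mono by blast
 have n: "\<forall>x\<in>nums i. blen x <= blen V" using assms(2) blen_mono by blast
 show ?thesis
 proof (cases i)
  case (Add x1 x2 x3)
  then show ?thesis using n r[of x2] r[of x3] by (simp add: icost_def Let_def)
 next
  case (Sub x1 x2 x3)
  then show ?thesis using n r[of x2] r[of x3] by (simp add: icost_def Let_def)
 next
  case (Load x1 x2)
  then show ?thesis using n r[of x2] r[of "regs c x2"] by (simp add: icost_def Let_def)
 next
  case (Store x1 x2)
  then show ?thesis using n r[of x2] r[of x1] by (simp add: icost_def Let_def)
 next
  case (Jz x1 x2)
  then show ?thesis using n r[of x1] by (simp add: icost_def Let_def)
 next
  case (Out x1)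
  then show ?thesis using n r[of x1] by (simp add: icost_def Let_def)
 qed (use n in \<open>simp add: icost_def Let_def\<close>)
qed

text \<open>The two components sit in the words \<open>p\<close> and \<open>p + 1\<close>, and 0 is
  the null pointer. Cells are immutable, so subtrees may share storage freely.\<close>

primrec rep :: "nat => (nat => nat) => nat => nat => tree => bool" where
 "rep h R H p Lf \<longleftrightarrow> p = 0"
| "rep h R H p (Nd a b) \<longleftrightarrow> h <= p \<and> p + 1 < H \<and> rep h R H (R p) a \<and> rep h R H (R (p + 1)) b"

lemma rep_mono:
 "rep h R H p t ==> H <= H' ==> (\<And>a. h <= a ==> a < H ==> R' a = R a) ==> rep h R' H' p t"
 by (induction t arbitrary: p) auto

text \<open>The last conjunct bounds every memory word, register or heap, by the heap top. This ties
  the logarithmic cost of an instruction to the number of words allocated so far. Registers 0 to 5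
  are reserved, hence \<open>6 <= h\<close>.\<close>

definition good_regs :: "nat => (nat => nat) => nat => bool" where
 "good_regs h R H \<longleftrightarrow> R 0 = 0 \<and> R 1 = 0 \<and> R 2 = 1 \<and> R 3 = H \<and> 6 <= h \<and> h <= H \<and> (\<forall>a. R a <= H)"

lemma cwalk_correct:
 assumes "good_regs h R H" "rep h R H (R d) t" "5 <= d" "d < h" "H <= V"
 shows "\<exists>v. execs (cwalk d p) \<lparr>pc = q, regs = R, outp = u\<rparr>
   = \<lparr>pc = q + length (cwalk d p), regs = R(d := v), outp = u\<rparr> \<and> rep h R H v (sub_at p t) \<and> v <= H
  \<and> costs (cwalk d p) \<lparr>pc = q, regs = R, outp = u\<rparr> <= length (cwalk d p) * (5 * blen V)"
 using assms
proof (induction p arbitrary: R t q)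
 case Nil
 then show ?case by (auto simp: good_regs_def intro!: exI[of _ "R d"])
next
 case (Cons b p)
 note g = Cons.prems(1)[unfolded good_regs_def]
 define x where "x = (if b then R d + 1 else R d)"
 have rx: "rep h R H (R x) (if b then tcdr t else tcar t)"
  using Cons.prems(2) g by (cases t) (auto simp: x_def)
 have xd: "x \<noteq> d" using Cons.prems(2-4) by (cases t) (auto simp: x_def)
 have xH: "x <= H" using Cons.prems(2) g by (cases t) (auto simp: x_def)
 define R1 where "R1 = R(d := R x)"
 have g1: "good_regs h R1 H" using g Cons.prems(3) by (auto simp: good_regs_def R1_def)
 have r1: "rep h R1 H (R1 d) (if b then tcdr t else tcar t)"
  unfolding R1_def using rep_mono[OF rx order_refl, of "R(d := R x)"] Cons.prems(4) by auto
 let ?pre = "(if b then [Add d d 2] else []) @ [Load d d]"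
 let ?c = "\<lparr>pc = q, regs = R, outp = u\<rparr>"
 have e: "execs ?pre ?c = \<lparr>pc = q + length ?pre, regs = R1, outp = u\<rparr>"
  using g Cons.prems(3) xd by (auto simp: exec_def Let_def R1_def x_def)
 have V: "\<forall>a. R a <= V" "d <= V" "2 <= V" "x <= V"
  using g Cons.prems xH by (auto intro: order_trans)
 have c1: "icost (Add d d 2) ?c <= 5 * blen V" by (rule icost_le) (use V in auto)
 have c2: "icost (Load d d) ?c <= 5 * blen V" by (rule icost_le) (use V in auto)
 have c3: "icost (Load d d) (exec (Add d d 2) ?c) <= 5 * blen V" if b
  by (rule icost_le) (use V g that in \<open>auto simp: exec_def Let_def x_def\<close>)
 have c: "costs ?pre ?c <= length ?pre * (5 * blen V)"
  using c1 c2 c3 by auto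
 from Cons.IH[OF g1 r1 Cons.prems(3-5), of "q + length ?pre"] obtain v where v:
  "execs (cwalk d p) \<lparr>pc = q + length ?pre, regs = R1, outp = u\<rparr>
   = \<lparr>pc = q + length ?pre + length (cwalk d p), regs = R1(d := v), outp = u\<rparr>"
  "rep h R1 H v (sub_at p (if b then tcdr t else tcar t))" "v <= H"
  "costs (cwalk d p) \<lparr>pc = q + length ?pre, regs = R1, outp = u\<rparr> <= length (cwalk d p) * (5 * blen V)"
  by blast
 have v2: "rep h R H v (sub_at (b # p) t)"
  using rep_mono[OF v(2) order_refl, of R] Cons.prems(4) by (auto simp: R1_def)
 have eq: "cwalk d (b # p) = ?pre @ cwalk d p" by simp
 have e2: "execs (cwalk d (b # p)) ?c = execs (cwalk d p) (execs ?pre ?c)"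
  "costs (cwalk d (b # p)) ?c = costs ?pre ?c + costs (cwalk d p) (execs ?pre ?c)"
  unfolding eq by (rule execs_append, rule costs_append)
 have l2: "length (cwalk d (b # p)) = length ?pre + length (cwalk d p)" by simp
 have "costs (cwalk d (b # p)) ?c <= length (cwalk d (b # p)) * (5 * blen V)"
  unfolding e2(2) e l2 add_mult_distrib using c v(4) by (rule add_mono)
 moreover have "execs (cwalk d (b # p)) ?c
   = \<lparr>pc = q + length (cwalk d (b # p)), regs = R(d := v), outp = u\<rparr>"
  unfolding e2(1) e v(1) l2 by (simp add: R1_def)
 ultimately show ?case using v v2 by blast
qed

lemma cpath_correct:
 assumes "good_regs h R H" "rep h R H (R 4) t" "5 <= d" "d < h" "H <= V"
 shows "\<exists>v. execs (cpath d p) \<lparr>pc = q, regs = R, outp = u\<rparr>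
   = \<lparr>pc = q + length (cpath d p), regs = R(d := v), outp = u\<rparr> \<and> rep h R H v (sub_at p t) \<and> v <= H
  \<and> costs (cpath d p) \<lparr>pc = q, regs = R, outp = u\<rparr> <= length (cpath d p) * (5 * blen V)"
proof -
 note g = assms(1)[unfolded good_regs_def]
 let ?c = "\<lparr>pc = q, regs = R, outp = u\<rparr>"
 define R1 where "R1 = R(d := R 4)"
 have e: "exec (Add d 4 0) ?c = \<lparr>pc = q + 1, regs = R1, outp = u\<rparr>"
  using g by (simp add: exec_def R1_def)
 have g1: "good_regs h R1 H" using g assms(3) by (auto simp: good_regs_def R1_def)
 have r1: "rep h R1 H (R1 d) t"
  unfolding R1_def using rep_mono[OF assms(2) order_refl, of "R(d := R 4)"] assms(4) by auto
 have c: "icost (Add d 4 0) ?c <= 5 * blen V"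
  by (rule icost_le) (use g assms in \<open>auto intro: order_trans\<close>)
 from cwalk_correct[OF g1 r1 assms(3-5), of p "q + 1" u] obtain v where v:
  "execs (cwalk d p) \<lparr>pc = q + 1, regs = R1, outp = u\<rparr>
   = \<lparr>pc = q + 1 + length (cwalk d p), regs = R1(d := v), outp = u\<rparr>"
  "rep h R1 H v (sub_at p t)" "v <= H"
  "costs (cwalk d p) \<lparr>pc = q + 1, regs = R1, outp = u\<rparr> <= length (cwalk d p) * (5 * blen V)"
  by blast
 have v2: "rep h R H v (sub_at p t)"
  using rep_mono[OF v(2) order_refl, of R] assms(4) by (auto simp: R1_def)
 show ?thesis
  unfolding cpath_def execs.simps costs.simps e
  by (rule exI[of _ v]) (use v v2 c in \<open>auto simp: R1_def\<close>)
qed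

text \<open>The two preservation clauses carry the induction: registers below \<open>d\<close> are
  kept, so the pointer to the first component survives the evaluation of the second one in
  \<open>d + 1\<close>; old heap cells are kept, so the input tree is still there.\<close>

lemma cex_correct:
 assumes "good_regs h R H" "rep h R H (R 4) t" "5 <= d" "d + xdepth e < h" "H + xcells e <= V"
 shows "\<exists>R'. execs (cex d e) \<lparr>pc = q, regs = R, outp = u\<rparr>
   = \<lparr>pc = q + length (cex d e), regs = R', outp = u\<rparr>
  \<and> good_regs h R' (H + xcells e) \<and> rep h R' (H + xcells e) (R' d) (evx e t)
  \<and> (\<forall>a. a < d \<longrightarrow> a \<noteq> 3 \<longrightarrow> R' a = R a) \<and> (\<forall>a. h <= a \<longrightarrow> a < H \<longrightarrow> R' a = R a)
  \<and> costs (cex d e) \<lparr>pc = q, regs = R, outp = u\<rparr> <= length (cex d e) * (5 * blen V)"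
 using assms
proof (induction e arbitrary: R H d q)
 case (Px p)
 note g = Px.prems(1)[unfolded good_regs_def]
 from cpath_correct[OF Px.prems(1-3), of V p q u] Px.prems obtain v where v:
  "execs (cpath d p) \<lparr>pc = q, regs = R, outp = u\<rparr>
   = \<lparr>pc = q + length (cpath d p), regs = R(d := v), outp = u\<rparr>" "rep h R H v (sub_at p t)" "v <= H"
  "costs (cpath d p) \<lparr>pc = q, regs = R, outp = u\<rparr> <= length (cpath d p) * (5 * blen V)"
  by auto
 have "rep h (R(d := v)) H v (sub_at p t)"
  using rep_mono[OF v(2) order_refl, of "R(d := v)"] Px.prems(4) by auto
 then show ?case using v g Px.prems(3,4) by (auto simp: good_regs_def)
next
 case Lx
 note g = Lx.prems(1)[unfolded good_regs_def]
 have "icost (Const d 0) \<lparr>pc = q, regs = R, outp = u\<rparr> <= 5 * blen V"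
  by (rule icost_le) (use g Lx.prems in \<open>auto intro: order_trans\<close>)
 then show ?case using g Lx.prems(3,4) by (auto simp: good_regs_def exec_def)
next
 case (Nx a b)
 let ?Ha = "H + xcells a" and ?Hb = "H + xcells a + xcells b"
 let ?c = "\<lparr>pc = q, regs = R, outp = u\<rparr>"
 have pr: "d + xdepth a < h" "H + xcells a <= V" "5 <= d + 1" "d + 1 + xdepth b < h"
  "?Ha + xcells b <= V" using Nx.prems by auto
 from Nx.IH(1)[OF Nx.prems(1-3) pr(1,2), of q] obtain R1 where R1:
  "execs (cex d a) ?c = \<lparr>pc = q + length (cex d a), regs = R1, outp = u\<rparr>"
  "good_regs h R1 ?Ha" "rep h R1 ?Ha (R1 d) (evx a t)"
  "\<And>a. a < d ==> a \<noteq> 3 ==> R1 a = R a" "\<And>a. h <= a ==> a < H ==> R1 a = R a"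
  "costs (cex d a) ?c <= length (cex d a) * (5 * blen V)" by blast
 have r4: "rep h R1 ?Ha (R1 4) t"
  using rep_mono[OF Nx.prems(2), of ?Ha R1] R1(4)[of 4] R1(5) Nx.prems(3) by auto
 let ?q1 = "q + length (cex d a)"
 from Nx.IH(2)[OF R1(2) r4 pr(3-5), of ?q1] obtain R2 where R2:
  "execs (cex (d+1) b) \<lparr>pc = ?q1, regs = R1, outp = u\<rparr>
   = \<lparr>pc = ?q1 + length (cex (d+1) b), regs = R2, outp = u\<rparr>"
  "good_regs h R2 ?Hb" "rep h R2 ?Hb (R2 (d+1)) (evx b t)"
  "\<And>a. a < d+1 ==> a \<noteq> 3 ==> R2 a = R1 a" "\<And>a. h <= a ==> a < ?Ha ==> R2 a = R1 a"
  "costs (cex (d+1) b) \<lparr>pc = ?q1, regs = R1, outp = u\<rparr> <= length (cex (d+1) b) * (5 * blen V)" by blast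
 note g2 = R2(2)[unfolded good_regs_def]
 have ra: "rep h R2 ?Hb (R2 d) (evx a t)"
  using rep_mono[OF R1(3), of ?Hb R2] R2(4)[of d] R2(5) Nx.prems(3) by auto
 define R3 where "R3 = R2(?Hb := R2 d, ?Hb + 1 := R2 (d+1), 3 := ?Hb + 2, d := ?Hb)"
 let ?l = "[Store 3 d, Add 3 3 2, Store 3 (d + 1), Add 3 3 2, Sub d 3 2, Sub d d 2]"
 let ?q2 = "?q1 + length (cex (d+1) b)"
 have hd: "d + 1 < ?Hb" "?Hb + 2 <= V" "6 <= h" "h <= ?Hb" using Nx.prems g2 pr by auto
 have R2le: "R2 a <= ?Hb" for a using g2 by auto
 have "R2 3 = ?Hb" "R2 2 = 1" using g2 by auto
 then have e3: "execs ?l \<lparr>pc = ?q2, regs = R2, outp = u\<rparr> = \<lparr>pc = ?q2 + 6, regs = R3, outp = u\<rparr>"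
  using hd Nx.prems(3) by (simp add: exec_def Let_def R3_def fun_eq_iff)
 have c3: "costs ?l \<lparr>pc = ?q2, regs = R2, outp = u\<rparr> <= 6 * (5 * blen V)"
 proof -
  have R2V: "\<forall>a. R2 a <= V" using R2le hd by (meson add_leD1 order_trans)
  have x: "d <= V" "d + 1 <= V" "3 <= V" "?Hb + 1 <= V" using hd by auto
  have *: "icost i \<lparr>pc = p, regs = R', outp = u\<rparr> <= 5 * blen V"
   if "\<forall>a. R' a <= V" "\<forall>x\<in>nums i. x <= V" for i p R' using icost_le that by simp
  show ?thesis using hd Nx.prems(3) \<open>R2 3 = ?Hb\<close> \<open>R2 2 = 1\<close>
   apply (simp only: costs.simps exec_def Let_def instr.case config.simps)
   apply (simp only: fun_upd_apply)
   apply simp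
   apply (rule order_trans[OF add_mono[OF * add_mono[OF * add_mono[OF * add_mono[OF * add_mono[OF * *]]]]]])
   using R2V x hd by auto
 qed
 have R3old: "R3 a = R2 a" if "h <= a" "a < ?Hb" for a
  using that Nx.prems(3,4) by (auto simp: R3_def)
 have "rep h R3 (?Hb + 2) (R3 ?Hb) (evx a t)" "rep h R3 (?Hb + 2) (R3 (?Hb + 1)) (evx b t)"
  using rep_mono[OF ra, of "?Hb + 2" R3] rep_mono[OF R2(3), of "?Hb + 2" R3] R3old hd
  by (auto simp: R3_def)
 then have rep3: "rep h R3 (?Hb + 2) (R3 d) (evx (Nx a b) t)" using hd by (simp add: R3_def)
 have g3: "good_regs h R3 (?Hb + 2)"
  using g2 Nx.prems(3) hd R2le by (auto simp: good_regs_def R3_def intro: le_SucI)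
 have "\<forall>a. a < d \<longrightarrow> a \<noteq> 3 \<longrightarrow> R3 a = R a" using R1(4) R2(4) hd by (auto simp: R3_def)
 moreover have "\<forall>a. h <= a \<longrightarrow> a < H \<longrightarrow> R3 a = R a" using R1(5) R2(5) R3old by auto
 moreover have "costs (cex d (Nx a b)) ?c <= length (cex d (Nx a b)) * (5 * blen V)"
  unfolding cex.simps costs_append R1(1) R2(1)
  using R1(6) R2(6) c3 by (simp add: algebra_simps)
 moreover have "execs (cex d (Nx a b)) ?c = \<lparr>pc = q + length (cex d (Nx a b)), regs = R3, outp = u\<rparr>"
  unfolding cex.simps execs_append R1(1) R2(1) e3 by simp
 ultimately show ?case using g3 rep3 by (auto simp: add.assoc)
qed

lemma jfree_cwalk: "list_all jfree (cwalk d p)"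
 by (induction p) auto

lemma jfree_cpath: "list_all jfree (cpath d p)"
 by (simp add: cpath_def jfree_cwalk)

lemma jfree_cex: "list_all jfree (cex d e)"
 by (induction e arbitrary: d) (auto simp: jfree_cpath)

lemma reach_weaken: "reach P c n k c' ==> k <= k' ==> reach P c n k' c'"
 by (auto simp: reach_def)

text \<open>Inside the code of a decision tree all jumps lead forward until the final return to
  \<open>l0\<close>. A pass therefore executes no instruction twice, and the code length bounds the
  number of steps.\<close>

lemma cdt_correct:
 assumes "frag P i (cdt l0 i D)" "good_regs h R H" "rep h R H (R 4) t"
  "5 + ddepth D < h" "H + dcells D <= V" "length P <= V" "l0 <= V"
 shows "\<exists>n R' H'. n <= length (cdt l0 i D) \<and>
  reach P \<lparr>pc = i, regs = R, outp = u\<rparr> n (n * (5 * blen V))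
   \<lparr>pc = l0, regs = R', outp = u @ snd (evd D t)\<rparr> \<and>
  good_regs h R' H' \<and> rep h R' H' (R' 4) (fst (evd D t)) \<and> H' <= H + dcells D"
 using assms
proof (induction D arbitrary: i R)
 case (Test p a b)
 note g = Test.prems(2)[unfolded good_regs_def]
 let ?c = "\<lparr>pc = i, regs = R, outp = u\<rparr>"
 define i' where "i' = i + length (cpath 5 p) + 1"
 define cb where "cb = cdt l0 i' b"
 define ca where "ca = cdt l0 (i' + length cb) a"
 have code: "cdt l0 i (Test p a b) = cpath 5 p @ Jz 5 (i' + length cb) # cb @ ca"
  by (simp add: i'_def cb_def ca_def Let_def)
 have f: "frag P i (cpath 5 p)" "frag P (i + length (cpath 5 p)) [Jz 5 (i' + length cb)]"
  "frag P i' cb" "frag P (i' + length cb) ca"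
  using Test.prems(1) unfolding code frag_append
   frag_Cons[of P "i + length (cpath 5 p)" "Jz 5 (i' + length cb)" "cb @ ca"]
  by (auto simp: i'_def frag_append)
 have lab: "i' + length cb <= V"
  using f(4) Test.prems(6) unfolding frag_def by auto
 have "\<exists>v. execs (cpath 5 p) ?c
   = \<lparr>pc = i + length (cpath 5 p), regs = R(5 := v), outp = u\<rparr> \<and> rep h R H v (sub_at p t) \<and> v <= H
  \<and> costs (cpath 5 p) ?c <= length (cpath 5 p) * (5 * blen V)"
  by (rule cpath_correct[OF Test.prems(2,3)]) (use Test.prems in auto)
 then obtain v where v: "execs (cpath 5 p) ?c
   = \<lparr>pc = i + length (cpath 5 p), regs = R(5 := v), outp = u\<rparr>" "rep h R H v (sub_at p t)" "v <= H"
  "costs (cpath 5 p) ?c <= length (cpath 5 p) * (5 * blen V)" by blast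
 let ?R1 = "R(5 := v)"
 let ?c1 = "\<lparr>pc = i + length (cpath 5 p), regs = ?R1, outp = u\<rparr>"
 have r1: "reach P ?c (length (cpath 5 p)) (length (cpath 5 p) * (5 * blen V)) ?c1"
 proof -
  have "frag P (pc ?c) (cpath 5 p)" using f(1) by simp
  from reach_weaken[OF reach_straight[OF this jfree_cpath] v(4)] show ?thesis by (simp only: v(1))
 qed
 have g1: "good_regs h ?R1 H" using g v(3) by (auto simp: good_regs_def)
 have rep1: "rep h ?R1 H (?R1 4) t"
  using rep_mono[OF Test.prems(3) order_refl, of ?R1] g by auto
 have zero: "v = 0 \<longleftrightarrow> sub_at p t = Lf"
  using v(2) g by (cases "sub_at p t") auto
 have jc: "icost (Jz 5 (i' + length cb)) ?c1 <= 5 * blen V"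
 proof (rule icost_le)
  have HV: "H <= V" "6 <= H" using Test.prems(5) g by auto
  then show "\<forall>a. regs ?c1 a <= V" using g v(3) by (auto intro: le_trans[of _ H])
  show "\<forall>x\<in>nums (Jz 5 (i' + length cb)). x <= V" using lab HV by auto
 qed
 define j where "j = (if v = 0 then i' + length cb else i')"
 have r2: "reach P ?c1 1 (5 * blen V) \<lparr>pc = j, regs = ?R1, outp = u\<rparr>"
 proof -
  have "exec (Jz 5 (i' + length cb)) ?c1 = \<lparr>pc = j, regs = ?R1, outp = u\<rparr>"
   by (simp add: exec_def j_def i'_def)
  moreover have "reach P ?c1 1 (5 * blen V) (exec (P ! pc ?c1) ?c1)"
   by (rule reach_step) (use frag_nth[OF f(2)] jc in auto)
  ultimately show ?thesis using frag_nth[OF f(2)] by simp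
 qed
 have r12: "reach P ?c (length (cpath 5 p) + 1) ((length (cpath 5 p) + 1) * (5 * blen V))
   \<lparr>pc = j, regs = ?R1, outp = u\<rparr>"
  using reach_trans[OF r1 r2] by (simp add: algebra_simps)
 have "\<exists>n R' H'. n <= length (if v = 0 then ca else cb) \<and>
  reach P \<lparr>pc = j, regs = ?R1, outp = u\<rparr> n (n * (5 * blen V))
   \<lparr>pc = l0, regs = R', outp = u @ snd (evd (Test p a b) t)\<rparr> \<and>
  good_regs h R' H' \<and> rep h R' H' (R' 4) (fst (evd (Test p a b) t)) \<and> H' <= H + dcells (Test p a b)"
 proof (cases "v = 0")
  case True
  have "5 + ddepth a < h" "H + dcells a <= V" using Test.prems by auto
  from Test.IH(1)[OF f(4)[unfolded ca_def] g1 rep1 this Test.prems(6,7)]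
  obtain n R' H' where n: "n <= length (cdt l0 (i' + length cb) a)"
  "reach P \<lparr>pc = (i' + length cb), regs = ?R1, outp = u\<rparr> n (n * (5 * blen V))
   \<lparr>pc = l0, regs = R', outp = u @ snd (evd a t)\<rparr>"
  "good_regs h R' H'" "rep h R' H' (R' 4) (fst (evd a t))" "H' <= H + dcells a" by blast
  have ev: "evd (Test p a b) t = evd a t" "j = (i' + length cb)" "(if v = 0 then ca else cb) = ca"
   "H' <= H + dcells (Test p a b)" using True zero n(5) by (auto simp: j_def)
  show ?thesis unfolding ev(1-3)
   by - (rule exI[of _ n], rule exI[of _ R'], rule exI[of _ H'], intro conjI; (use n ev(4) in \<open>auto simp: ca_def simp del: dcells.simps\<close>))
 next
  case False
  have "5 + ddepth b < h" "H + dcells b <= V" using Test.prems by auto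
  from Test.IH(2)[OF f(3)[unfolded cb_def] g1 rep1 this Test.prems(6,7)]
  obtain n R' H' where n: "n <= length (cdt l0 i' b)"
  "reach P \<lparr>pc = i', regs = ?R1, outp = u\<rparr> n (n * (5 * blen V))
   \<lparr>pc = l0, regs = R', outp = u @ snd (evd b t)\<rparr>"
  "good_regs h R' H'" "rep h R' H' (R' 4) (fst (evd b t))" "H' <= H + dcells b" by blast
  have ev: "evd (Test p a b) t = evd b t" "j = i'" "(if v = 0 then ca else cb) = cb"
   "H' <= H + dcells (Test p a b)" using False zero n(5) by (auto simp: j_def)
  show ?thesis unfolding ev(1-3)
   by - (rule exI[of _ n], rule exI[of _ R'], rule exI[of _ H'], intro conjI; (use n ev(4) in \<open>auto simp: cb_def simp del: dcells.simps\<close>))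
 qed
 then obtain n R' H' where n: "n <= length (if v = 0 then ca else cb)"
  "reach P \<lparr>pc = j, regs = ?R1, outp = u\<rparr> n (n * (5 * blen V))
   \<lparr>pc = l0, regs = R', outp = u @ snd (evd (Test p a b) t)\<rparr>"
  "good_regs h R' H'" "rep h R' H' (R' 4) (fst (evd (Test p a b) t))" "H' <= H + dcells (Test p a b)"
  by blast
 have "reach P ?c (length (cpath 5 p) + 1 + n) ((length (cpath 5 p) + 1 + n) * (5 * blen V))
   \<lparr>pc = l0, regs = R', outp = u @ snd (evd (Test p a b) t)\<rparr>"
  using reach_trans[OF r12 n(2)] by (simp add: algebra_simps)
 moreover have "length (cpath 5 p) + 1 + n <= length (cdt l0 i (Test p a b))"
  using n(1) unfolding code by (auto split: if_splits)
 ultimately show ?case using n(3-5) by blast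
next
 case (Do q e)
 define co where "co = (case q of None => [] | Some p => cpath 5 p @ [Out 5])"
 define w where "w = (case q of None => [] | Some p => [sub_at p t \<noteq> Lf])"
 let ?c = "\<lparr>pc = i, regs = R, outp = u\<rparr>"
 note g = Do.prems(2)[unfolded good_regs_def]
 have code: "cdt l0 i (Do q e) = co @ cex 5 e @ [Add 4 5 0] @ [Jz 0 l0]" by (simp add: co_def)
 have "\<exists>R1. execs co ?c = \<lparr>pc = i + length co, regs = R1, outp = u @ w\<rparr>
  \<and> costs co ?c <= length co * (5 * blen V) \<and> good_regs h R1 H \<and> rep h R1 H (R1 4) t"
 proof (cases q)
  case None
  then show ?thesis using Do.prems by (auto simp: co_def w_def)
 next
  case (Some p)
  have "\<exists>v. execs (cpath 5 p) ?c
   = \<lparr>pc = i + length (cpath 5 p), regs = R(5 := v), outp = u\<rparr> \<and> rep h R H v (sub_at p t) \<and> v <= H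
  \<and> costs (cpath 5 p) ?c <= length (cpath 5 p) * (5 * blen V)"
   by (rule cpath_correct[OF Do.prems(2,3)]) (use Do.prems in auto)
  then obtain v where v: "execs (cpath 5 p) ?c
   = \<lparr>pc = i + length (cpath 5 p), regs = R(5 := v), outp = u\<rparr>" "rep h R H v (sub_at p t)" "v <= H"
  "costs (cpath 5 p) ?c <= length (cpath 5 p) * (5 * blen V)" by blast
  let ?R1 = "R(5 := v)"
  have g1: "good_regs h ?R1 H" using g v(3) by (auto simp: good_regs_def)
  have rep1: "rep h ?R1 H (?R1 4) t"
   using rep_mono[OF Do.prems(3) order_refl, of ?R1] g by auto
  have zero: "v = 0 \<longleftrightarrow> sub_at p t = Lf"
   using v(2) g by (cases "sub_at p t") auto
  have jc: "icost (Out 5) \<lparr>pc = i + length (cpath 5 p), regs = R(5 := v), outp = u\<rparr> <= 5 * blen V"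
  proof (rule icost_le)
   have HV: "H <= V" "6 <= H" using Do.prems(5) g by auto
   then show "\<forall>a. regs \<lparr>pc = i + length (cpath 5 p), regs = R(5 := v), outp = u\<rparr> a <= V"
    using g v(3) by (auto intro: le_trans[of _ H])
   show "\<forall>x\<in>nums (Out 5). x <= V" using HV by auto
  qed
  have "execs co ?c = \<lparr>pc = i + length co, regs = ?R1, outp = u @ w\<rparr>"
   using v(1) zero by (cases "v = 0") (simp_all add: co_def Some execs_append exec_def w_def Let_def)
  moreover have "costs co ?c <= length co * (5 * blen V)"
   using v(1,4) jc by (simp add: co_def Some costs_append)
  ultimately show ?thesis using g1 rep1 by blast
 qed
 then obtain R1 where R1: "execs co ?c = \<lparr>pc = i + length co, regs = R1, outp = u @ w\<rparr>"
  "costs co ?c <= length co * (5 * blen V)" "good_regs h R1 H" "rep h R1 H (R1 4) t" by blast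
 have pr: "5 + xdepth e < h" "H + xcells e <= V" using Do.prems by auto
 from cex_correct[OF R1(3,4) order_refl pr, of "i + length co" "u @ w"] obtain R2 where R2:
  "execs (cex 5 e) \<lparr>pc = i + length co, regs = R1, outp = u @ w\<rparr>
   = \<lparr>pc = i + length co + length (cex 5 e), regs = R2, outp = u @ w\<rparr>"
  "good_regs h R2 (H + xcells e)" "rep h R2 (H + xcells e) (R2 5) (evx e t)"
  "costs (cex 5 e) \<lparr>pc = i + length co, regs = R1, outp = u @ w\<rparr> <= length (cex 5 e) * (5 * blen V)"
  by blast
 note g2 = R2(2)[unfolded good_regs_def]
 let ?R3 = "R2(4 := R2 5)"
 let ?q = "i + length co + length (cex 5 e)"
 let ?c2 = "\<lparr>pc = ?q, regs = R2, outp = u @ w\<rparr>"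
 let ?c3 = "\<lparr>pc = ?q + 1, regs = ?R3, outp = u @ w\<rparr>"
 have R2V: "\<forall>a. R2 a <= V"
 proof
  fix a have "R2 a <= H + xcells e" using g2 by blast
  then show "R2 a <= V" using pr by simp
 qed
 have V6: "6 <= V" using g2 pr by auto
 have a3: "icost (Add 4 5 0) ?c2 <= 5 * blen V" by (rule icost_le) (use R2V V6 in auto)
 have e3: "exec (Add 4 5 0) ?c2 = ?c3" using g2 by (simp add: exec_def)
 have g3: "good_regs h ?R3 (H + xcells e)" using g2 by (auto simp: good_regs_def)
 have rep3: "rep h ?R3 (H + xcells e) (?R3 4) (evx e t)"
  using rep_mono[OF R2(3) order_refl, of ?R3] g2 by auto
 have f: "frag P i (co @ cex 5 e @ [Add 4 5 0])" "frag P (?q + 1) [Jz 0 l0]"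
  using Do.prems(1) frag_Cons[of P ?q "Add 4 5 0" "[Jz 0 l0]"] unfolding code
  by (auto simp: frag_append add.assoc)
 let ?s = "co @ cex 5 e @ [Add 4 5 0]"
 have es: "execs ?s ?c = ?c3" by (simp add: execs_append R1(1) R2(1) e3)
 have cs: "costs ?s ?c <= length ?s * (5 * blen V)"
  using R1(2) R2(4) a3 by (simp add: costs_append R1(1) R2(1) algebra_simps)
 have js: "list_all jfree ?s" by (auto simp: co_def jfree_cex jfree_cpath split: option.split)
 have r1: "reach P ?c (length ?s) (length ?s * (5 * blen V)) ?c3"
 proof -
  have "frag P (pc ?c) ?s" using f(1) by simp
  from reach_weaken[OF reach_straight[OF this js] cs] show ?thesis by (simp only: es)
 qed
 have jc: "icost (Jz 0 l0) ?c3 <= 5 * blen V"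
  by (rule icost_le) (use R2V V6 Do.prems(7) in auto)
 have "reach P ?c3 1 (5 * blen V) (exec (Jz 0 l0) ?c3)"
  using reach_step[of ?c3 P "5 * blen V"] frag_nth[OF f(2)] jc by simp
 moreover have "exec (Jz 0 l0) ?c3 = \<lparr>pc = l0, regs = ?R3, outp = u @ w\<rparr>"
  using g2 by (simp add: exec_def)
 ultimately have r2: "reach P ?c3 1 (5 * blen V) \<lparr>pc = l0, regs = ?R3, outp = u @ w\<rparr>" by simp
 have "reach P ?c (length ?s + 1) ((length ?s + 1) * (5 * blen V)) \<lparr>pc = l0, regs = ?R3, outp = u @ w\<rparr>"
  using reach_trans[OF r1 r2] by (simp add: algebra_simps)
 moreover have "length ?s + 1 <= length (cdt l0 i (Do q e))" unfolding code by simp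
 moreover have "snd (evd (Do q e) t) = w" "fst (evd (Do q e) t) = evx e t" "dcells (Do q e) = xcells e"
  by (simp_all add: w_def)
 ultimately show ?case using g3 rep3
  by - (rule exI[of _ "length ?s + 1"], rule exI[of _ ?R3], rule exI[of _ "H + xcells e"], (simp del: fun_upd_apply cdt.simps))
qed

definition mstep :: "dt => tree \<times> bool list => tree \<times> bool list" where
 "mstep D = (%(t, u). (fst (evd D t), u @ snd (evd D t)))"

text \<open>Each of the \<open>T\<close> transitions allocates at most \<open>dcells D\<close> words
  and nothing is reclaimed, so addresses and contents stay linear in \<open>T\<close>. Every
  instruction then costs O(log T): the simulation loses one logarithmic factor.\<close>

theorem ram_simulation:
 "\<exists>P C. \<forall>T. \<exists>n. outp (run P n) = snd ((mstep D ^^ T) (evx x0 Lf, []))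
   \<and> cost P n <= C * (T + 1) * blen (C * (T + 1))"
proof -
 \<comment> \<open>The heap begins above the registers 5, 6, ... that serve as evaluation stack for
   the initial expression and for the transitions.\<close>
 define h where "h = 7 + xdepth x0 + ddepth D"
 define l0 where "l0 = 3 + length (cex 5 x0)"
 define pre where "pre = [Const 2 1, Const 3 h] @ cex 5 x0 @ [Add 4 5 0]"
 define P where "P = pre @ cdt l0 l0 D"
 have l0: "length pre = l0" by (simp add: pre_def l0_def)
 define H0 where "H0 = h + xcells x0"
 define B where "B = H0 + length P"
 have fr: "frag P l0 (cdt l0 l0 D)" "frag P 0 pre"
  unfolding frag_def P_def using l0 by (auto intro: exI[of _ "[]"])
 have start: "\<exists>R. reach P init l0 (l0 * (5 * blen V)) \<lparr>pc = l0, regs = R, outp = []\<rparr> \<and>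
   good_regs h R H0 \<and> rep h R H0 (R 4) (evx x0 Lf)" if V: "B <= V" for V
 proof -
  let ?R = "(%_::nat. 0::nat)(2 := 1, 3 := h)"
  let ?i = "\<lparr>pc = 2, regs = ?R, outp = []\<rparr>"
  have g: "good_regs h ?R h" by (auto simp: good_regs_def h_def)
  have r: "rep h ?R h (?R 4) Lf" by simp
  have "5 + xdepth x0 < h" "h + xcells x0 <= V" using V by (auto simp: B_def H0_def h_def)
  from cex_correct[OF g r order_refl this, of 2 "[]"] obtain R2 where R2:
   "execs (cex 5 x0) ?i = \<lparr>pc = 2 + length (cex 5 x0), regs = R2, outp = []\<rparr>"
   "good_regs h R2 H0" "rep h R2 H0 (R2 5) (evx x0 Lf)"
   "costs (cex 5 x0) ?i <= length (cex 5 x0) * (5 * blen V)" unfolding H0_def by blast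
  note g2 = R2(2)[unfolded good_regs_def]
  let ?R3 = "R2(4 := R2 5)"
  have R2V: "\<forall>a. R2 a <= V"
  proof
   fix a have "R2 a <= H0" using g2 by blast
   then show "R2 a <= V" using V by (simp add: B_def)
  qed
  have V6: "6 <= V" "h <= V" using g2 V by (auto simp: B_def)
  have e0: "execs [Const 2 1, Const 3 h] init = ?i" by (simp add: exec_def init_def)
  have c0: "costs [Const 2 1, Const 3 h] init <= 2 * (5 * blen V)"
  proof -
   have "icost (Const 2 1) init <= 5 * blen V" by (rule icost_le) (use V6 in \<open>auto simp: init_def\<close>)
   moreover have "icost (Const 3 h) (exec (Const 2 1) init) <= 5 * blen V"
    by (rule icost_le) (use V6 in \<open>auto simp: init_def exec_def\<close>)
   ultimately show ?thesis by simp
  qed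
  have c3: "icost (Add 4 5 0) \<lparr>pc = 2 + length (cex 5 x0), regs = R2, outp = []\<rparr> <= 5 * blen V"
   by (rule icost_le) (use R2V V6 in auto)
  have es: "execs pre init = \<lparr>pc = l0, regs = ?R3, outp = []\<rparr>"
   unfolding pre_def execs_append e0 R2(1) using g2 by (simp add: exec_def l0_def)
  have cs: "costs pre init <= l0 * (5 * blen V)"
   unfolding pre_def costs_append e0 R2(1) using c0 R2(4) c3 by (simp add: l0_def algebra_simps)
  have js: "list_all jfree pre" by (auto simp: pre_def jfree_cex)
  have "reach P init l0 (l0 * (5 * blen V)) \<lparr>pc = l0, regs = ?R3, outp = []\<rparr>"
  proof -
   have "frag P (pc init) pre" using fr(2) by (simp add: init_def)
   from reach_weaken[OF reach_straight[OF this js] cs] show ?thesis by (simp only: es l0)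
  qed
  moreover have "good_regs h ?R3 H0" using g2 by (auto simp: good_regs_def)
  moreover have "rep h ?R3 H0 (?R3 4) (evx x0 Lf)"
   using rep_mono[OF R2(3) order_refl, of ?R3] g2 by auto
  ultimately show ?thesis by blast
 qed
 have main: "B + dcells D * T <= V ==> \<exists>n R H. n <= length P * (T + 1) \<and>
   reach P init n (n * (5 * blen V)) \<lparr>pc = l0, regs = R, outp = snd ((mstep D ^^ T) (evx x0 Lf, []))\<rparr> \<and>
   good_regs h R H \<and> rep h R H (R 4) (fst ((mstep D ^^ T) (evx x0 Lf, []))) \<and> H <= H0 + dcells D * T"
  for T V
 proof (induction T)
  case 0
  have "l0 <= length P" using l0 by (simp add: P_def)
  moreover obtain R where "reach P init l0 (l0 * (5 * blen V)) \<lparr>pc = l0, regs = R, outp = []\<rparr>"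
   "good_regs h R H0" "rep h R H0 (R 4) (evx x0 Lf)" using start[of V] 0 by auto
  ultimately show ?case by - (rule exI[of _ l0], rule exI[of _ R], rule exI[of _ H0], simp)
 next
  case (Suc T)
  have "B + dcells D * T <= V" using Suc.prems by simp
  from Suc.IH[OF this] obtain n R H where n: "n <= length P * (T + 1)"
   "reach P init n (n * (5 * blen V)) \<lparr>pc = l0, regs = R, outp = snd ((mstep D ^^ T) (evx x0 Lf, []))\<rparr>"
   "good_regs h R H" "rep h R H (R 4) (fst ((mstep D ^^ T) (evx x0 Lf, [])))" "H <= H0 + dcells D * T"
   by blast
  have "5 + ddepth D < h" "H + dcells D <= V" "length P <= V" "l0 <= V"
   using n(5) Suc.prems l0 by (auto simp: B_def P_def h_def)
  from cdt_correct[OF fr(1) n(3,4) this, of "snd ((mstep D ^^ T) (evx x0 Lf, []))"]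
  obtain n2 R2 H2 where n2: "n2 <= length (cdt l0 l0 D)"
   "reach P \<lparr>pc = l0, regs = R, outp = snd ((mstep D ^^ T) (evx x0 Lf, []))\<rparr> n2 (n2 * (5 * blen V))
    \<lparr>pc = l0, regs = R2, outp = snd ((mstep D ^^ T) (evx x0 Lf, []))
      @ snd (evd D (fst ((mstep D ^^ T) (evx x0 Lf, []))))\<rparr>"
   "good_regs h R2 H2" "rep h R2 H2 (R2 4) (fst (evd D (fst ((mstep D ^^ T) (evx x0 Lf, [])))))"
   "H2 <= H + dcells D" by blast
  have st: "(mstep D ^^ Suc T) (evx x0 Lf, []) =
   (fst (evd D (fst ((mstep D ^^ T) (evx x0 Lf, [])))), snd ((mstep D ^^ T) (evx x0 Lf, []))
      @ snd (evd D (fst ((mstep D ^^ T) (evx x0 Lf, [])))))"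
   by (simp add: mstep_def split_beta)
  have "reach P init (n + n2) ((n + n2) * (5 * blen V))
   \<lparr>pc = l0, regs = R2, outp = snd ((mstep D ^^ Suc T) (evx x0 Lf, []))\<rparr>"
   using reach_trans[OF n(2) n2(2)] unfolding st by (simp add: algebra_simps)
  moreover have "n + n2 <= length P * (Suc T + 1)" using n(1) n2(1) by (simp add: P_def)
  moreover have "H2 <= H0 + dcells D * Suc T" using n2(5) n(5) by simp
  ultimately show ?case using n2(3,4)
   by - (rule exI[of _ "n + n2"], rule exI[of _ R2], rule exI[of _ H2], (simp only: st fst_conv snd_conv simp_thms))
 qed
 define C where "C = 5 * length P + B + dcells D"
 have "\<exists>n. outp (run P n) = snd ((mstep D ^^ T) (evx x0 Lf, []))
   \<and> cost P n <= C * (T + 1) * blen (C * (T + 1))" for T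
 proof -
  have V: "B + dcells D * T <= C * (T + 1)" by (simp add: C_def algebra_simps)
  from main[OF V] obtain n R where n: "n <= length P * (T + 1)"
   "reach P init n (n * (5 * blen (C * (T + 1)))) \<lparr>pc = l0, regs = R, outp = snd ((mstep D ^^ T) (evx x0 Lf, []))\<rparr>"
   by blast
  have "n * (5 * blen (C * (T + 1))) <= length P * (T + 1) * (5 * blen (C * (T + 1)))"
   using n(1) by (rule mult_le_mono1)
  also have "... <= C * (T + 1) * blen (C * (T + 1))"
  proof -
   have "length P * (T + 1) * (5 * blen (C * (T + 1))) = (5 * length P) * ((T + 1) * blen (C * (T + 1)))"
    by (simp add: algebra_simps)
   also have "... <= C * ((T + 1) * blen (C * (T + 1)))" by (rule mult_le_mono1) (simp add: C_def)
   finally show ?thesis by (simp add: algebra_simps)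
  qed
  finally have "n * (5 * blen (C * (T + 1))) <= C * (T + 1) * blen (C * (T + 1))" .
  moreover have "cost P n <= n * (5 * blen (C * (T + 1)))"
   using n(2) unfolding reach_def cost_def run_def by blast
  ultimately have "cost P n <= C * (T + 1) * blen (C * (T + 1))" by (rule order_trans[rotated])
  moreover have "outp (run P n) = snd ((mstep D ^^ T) (evx x0 Lf, []))"
   using n(2) by (simp add: reach_def run_def)
  ultimately show ?thesis by blast
 qed
 then show ?thesis by blast
qed

section \<open>A stack machine and cost-annotated programs\<close>

text \<open>A language of one-argument functions acting on a current value. \<open>IBr\<close> tests
  the current value and restores the argument saved on the stack; \<open>IFix\<close> runs a body
  that \<open>ICall\<close> can re-enter. Return frames save the enclosing body, so recursive
  functions may be nested.\<close>

datatype ins = IHd | ITl | INil | IPush | ISwap | ICons | IBr "ins list" "ins list"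
 | IFix "ins list" | ICall | IOut

primrec unary :: "nat => tree" where
 "unary 0 = Lf" | "unary (Suc n) = Nd Lf (unary n)"

text \<open>Opcodes are unary so that a chain of tests decodes them: the path \<open>ptag n\<close>
  ends in \<open>Lf\<close> exactly when the opcode is at most \<open>n\<close>.\<close>

fun enc_ins :: "ins => tree" and enc_code :: "ins list => tree" where
 "enc_ins IHd = Nd (unary 0) Lf"
| "enc_ins ITl = Nd (unary 1) Lf"
| "enc_ins INil = Nd (unary 2) Lf"
| "enc_ins IPush = Nd (unary 3) Lf"
| "enc_ins ISwap = Nd (unary 4) Lf"
| "enc_ins ICons = Nd (unary 5) Lf"
| "enc_ins (IBr a b) = Nd (unary 6) (Nd (enc_code a) (enc_code b))"
| "enc_ins (IFix a) = Nd (unary 7) (enc_code a)"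
| "enc_ins ICall = Nd (unary 8) Lf"
| "enc_ins IOut = Nd (unary 9) Lf"
| "enc_code [] = Lf"
| "enc_code (i # c) = Nd (enc_ins i) (enc_code c)"

definition mstate :: "tree => tree => tree => tree => tree" where
 "mstate c v s f = Nd (Nd c v) (Nd s f)"

definition xstate :: "ex => ex => ex => ex => ex" where
 "xstate c v s f = Nx (Nx c v) (Nx s f)"

abbreviation (input) "pC \<equiv> [False, False]"
abbreviation (input) "pV \<equiv> [False, True]"
abbreviation (input) "pS \<equiv> [True, False]"
abbreviation (input) "pF \<equiv> [True, True]"
abbreviation (input) "xrest \<equiv> Px (pC @ [True])"
abbreviation (input) "xarg \<equiv> pC @ [False, True]"
abbreviation (input) "xframe \<equiv> Nx xrest (Px pF)"
abbreviation (input) "ptag n \<equiv> pC @ [False, False] @ replicate n True"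

text \<open>A state consists of the remaining code, the current value, a stack of values and
 return frames, and the body of the innermost enclosing recursive function.\<close>

definition machine :: dt where
 "machine =
  Test pC (Do None (xstate (Px (pS @ [False, False])) (Px pV) (Px (pS @ [True])) (Px (pS @ [False, True]))))
 (Test (ptag 0) (Do None (xstate xrest (Px (pV @ [False])) (Px pS) (Px pF)))
 (Test (ptag 1) (Do None (xstate xrest (Px (pV @ [True])) (Px pS) (Px pF)))
 (Test (ptag 2) (Do None (xstate xrest Lx (Px pS) (Px pF)))
 (Test (ptag 3) (Do None (xstate xrest (Px pV) (Nx (Px pV) (Px pS)) (Px pF)))
 (Test (ptag 4) (Do None (xstate xrest (Px (pS @ [False])) (Nx (Px pV) (Px (pS @ [True]))) (Px pF)))
 (Test (ptag 5) (Do None (xstate xrest (Nx (Px (pS @ [False])) (Px pV)) (Px (pS @ [True])) (Px pF)))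
 (Test (ptag 6) (Test pV
   (Do None (xstate (Px (xarg @ [True])) (Px (pS @ [False])) (Nx xframe (Px (pS @ [True]))) (Px pF)))
   (Do None (xstate (Px (xarg @ [False])) (Px (pS @ [False])) (Nx xframe (Px (pS @ [True]))) (Px pF))))
 (Test (ptag 7) (Do None (xstate (Px xarg) (Px pV) (Nx xframe (Px pS)) (Px xarg)))
 (Test (ptag 8) (Do None (xstate (Px pF) (Px pV) (Nx xframe (Px pS)) (Px pF)))
   (Do (Some pV) (xstate xrest (Px pV) (Px pS) (Px pF))))))))))))"

definition goes :: "nat => tree \<times> bool list => tree \<times> bool list => bool" where
 "goes n s s' \<longleftrightarrow> (mstep machine ^^ n) s = s'"

lemma goes_trans: "goes n s s' ==> goes m s' s'' ==> goes (n + m) s s''"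
 by (simp add: goes_def add.commute[of n] funpow_add)

lemma goes_1: "goes 1 (t, u) (fst (evd machine t), u @ snd (evd machine t))"
 by (simp add: goes_def mstep_def)

lemmas mdefs = machine_def mstate_def xstate_def eval_nat_numeral

lemma goes_steps:
 "goes 1 (mstate (enc_code (IHd # r)) v s f, u) (mstate (enc_code r) (tcar v) s f, u)"
 "goes 1 (mstate (enc_code (ITl # r)) v s f, u) (mstate (enc_code r) (tcdr v) s f, u)"
 "goes 1 (mstate (enc_code (INil # r)) v s f, u) (mstate (enc_code r) Lf s f, u)"
 "goes 1 (mstate (enc_code (IPush # r)) v s f, u) (mstate (enc_code r) v (Nd v s) f, u)"
 "goes 1 (mstate (enc_code (ISwap # r)) v (Nd w s) f, u) (mstate (enc_code r) w (Nd v s) f, u)"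
 "goes 1 (mstate (enc_code (ICons # r)) v (Nd w s) f, u) (mstate (enc_code r) (Nd w v) s f, u)"
 "goes 1 (mstate (enc_code (IBr a b # r)) v (Nd w s) f, u)
  (mstate (enc_code (if v = Lf then b else a)) w (Nd (Nd (enc_code r) f) s) f, u)"
 "goes 1 (mstate (enc_code (IFix a # r)) v s f, u) (mstate (enc_code a) v (Nd (Nd (enc_code r) f) s) (enc_code a), u)"
 "goes 1 (mstate (enc_code (ICall # r)) v s f, u) (mstate f v (Nd (Nd (enc_code r) f) s) f, u)"
 "goes 1 (mstate (enc_code (IOut # r)) v s f, u) (mstate (enc_code r) v s f, u @ [v \<noteq> Lf])"
 "goes 1 (mstate (enc_code []) v (Nd (Nd q g) s) f, u) (mstate q v s g, u)"
 by (rule subst[of "(fst _, _)" _ "goes 1 _", OF _ goes_1], simp add: mdefs)+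

text \<open>Quantifying over the continuation \<open>r\<close>, the stack \<open>s\<close> and the
  output \<open>u\<close> makes the relation compositional. The body \<open>f\<close> stays a
  parameter because the effect of \<open>ICall\<close> depends on it. The output is unchanged, so
  printing is outside this relation.\<close>

definition does :: "tree => ins list => tree => tree => nat => bool" where
 "does f c v v' n \<longleftrightarrow> (\<forall>r s u. goes n (mstate (enc_code (c @ r)) v s f, u) (mstate (enc_code r) v' s f, u))"

lemma does_Nil: "does f [] v v 0"
 by (simp add: does_def goes_def)

lemma does_append: "does f c v v' n ==> does f d v' v'' m ==> does f (c @ d) v v'' (n + m)"
 unfolding does_def append_assoc using goes_trans by blast

lemma does_prims:
 "does f [IHd] v (tcar v) 1" "does f [ITl] v (tcdr v) 1" "does f [INil] v Lf 1"
 unfolding does_def append_Cons append_Nil by (blast intro: goes_steps)+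

definition cpair :: "ins list => ins list => ins list" where
 "cpair c d = [IPush] @ c @ [ISwap] @ d @ [ICons]"

lemma does_pair:
 assumes "does f c v a n" "does f d v b m"
 shows "does f (cpair c d) v (Nd a b) (n + m + 3)"
 unfolding does_def
proof (intro allI)
 fix r s u
 have 1: "goes 1 (mstate (enc_code (cpair c d @ r)) v s f, u)
   (mstate (enc_code (c @ ISwap # d @ ICons # r)) v (Nd v s) f, u)"
  using goes_steps(4) by (simp add: cpair_def)
 have 2: "goes n (mstate (enc_code (c @ ISwap # d @ ICons # r)) v (Nd v s) f, u)
   (mstate (enc_code (ISwap # d @ ICons # r)) a (Nd v s) f, u)"
  using assms(1) unfolding does_def by blast
 have 3: "goes 1 (mstate (enc_code (ISwap # d @ ICons # r)) a (Nd v s) f, u)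
  (mstate (enc_code (d @ ICons # r)) v (Nd a s) f, u)" by (rule goes_steps)
 have 4: "goes m (mstate (enc_code (d @ ICons # r)) v (Nd a s) f, u)
  (mstate (enc_code (ICons # r)) b (Nd a s) f, u)"
  using assms(2) unfolding does_def by blast
 have 5: "goes 1 (mstate (enc_code (ICons # r)) b (Nd a s) f, u) (mstate (enc_code r) (Nd a b) s f, u)"
  by (rule goes_steps)
 have "goes (1 + n + 1 + m + 1) (mstate (enc_code (cpair c d @ r)) v s f, u) (mstate (enc_code r) (Nd a b) s f, u)"
  by (rule goes_trans[OF goes_trans[OF goes_trans[OF goes_trans[OF 1 2] 3] 4] 5])
 then show "goes (n + m + 3) (mstate (enc_code (cpair c d @ r)) v s f, u) (mstate (enc_code r) (Nd a b) s f, u)"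
  by (simp add: eval_nat_numeral)
qed

definition cif :: "ins list => ins list => ins list => ins list" where
 "cif c a b = [IPush] @ c @ [IBr a b]"

lemma does_if:
 assumes "does f c v w n" "does f (if w = Lf then b else a) v v' m"
 shows "does f (cif c a b) v v' (n + m + 3)"
 unfolding does_def
proof (intro allI)
 fix r s u
 let ?e = "if w = Lf then b else a"
 have 1: "goes 1 (mstate (enc_code (cif c a b @ r)) v s f, u)
   (mstate (enc_code (c @ IBr a b # r)) v (Nd v s) f, u)"
  using goes_steps(4) by (simp add: cif_def)
 have 2: "goes n (mstate (enc_code (c @ IBr a b # r)) v (Nd v s) f, u)
   (mstate (enc_code (IBr a b # r)) w (Nd v s) f, u)"
  using assms(1) unfolding does_def by blast
 have 3: "goes 1 (mstate (enc_code (IBr a b # r)) w (Nd v s) f, u)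
  (mstate (enc_code ?e) v (Nd (Nd (enc_code r) f) s) f, u)" by (rule goes_steps)
 have 4: "goes m (mstate (enc_code ?e) v (Nd (Nd (enc_code r) f) s) f, u)
  (mstate (enc_code []) v' (Nd (Nd (enc_code r) f) s) f, u)"
  using assms(2)[unfolded does_def, rule_format, of "[]"] by simp
 have 5: "goes 1 (mstate (enc_code []) v' (Nd (Nd (enc_code r) f) s) f, u) (mstate (enc_code r) v' s f, u)"
  by (rule goes_steps)
 have "goes (1 + n + 1 + m + 1) (mstate (enc_code (cif c a b @ r)) v s f, u) (mstate (enc_code r) v' s f, u)"
  by (rule goes_trans[OF goes_trans[OF goes_trans[OF goes_trans[OF 1 2] 3] 4] 5])
 then show "goes (n + m + 3) (mstate (enc_code (cif c a b @ r)) v s f, u) (mstate (enc_code r) v' s f, u)"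
  by (simp add: eval_nat_numeral)
qed

lemma does_call:
 assumes "does (enc_code c) c v v' n"
 shows "does (enc_code c) [ICall] v v' (n + 2)" "does f [IFix c] v v' (n + 2)"
proof -
 have *: "goes (n + 1) (mstate (enc_code c) v (Nd (Nd (enc_code r) g) s) (enc_code c), u) (mstate (enc_code r) v' s g, u)" for r s u g
  using goes_trans[OF assms[unfolded does_def, rule_format, of "[]", simplified] goes_steps(11)[simplified]] by simp
 show "does (enc_code c) [ICall] v v' (n + 2)" "does f [IFix c] v v' (n + 2)"
  unfolding does_def append_Cons append_Nil
  using goes_trans[OF goes_steps(9) *] goes_trans[OF goes_steps(8) *] by simp_all
qed

primrec cconst :: "tree => ins list" where
 "cconst Lf = [INil]"
| "cconst (Nd a b) = cpair (cconst a) (cconst b)"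

lemma does_const: "\<exists>n. \<forall>f v. does f (cconst t) v t n"
proof (induction t)
 case Lf
 show ?case using does_prims(3) by auto
next
 case (Nd a b)
 then obtain n m where "\<forall>f v. does f (cconst a) v a n" "\<forall>f v. does f (cconst b) v b m" by blast
 then show ?case using does_pair[of _ "cconst a" _ a n "cconst b" b m] by auto
qed

section \<open>Functions on encoded data with a bound on the running time\<close>

class enc = fixes enc :: "'a => tree"

instantiation bool :: enc
begin
definition "enc_bool b = (if b then Nd Lf Lf else Lf)"
instance ..
end

text \<open>Numbers of type \<open>nat\<close> are unary; they serve as lengths, indices and the
  small values of the block search. Long integers are bit lists, least significant bit
  first.\<close>

instantiation nat :: enc
begin
definition "enc_nat n = unary n"
instance ..
end

instantiation prod :: (enc, enc) enc
begin
definition "enc_prod p = Nd (enc (fst p)) (enc (snd p))"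
instance ..
end

instantiation list :: (enc) enc
begin
primrec enc_list :: "'a list => tree" where
 "enc_list [] = Lf" | "enc_list (x # xs) = Nd (enc x) (enc_list xs)"
instance ..
end

text \<open>\<open>D\<close> is a promise on the inputs, and \<open>T\<close> counts steps up to a
  constant factor and an additive constant, which spares exact step counts. Correctness for every
  \<open>f\<close> makes the code independent of the recursion it is placed in.\<close>

definition cmp :: "('a::enc => bool) => ('a => 'b::enc) => ('a => nat) => bool" where
 "cmp D F T \<longleftrightarrow> (\<exists>c K. \<forall>x. D x \<longrightarrow> (\<forall>f. \<exists>n \<le> K * (T x + 1). does f c (enc x) (enc (F x)) n))"

lemma cmpI: "(\<And>x f. D x ==> \<exists>n \<le> K * (T x + 1). does f c (enc x) (enc (F x)) n) ==> cmp D F T"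
 unfolding cmp_def by blast

lemma cmpE:
 assumes "cmp D F T"
 obtains c K where "\<And>x f. D x ==> \<exists>n \<le> K * (T x + 1). does f c (enc x) (enc (F x)) n"
 using assms unfolding cmp_def by blast

lemma cmp_le:
 assumes "cmp D F T" "\<And>x. D' x ==> D x" "\<And>x. D' x ==> T x <= K * (T' x + 1)"
 shows "cmp D' F T'"
proof -
 from assms(1) obtain c K0 where c: "\<And>x f. D x ==> \<exists>n \<le> K0 * (T x + 1). does f c (enc x) (enc (F x)) n"
  by (rule cmpE) blast
 have "K0 * (T x + 1) <= (K0 * (K + 1)) * (T' x + 1)" if "D' x" for x
 proof -
  have "T x + 1 <= (K + 1) * (T' x + 1)" using assms(3)[OF that] by simp
  then have "K0 * (T x + 1) <= K0 * ((K + 1) * (T' x + 1))" by (rule mult_le_mono2)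
  then show ?thesis by (simp only: mult.assoc)
 qed
 then show ?thesis using c assms(2) by (intro cmpI[where c = c and K = "K0 * (K + 1)"]) (meson le_trans)
qed

lemma cmp_cong: "cmp D F T ==> (\<And>x. D x ==> F x = G x) ==> cmp D G T"
 unfolding cmp_def by metis

lemma cmp_id: "cmp D (%x. x) (%x. 0)"
 by (rule cmpI[where c = "[]" and K = 1]) (use does_Nil in blast)

lemma cmp_const: "cmp D (%x. k) (%x. 0)"
proof -
 from does_const obtain n where "\<forall>f v. does f (cconst (enc k)) v (enc k) n" by blast
 then show ?thesis by (intro cmpI[where c = "cconst (enc k)" and K = n]) auto
qed

lemma cmp_app:
 assumes "cmp E h T" "cmp D f Tf" "\<And>x. D x ==> E (f x)"
 shows "cmp D (%x. h (f x)) (%x. Tf x + T (f x))"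
proof -
 from assms(1) obtain c K where c: "\<And>x g. E x ==> \<exists>n \<le> K * (T x + 1). does g c (enc x) (enc (h x)) n"
  by (rule cmpE) blast
 from assms(2) obtain d J where d: "\<And>x g. D x ==> \<exists>n \<le> J * (Tf x + 1). does g d (enc x) (enc (f x)) n"
  by (rule cmpE) blast
 show ?thesis
 proof (rule cmpI[where c = "d @ c" and K = "J + K"])
  fix x g assume x: "D x"
  obtain n m where "n <= J * (Tf x + 1)" "does g d (enc x) (enc (f x)) n"
   "m <= K * (T (f x) + 1)" "does g c (enc (f x)) (enc (h (f x))) m"
   using c[OF assms(3)[OF x]] d[OF x] by blast
  moreover from this have "n + m <= (J + K) * (Tf x + T (f x) + 1)" by (simp add: algebra_simps)
  ultimately show "\<exists>n\<le>(J + K) * (Tf x + T (f x) + 1). does g (d @ c) (enc x) (enc (h (f x))) n"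
   using does_append by blast
 qed
qed

lemma cmp_raw_pair:
 assumes "cmp D f Tf" "cmp D g Tg" "\<And>x. D x ==> enc (h x) = Nd (enc (f x)) (enc (g x))"
 shows "cmp D h (%x. Tf x + Tg x)"
proof -
 from assms(1) obtain c K where c: "\<And>x e. D x ==> \<exists>n \<le> K * (Tf x + 1). does e c (enc x) (enc (f x)) n"
  by (rule cmpE) blast
 from assms(2) obtain d J where d: "\<And>x e. D x ==> \<exists>n \<le> J * (Tg x + 1). does e d (enc x) (enc (g x)) n"
  by (rule cmpE) blast
 show ?thesis
 proof (rule cmpI[where c = "cpair c d" and K = "J + K + 3"])
  fix x e assume x: "D x"
  obtain n m where "n <= K * (Tf x + 1)" "does e c (enc x) (enc (f x)) n"
   "m <= J * (Tg x + 1)" "does e d (enc x) (enc (g x)) m"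
   using c[OF x] d[OF x] by blast
  moreover from this have "n + m + 3 <= (J + K + 3) * (Tf x + Tg x + 1)" by (simp add: algebra_simps)
  ultimately show "\<exists>n\<le>(J + K + 3) * (Tf x + Tg x + 1). does e (cpair c d) (enc x) (enc (h x)) n"
   unfolding assms(3)[OF x] using does_pair by blast
 qed
qed

lemma cmp_prim:
 assumes "\<And>f x. E x ==> does f c (enc x) (enc (h x)) 1" "cmp D f Tf" "\<And>x. D x ==> E (f x)"
 shows "cmp D (%x. h (f x)) Tf"
proof -
 have "cmp E h (%_. 0)" by (rule cmpI[where K = 1 and c = c]) (use assms(1) in fastforce)
 from cmp_app[OF this assms(2,3)] show ?thesis by simp
qed

named_theorems cmp_intros

lemma cmp_Pair: "cmp D f Tf ==> cmp D g Tg ==> cmp D (%x. (f x, g x)) (%x. Tf x + Tg x)"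
 by (erule cmp_raw_pair) (auto simp: enc_prod_def)

lemma cmp_Cons: "cmp D f Tf ==> cmp D g Tg ==> cmp D (%x. f x # g x) (%x. Tf x + Tg x)"
 by (erule cmp_raw_pair) auto

lemma cmp_Suc: "cmp D f Tf ==> cmp D (%x. Suc (f x)) Tf"
 using cmp_raw_pair[OF cmp_const[of D False], of f Tf "%x. Suc (f x)"]
 by (simp add: enc_bool_def enc_nat_def)

lemma cmp_fst: "cmp D f Tf ==> cmp D (%x. fst (f x)) Tf"
 by (rule cmp_prim[where E = "%_. True" and c = "[IHd]"]) (auto simp: enc_prod_def intro: does_prims(1)[of _ "Nd _ _", simplified])

lemma cmp_snd: "cmp D f Tf ==> cmp D (%x. snd (f x)) Tf"
 by (rule cmp_prim[where E = "%_. True" and c = "[ITl]"]) (auto simp: enc_prod_def intro: does_prims(2)[of _ "Nd _ _", simplified])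

lemma cmp_hd: "cmp D f Tf ==> (\<And>x. D x ==> f x \<noteq> []) ==> cmp D (%x. hd (f x)) Tf"
 by (rule cmp_prim[where E = "%x. x \<noteq> []" and c = "[IHd]"])
  (auto simp: neq_Nil_conv intro: does_prims(1)[of _ "Nd _ _", simplified])

lemma cmp_tl: "cmp D f Tf ==> cmp D (%x. tl (f x)) Tf"
proof (rule cmp_prim[where h = tl and f = f and E = "%_. True" and c = "[ITl]"])
 show "does g [ITl] (enc x) (enc (tl x)) 1" for g and x :: "'b list"
  using does_prims(2)[of g "enc x"] by (cases x) auto
qed auto

lemma cmp_pred: "cmp D f Tf ==> cmp D (%x. f x - Suc 0) Tf"
proof (rule cmp_prim[where h = "%n. n - Suc 0" and f = f and E = "%_. True" and c = "[ITl]"])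
 show "does g [ITl] (enc x) (enc (x - Suc 0)) 1" for g and x :: nat
  using does_prims(2)[of g "enc x"] by (cases x) (auto simp: enc_nat_def)
qed auto

lemma cmp_raw_if:
 assumes "cmp D p Tp" "cmp (%x. D x \<and> enc (p x) \<noteq> Lf) f Tf" "cmp (%x. D x \<and> enc (p x) = Lf) g Tg"
 shows "cmp D (%x. if enc (p x) \<noteq> Lf then f x else g x)
  (%x. Tp x + (if enc (p x) \<noteq> Lf then Tf x else Tg x))"
proof -
 from assms(1) obtain c K where c: "\<And>x e. D x ==> \<exists>n \<le> K * (Tp x + 1). does e c (enc x) (enc (p x)) n"
  by (rule cmpE) blast
 from assms(2) obtain a J where a: "\<And>x e. D x \<and> enc (p x) \<noteq> Lf ==> \<exists>n \<le> J * (Tf x + 1). does e a (enc x) (enc (f x)) n"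
  by (rule cmpE) blast
 from assms(3) obtain b I where b: "\<And>x e. D x \<and> enc (p x) = Lf ==> \<exists>n \<le> I * (Tg x + 1). does e b (enc x) (enc (g x)) n"
  by (rule cmpE) blast
 show ?thesis
 proof (rule cmpI[where c = "cif c a b" and K = "K + J + I + 3"])
  fix x e assume x: "D x"
  obtain n where n: "n <= K * (Tp x + 1)" "does e c (enc x) (enc (p x)) n" using c[OF x] by blast
  show "\<exists>n\<le>(K + J + I + 3) * (Tp x + (if enc (p x) \<noteq> Lf then Tf x else Tg x) + 1).
   does e (cif c a b) (enc x) (enc (if enc (p x) \<noteq> Lf then f x else g x)) n"
  proof (cases "enc (p x) = Lf")
   case True
   with b x obtain m where m: "m <= I * (Tg x + 1)" "does e b (enc x) (enc (g x)) m" by blast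
   have "does e (cif c a b) (enc x) (enc (g x)) (n + m + 3)"
    by (rule does_if[OF n(2)]) (use True m in simp)
   moreover have "n + m + 3 <= (K + J + I + 3) * (Tp x + Tg x + 1)"
    using n(1) m(1) by (simp add: algebra_simps)
   ultimately show ?thesis using True by (intro exI[of _ "n + m + 3"]) simp
  next
   case False
   with a x obtain m where m: "m <= J * (Tf x + 1)" "does e a (enc x) (enc (f x)) m" by blast
   have "does e (cif c a b) (enc x) (enc (f x)) (n + m + 3)"
    by (rule does_if[OF n(2)]) (use False m in simp)
   moreover have "n + m + 3 <= (K + J + I + 3) * (Tp x + Tf x + 1)"
    using n(1) m(1) by (simp add: algebra_simps)
   ultimately show ?thesis using False by (intro exI[of _ "n + m + 3"]) simp
  qed
 qed
qed

text \<open>\<open>Lf\<close> encodes 0, the empty list and \<open>False\<close> alike, so the one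
  conditional of the machine tests for all three.\<close>

lemma enc_Lf [simp]: "enc (n::nat) = Lf \<longleftrightarrow> n = 0" "enc (xs::'a::enc list) = Lf \<longleftrightarrow> xs = []"
 "enc (b::bool) = Lf \<longleftrightarrow> \<not> b"
proof -
 show "enc n = Lf \<longleftrightarrow> n = 0" by (cases n) (auto simp: enc_nat_def)
 show "enc xs = Lf \<longleftrightarrow> xs = []" by (cases xs) auto
 show "enc b = Lf \<longleftrightarrow> \<not> b" by (simp add: enc_bool_def)
qed

lemma cmp_if:
 assumes "cmp D p Tp" "cmp (%x. D x \<and> p x) f Tf" "cmp (%x. D x \<and> \<not> p x) g Tg"
 shows "cmp D (%x. if p x then f x else g x) (%x. Tp x + (if p x then Tf x else Tg x))"
 using cmp_raw_if[OF assms(1), of f Tf g Tg] assms(2,3) by simp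

lemma cmp_eq0: "cmp D f Tf ==> cmp D (%x. f x = (0::nat)) Tf"
 by (rule cmp_cong[OF cmp_le[OF cmp_raw_if[where p = f and D = D and Tp = Tf, OF _ cmp_const[of _ False] cmp_const[of _ True]], where K = 1]]) auto

lemma cmp_null: "cmp D f Tf ==> cmp D (%x. f x = []) Tf"
 by (rule cmp_cong[OF cmp_le[OF cmp_raw_if[where p = f and D = D and Tp = Tf, OF _ cmp_const[of _ False] cmp_const[of _ True]], where K = 1]]) auto

lemma cmp_not: "cmp D p Tp ==> cmp D (%x. \<not> p x) Tp"
 by (rule cmp_cong[OF cmp_le[OF cmp_if[where p = p and D = D and Tp = Tp, OF _ cmp_const[of _ False] cmp_const[of _ True]], where K = 1]]) auto

lemma cmp_and: "cmp D p Tp ==> cmp (%x. D x \<and> p x) q Tq ==> cmp D (%x. p x \<and> q x) (%x. Tp x + (if p x then Tq x else 0))"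
 by (rule cmp_cong[OF cmp_if[where p = p and f = q, OF _ _ cmp_const[of _ False]]]) auto

lemma cmp_or: "cmp D p Tp ==> cmp (%x. D x \<and> \<not> p x) q Tq ==> cmp D (%x. p x \<or> q x) (%x. Tp x + (if p x then 0 else Tq x))"
 by (rule cmp_cong[OF cmp_if[where p = p and g = q, OF _ cmp_const[of _ True]]]) auto

lemma cmp_beq: "cmp D p Tp ==> cmp D q Tq ==> cmp D (%x. p x = (q x :: bool)) (%x. Tp x + Tq x)"
proof -
 assume a: "cmp D p Tp" "cmp D q Tq"
 have q: "cmp (%x. D x \<and> p x) q Tq" "cmp (%x. D x \<and> \<not> p x) (%x. \<not> q x) Tq"
  by (rule cmp_le[OF a(2), where K = 1]; auto) (rule cmp_le[OF cmp_not[OF a(2)], where K = 1]; auto)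
 show ?thesis by (rule cmp_cong[OF cmp_le[OF cmp_if[OF a(1) q], where K = 1]]) auto
qed

lemma cmp_app2:
 assumes "cmp E (%p. h (fst p) (snd p)) T" "cmp D f Tf" "cmp D g Tg" "\<And>x. D x ==> E (f x, g x)"
 shows "cmp D (%x. h (f x) (g x)) (%x. Tf x + Tg x + T (f x, g x))"
 using cmp_app[OF assms(1) cmp_Pair[OF assms(2,3)]] assms(4) by simp

lemma cmp_app3:
 assumes "cmp E (%p. h (fst p) (fst (snd p)) (snd (snd p))) T" "cmp D f Tf" "cmp D g Tg" "cmp D k Tk"
  "\<And>x. D x ==> E (f x, g x, k x)"
 shows "cmp D (%x. h (f x) (g x) (k x)) (%x. Tf x + Tg x + Tk x + T (f x, g x, k x))"
 using cmp_app[OF assms(1) cmp_Pair[OF assms(2) cmp_Pair[OF assms(3,4)]]] assms(5) by (simp add: add.assoc)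

lemmas [cmp_intros] = cmp_beq cmp_or cmp_and cmp_not cmp_null cmp_eq0 cmp_if cmp_pred cmp_tl cmp_hd cmp_snd
 cmp_fst cmp_Suc cmp_Cons cmp_Pair cmp_const cmp_id

text \<open>Divide and conquer with two calls, where the second argument may depend on the first
  result. \<open>W\<close> is the work outside the calls and \<open>S\<close> any solution of the
  cost recurrence; since \<open>S\<close> strictly decreases, it is also the induction measure. The
  summand 2 absorbs the additive constants of the two calls.\<close>

theorem cmp_rec2:
 assumes eq: "\<And>x. D x ==> F x = (if p x then base x else post ((x, F (s1 x)), F (s2 (x, F (s1 x)))))"
  and D1: "\<And>x. D x ==> \<not> p x ==> D (s1 x)"
  and D2: "\<And>x. D x ==> \<not> p x ==> D (s2 (x, F (s1 x)))"
  and p: "cmp D p W" and b: "cmp (%x. D x \<and> p x) base W" and s1: "cmp (%x. D x \<and> \<not> p x) s1 W"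
  and s2: "cmp (%y. D (fst y) \<and> \<not> p (fst y) \<and> snd y = F (s1 (fst y))) s2 (%y. W (fst y))"
  and po: "cmp (%y. D (fst (fst y)) \<and> \<not> p (fst (fst y)) \<and> snd (fst y) = F (s1 (fst (fst y)))
    \<and> snd y = F (s2 (fst y))) post (%y. W (fst (fst y)))"
  and S1: "\<And>x. D x ==> p x ==> W x <= S x"
  and S2: "\<And>x. D x ==> \<not> p x ==> W x + S (s1 x) + S (s2 (x, F (s1 x))) + 2 <= S x"
 shows "cmp D F S"
proof -
 from p obtain cp Kp where cp: "\<And>x e. D x ==> \<exists>n \<le> Kp * (W x + 1). does e cp (enc x) (enc (p x)) n"
  by (rule cmpE) blast
 from b obtain cb Kb where cb: "\<And>x e. D x \<and> p x ==> \<exists>n \<le> Kb * (W x + 1). does e cb (enc x) (enc (base x)) n"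
  by (rule cmpE) blast
 from s1 obtain c1 K1 where c1: "\<And>x e. D x \<and> \<not> p x ==> \<exists>n \<le> K1 * (W x + 1). does e c1 (enc x) (enc (s1 x)) n"
  by (rule cmpE) blast
 from s2 obtain c2 K2 where c2: "\<And>y e. D (fst y) \<and> \<not> p (fst y) \<and> snd y = F (s1 (fst y)) ==>
  \<exists>n \<le> K2 * (W (fst y) + 1). does e c2 (enc y) (enc (s2 y)) n" by (rule cmpE) blast
 from po obtain c3 K3 where c3: "\<And>y e. D (fst (fst y)) \<and> \<not> p (fst (fst y)) \<and> snd (fst y) = F (s1 (fst (fst y)))
    \<and> snd y = F (s2 (fst y)) ==>
  \<exists>n \<le> K3 * (W (fst (fst y)) + 1). does e c3 (enc y) (enc (post y)) n" by (rule cmpE) blast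
 \<comment> \<open>\<open>cpair [] (c @ [ICall])\<close> keeps the argument beside the result of the
   call: the value goes from x to (x, F (s1 x)) and then to the triple that \<open>post\<close>
   expects.\<close>
 define body where "body = cif cp cb (cpair [] (c1 @ [ICall]) @ cpair [] (c2 @ [ICall]) @ c3)"
 define K where "K = Kp + Kb + K1 + K2 + K3 + 20"
 have main: "D x ==> \<exists>n \<le> K * (S x + 1). does (enc_code body) body (enc x) (enc (F x)) n" for x
 proof (induction "S x" arbitrary: x rule: less_induct)
  case less
  let ?f = "enc_code body"
  obtain np where np: "np <= Kp * (W x + 1)" "does ?f cp (enc x) (enc (p x)) np" using cp[OF less.prems] by blast
  show ?case
  proof (cases "p x")
   case True
   then obtain nb where nb: "nb <= Kb * (W x + 1)" "does ?f cb (enc x) (enc (base x)) nb"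
    using cb less.prems by blast
   have "does ?f body (enc x) (enc (F x)) (np + nb + 3)"
    by (subst (2) body_def, rule does_if[OF np(2)]) (use nb True eq[OF less.prems] in \<open>simp add: enc_bool_def\<close>)
   moreover have "np + nb + 3 <= K * (S x + 1)"
   proof -
    have "np + nb + 3 <= K * (W x + 1)" using np(1) nb(1) by (simp add: K_def algebra_simps)
    also have "... <= K * (S x + 1)" using S1[OF less.prems True] by (intro mult_le_mono2) simp
    finally show ?thesis .
   qed
   ultimately show ?thesis by blast
  next
   case False
   note S2' = S2[OF less.prems False]
   define r1 where "r1 = F (s1 x)"
   define y where "y = (x, r1)"
   define r2 where "r2 = F (s2 y)"
   obtain n1 where n1: "n1 <= K1 * (W x + 1)" "does ?f c1 (enc x) (enc (s1 x)) n1"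
    using c1 less.prems False by blast
   have "S (s1 x) < S x" "S (s2 y) < S x" using S2' by (auto simp: y_def r1_def)
   then obtain m1 m2 where m1: "m1 <= K * (S (s1 x) + 1)" "does ?f body (enc (s1 x)) (enc r1) m1"
    and m2: "m2 <= K * (S (s2 y) + 1)" "does ?f body (enc (s2 y)) (enc r2) m2"
    using less.hyps D1[OF less.prems False] D2[OF less.prems False]
    unfolding r1_def r2_def y_def by blast
   obtain n2 where n2: "n2 <= K2 * (W x + 1)" "does ?f c2 (enc y) (enc (s2 y)) n2"
    using c2[of y] less.prems False by (auto simp: y_def r1_def)
   obtain n3 where n3: "n3 <= K3 * (W x + 1)" "does ?f c3 (enc (y, r2)) (enc (post (y, r2))) n3"
    using c3[of "(y, r2)"] less.prems False by (auto simp: y_def r1_def r2_def)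
   have a1: "does ?f (cpair [] (c1 @ [ICall])) (enc x) (enc y) (0 + (n1 + (m1 + 2)) + 3)"
    using does_pair[OF does_Nil does_append[OF n1(2) does_call(1)[OF m1(2)]]] by (simp add: y_def enc_prod_def)
   have a2: "does ?f (cpair [] (c2 @ [ICall])) (enc y) (enc (y, r2)) (0 + (n2 + (m2 + 2)) + 3)"
    using does_pair[OF does_Nil does_append[OF n2(2) does_call(1)[OF m2(2)]]] by (simp add: enc_prod_def)
   have Fx: "F x = post (y, r2)" using eq[OF less.prems] False by (simp add: y_def r1_def r2_def)
   define N where "N = np + (0 + (n1 + (m1 + 2)) + 3 + (0 + (n2 + (m2 + 2)) + 3 + n3)) + 3"
   have "does ?f body (enc x) (enc (F x)) N"
    unfolding N_def Fx
    by (subst (2) body_def, rule does_if[OF np(2)]) (use does_append[OF a1 does_append[OF a2 n3(2)]] False in \<open>simp add: enc_bool_def\<close>)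
   moreover have "N <= K * (S x + 1)"
   proof -
    have "N <= (Kp + K1 + K2 + K3 + 13) * (W x + 1) + K * (S (s1 x) + 1) + K * (S (s2 y) + 1)"
     using np(1) n1(1) n2(1) n3(1) m1(1) m2(1) by (simp add: N_def algebra_simps)
    also have "... <= K * (W x + 1) + K * (S (s1 x) + 1) + K * (S (s2 y) + 1)"
     by (intro add_mono mult_le_mono1) (auto simp: K_def)
    also have "... = K * (W x + S (s1 x) + S (s2 y) + 3)" by (simp add: algebra_simps)
    also have "... <= K * (S x + 1)" using S2' by (intro mult_le_mono2) (simp add: y_def r1_def)
    finally show ?thesis .
   qed
   ultimately show ?thesis by blast
  qed
 qed
 show ?thesis
 proof (rule cmpI[where c = "[IFix body]" and K = "K + 2"])
  fix x f assume "D x"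
  then obtain n where "n <= K * (S x + 1)" "does (enc_code body) body (enc x) (enc (F x)) n" using main by blast
  moreover from this have "n + 2 <= (K + 2) * (S x + 1)" by (simp add: algebra_simps)
  ultimately show "\<exists>n\<le>(K + 2) * (S x + 1). does f [IFix body] (enc x) (enc (F x)) n"
   using does_call(2) by blast
 qed
qed

theorem cmp_rec1:
 assumes eq: "\<And>x. D x ==> F x = (if p x then base x else post (x, F (s x)))"
  and Ds: "\<And>x. D x ==> \<not> p x ==> D (s x)"
  and p: "cmp D p W" and b: "cmp (%x. D x \<and> p x) base W" and s: "cmp (%x. D x \<and> \<not> p x) s W"
  and po: "cmp (%y. D (fst y) \<and> \<not> p (fst y) \<and> snd y = F (s (fst y))) post (%y. W (fst y))"
  and S1: "\<And>x. D x ==> p x ==> W x <= S x"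
  and S2: "\<And>x. D x ==> \<not> p x ==> W x + S (s x) + 1 <= S x"
 shows "cmp D F S"
proof -
 from p obtain cp Kp where cp: "\<And>x e. D x ==> \<exists>n \<le> Kp * (W x + 1). does e cp (enc x) (enc (p x)) n"
  by (rule cmpE) blast
 from b obtain cb Kb where cb: "\<And>x e. D x \<and> p x ==> \<exists>n \<le> Kb * (W x + 1). does e cb (enc x) (enc (base x)) n"
  by (rule cmpE) blast
 from s obtain c1 K1 where c1: "\<And>x e. D x \<and> \<not> p x ==> \<exists>n \<le> K1 * (W x + 1). does e c1 (enc x) (enc (s x)) n"
  by (rule cmpE) blast
 from po obtain c3 K3 where c3: "\<And>y e. D (fst y) \<and> \<not> p (fst y) \<and> snd y = F (s (fst y)) ==>
  \<exists>n \<le> K3 * (W (fst y) + 1). does e c3 (enc y) (enc (post y)) n" by (rule cmpE) blast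
 define body where "body = cif cp cb (cpair [] (c1 @ [ICall]) @ c3)"
 define K where "K = Kp + Kb + K1 + K3 + 20"
 have main: "D x ==> \<exists>n \<le> K * (S x + 1). does (enc_code body) body (enc x) (enc (F x)) n" for x
 proof (induction "S x" arbitrary: x rule: less_induct)
  case less
  let ?f = "enc_code body"
  obtain np where np: "np <= Kp * (W x + 1)" "does ?f cp (enc x) (enc (p x)) np" using cp[OF less.prems] by blast
  show ?case
  proof (cases "p x")
   case True
   then obtain nb where nb: "nb <= Kb * (W x + 1)" "does ?f cb (enc x) (enc (base x)) nb"
    using cb less.prems by blast
   have "does ?f body (enc x) (enc (F x)) (np + nb + 3)"
    by (subst (2) body_def, rule does_if[OF np(2)]) (use nb True eq[OF less.prems] in \<open>simp add: enc_bool_def\<close>)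
   moreover have "np + nb + 3 <= K * (S x + 1)"
   proof -
    have "np + nb + 3 <= K * (W x + 1)" using np(1) nb(1) by (simp add: K_def algebra_simps)
    also have "... <= K * (S x + 1)" using S1[OF less.prems True] by (intro mult_le_mono2) simp
    finally show ?thesis .
   qed
   ultimately show ?thesis by blast
  next
   case False
   note S2' = S2[OF less.prems False]
   define r1 where "r1 = F (s x)"
   obtain n1 where n1: "n1 <= K1 * (W x + 1)" "does ?f c1 (enc x) (enc (s x)) n1"
    using c1 less.prems False by blast
   have "S (s x) < S x" using S2' by auto
   then obtain m1 where m1: "m1 <= K * (S (s x) + 1)" "does ?f body (enc (s x)) (enc r1) m1"
    using less.hyps Ds[OF less.prems False] unfolding r1_def by blast
   obtain n3 where n3: "n3 <= K3 * (W x + 1)" "does ?f c3 (enc (x, r1)) (enc (post (x, r1))) n3"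
    using c3[of "(x, r1)"] less.prems False by (auto simp: r1_def)
   have a1: "does ?f (cpair [] (c1 @ [ICall])) (enc x) (enc (x, r1)) (0 + (n1 + (m1 + 2)) + 3)"
    using does_pair[OF does_Nil does_append[OF n1(2) does_call(1)[OF m1(2)]]] by (simp add: enc_prod_def)
   have Fx: "F x = post (x, r1)" using eq[OF less.prems] False by (simp add: r1_def)
   define N where "N = np + (0 + (n1 + (m1 + 2)) + 3 + n3) + 3"
   have "does ?f body (enc x) (enc (F x)) N"
    unfolding N_def Fx
    by (subst (2) body_def, rule does_if[OF np(2)]) (use does_append[OF a1 n3(2)] False in \<open>simp add: enc_bool_def\<close>)
   moreover have "N <= K * (S x + 1)"
   proof -
    have "N <= (Kp + K1 + K3 + 13) * (W x + 1) + K * (S (s x) + 1)"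
     using np(1) n1(1) n3(1) m1(1) by (simp add: N_def algebra_simps)
    also have "... <= K * (W x + 1) + K * (S (s x) + 1)"
     by (intro add_mono mult_le_mono1) (auto simp: K_def)
    also have "... = K * (W x + S (s x) + 2)" by (simp add: algebra_simps)
    also have "... <= K * (S x + 1)" using S2' by (intro mult_le_mono2) simp
    finally show ?thesis .
   qed
   ultimately show ?thesis by blast
  qed
 qed
 show ?thesis
 proof (rule cmpI[where c = "[IFix body]" and K = "K + 2"])
  fix x f assume "D x"
  then obtain n where "n <= K * (S x + 1)" "does (enc_code body) body (enc x) (enc (F x)) n" using main by blast
  moreover from this have "n + 2 <= (K + 2) * (S x + 1)" by (simp add: algebra_simps)
  ultimately show "\<exists>n\<le>(K + 2) * (S x + 1). does f [IFix body] (enc x) (enc (F x)) n"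
   using does_call(2) by blast
 qed
qed

text \<open>The pieces of the recursion may come with whatever cost terms \<open>cmp_intros\<close>
  produces for them; only their comparison with \<open>W\<close>, up to a common \<open>K\<close>,
  is left as an obligation.\<close>

lemma cmp_rec1':
 assumes "\<And>x. D x ==> F x = (if p x then base x else post (x, F (s x)))"
  and "\<And>x. D x ==> \<not> p x ==> D (s x)"
  and "cmp D p Tp" "cmp (%x. D x \<and> p x) base Tb" "cmp (%x. D x \<and> \<not> p x) s Ts"
  and "cmp (%y. D (fst y) \<and> \<not> p (fst y) \<and> snd y = F (s (fst y))) post To"
  and "\<And>x. D x ==> Tp x <= K * (W x + 1)" "\<And>x. D x ==> p x ==> Tb x <= K * (W x + 1)"
  "\<And>x. D x ==> \<not> p x ==> Ts x <= K * (W x + 1)"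
  "\<And>x. D x ==> \<not> p x ==> To (x, F (s x)) <= K * (W x + 1)"
  and "\<And>x. D x ==> p x ==> W x <= S x" "\<And>x. D x ==> \<not> p x ==> W x + S (s x) + 1 <= S x"
 shows "cmp D F S"
proof (rule cmp_rec1[where W = W])
 show "cmp (%y. D (fst y) \<and> \<not> p (fst y) \<and> snd y = F (s (fst y))) post (%y. W (fst y))"
  by (rule cmp_le[OF assms(6), where K = K]) (auto, metis assms(10) prod.collapse mult_Suc_right add.commute plus_1_eq_Suc)
qed (use assms in \<open>auto intro: cmp_le[where K = K, OF assms(3)] cmp_le[where K = K, OF assms(4)] cmp_le[where K = K, OF assms(5)]\<close>)

section \<open>Unary arithmetic and list functions\<close>

lemma length_pred [simp]: "xs \<noteq> [] ==> Suc (length xs - Suc 0) = length xs"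
 by (cases xs) auto

lemma cmp_nat_add: "cmp (%_. True) (%x. fst x + snd x :: nat) (%x. fst x)"
 by (rule cmp_rec1'[where p = "%x. fst x = 0" and base = snd and s = "%x. (fst x - Suc 0, snd x)"
  and post = "%y. Suc (snd y)" and W = "%_. 0" and K = 1], (rule cmp_intros | force)+)

lemma cmp_nat_sub: "cmp (%_. True) (%x. fst x - snd x :: nat) (%x. snd x)"
 by (rule cmp_rec1'[where p = "%x. snd x = 0 \<or> fst x = 0" and base = fst and s = "%x. (fst x - Suc 0, snd x - Suc 0)"
  and post = "%y. snd y" and W = "%_. 0" and K = 1], (rule cmp_intros | force)+)

lemma cmp_nat_le: "cmp (%_. True) (%x. fst x <= (snd x :: nat)) (%x. fst x)"
 by (rule cmp_rec1'[where p = "%x. fst x = 0 \<or> snd x = 0" and base = "%x. fst x = 0" and s = "%x. (fst x - Suc 0, snd x - Suc 0)"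
  and post = "%y. snd y" and W = "%_. 0" and K = 1], (rule cmp_intros | force)+)

lemma cmp_length: "cmp (%_. True) length (%x. length x)"
 by (rule cmp_rec1'[where p = "%x. x = []" and base = "%x. 0" and s = tl
  and post = "%y. Suc (snd y)" and W = "%_. 0" and K = 1], (rule cmp_intros | force simp: neq_Nil_conv)+)

lemma cmp_append: "cmp (%_. True) (%x. fst x @ snd x) (%x. length (fst x))"
 by (rule cmp_rec1'[where p = "%x. fst x = []" and base = snd and s = "%x. (tl (fst x), snd x)"
  and post = "%y. hd (fst (fst y)) # snd y" and W = "%_. 0" and K = 1], (rule cmp_intros | force simp: neq_Nil_conv)+)

lemma cmp_revapp: "cmp (%_. True) (%x. rev (fst x) @ snd x) (%x. length (fst x))"
 by (rule cmp_rec1'[where p = "%x. fst x = []" and base = snd and s = "%x. (tl (fst x), hd (fst x) # snd x)"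
  and post = "%y. snd y" and W = "%_. 0" and K = 1], (rule cmp_intros | force simp: neq_Nil_conv)+)

lemma cmp_take: "cmp (%_. True) (%x. take (fst x) (snd x)) (%x. fst x)"
 by (rule cmp_rec1'[where p = "%x. fst x = 0 \<or> snd x = []" and base = "%x. []" and s = "%x. (fst x - Suc 0, tl (snd x))"
  and post = "%y. hd (snd (fst y)) # snd y" and W = "%_. 0" and K = 1], (rule cmp_intros | force simp: neq_Nil_conv gr0_conv_Suc)+)

lemma cmp_drop: "cmp (%_. True) (%x. drop (fst x) (snd x)) (%x. fst x)"
 by (rule cmp_rec1'[where p = "%x. fst x = 0 \<or> snd x = []" and base = snd and s = "%x. (fst x - Suc 0, tl (snd x))"
  and post = "%y. snd y" and W = "%_. 0" and K = 1], (rule cmp_intros | force simp: neq_Nil_conv gr0_conv_Suc)+)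

lemma cmp_replicate: "cmp (%_. True) (%x. replicate (fst x) (snd x)) (%x. fst x)"
 by (rule cmp_rec1'[where p = "%x. fst x = 0" and base = "%x. []" and s = "%x. (fst x - Suc 0, snd x)"
  and post = "%y. snd (fst y) # snd y" and W = "%_. 0" and K = 1], (rule cmp_intros | force simp: gr0_conv_Suc)+)

lemma cmp_zip: "cmp (%_. True) (%x. zip (fst x) (snd x)) (%x. length (fst x))"
 by (rule cmp_rec1'[where p = "%x. fst x = [] \<or> snd x = []" and base = "%x. []" and s = "%x. (tl (fst x), tl (snd x))"
  and post = "%y. (hd (fst (fst y)), hd (snd (fst y))) # snd y" and W = "%_. 0" and K = 1], (rule cmp_intros | force simp: neq_Nil_conv | (case_tac "fst x"; simp))+)

lemmas true_app = cmp_app[where E = "%_. True", OF _ _ TrueI]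
lemmas true_app2 = cmp_app2[where E = "%_. True", OF _ _ _ TrueI, simplified fst_conv snd_conv]

lemmas [cmp_intros] = true_app2[OF cmp_nat_add, unfolded fst_conv snd_conv] true_app2[OF cmp_nat_sub, unfolded fst_conv snd_conv] true_app2[OF cmp_nat_le, unfolded fst_conv snd_conv]
 true_app[OF cmp_length, unfolded fst_conv snd_conv] true_app2[OF cmp_append, unfolded fst_conv snd_conv] true_app2[OF cmp_take, unfolded fst_conv snd_conv] true_app2[OF cmp_drop, unfolded fst_conv snd_conv]
 true_app2[OF cmp_replicate, unfolded fst_conv snd_conv] true_app2[OF cmp_zip, unfolded fst_conv snd_conv]

lemma cmp_nat_less [cmp_intros]:
 "cmp D f Tf ==> cmp D g Tg ==> cmp D (%x. f x < (g x :: nat)) (%x. Tg x + Tf x + g x)"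
 unfolding not_le[symmetric] by (rule cmp_not, rule true_app2[OF cmp_nat_le, unfolded fst_conv snd_conv])

lemma cmp_rev [cmp_intros]: "cmp D f Tf ==> cmp D (%x. rev (f x)) (%x. Tf x + length (f x))"
 using true_app2[OF cmp_revapp, of D f Tf "%x. []" "%x. 0"] cmp_const[of D "[]"] by simp

text \<open>The language has no closures, so the free variables of the mapped function travel along
  as the parameter \<open>c x\<close>.\<close>

lemma cmp_map:
 assumes "cmp E (%p. h (fst p) (snd p)) T" "cmp D c Tc" "cmp D xs Tx"
  "\<And>x y. D x ==> y \<in> set (xs x) ==> E (c x, y)"
 shows "cmp D (%x. map (h (c x)) (xs x)) (%x. Tc x + Tx x + (\<Sum>y\<leftarrow>xs x. T (c x, y) + 1))"
proof -
 let ?D = "%x. \<forall>y\<in>set (snd x). E (fst x, y)"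
 let ?W = "%x. if snd x = [] then 0 else T (fst x, hd (snd x))"
 have "cmp ?D (%x. map (h (fst x)) (snd x)) (%x. \<Sum>y\<leftarrow>snd x. T (fst x, y) + 1)"
 proof (rule cmp_rec1'[where p = "%x. snd x = []" and base = "%x. []" and s = "%x. (fst x, tl (snd x))"
   and post = "%y. h (fst (fst y)) (hd (snd (fst y))) # snd y" and W = ?W and K = 1])
  show "cmp (%y. ?D (fst y) \<and> snd (fst y) \<noteq> [] \<and> snd y = map (h (fst (fst (fst y), tl (snd (fst y))))) (snd (fst (fst y), tl (snd (fst y)))))
   (%y. h (fst (fst y)) (hd (snd (fst y))) # snd y) (%y. 0 + 0 + T (fst (fst y), hd (snd (fst y))) + 0)"
   by (rule cmp_Cons, rule cmp_app2[OF assms(1)], (rule cmp_intros | force)+)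
 qed ((rule cmp_intros | force simp: neq_Nil_conv)+)
 from cmp_app[OF this cmp_Pair[OF assms(2,3)]] assms(4) show ?thesis by simp
qed

lemma cmp_nat_mult: "cmp (%_. True) (%x. fst x * snd x :: nat) (%x. fst x * (snd x + 1))"
 by (rule cmp_rec1'[where p = "%x. fst x = 0" and base = "%x. 0" and s = "%x. (fst x - Suc 0, snd x)"
  and post = "%y. snd (fst y) + snd y" and W = "%x. if fst x = 0 then 0 else snd x" and K = 1],
  (rule cmp_intros | force simp: gr0_conv_Suc algebra_simps)+)

lemma cmp_nat_div: "cmp (%_. True) (%x. fst x div snd x :: nat) (%x. 3 * fst x + snd x)"
 by (rule cmp_rec1'[where p = "%x. snd x = 0 \<or> fst x < snd x" and base = "%x. 0" and s = "%x. (fst x - snd x, snd x)"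
  and post = "%y. Suc (snd y)" and W = "%x. snd x" and K = 1], (rule cmp_intros | force simp: le_div_geq)+)

lemmas [cmp_intros] = true_app2[OF cmp_nat_mult, unfolded fst_conv snd_conv] true_app2[OF cmp_nat_div, unfolded fst_conv snd_conv]

lemma cmp_nat_mod [cmp_intros]:
 assumes "cmp D f Tf" "cmp D g Tg"
 shows "cmp D (%x. f x mod g x :: nat) (%x. Tf x + Tg x + f x + g x)"
 unfolding minus_div_mult_eq_mod[symmetric]
 apply (rule cmp_le[where K = 10])
  apply (rule cmp_intros assms)+
 apply simp
 subgoal for x
 proof -
  obtain q where q: "f x div g x = q" by blast
  have "g x * q <= f x" "q <= f x" using q times_div_less_eq_dividend[of "g x" "f x"] div_le_dividend[of "f x" "g x"] by auto
  then show ?thesis unfolding q by (simp add: algebra_simps)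
 qed
 done

lemma cmp_nat_power: "cmp (%_. True) (%x. fst x ^ snd x :: nat) (%x. snd x * (fst x ^ snd x + fst x + 3))"
proof (rule cmp_rec1'[where p = "%x. snd x = 0" and base = "%x. 1" and s = "%x. (fst x, snd x - Suc 0)"
  and post = "%y. fst (fst y) * snd y" and W = "%x. if snd x = 0 then 0 else fst x ^ snd x + fst x" and K = 1])
 fix x :: "nat \<times> nat" assume "snd x \<noteq> 0"
 then obtain a e where x: "x = (a, Suc e)" by (metis not0_implies_Suc prod.collapse)
 have le: "e * a ^ e <= a * (e * a ^ e)" by (cases "a = 0"; cases e) auto
 show "(if snd x = 0 then 0 else fst x ^ snd x + fst x) + snd (fst x, snd x - Suc 0) *
  (fst (fst x, snd x - Suc 0) ^ snd (fst x, snd x - Suc 0) + fst (fst x, snd x - Suc 0) + 3) + 1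
   <= snd x * (fst x ^ snd x + fst x + 3)"
  unfolding x apply (simp add: algebra_simps) using le by linarith
qed ((rule cmp_intros | force simp: gr0_conv_Suc)+)

lemmas [cmp_intros] = true_app2[OF cmp_nat_power, unfolded fst_conv snd_conv]

section \<open>Arithmetic on bit lists\<close>

primrec val :: "bool list => nat" where
 "val [] = 0" | "val (b # bs) = of_bool b + 2 * val bs"

fun addb :: "bool => bool list => bool list => bool list" where
 "addb c [] [] = [c]"
| "addb c (x # xs) [] = (x \<noteq> c) # addb (x \<and> c) xs []"
| "addb c [] (y # ys) = (y \<noteq> c) # addb (y \<and> c) [] ys"
| "addb c (x # xs) (y # ys) = ((x \<noteq> y) \<noteq> c) # addb (x \<and> y \<or> c \<and> (x \<or> y)) xs ys"

fun subb :: "bool => bool list => bool list => bool list" where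
 "subb c [] ys = []"
| "subb c (x # xs) [] = (x \<noteq> c) # subb (\<not> x \<and> c) xs []"
| "subb c (x # xs) (y # ys) = ((x \<noteq> y) \<noteq> c) # subb (\<not> x \<and> (y \<or> c) \<or> y \<and> c) xs ys"

text \<open>School multiplication, for the base case of the fast algorithm and for multiplying a
  long number by a small base.\<close>

primrec nmul :: "bool list => bool list => bool list" where
 "nmul [] ys = []"
| "nmul (x # xs) ys = addb False (if x then ys else []) (False # nmul xs ys)"

lemma val_addb [simp]: "val (addb c xs ys) = of_bool c + val xs + val ys"
 by (induction c xs ys rule: addb.induct) (auto simp: of_bool_def)

lemma length_addb [simp]: "length (addb c xs ys) = Suc (max (length xs) (length ys))"
 by (induction c xs ys rule: addb.induct) auto

lemma val_subb: "val ys + of_bool c <= val xs ==> val (subb c xs ys) + val ys + of_bool c = val xs"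
 by (induction c xs ys rule: subb.induct) (auto simp: of_bool_def split: if_splits)

lemma length_subb [simp]: "length (subb c xs ys) = length xs"
 by (induction c xs ys rule: subb.induct) auto

lemma val_nmul [simp]: "val (nmul xs ys) = val xs * val ys"
 by (induction xs) (auto simp: algebra_simps)

lemma length_nmul: "length (nmul xs ys) <= length ys + 2 * length xs"
 by (induction xs) auto

lemma val_append [simp]: "val (xs @ ys) = val xs + 2 ^ length xs * val ys"
 by (induction xs) (auto simp: algebra_simps)

lemma val_replicate_False [simp]: "val (replicate n False) = 0"
 by (induction n) auto

lemma val_less: "val xs < 2 ^ length xs"
 by (induction xs) (auto simp: of_bool_def)

lemma val_drop: "val (drop n xs) = val xs div 2 ^ n"
proof (induction n arbitrary: xs)
 case (Suc n)
 then show ?case by (cases xs) (auto simp: div_mult2_eq of_bool_def)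
qed simp

lemma val_take: "val (take n xs) = val xs mod 2 ^ n"
proof (induction n arbitrary: xs)
 case (Suc n)
 then show ?case by (cases xs) (auto simp: mod_mult2_eq of_bool_def)
qed simp

text \<open>The pattern equations of \<open>addb\<close> brought into the single conditional that
  \<open>cmp_rec1'\<close> expects; a missing bit counts as \<open>False\<close>.\<close>

lemma addb_rec: "addb c xs ys = (if xs = [] \<and> ys = [] then [c] else
 (((xs \<noteq> [] \<and> hd xs) \<noteq> (ys \<noteq> [] \<and> hd ys)) \<noteq> c)
 # addb ((xs \<noteq> [] \<and> hd xs) \<and> (ys \<noteq> [] \<and> hd ys) \<or> c \<and> ((xs \<noteq> [] \<and> hd xs) \<or> (ys \<noteq> [] \<and> hd ys))) (tl xs) (tl ys))"
 by (cases xs; cases ys) (auto simp: conj_commute)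

lemma cmp_addb: "cmp (%_. True) (%x. addb (fst x) (fst (snd x)) (snd (snd x))) (%x. length (fst (snd x)) + length (snd (snd x)))"
 by (rule cmp_rec1'[where p = "%x. fst (snd x) = [] \<and> snd (snd x) = []" and base = "%x. [fst x]"
  and s = "%x. ((fst (snd x) \<noteq> [] \<and> hd (fst (snd x))) \<and> (snd (snd x) \<noteq> [] \<and> hd (snd (snd x))) \<or>
    fst x \<and> ((fst (snd x) \<noteq> [] \<and> hd (fst (snd x))) \<or> (snd (snd x) \<noteq> [] \<and> hd (snd (snd x)))), tl (fst (snd x)), tl (snd (snd x)))"
  and post = "%y. (((fst (snd (fst y)) \<noteq> [] \<and> hd (fst (snd (fst y)))) \<noteq> (snd (snd (fst y)) \<noteq> [] \<and> hd (snd (snd (fst y))))) \<noteq> fst (fst y)) # snd y"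
  and W = "%x. 0" and K = 1],
  (rule addb_rec[THEN trans] | rule cmp_intros | force simp: neq_Nil_conv | simp; (case_tac "fst (snd x)"; case_tac "snd (snd x)"; simp))+)

section \<open>Quasi-linear multiplication\<close>

primrec lp :: "('a => complex) => 'a list => complex poly" where
 "lp g [] = 0" | "lp g (c # cs) = pCons (g c) (lp g cs)"

lemma coeff_lp: "coeff (lp g xs) i = (if i < length xs then g (xs ! i) else 0)"
proof (induction xs arbitrary: i)
 case (Cons x xs)
 then show ?case by (cases i) auto
qed simp

lemma sum_in_Nats: "(\<And>i. i \<in> A ==> f i \<in> \<nat>) ==> sum f A \<in> (\<nat> :: complex set)"
 by (induction A rule: infinite_finite_induct) auto

lemma degree_lp: "degree (lp g xs) <= length xs - 1"
 by (rule degree_le) (auto simp: coeff_lp)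

lemma lp_append: "lp g (xs @ ys) = lp g xs + monom 1 (length xs) * lp g ys"
 by (induction xs) (auto simp: monom_Suc monom_0 one_pCons[symmetric])

lemma lp_zero: "(\<And>x. x \<in> set xs ==> g x = 0) ==> lp g xs = 0"
 by (induction xs) auto

text \<open>Congruences modulo x^m + 1 or y^(2r) - 1 are expressed by evaluation at the complex
  roots of the modulus. This replaces calculations in quotient rings by equations between complex
  numbers.\<close>

definition pe :: "bool list list => complex poly" where "pe = lp (%c. of_nat (val c))"
definition ev :: "complex => bool list list => complex" where "ev x u = poly (pe u) x"
definition ev2 :: "complex => complex => bool list list list => complex" where
 "ev2 x y F = poly (lp (ev x) F) y"

lemma ev_Nil [simp]: "ev x [] = 0" by (simp add: ev_def pe_def)
lemma ev_Cons [simp]: "ev x (c # u) = of_nat (val c) + x * ev x u" by (simp add: ev_def pe_def)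
lemma ev2_Nil [simp]: "ev2 x y [] = 0" by (simp add: ev2_def)
lemma ev2_Cons [simp]: "ev2 x y (u # F) = ev x u + y * ev2 x y F" by (simp add: ev2_def)
lemma ev_append [simp]: "ev x (u @ v) = ev x u + x ^ length u * ev x v"
 by (induction u) (auto simp: algebra_simps)
lemma ev2_append [simp]: "ev2 x y (F @ G) = ev2 x y F + y ^ length F * ev2 x y G"
 by (induction F) (auto simp: algebra_simps)
lemma ev_zeros [simp]: "ev x (replicate n []) = 0" by (induction n) auto
lemma ev2_zeros [simp]: "ev2 x y (replicate n (replicate m [])) = 0" by (induction n) auto

fun padd :: "bool list list => bool list list => bool list list" where
 "padd [] gs = gs"
| "padd (f # fs) [] = f # fs"
| "padd (f # fs) (g # gs) = addb False f g # padd fs gs"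

lemma ev_padd [simp]: "ev x (padd f g) = ev x f + ev x g"
 by (induction f g rule: padd.induct) (auto simp: algebra_simps)

lemma length_padd [simp]: "length (padd f g) = max (length f) (length g)"
 by (induction f g rule: padd.induct) auto

definition narrow :: "nat => bool list list => bool" where
 "narrow w f \<longleftrightarrow> (\<forall>c\<in>set f. length c <= w)"

lemma narrow_simps [simp]: "narrow w []" "narrow w (c # f) \<longleftrightarrow> length c <= w \<and> narrow w f"
 "narrow w (f @ g) \<longleftrightarrow> narrow w f \<and> narrow w g" "narrow w (replicate n [])"
 by (auto simp: narrow_def)

lemma narrow_mono: "narrow w f ==> w <= w' ==> narrow w' f"
 by (auto simp: narrow_def)

lemma narrow_take: "narrow w f ==> narrow w (take n f)" and narrow_drop: "narrow w f ==> narrow w (drop n f)"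
 by (auto simp: narrow_def dest: in_set_takeD in_set_dropD)

lemma narrow_padd: "narrow w f ==> narrow w g ==> narrow (Suc w) (padd f g)"
 by (induction f g rule: padd.induct) (auto intro: narrow_mono)

text \<open>Multiplication by x^e modulo x^n - 1, where n is the length of \<open>f\<close>. With n
  = 2m and x^m = -1 at the relevant points, negation is rotation by m; coefficients can thus stay
  natural numbers throughout the transform.\<close>

definition rotr :: "nat => bool list list => bool list list" where
 "rotr e f = drop (length f - e) f @ take (length f - e) f"

lemma length_rotr [simp]: "length (rotr e f) = length f" by (simp add: rotr_def)

lemma narrow_rotr: "narrow w f ==> narrow w (rotr e f)"
 by (simp add: rotr_def narrow_take narrow_drop)

lemma ev_rotr:
 assumes "x ^ length f = 1" "e <= length f"
 shows "ev x (rotr e f) = x ^ e * ev x f"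
proof -
 let ?k = "length f - e"
 have "ev x f = ev x (take ?k f @ drop ?k f)" by simp
 also have "... = ev x (take ?k f) + x ^ ?k * ev x (drop ?k f)" by (subst ev_append) simp
 finally have "x ^ e * ev x f = x ^ e * ev x (take ?k f) + x ^ (e + ?k) * ev x (drop ?k f)"
  by (simp add: algebra_simps power_add)
 then show ?thesis using assms by (simp add: rotr_def)
qed

definition madd :: "bool list list list => bool list list list => bool list list list" where
 "madd F G = map (%p. padd (fst p) (snd p)) (zip F G)"

text \<open>A family of polynomials over Z[x]/(x^n - 1), given by coefficient lists of length n.\<close>
definition family :: "nat => nat => nat => bool list list list => bool" where
 "family N n w F \<longleftrightarrow> length F = N \<and> (\<forall>u\<in>set F. length u = n \<and> narrow w u)"

lemma family_Nil: "family 0 n w F \<longleftrightarrow> F = []" by (auto simp: family_def)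

lemma family_append: "family N n w F ==> family M n w G ==> family (N + M) n w (F @ G)"
 by (auto simp: family_def)

lemma family_take: "family (N + M) n w F ==> family N n w (take N F)"
 and family_drop: "family (N + M) n w F ==> family M n w (drop N F)"
 by (auto simp: family_def dest: in_set_takeD in_set_dropD)

lemma family_rotr: "family N n w F ==> family N n w (map (rotr e) F)"
 by (auto simp: family_def narrow_rotr)

lemma family_madd: "family N n w F ==> family N n w G ==> family N n (Suc w) (madd F G)"
 unfolding family_def madd_def
 by auto (metis set_zip_leftD set_zip_rightD max.idem narrow_padd)+

lemma ev2_madd: "length F = length G ==> ev2 x y (madd F G) = ev2 x y F + ev2 x y G"
 by (induction F G rule: list_induct2) (auto simp: madd_def algebra_simps)

lemma ev2_rotr:
 "x ^ n = 1 ==> e <= n ==> (\<And>u. u \<in> set F ==> length u = n) ==> ev2 x y (map (rotr e) F) = x ^ e * ev2 x y F"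
 by (induction F) (auto simp: algebra_simps ev_rotr)

text \<open>\<open>F\<close> is a polynomial in y modulo y^(2^l) - x^e. With h = e/2 the two halves
  are its residues modulo the factors y^(2^(l-1)) - x^h and y^(2^(l-1)) + x^h, the second being
  written with the exponent h + m.\<close>

primrec fft :: "nat => nat => nat => bool list list list => bool list list list" where
 "fft m 0 e F = F"
| "fft m (Suc l) e F = (let h = e div 2; k = length F div 2; hi = map (rotr h) (drop k F)
  in fft m l h (madd (take k F) hi) @ fft m l (h + m) (madd (take k F) (map (rotr m) hi)))"

text \<open>The inverse up to a factor: the 2 that arises at every level is left in place, for a
  total of 2^l. Rotation by 2m - h is multiplication by x^(-h).\<close>

primrec ifft :: "nat => nat => nat => bool list list list => bool list list list" where
 "ifft m 0 e H = H"
| "ifft m (Suc l) e H = (let h = e div 2; k = length H div 2;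
   h1 = ifft m l h (take k H); h2 = ifft m l (h + m) (drop k H)
  in madd h1 h2 @ map (rotr (2 * m - h)) (madd h1 (map (rotr m) h2)))"

lemma family_fft: "family (2 ^ l) n w F ==> family (2 ^ l) n (w + l) (fft m l e F)"
proof (induction l arbitrary: e F w)
 case (Suc l)
 have F: "family (2 ^ l + 2 ^ l) n w F" using Suc.prems by (simp add: mult_2)
 have k: "length F div 2 = 2 ^ l" using Suc.prems by (simp add: family_def)
 note lo = family_take[OF F] and hi = family_rotr[OF family_drop[OF F], of "e div 2"]
 have "family (2 ^ l + 2 ^ l) n (Suc w + l) (fft m (Suc l) e F)"
  unfolding fft.simps Let_def k
  by (intro family_append Suc.IH family_madd lo hi family_rotr)
 then show ?case by (simp add: mult_2)
qed simp

lemma family_ifft: "family (2 ^ l) n w F ==> family (2 ^ l) n (w + l) (ifft m l e F)"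
proof (induction l arbitrary: e F w)
 case (Suc l)
 have F: "family (2 ^ l + 2 ^ l) n w F" using Suc.prems by (simp add: mult_2)
 have k: "length F div 2 = 2 ^ l" using Suc.prems by (simp add: family_def)
 have "family (2 ^ l + 2 ^ l) n (Suc (w + l)) (ifft m (Suc l) e F)"
  unfolding ifft.simps Let_def k
  by (intro family_append family_madd family_rotr Suc.IH family_take[OF F] family_drop[OF F])
 then show ?case by (simp add: mult_2)
qed simp

text \<open>At a point with y^(2^l) = x^e the number y^(2^(l-1)) is x^h or -x^h, so exactly one of
  the two subtransforms belongs to the point. Recombination yields twice its value, whence the
  factor 2^l. The pointwise product \<open>r\<close> has to be right only after evaluation at
  \<open>x\<close>, so it may reduce modulo x^(2m) - 1.\<close>

lemma fft_convolution:
 assumes x: "x ^ m = -1"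
  and r: "\<And>u v. length u = 2 * m ==> narrow W u ==> length v = 2 * m ==> narrow W v ==>
   length (r (u, v)) = 2 * m \<and> ev x (r (u, v)) = ev x u * ev x v"
  and "y ^ (2 ^ l) = x ^ e" "2 ^ l dvd e" "2 ^ l dvd 2 * m" "e <= 2 * m"
  "family (2 ^ l) (2 * m) w F" "family (2 ^ l) (2 * m) w G" "w + l <= W"
 shows "ev2 x y (ifft m l e (map r (zip (fft m l e F) (fft m l e G)))) = 2 ^ l * (ev2 x y F * ev2 x y G)"
  (is "?C l e F G y")
 using assms(3-)
proof (induction l arbitrary: e F G w y)
 case 0
 then obtain u v where "F = [u]" "G = [v]" by (auto simp: family_def length_Suc_conv)
 then show ?case using 0 r[of u v] by (auto simp: family_def intro: narrow_mono)
next
 case (Suc l)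
 define h where "h = e div 2"
 have e: "e = 2 * h" "2 ^ l dvd h" using Suc.prems(2) by (auto simp: h_def dvd_def)
 have m: "2 ^ l dvd m" "2 ^ l dvd 2 * m" using Suc.prems(3) by (auto simp: dvd_def)
 have hm: "h <= m" using Suc.prems(4) e by simp
 have x2: "x ^ (2 * m) = 1" using x by (simp add: power_mult mult.commute[of 2])
 have dims: "family (2 ^ l + 2 ^ l) (2 * m) w F" "family (2 ^ l + 2 ^ l) (2 * m) w G"
  using Suc.prems by (simp_all add: mult_2)
 have k: "length F div 2 = 2 ^ l" "length G div 2 = 2 ^ l" using Suc.prems by (auto simp: family_def)
 let ?k = "2 ^ l :: nat"
 define F1 where "F1 = madd (take ?k F) (map (rotr h) (drop ?k F))"
 define F2 where "F2 = madd (take ?k F) (map (rotr m) (map (rotr h) (drop ?k F)))"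
 define G1 where "G1 = madd (take ?k G) (map (rotr h) (drop ?k G))"
 define G2 where "G2 = madd (take ?k G) (map (rotr m) (map (rotr h) (drop ?k G)))"
 have fam: "family ?k (2 * m) (Suc w) F1" "family ?k (2 * m) (Suc w) F2"
  "family ?k (2 * m) (Suc w) G1" "family ?k (2 * m) (Suc w) G2"
  unfolding F1_def F2_def G1_def G2_def
  by (intro family_madd family_rotr family_take[OF dims(1)] family_take[OF dims(2)]
    family_drop[OF dims(1)] family_drop[OF dims(2)])+
 have lens: "length F = ?k + ?k" "length G = ?k + ?k"
  "\<And>u. u \<in> set (drop ?k F) ==> length u = 2 * m" "\<And>u. u \<in> set (drop ?k G) ==> length u = 2 * m"
  using dims by (auto simp: family_def dest: in_set_dropD)
 have evF: "ev2 x y F = ev2 x y (take ?k F) + y ^ ?k * ev2 x y (drop ?k F)"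
  using ev2_append[of x y "take ?k F" "drop ?k F"] lens by simp
 have evG: "ev2 x y G = ev2 x y (take ?k G) + y ^ ?k * ev2 x y (drop ?k G)"
  using ev2_append[of x y "take ?k G" "drop ?k G"] lens by simp
 have rot: "ev2 x y (map (rotr h) (drop ?k F)) = x ^ h * ev2 x y (drop ?k F)"
  "ev2 x y (map (rotr h) (drop ?k G)) = x ^ h * ev2 x y (drop ?k G)"
  using lens hm by (auto intro!: ev2_rotr[OF x2])
 have rot2: "ev2 x y (map (rotr m) (map (rotr h) (drop ?k F))) = x ^ m * (x ^ h * ev2 x y (drop ?k F))"
  "ev2 x y (map (rotr m) (map (rotr h) (drop ?k G))) = x ^ m * (x ^ h * ev2 x y (drop ?k G))"
  unfolding rot[symmetric] using lens hm by (intro ev2_rotr[OF x2]; auto)+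
 have ev1: "ev2 x y F1 = ev2 x y (take ?k F) + x ^ h * ev2 x y (drop ?k F)"
  "ev2 x y G1 = ev2 x y (take ?k G) + x ^ h * ev2 x y (drop ?k G)"
  "ev2 x y F2 = ev2 x y (take ?k F) - x ^ h * ev2 x y (drop ?k F)"
  "ev2 x y G2 = ev2 x y (take ?k G) - x ^ h * ev2 x y (drop ?k G)"
  unfolding F1_def F2_def G1_def G2_def
  using lens rot rot2 x by (simp_all add: ev2_madd del: map_map)
 define p1 where "p1 = map r (zip (fft m l h F1) (fft m l h G1))"
 define p2 where "p2 = map r (zip (fft m l (h + m) F2) (fft m l (h + m) G2))"
 define h1 where "h1 = ifft m l h p1"
 define h2 where "h2 = ifft m l (h + m) p2"
 have "length (fft m l h F1) = ?k" "length (fft m l h G1) = ?k"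
  "length (fft m l (h + m) F2) = ?k" "length (fft m l (h + m) G2) = ?k"
  using fam[THEN family_fft] by (auto simp: family_def)
 note lf = this
 have pw: "map r (zip (fft m (Suc l) e F) (fft m (Suc l) e G)) = p1 @ p2"
  unfolding fft.simps Let_def k h_def[symmetric] F1_def[symmetric] F2_def[symmetric] G1_def[symmetric] G2_def[symmetric]
  using lf by (simp add: p1_def p2_def)
 have lp: "length p1 = ?k" "length p2 = ?k" using lf by (auto simp: p1_def p2_def)
 have elems: "length (r z) = 2 * m"
  if z: "z \<in> set (zip (fft m l a A) (fft m l a B))" and A: "family ?k (2 * m) (Suc w) A" and B: "family ?k (2 * m) (Suc w) B" for z a A B
 proof -
  obtain u v where uv: "z = (u, v)" by (cases z)
  have "u \<in> set (fft m l a A)" "v \<in> set (fft m l a B)" using z uv by (auto dest: set_zip_leftD set_zip_rightD)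
  then have "length u = 2 * m" "narrow (Suc w + l) u" "length v = 2 * m" "narrow (Suc w + l) v"
   using family_fft[OF A, of m a] family_fft[OF B, of m a] by (auto simp: family_def)
  then show ?thesis using r[of u v] uv Suc.prems(7) narrow_mono by auto
 qed
 \<comment> \<open>Nothing is assumed about the widths that \<open>r\<close> produces;
   \<open>V\<close> is just a common finite bound, so that \<open>family_ifft\<close> can be used
   for the lengths.\<close>
 define V where "V = Max (insert 0 (length ` \<Union> (set ` set (p1 @ p2))))"
 have V: "length c <= V" if "u \<in> set (p1 @ p2)" "c \<in> set u" for u c
  unfolding V_def using that by (intro Max_ge) auto
 have famp: "family ?k (2 * m) V p1" "family ?k (2 * m) V p2"
 proof -
  have "length u = 2 * m" if "u \<in> set p1 \<or> u \<in> set p2" for u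
   using that elems[OF _ fam(1,3)] elems[OF _ fam(2,4)] unfolding p1_def p2_def by auto
  then show "family ?k (2 * m) V p1" "family ?k (2 * m) V p2"
   using lp V unfolding family_def narrow_def by auto
 qed
 have famh: "family ?k (2 * m) (V + l) h1" "family ?k (2 * m) (V + l) h2"
  using famp by (auto simp: h1_def h2_def intro: family_ifft)
 have kk: "length (p1 @ p2) div 2 = ?k" using lp by simp
 have res: "ifft m (Suc l) e (p1 @ p2) = madd h1 h2 @ map (rotr (2 * m - h)) (madd h1 (map (rotr m) h2))"
  unfolding ifft.simps Let_def kk using lp by (simp add: h1_def h2_def h_def)
 have lh: "length h1 = ?k" "length h2 = ?k" "\<And>u. u \<in> set h2 ==> length u = 2 * m"
  using famh by (auto simp: family_def)
 have "family ?k (2 * m) (Suc (V + l)) (madd h1 (map (rotr m) h2))"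
  by (intro family_madd family_rotr famh)
 then have rr: "ev2 x y (map (rotr (2 * m - h)) (madd h1 (map (rotr m) h2)))
   = x ^ (2 * m - h) * ev2 x y (madd h1 (map (rotr m) h2))"
  by (intro ev2_rotr[OF x2]) (auto simp: family_def)
 have "ev2 x y (map (rotr m) h2) = x ^ m * ev2 x y h2" by (rule ev2_rotr[OF x2]) (use lh in auto)
 then have out: "ev2 x y (ifft m (Suc l) e (p1 @ p2)) =
  ev2 x y h1 + ev2 x y h2 + y ^ ?k * (x ^ (2 * m - h) * (ev2 x y h1 - ev2 x y h2))"
  unfolding res using lh x rr by (simp add: ev2_madd madd_def[of h1 h2]) (simp add: madd_def[symmetric] ev2_madd)
 have inv: "x ^ h * x ^ (2 * m - h) = 1" using hm x2 by (simp add: power_add[symmetric])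
 \<comment> \<open>Of the two square roots, the first makes y^k * x^(-h) equal to 1 and leaves 2 h1,
   the second makes it -1 and leaves 2 h2.\<close>
 have "(y ^ ?k) ^ 2 = (x ^ h) ^ 2" using Suc.prems(1) e by (simp add: power_mult[symmetric] mult.commute)
 then consider "y ^ ?k = x ^ h" | "y ^ ?k = - (x ^ h)" by (auto simp: power2_eq_iff)
 then show ?case
 proof cases
  case 1
  have "ev2 x y h1 = 2 ^ l * (ev2 x y F1 * ev2 x y G1)"
   unfolding h1_def p1_def by (rule Suc.IH[OF 1 e(2) m(2) _ fam(1,3)]) (use hm Suc.prems in auto)
  then have E1: "ev2 x y h1 = 2 ^ l * (ev2 x y F * ev2 x y G)" using ev1 evF evG 1 by simp
  have E2: "y ^ ?k * (x ^ (2 * m - h) * (ev2 x y h1 - ev2 x y h2)) = ev2 x y h1 - ev2 x y h2"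
   using inv 1 by (simp add: mult.assoc[symmetric])
  show ?thesis unfolding pw out E2 by (simp add: E1)
 next
  case 2
  have 22: "y ^ ?k = x ^ (h + m)" using 2 x by (simp add: power_add)
  have "ev2 x y h2 = 2 ^ l * (ev2 x y F2 * ev2 x y G2)"
   unfolding h2_def p2_def
   by (rule Suc.IH[OF 22 _ m(2) _ fam(2,4)]) (use hm e m Suc.prems in auto)
  then have E1: "ev2 x y h2 = 2 ^ l * (ev2 x y F * ev2 x y G)" using ev1 evF evG 2 by simp
  have E2: "y ^ ?k * (x ^ (2 * m - h) * (ev2 x y h1 - ev2 x y h2)) = ev2 x y h2 - ev2 x y h1"
   using inv 2 by (simp add: mult.assoc[symmetric])
  show ?thesis unfolding pw out E2 by (simp add: E1)
 qed
qed

text \<open>Reduction modulo x^m + 1 by subtracting the upper half from the lower one, followed by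
  division by 2^l, which drops the low bits. Both are exact when the true coefficients are natural
  numbers.\<close>

definition fin :: "nat => nat => bool list list => bool list list" where
 "fin l m u = map (%p. drop l (subb False (fst p) (snd p))) (zip (take m u) (drop m u))"

text \<open>An identity that holds at all pairs of an m-th root of -1 and a 2r-th root of unity is an
 identity of polynomials, because of the degree bounds.\<close>
lemma roots_determine_product:
 fixes F G :: "bool list list list"
 assumes F: "length F = r" "\<And>u. u \<in> set F ==> length u = s" and G: "length G = r" "\<And>u. u \<in> set G ==> length u = s"
  and H: "length H = 2 * r" "\<And>u. u \<in> set H ==> length u = 2 * m" and m: "m = 2 * s" "0 < s" "0 < r"
  and ev: "\<And>x y. x ^ m = -1 ==> y ^ (2 * r) = 1 ==> ev2 x y H = 2 ^ l * (ev2 x y F * ev2 x y G)"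
 shows "ev2 x y (map (fin l m) H) = ev2 x y F * ev2 x y G"
  and "ev x (fin l m (H ! (2 * r - 1))) = 0"
proof -
 \<comment> \<open>\<open>C i\<close> is the coefficient of y^i in the true product, as a polynomial
   in x. Its degree is below m, so it is determined by its values at the m roots of x^m =
   -1.\<close>
 define C where "C i = (\<Sum>j\<le>i. if j < r \<and> i - j < r then pe (F ! j) * pe (G ! (i - j)) else 0)" for i
 have prodC: "coeff (lp (ev x) F * lp (ev x) G) i = poly (C i) x" for x i
  unfolding C_def coeff_mult poly_sum
  by (rule sum.cong) (auto simp: coeff_lp F(1) G(1) ev_def)
 have degC: "degree (C i) < m" for i
 proof -
  have "degree (C i) <= 2 * (s - 1)" unfolding C_def
  proof (rule degree_sum_le)
   fix j
   have "degree (pe (F ! j) * pe (G ! (i - j))) <= 2 * (s - 1)" if "j < r" "i - j < r"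
   proof -
    have "degree (pe (F ! j) * pe (G ! (i - j))) <= degree (pe (F ! j)) + degree (pe (G ! (i - j)))"
     by (rule degree_mult_le)
    also have "degree (pe (F ! j)) <= s - 1"
     using degree_lp[of _ "F ! j"] F that by (simp add: pe_def)
    also have "degree (pe (G ! (i - j))) <= s - 1"
     using degree_lp[of _ "G ! (i - j)"] G that by (simp add: pe_def)
    finally show ?thesis by simp
   qed
   then show "degree (if j < r \<and> i - j < r then pe (F ! j) * pe (G ! (i - j)) else 0) <= 2 * (s - 1)" by auto
  qed simp
  then show ?thesis using m by simp
 qed
 have natC: "coeff (C i) t \<in> \<nat>" for i t
 proof -
  have "coeff (pe (F ! j) * pe (G ! k)) t \<in> \<nat>" for j k
   unfolding coeff_mult pe_def by (intro sum_in_Nats Nats_mult) (auto simp: coeff_lp)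
  then show ?thesis unfolding C_def coeff_sum by (intro sum_in_Nats) auto
 qed
 have degp: "degree (lp (ev x) F * lp (ev x) G) < 2 * r" for x
 proof -
  have "degree (lp (ev x) F * lp (ev x) G) <= (r - 1) + (r - 1)"
   using degree_mult_le[of "lp (ev x) F" "lp (ev x) G"] degree_lp[of "ev x" F] degree_lp[of "ev x" G] F(1) G(1)
   by linarith
  then show ?thesis using m by linarith
 qed
 have one: "lp (ev x) H = smult (2 ^ l) (lp (ev x) F * lp (ev x) G)" if x: "x ^ m = -1" for x
 proof (rule poly_eqI_degree[where A = "{y::complex. y ^ (2 * r) = 1}"])
  have c: "card {y::complex. y ^ (2 * r) = 1} = 2 * r" using m by (intro card_roots_unity_eq) simp
  show "card {y::complex. y ^ (2 * r) = 1} > degree (lp (ev x) H)"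
   using degree_lp[of "ev x" H] H(1) m c by simp
  show "card {y::complex. y ^ (2 * r) = 1} > degree (smult (2 ^ l) (lp (ev x) F * lp (ev x) G))"
   using degp[of x] c by simp
 qed (use ev[OF x] in \<open>auto simp: ev2_def\<close>)
 have two: "pe (take m u) - pe (drop m u) = smult (2 ^ l) (C i)" if i: "i < 2 * r" and u: "u = H ! i" for i u
 proof (rule poly_eqI_degree[where A = "{x::complex. x ^ m = -1}"])
  have lu: "length u = 2 * m" using i u H by simp
  have c: "card {x::complex. x ^ m = -1} = m" using m by (intro card_nth_roots) auto
  have "degree (pe v) < m" if "length v = m" for v
   using degree_lp[of "%c. of_nat (val c)" v] that m unfolding pe_def by linarith
  then have "degree (pe (take m u)) < m" "degree (pe (drop m u)) < m" using lu by auto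
  then show "card {x::complex. x ^ m = -1} > degree (pe (take m u) - pe (drop m u))"
   unfolding c by (rule degree_diff_less)
  show "card {x::complex. x ^ m = -1} > degree (smult (2 ^ l) (C i))" using c degC[of i] by simp
  fix x :: complex assume "x \<in> {x. x ^ m = -1}"
  then have x: "x ^ m = -1" by simp
  have "ev x u = ev x (take m u) + x ^ m * ev x (drop m u)"
   using ev_append[of x "take m u" "drop m u"] lu by simp
  moreover have "ev x u = 2 ^ l * poly (C i) x"
   using arg_cong[OF one[OF x], of "%p. coeff p i"] i u H(1) prodC[of x i] by (simp add: coeff_lp)
  ultimately show "poly (pe (take m u) - pe (drop m u)) x = poly (smult (2 ^ l) (C i)) x"
   using x by (simp add: ev_def)
 qed
 have fin: "pe (fin l m (H ! i)) = C i" if i: "i < 2 * r" for i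
 proof (rule poly_eqI)
  fix t
  define u where "u = H ! i"
  have lu: "length u = 2 * m" using i u_def H by simp
  show "coeff (pe (fin l m (H ! i))) t = coeff (C i) t"
  proof (cases "t < m")
   case False
   then show ?thesis using degC[of i] lu by (simp add: pe_def coeff_lp fin_def u_def coeff_eq_0)
  next
   case True
   define a where "a = val (u ! t)"
   define b where "b = val (u ! (m + t))"
   \<comment> \<open>The coefficients of the true product are natural numbers; therefore the
     difference of the two halves is a nonnegative multiple of 2^l and \<open>subb\<close> does not
     underflow.\<close>
   obtain N where N: "coeff (C i) t = of_nat N" using natC[of i t] by (auto elim: Nats_cases)
   have "coeff (pe (take m u)) t - coeff (pe (drop m u)) t = 2 ^ l * coeff (C i) t"
    using arg_cong[OF two[OF i u_def], of "%p. coeff p t"] by simp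
   then have "complex_of_nat a - of_nat b = 2 ^ l * of_nat N"
    using True lu by (simp add: pe_def coeff_lp a_def b_def N)
   then have "complex_of_nat a = of_nat (b + 2 ^ l * N)" by (simp add: algebra_simps)
   then have ab: "a = b + 2 ^ l * N" by (simp only: of_nat_eq_iff)
   then have "val (subb False (u ! t) (u ! (m + t))) = 2 ^ l * N"
    using val_subb[of "u ! (m + t)" False "u ! t"] by (simp add: a_def b_def)
   then have "val (drop l (subb False (u ! t) (u ! (m + t)))) = N" by (simp add: val_drop)
   then show ?thesis using True lu by (simp add: pe_def coeff_lp fin_def u_def[symmetric] N)
  qed
 qed
 have all: "lp (ev x) (map (fin l m) H) = lp (ev x) F * lp (ev x) G" for x
 proof (rule poly_eqI)
  fix i
  show "coeff (lp (ev x) (map (fin l m) H)) i = coeff (lp (ev x) F * lp (ev x) G) i"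
  proof (cases "i < 2 * r")
   case True
   then show ?thesis using prodC[of x i] fin[OF True] H(1) by (simp add: coeff_lp ev_def)
  next
   case False
   then show ?thesis using degp[of x] H(1) by (simp add: coeff_lp coeff_eq_0)
  qed
 qed
 show "ev2 x y (map (fin l m) H) = ev2 x y F * ev2 x y G" by (simp add: ev2_def all)
 have "ev x (fin l m (H ! (2 * r - 1))) = coeff (lp (ev x) (map (fin l m) H)) (2 * r - 1)"
  using m H(1) by (simp add: coeff_lp)
 also have "... = 0"
 proof -
  have "coeff (lp (ev x) F) j * coeff (lp (ev x) G) (2 * r - 1 - j) = 0" for j
   using F(1) G(1) by (cases "j < r") (auto simp: coeff_lp)
  then show ?thesis unfolding all coeff_mult by (intro sum.neutral ballI)
 qed
 finally show "ev x (fin l m (H ! (2 * r - 1))) = 0" .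
qed

primrec chunks :: "nat => nat => bool list list => bool list list list" where
 "chunks 0 s f = []" | "chunks (Suc r) s f = take s f # chunks r s (drop s f)"

lemma length_chunks [simp]: "length (chunks r s f) = r"
 by (induction r arbitrary: f) auto

lemma chunks_elems: "length f = r * s ==> narrow w f ==> u \<in> set (chunks r s f) ==> length u = s \<and> narrow w u"
proof (induction r arbitrary: f)
 case (Suc r)
 have "length (drop s f) = r * s" "narrow w (drop s f)" using Suc.prems by (auto simp: narrow_drop)
 then show ?case using Suc.IH[of "drop s f"] Suc.prems by (auto simp: narrow_take)
qed simp

lemma ev2_chunks: "length f = r * s ==> ev2 x (x ^ s) (chunks r s f) = ev x f"
proof (induction r arbitrary: f)
 case (Suc r)
 have "ev x f = ev x (take s f) + x ^ s * ev x (drop s f)"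
  using ev_append[of x "take s f" "drop s f"] Suc.prems by simp
 then show ?case using Suc by simp
qed simp

text \<open>Zero padding that prevents wrap-around: the product of two chunks has degree below 2s =
  m in x, and r chunks padded to 2r give a product of degree below 2r in y. Chunks get length 4s =
  2m because the transform works modulo x^(2m) - 1.\<close>

definition prep :: "nat => nat => bool list list => bool list list list" where
 "prep r s f = map (%u. u @ replicate (3 * s) []) (chunks r s f) @ replicate r (replicate (4 * s) [])"

lemma ev2_prep: "ev2 x y (prep r s f) = ev2 x y (chunks r s f)"
proof -
 have "ev2 x y (map (%u. u @ replicate (3 * s) []) F) = ev2 x y F" for F by (induction F) auto
 then show ?thesis by (simp add: prep_def)
qed

lemma family_prep: "length f = r * s ==> narrow w f ==> family (2 * r) (4 * s) w (prep r s f)"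
 using chunks_elems[of f r s w] by (auto simp: family_def prep_def)

primrec recomb :: "nat => bool list list => bool list list list => bool list list" where
 "recomb s acc [] = acc"
| "recomb s acc (u # H) = padd (take s u) acc @ recomb s (drop s u) H"

text \<open>Overlap-add: consecutive blocks of length 2s are shifted by s.\<close>
lemma recomb:
 "length acc = s ==> (\<And>u. u \<in> set H ==> length u = 2 * s) ==>
  ev x (recomb s acc H) = ev x acc + ev2 x (x ^ s) H \<and> length (recomb s acc H) = s * length H + s"
proof (induction H arbitrary: acc)
 case (Cons u H)
 have "ev x u = ev x (take s u) + x ^ s * ev x (drop s u)"
  using ev_append[of x "take s u" "drop s u"] Cons.prems by simp
 then show ?case using Cons by (simp add: algebra_simps)
qed simp

lemma narrow_recomb:
 "narrow w acc ==> (\<And>u. u \<in> set H ==> narrow w u) ==> narrow (Suc w) (recomb s acc H)"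
 by (induction H arbitrary: acc) (auto simp: narrow_take narrow_drop narrow_padd intro: narrow_mono)

primrec pmul :: "bool list list => bool list list => bool list list" where
 "pmul [] g = []" | "pmul (a # f) g = padd (map (nmul a) g) ([] # pmul f g)"

lemma ev_pmul: "ev x (pmul f g) = ev x f * ev x g"
proof -
 have *: "ev x (map (nmul a) g) = of_nat (val a) * ev x g" for a
  by (induction g) (auto simp: algebra_simps)
 show ?thesis by (induction f) (auto simp: * algebra_simps)
qed

lemma length_pmul: "f \<noteq> [] ==> g \<noteq> [] ==> length (pmul f g) = length f + length g - 1"
proof (induction f)
 case (Cons a f)
 then show ?case by (cases f) (auto simp: max_def Suc_diff_le neq_Nil_conv)
qed simp

lemma narrow_pmul: "narrow w f ==> narrow w g ==> narrow (3 * w + length f) (pmul f g)"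
proof (induction f)
 case (Cons a f)
 have "narrow (3 * w) (map (nmul a) g)"
  unfolding narrow_def
 proof (clarsimp)
  fix c assume "c \<in> set g"
  then show "length (nmul a c) <= 3 * w"
   using length_nmul[of a c] Cons.prems by (auto simp: narrow_def)
 qed
 then have "narrow (Suc (3 * w + length f)) (padd (map (nmul a) g) ([] # pmul f g))"
  using Cons by (intro narrow_padd) (auto intro: narrow_mono)
 then show ?case by simp
qed simp

text \<open>With a about k/2, the 2^k coefficients are read as r = 2^a chunks of s coefficients, a
  polynomial in y = x^s. The transform starts modulo y^(2r) - 1, written with the exponent 2m. Its
  2r pointwise products of length 4s are computed recursively and folded modulo x^(2m) - 1. The base
  case appends a zero coefficient so that a product always has length 2 * 2^k; \<open>w\<close>
  records the width of the coefficients.\<close>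

function polymul :: "nat => nat => bool list list => bool list list => bool list list" where
 "polymul k w f g = (if k < 10 then pmul f g @ [[]] else
  let a = k div 2; s = 2 ^ (k - a); r = 2 ^ a; m = 2 * s; l = Suc a;
   A = fft m l (2 * m) (prep r s f); B = fft m l (2 * m) (prep r s g);
   ps = map (%p. polymul (k - a + 2) (w + l) (fst p) (snd p)) (zip A B);
   H = map (fin l m) (ifft m l (2 * m) (map (%p. padd (take (2 * m) p) (drop (2 * m) p)) ps))
  in recomb s (replicate s []) (take (2 * r - 1) H))"
 by pat_completeness auto
termination by (relation "measure (%(k, w, f, g). k)") auto

declare polymul.simps [simp del]

text \<open>The width bound reproduces itself: the forward transform adds l bits, which the
  recursion triples, but the index k falls to about k/2 and the term 10 k absorbs the gain; the bits
  added by the inverse transform are removed by \<open>fin\<close>. The 600 covers the at most 512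
  coefficients of the base case.\<close>

theorem polymul_correct:
 assumes "length f = 2 ^ k" "length g = 2 ^ k" "narrow w f" "narrow w g"
 shows "ev x (polymul k w f g) = ev x f * ev x g" "length (polymul k w f g) = 2 * 2 ^ k"
  "narrow (3 * w + 600 + 10 * k) (polymul k w f g)"
proof -
 have "(\<forall>x. ev x (polymul k w f g) = ev x f * ev x g) \<and> length (polymul k w f g) = 2 * 2 ^ k \<and>
  narrow (3 * w + 600 + 10 * k) (polymul k w f g)"
  using assms
 proof (induction k arbitrary: w f g rule: less_induct)
  case (less k)
  show ?case
  proof (cases "k < 10")
   case True
   have ne: "f \<noteq> []" "g \<noteq> []" using less.prems(1,2) by auto
   have "(2::nat) ^ k <= 2 ^ 9" using True by (intro power_increasing) auto
   then have "length f <= 600" using less.prems(1) by simp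
   then have "narrow (3 * w + 600 + 10 * k) (pmul f g)"
    using narrow_pmul[OF less.prems(3,4)] by (auto intro: narrow_mono)
   moreover have "length (pmul f g) + 1 = 2 * 2 ^ k" using length_pmul[OF ne] less.prems(1,2) by simp
   ultimately show ?thesis using True by (subst (1 2 3) polymul.simps) (simp add: ev_pmul)
  next
   case False
   define a where "a = k div 2"
   define s :: nat where "s = 2 ^ (k - a)"
   define r :: nat where "r = 2 ^ a"
   define m where "m = 2 * s"
   define l where "l = Suc a"
   define k' where "k' = k - a + 2"
   define A where "A = fft m l (2 * m) (prep r s f)"
   define B where "B = fft m l (2 * m) (prep r s g)"
   define rr where "rr = (%p. let q = polymul k' (w + l) (fst p) (snd p) in padd (take (2 * m) q) (drop (2 * m) q))"
   define H' where "H' = ifft m l (2 * m) (map rr (zip A B))"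
   define H where "H = map (fin l m) H'"
   have a5: "5 <= a" "a <= k - a" "a <= k" "k' < k" using False by (auto simp: a_def k'_def)
   have res: "polymul k w f g = recomb s (replicate s []) (take (2 * r - 1) H)"
    by (subst polymul.simps) (simp only: False if_False Let_def H_def H'_def A_def B_def rr_def k'_def
     m_def l_def s_def r_def a_def map_map comp_def)
   have rs: "r * s = 2 ^ k" using a5 by (simp add: r_def s_def power_add[symmetric])
   have m4: "2 * m = 2 ^ k'" "4 * s = 2 * m" by (simp_all add: m_def s_def k'_def)
   have lr: "2 ^ l = 2 * r" by (simp add: l_def r_def)
   have pos: "0 < s" "0 < r" by (auto simp: s_def r_def)
   have pf: "family (2 ^ l) (2 * m) w (prep r s f)" "family (2 ^ l) (2 * m) w (prep r s g)"
    using family_prep[of f r s w] family_prep[of g r s w] less.prems rs m4 lr by auto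
   have rr: "length (rr (u, v)) = 2 * m \<and> ev x (rr (u, v)) = ev x u * ev x v \<and> narrow (3 * (w + l) + 600 + 10 * k' + 1) (rr (u, v))"
    if uv: "length u = 2 * m" "narrow (w + l) u" "length v = 2 * m" "narrow (w + l) v" and x: "x ^ m = -1" for u v x
   proof -
    define q where "q = polymul k' (w + l) u v"
    have q: "ev x q = ev x u * ev x v" "length q = 2 * (2 * m)" "narrow (3 * (w + l) + 600 + 10 * k') q"
     using less.IH[OF a5(4), of u v "w + l"] uv m4 by (auto simp: q_def)
    have x2: "x ^ (2 * m) = 1" using x by (simp add: power_mult mult.commute[of 2])
    have "ev x q = ev x (take (2 * m) q) + x ^ (2 * m) * ev x (drop (2 * m) q)"
     using ev_append[of x "take (2 * m) q" "drop (2 * m) q"] q(2) by simp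
    then have "ev x (rr (u, v)) = ev x u * ev x v" using q(1) x2 by (simp add: rr_def q_def[symmetric] Let_def)
    moreover have "length (rr (u, v)) = 2 * m" using q(2) by (simp add: rr_def q_def[symmetric] Let_def)
    moreover have "narrow (3 * (w + l) + 600 + 10 * k' + 1) (rr (u, v))"
     using narrow_padd[OF narrow_take[OF q(3), of "2 * m"] narrow_drop[OF q(3), of "2 * m"]]
     by (simp add: rr_def q_def[symmetric] Let_def)
    ultimately show ?thesis by blast
   qed
   \<comment> \<open>Since a <= k - a, the order 2m is divisible by 2^l, so the exponent can be
     halved exactly at each of the l levels. This is why the chunks must not be shorter than their
     number.\<close>
   have dv: "2 ^ l dvd 2 * m"
    unfolding m4 using a5 by (intro le_imp_power_dvd) (simp add: l_def k'_def)
   have conv: "ev2 x y H' = 2 ^ l * (ev2 x y (chunks r s f) * ev2 x y (chunks r s g))"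
    if x: "x ^ m = -1" and y: "y ^ (2 * r) = 1" for x y
   proof -
    have x2: "x ^ (2 * m) = 1" using x by (simp add: power_mult mult.commute[of 2])
    show ?thesis unfolding H'_def A_def B_def ev2_prep[symmetric]
     by (rule fft_convolution[OF x _ _ dv dv order_refl pf order_refl]) (use rr x x2 y lr in auto)
   qed
   \<comment> \<open>The length and width clauses of \<open>rr\<close> are stated together with the
     evaluation at a root; any one root gives access to them.\<close>
   obtain x0 :: complex where x0: "x0 ^ m = -1"
   proof -
    have "card {z::complex. z ^ m = -1} = m" using pos m_def by (intro card_nth_roots) auto
    then have "{z::complex. z ^ m = -1} \<noteq> {}" using pos m_def by (auto simp del: Collect_empty_eq)
    then show ?thesis using that by blast
   qed
   define W where "W = 3 * (w + l) + 600 + 10 * k' + 1"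
   have fAB: "family (2 ^ l) (2 * m) (w + l) A" "family (2 ^ l) (2 * m) (w + l) B"
    unfolding A_def B_def by (intro family_fft pf)+
   have frr: "family (2 ^ l) (2 * m) W (map rr (zip A B))"
    unfolding family_def
   proof (intro conjI ballI)
    show "length (map rr (zip A B)) = 2 ^ l" using fAB by (simp add: family_def)
    fix z assume "z \<in> set (map rr (zip A B))"
    then obtain u v where uv: "z = rr (u, v)" "u \<in> set A" "v \<in> set B"
     by (auto dest: set_zip_leftD set_zip_rightD)
    then show "length z = 2 * m" "narrow W z"
     using rr[of u v, OF _ _ _ _ x0] fAB by (auto simp: family_def W_def)
   qed
   have fH': "family (2 ^ l) (2 * m) (W + l) H'" unfolding H'_def by (rule family_ifft[OF frr])
   have lH: "length H' = 2 * r" "\<And>u. u \<in> set H' ==> length u = 2 * m"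
    using fH' lr by (auto simp: family_def)
   have ce: "\<And>u. u \<in> set (chunks r s f) ==> length u = s" "\<And>u. u \<in> set (chunks r s g) ==> length u = s"
    using chunks_elems less.prems rs by (metis, metis)
   note det = roots_determine_product[OF length_chunks ce(1) length_chunks ce(2) lH m_def pos conv]
   have eH: "length u = 2 * s" "narrow W u" if uH: "u \<in> set H" for u
   proof -
    obtain v where v: "v \<in> set H'" "u = fin l m v" using uH unfolding H_def by auto
    then have lv: "length v = 2 * m" "narrow (W + l) v" using fH' by (auto simp: family_def)
    then show "length u = 2 * s" using v by (simp add: fin_def m_def)
    show "narrow W u" unfolding v(2) fin_def narrow_def
     using lv(2) by (auto simp: narrow_def dest!: set_zip_leftD in_set_takeD)
   qed
   have tH: "u \<in> set (take (2 * r - 1) H) ==> u \<in> set H" for u by (rule in_set_takeD)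
   \<comment> \<open>The factors have degree below r in y, so the coefficient of y^(2r-1) vanishes.
     Dropping it makes the overlap-add return exactly 2rs coefficients.\<close>
   have Hsplit: "H = take (2 * r - 1) H @ [fin l m (H' ! (2 * r - 1))]"
   proof -
    have "H = take (2 * r - 1) H @ drop (2 * r - 1) H" by simp
    also have "drop (2 * r - 1) H = [H ! (2 * r - 1)]"
     using lH(1) pos Cons_nth_drop_Suc[of "2 * r - 1" H] by (simp add: H_def)
    finally show ?thesis using lH(1) pos by (simp add: H_def)
   qed
   have "ev2 x y (take (2 * r - 1) H) = ev2 x y (chunks r s f) * ev2 x y (chunks r s g)" for x y
   proof -
    have "ev2 x y H = ev2 x y (take (2 * r - 1) H)"
     by (subst Hsplit, subst ev2_append) (use det(2) in simp)
    then show ?thesis using det(1)[of x y] by (simp add: H_def)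
   qed
   moreover have "length (take (2 * r - 1) H) = 2 * r - 1" using lH(1) by (simp add: H_def)
   ultimately have "ev x (polymul k w f g) = ev x f * ev x g" "length (polymul k w f g) = 2 * 2 ^ k" for x
    unfolding res using recomb[of "replicate s []" s "take (2 * r - 1) H" x] eH(1)[OF tH] less.prems rs pos
    by (auto simp: ev2_chunks diff_mult_distrib2 diff_mult_distrib mult.commute mult.left_commute)
   moreover have "narrow (Suc W) (polymul k w f g)"
    unfolding res using eH(2)[OF tH] by (intro narrow_recomb) auto
   moreover have "Suc W <= 3 * w + 600 + 10 * k"
    using a5 False by (simp add: W_def l_def k'_def)
   ultimately show ?thesis by (auto intro: narrow_mono)
  qed
 qed
 then show "ev x (polymul k w f g) = ev x f * ev x g" "length (polymul k w f g) = 2 * 2 ^ k"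
  "narrow (3 * w + 600 + 10 * k) (polymul k w f g)" by auto
qed

section \<open>Running time of the multiplication\<close>

abbreviation "arg1 x \<equiv> fst x"
abbreviation "arg2 x \<equiv> fst (snd x)"
abbreviation "arg3 x \<equiv> fst (snd (snd x))"
abbreviation "arg4 x \<equiv> fst (snd (snd (snd x)))"
abbreviation "rst2 x \<equiv> snd x"
abbreviation "rst3 x \<equiv> snd (snd x)"
abbreviation "rst4 x \<equiv> snd (snd (snd x))"
abbreviation "rst5 x \<equiv> snd (snd (snd (snd x)))"

lemma cmp_le': "cmp D F T ==> (\<And>x. D x ==> T x <= K * (T' x + 1)) ==> cmp D F T'"
 by (rule cmp_le)

lemmas [cmp_intros] = cmp_app3[where E = "%_. True", OF cmp_addb, OF _ _ _ TrueI, unfolded fst_conv snd_conv]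

lemma subb_rec: "subb c xs ys = (if xs = [] then [] else
 ((hd xs \<noteq> (ys \<noteq> [] \<and> hd ys)) \<noteq> c)
 # subb (\<not> hd xs \<and> ((ys \<noteq> [] \<and> hd ys) \<or> c) \<or> (ys \<noteq> [] \<and> hd ys) \<and> c) (tl xs) (tl ys))"
 by (cases xs; cases ys) auto

lemma cmp_subb: "cmp (%_. True) (%x. subb (arg1 x) (arg2 x) (rst3 x)) (%x. length (arg2 x))"
 by (rule cmp_rec1'[where p = "%x. arg2 x = []" and base = "%x. []"
  and s = "%x. (\<not> hd (arg2 x) \<and> ((rst3 x \<noteq> [] \<and> hd (rst3 x)) \<or> arg1 x) \<or> (rst3 x \<noteq> [] \<and> hd (rst3 x)) \<and> arg1 x, tl (arg2 x), tl (rst3 x))"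
  and post = "%y. ((hd (arg2 (fst y)) \<noteq> (rst3 (fst y) \<noteq> [] \<and> hd (rst3 (fst y)))) \<noteq> arg1 (fst y)) # snd y"
  and W = "%x. 0" and K = 1],
  (rule subb_rec[THEN trans] | rule cmp_intros | force simp: neq_Nil_conv | simp; (case_tac "arg2 x"; simp))+)

lemmas [cmp_intros] = cmp_app3[where E = "%_. True", OF cmp_subb, OF _ _ _ TrueI, unfolded fst_conv snd_conv]

lemma nmul_rec: "nmul xs ys = (if xs = [] then [] else addb False (if hd xs then ys else []) (False # nmul (tl xs) ys))"
 by (cases xs) auto

lemma cmp_nmul: "cmp (%_. True) (%x. nmul (fst x) (snd x)) (%x. length (fst x) * (2 * length (snd x) + 2 * length (fst x) + 3))"
proof -
 let ?W = "%x. if fst x = [] then 0 else 2 * length (snd x) + 2 * length (fst x)"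
 let ?po = "%y. addb False (if hd (fst (fst y)) then snd (fst y) else []) (False # snd y)"
 let ?s = "%x. (tl (fst x), snd x)"
 have po: "cmp (%y. True \<and> fst (fst y) \<noteq> [] \<and> snd y = nmul (fst (?s (fst y))) (snd (?s (fst y)))) ?po (%y. ?W (fst y))"
  apply (rule cmp_le'[where K = 3])
  apply (rule cmp_intros | force)+
  subgoal for y using length_nmul[of "tl (fst (fst y))" "snd (fst y)"] by auto
  done
 show ?thesis
 proof (rule cmp_rec1[where p = "%x. fst x = []" and base = "%x. []" and s = ?s, OF _ _ _ _ _ po])
  fix x :: "bool list \<times> bool list"
  show "nmul (fst x) (snd x) = (if fst x = [] then [] else ?po (x, nmul (fst (?s x)) (snd (?s x))))"
   by (subst nmul_rec) simp
  assume ne: "fst x \<noteq> []"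
  then obtain a as where a: "fst x = a # as" by (cases "fst x") auto
  show "?W x + length (fst (?s x)) * (2 * length (snd (?s x)) + 2 * length (fst (?s x)) + 3) + 1
   <= length (fst x) * (2 * length (snd x) + 2 * length (fst x) + 3)"
   unfolding a by (simp add: algebra_simps)
 qed ((rule cmp_le'[where K = 1], (rule cmp_intros)+, force) | force)+
qed

lemmas [cmp_intros] = true_app2[OF cmp_nmul, unfolded fst_conv snd_conv]

definition sz :: "bool list list => nat" where "sz f = (\<Sum>c\<leftarrow>f. length c + 1)"
definition sz2 :: "bool list list list => nat" where "sz2 F = (\<Sum>u\<leftarrow>F. sz u + 1)"

lemma sz_simps [simp]: "sz [] = 0" "sz (c # f) = length c + 1 + sz f" "sz2 [] = 0" "sz2 (u # F) = sz u + 1 + sz2 F"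
 by (simp_all add: sz_def sz2_def)

lemma sum_list_bound: "(\<And>u. u \<in> set F ==> T u <= B) ==> (\<Sum>u\<leftarrow>F. T u) <= length F * (B::nat)"
 by (induction F) (auto intro: add_mono)

lemma sz_narrow: "narrow w f ==> sz f <= length f * (w + 1)"
 unfolding sz_def by (rule sum_list_bound) (auto simp: narrow_def)

lemma sz2_family: "family N n w F ==> sz2 F <= N * (n * (w + 1) + 1)"
 unfolding sz2_def family_def using sum_list_bound[of F "%u. sz u + 1" "n * (w + 1) + 1"] sz_narrow by fastforce

lemma padd_rec: "padd f g = (if f = [] \<or> g = [] then (if f = [] then g else f) else addb False (hd f) (hd g) # padd (tl f) (tl g))"
 by (cases f; cases g) auto

lemma cmp_padd: "cmp (%_. True) (%x. padd (fst x) (snd x)) (%x. sz (fst x) + sz (snd x))"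
 by (rule cmp_rec1'[where p = "%x. fst x = [] \<or> snd x = []" and base = "%x. if fst x = [] then snd x else fst x" and s = "%x. (tl (fst x), tl (snd x))"
  and post = "%y. addb False (hd (fst (fst y))) (hd (snd (fst y))) # snd y"
  and W = "%x. if fst x = [] \<or> snd x = [] then 0 else length (hd (fst x)) + length (hd (snd x))" and K = 1],
  (rule padd_rec[THEN trans] | rule cmp_intros | (simp; fail) | force simp: neq_Nil_conv | (case_tac "fst x"; case_tac "snd x"; simp; fail))+)

lemmas [cmp_intros] = true_app2[OF cmp_padd, unfolded fst_conv snd_conv]

lemma cmp_rotr [cmp_intros]:
 assumes "cmp D f Tf" "cmp D g Tg"
 shows "cmp D (%x. rotr (f x) (g x)) (%x. Tf x + Tg x + f x + length (g x))"
 unfolding rotr_def by (rule cmp_le'[where K = 10], (rule cmp_intros assms | force)+)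

lemma sum_zip_le: "(\<Sum>p\<leftarrow>zip F G. sz (fst p) + sz (snd p) + 1) <= sz2 F + sz2 G"
proof (induction F arbitrary: G)
 case (Cons u F)
 show ?case using Cons[of "tl G"] by (cases G) auto
qed simp

lemma length_le_sz2: "length F <= sz2 F" by (induction F) auto

lemma cmp_madd [cmp_intros]:
 assumes "cmp D f Tf" "cmp D g Tg"
 shows "cmp D (%x. madd (f x) (g x)) (%x. Tf x + Tg x + sz2 (f x) + sz2 (g x))"
proof -
 have "cmp (%_. True) (%p. padd (fst (snd p)) (snd (snd p))) (%p. sz (fst (snd p)) + sz (snd (snd p)))"
  by (rule cmp_le'[where K = 1], (rule cmp_intros | force)+)
 from cmp_map[of _ "%_ q. padd (fst q) (snd q)", OF this cmp_const[of D False], of "%x. zip (f x) (g x)"]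
 show ?thesis unfolding madd_def
  apply (rule cmp_le'[where K = 2])
  apply (rule cmp_intros assms TrueI)+
  subgoal for x
   using sum_zip_le[of "f x" "g x"] length_le_sz2[of "f x"] by simp
  done
qed

lemma cmp_map_rotr [cmp_intros]:
 assumes "cmp D f Tf" "cmp D g Tg"
 shows "cmp D (%x. map (rotr (f x)) (g x)) (%x. Tf x + Tg x + (\<Sum>u\<leftarrow>g x. f x + length u + 1))"
proof -
 have "cmp (%_. True) (%p. rotr (fst p) (snd p)) (%p. fst p + length (snd p))"
  by (rule cmp_le'[where K = 1], (rule cmp_intros | force)+)
 from cmp_map[OF this assms] show ?thesis by simp
qed

lemma sz2_take: "sz2 (take k F) <= sz2 F" and sz2_drop: "sz2 (drop k F) <= sz2 F"
proof -
 have *: "sz2 (A @ B) = sz2 A + sz2 B" for A B by (simp add: sz2_def)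
 show "sz2 (take k F) <= sz2 F" "sz2 (drop k F) <= sz2 F"
  using *[of "take k F" "drop k F"] by simp_all
qed

lemma sz_rotr [simp]: "sz (rotr e f) = sz f"
proof -
 have *: "sz (A @ B) = sz A + sz B" for A B by (simp add: sz_def)
 show ?thesis unfolding rotr_def * using *[of "take (length f - e) f" "drop (length f - e) f"] by simp
qed

lemma sz2_map_rotr [simp]: "sz2 (map (rotr e) F) = sz2 F"
 by (induction F) auto

lemma family_bounds:
 assumes "family N (2 * m) w F" "1 <= m" "e <= 2 * m"
 shows "sz2 F <= 3 * (N * (m * (w + 1)))" "length F <= N * (m * (w + 1))"
  "set G \<subseteq> set F ==> length G <= length F ==> (\<Sum>u\<leftarrow>G. e + length u + 1) <= 5 * (N * (m * (w + 1)))"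
proof -
 have "N * (2 * m * (w + 1) + 1) <= N * (3 * (m * (w + 1)))"
  using assms(2) by (intro mult_le_mono2) (cases m; simp)
 then show 1: "sz2 F <= 3 * (N * (m * (w + 1)))" using sz2_family[OF assms(1)] by (simp add: algebra_simps)
 have "1 <= m * (w + 1)" using assms(2) by simp
 then show 2: "length F <= N * (m * (w + 1))" using assms(1) by (simp add: family_def)
 assume G: "set G \<subseteq> set F" "length G <= length F"
 have "(\<Sum>u\<leftarrow>G. e + length u + 1) <= length G * (5 * m)"
  by (rule sum_list_bound) (use assms G in \<open>auto simp: family_def\<close>)
 also have "... <= N * (5 * (m * (w + 1)))" using G assms(1) by (intro mult_le_mono) (auto simp: family_def)
 finally show "(\<Sum>u\<leftarrow>G. e + length u + 1) <= 5 * (N * (m * (w + 1)))" by (simp add: algebra_simps)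
qed

text \<open>Each level adds and rotates 2^l polynomials of O(m) coefficients with at most w + l
  bits. The component \<open>arg1\<close> is the width bound w: it rises by one per level and makes
  the cost a function of the argument.\<close>

lemma cmp_fft: "cmp (%x. family (2 ^ arg3 x) (2 * arg2 x) (arg1 x) (rst5 x) \<and> arg4 x <= 2 * arg2 x \<and> 1 <= arg2 x)
 (%x. fft (arg2 x) (arg3 x) (arg4 x) (rst5 x))
 (%x. 2 ^ arg3 x * ((arg2 x * (arg1 x + arg3 x + 1) + 2) * (arg3 x + 1)))" (is "cmp ?D ?F ?S")
proof -
 let ?s1 = "%x. (Suc (arg1 x), arg2 x, arg3 x - Suc 0, arg4 x div 2,
  madd (take (length (rst5 x) div 2) (rst5 x)) (map (rotr (arg4 x div 2)) (drop (length (rst5 x) div 2) (rst5 x))))"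
 let ?s2 = "%y. (Suc (arg1 (fst y)), arg2 (fst y), arg3 (fst y) - Suc 0, arg4 (fst y) div 2 + arg2 (fst y),
  madd (take (length (rst5 (fst y)) div 2) (rst5 (fst y)))
   (map (rotr (arg2 (fst y))) (map (rotr (arg4 (fst y) div 2)) (drop (length (rst5 (fst y)) div 2) (rst5 (fst y))))))"
 let ?W = "%x. if arg3 x = 0 then 0 else 2 ^ arg3 x * (arg2 x * (arg1 x + 1))"
 have bounds: "sz2 (rst5 x) <= 3 * ?W x" "length (rst5 x) <= ?W x" "arg2 x <= ?W x"
  "(\<Sum>u\<leftarrow>drop k (rst5 x). arg4 x div 2 + length u + 1) <= 5 * ?W x"
  "(\<Sum>u\<leftarrow>map (rotr e') (drop k (rst5 x)). arg2 x + length u + 1) <= 5 * ?W x"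
  if "?D x" "arg3 x \<noteq> 0" for x k e'
 proof -
  have F: "family (2 ^ arg3 x) (2 * arg2 x) (arg1 x) (rst5 x)" and m: "1 <= arg2 x" using that(1) by auto
  have W: "?W x = 2 ^ arg3 x * (arg2 x * (arg1 x + 1))" using that(2) by simp
  note b = family_bounds[OF F m]
  have h: "arg4 x div 2 <= 2 * arg2 x" "arg2 x <= 2 * arg2 x" using that(1) by auto
  show "sz2 (rst5 x) <= 3 * ?W x" "length (rst5 x) <= ?W x" unfolding W by (rule b[OF h(1)])+
  show "(\<Sum>u\<leftarrow>drop k (rst5 x). arg4 x div 2 + length u + 1) <= 5 * ?W x"
   unfolding W by (rule b(3)[OF h(1)]) (auto dest: in_set_dropD)
  have "(\<Sum>u\<leftarrow>map (rotr e') (drop k (rst5 x)). arg2 x + length u + 1) = (\<Sum>u\<leftarrow>drop k (rst5 x). arg2 x + length u + 1)"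
   by (simp add: comp_def)
  also have "... <= 5 * ?W x" unfolding W by (rule b(3)[OF h(2)]) (auto dest: in_set_dropD)
  finally show "(\<Sum>u\<leftarrow>map (rotr e') (drop k (rst5 x)). arg2 x + length u + 1) <= 5 * ?W x" .
  have "1 * (arg2 x * 1) <= 2 ^ arg3 x * (arg2 x * (arg1 x + 1))" by (intro mult_le_mono) auto
  then show "arg2 x <= ?W x" using that(2) by simp
 qed
 have D1: "?D (?s1 x)" and D2: "?D (?s2 (x, r))" if D: "?D x" and l: "arg3 x \<noteq> 0" for x r
 proof -
  obtain l' where l': "arg3 x = Suc l'" using l not0_implies_Suc by blast
  have F: "family (2 ^ l' + 2 ^ l') (2 * arg2 x) (arg1 x) (rst5 x)" using D l' by (simp add: mult_2)
  have k: "length (rst5 x) div 2 = 2 ^ l'" using F by (simp add: family_def)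
  show "?D (?s1 x)" "?D (?s2 (x, r))"
   using D l' family_madd[OF family_take[OF F] family_rotr[OF family_drop[OF F]]]
   family_madd[OF family_take[OF F] family_rotr[OF family_rotr[OF family_drop[OF F]]]] by (auto simp: k simp del: map_map)
 qed
 have s1: "cmp (%x. ?D x \<and> arg3 x \<noteq> 0) ?s1 ?W"
  apply (rule cmp_le'[where K = 60])
  apply (rule cmp_intros)+
  subgoal for x
  proof -
   assume a: "?D x \<and> arg3 x \<noteq> 0"
   obtain h where h: "arg4 x div 2 = h" by blast
   obtain k where k: "length (rst5 x) div 2 = k" by blast
   have hk: "h <= arg4 x" "k <= length (rst5 x)" using h k by auto
   note b = bounds(1)[of x] bounds(2)[of x] bounds(3)[of x] bounds(4)[of x k]
    sz2_take[of k "rst5 x"] sz2_drop[of k "rst5 x"]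
   show ?thesis using a b hk unfolding h k by simp
  qed
  done
 have s2: "cmp (%y. ?D (fst y) \<and> arg3 (fst y) \<noteq> 0 \<and> snd y = ?F (?s1 (fst y))) ?s2 (%y. ?W (fst y))"
  apply (rule cmp_le'[where K = 60])
  apply (rule cmp_intros)+
  subgoal for y
  proof -
   assume a: "?D (fst y) \<and> arg3 (fst y) \<noteq> 0 \<and> snd y = ?F (?s1 (fst y))"
   obtain h where h: "arg4 (fst y) div 2 = h" by blast
   obtain k where k: "length (rst5 (fst y)) div 2 = k" by blast
   have hk: "h <= arg4 (fst y)" "k <= length (rst5 (fst y))" using h k by auto
   note b = bounds(1)[of "fst y"] bounds(2)[of "fst y"] bounds(3)[of "fst y"] bounds(4)[of "fst y" k] bounds(5)[of "fst y" h k]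
    sz2_take[of k "rst5 (fst y)"] sz2_drop[of k "rst5 (fst y)"]
   show ?thesis using a b hk unfolding h k by (simp del: map_map)
  qed
  done
 have po: "cmp (%y. ?D (fst (fst y)) \<and> arg3 (fst (fst y)) \<noteq> 0 \<and> snd (fst y) = ?F (?s1 (fst (fst y)))
    \<and> snd y = ?F (?s2 (fst y))) (%y. snd (fst y) @ snd y) (%y. ?W (fst (fst y)))"
  apply (rule cmp_le'[where K = 60])
  apply (rule cmp_intros)+
  subgoal for y
  proof -
   assume a: "?D (fst (fst y)) \<and> arg3 (fst (fst y)) \<noteq> 0 \<and> snd (fst y) = ?F (?s1 (fst (fst y)))
    \<and> snd y = ?F (?s2 (fst y))"
   obtain x r where x: "fst y = (x, r)" by (cases "fst y")
   have "?D (?s1 x)" using D1[of x] a x by simp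
   from family_fft[OF conjunct1[OF this], of "arg2 x" "arg4 x div 2"]
   have "length (?F (?s1 x)) = 2 ^ (arg3 x - Suc 0)" unfolding family_def by simp
   also have "... <= 2 ^ arg3 x" by (intro power_increasing) auto
   also have "... = length (rst5 x)" using a x by (simp add: family_def)
   finally show ?thesis using bounds(2)[of x] a x by simp
  qed
  done
 show ?thesis
 proof (rule cmp_rec2[where p = "%x. arg3 x = 0" and base = "%x. rst5 x" and W = ?W, OF _ D1 D2 _ _ s1 s2 po])
  fix x assume D: "?D x"
  show "?F x = (if arg3 x = 0 then rst5 x else snd (fst ((x, ?F (?s1 x)), ?F (?s2 (x, ?F (?s1 x))))) @ snd ((x, ?F (?s1 x)), ?F (?s2 (x, ?F (?s1 x)))))"
   by (cases "arg3 x") (auto simp: Let_def)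
  assume l: "arg3 x \<noteq> 0"
  obtain w m l' e F where x: "x = (w, m, Suc l', e, F)" using l by (metis not0_implies_Suc prod.collapse)
  let ?Q = "m * (w + Suc l' + 1) + 2"
  have "m * (w + 1) <= m * (w + Suc l' + 1)" by (intro mult_le_mono2) simp
  then have "2 ^ Suc l' * (m * (w + 1)) + 2 <= 2 ^ Suc l' * ?Q"
   using mult_le_mono[of 1 "2 ^ Suc l'" "2" 2] by (simp add: algebra_simps)
  then have "2 ^ Suc l' * (m * (w + 1)) + 2 ^ Suc l' * (?Q * Suc l') + 2 <= 2 ^ Suc l' * (?Q * (Suc l' + 1))"
   by (simp add: algebra_simps)
  then show "?W x + ?S (?s1 x) + ?S (?s2 (x, ?F (?s1 x))) + 2 <= ?S x"
   unfolding x by (simp add: algebra_simps)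
 qed ((rule cmp_le'[where K = 1], (rule cmp_intros)+, force) | force)+
qed

lemma cmp_ifft: "cmp (%x. family (2 ^ arg3 x) (2 * arg2 x) (arg1 x) (rst5 x) \<and> arg4 x <= 2 * arg2 x \<and> 1 <= arg2 x)
 (%x. ifft (arg2 x) (arg3 x) (arg4 x) (rst5 x))
 (%x. 2 ^ arg3 x * ((arg2 x * (arg1 x + arg3 x + 1) + 2) * (arg3 x + 1)))" (is "cmp ?D ?F ?S")
proof -
 let ?s1 = "%x. (arg1 x, arg2 x, arg3 x - Suc 0, arg4 x div 2, take (length (rst5 x) div 2) (rst5 x))"
 let ?s2 = "%y. (arg1 (fst y), arg2 (fst y), arg3 (fst y) - Suc 0, arg4 (fst y) div 2 + arg2 (fst y),
  drop (length (rst5 (fst y)) div 2) (rst5 (fst y)))"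
 let ?po = "%y. madd (snd (fst y)) (snd y) @ map (rotr (2 * arg2 (fst (fst y)) - arg4 (fst (fst y)) div 2))
  (madd (snd (fst y)) (map (rotr (arg2 (fst (fst y)))) (snd y)))"
 let ?W = "%x. if arg3 x = 0 then 0 else 2 ^ arg3 x * (arg2 x * (arg1 x + arg3 x + 1))"
 have ml: "arg2 x <= ?W x" "length (rst5 x) <= ?W x" if "?D x" "arg3 x \<noteq> 0" for x
 proof -
  have "1 * (arg2 x * 1) <= 2 ^ arg3 x * (arg2 x * (arg1 x + arg3 x + 1))" by (intro mult_le_mono) auto
  then show "arg2 x <= ?W x" using that(2) by simp
  have "2 ^ arg3 x * (1 * 1) <= 2 ^ arg3 x * (arg2 x * (arg1 x + arg3 x + 1))" using that by (intro mult_le_mono) auto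
  then show "length (rst5 x) <= ?W x" using that by (simp add: family_def)
 qed
 have D1: "?D (?s1 x)" and D2: "?D (?s2 (x, r))" if D: "?D x" and l: "arg3 x \<noteq> 0" for x r
 proof -
  obtain l' where l': "arg3 x = Suc l'" using l not0_implies_Suc by blast
  have F: "family (2 ^ l' + 2 ^ l') (2 * arg2 x) (arg1 x) (rst5 x)" using D l' by (simp add: mult_2)
  have k: "length (rst5 x) div 2 = 2 ^ l'" using F by (simp add: family_def)
  show "?D (?s1 x)" "?D (?s2 (x, r))" using D l' family_take[OF F] family_drop[OF F] by (auto simp: k)
 qed
 have s1: "cmp (%x. ?D x \<and> arg3 x \<noteq> 0) ?s1 ?W"
  apply (rule cmp_le'[where K = 60])
  apply (rule cmp_intros)+
  subgoal for x
  proof -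
   assume a: "?D x \<and> arg3 x \<noteq> 0"
   obtain h where h: "arg4 x div 2 = h" by blast
   obtain k where k: "length (rst5 x) div 2 = k" by blast
   have hk: "h <= arg4 x" "k <= length (rst5 x)" using h k by auto
   show ?thesis using a ml[of x] hk unfolding h k by simp
  qed
  done
 have s2: "cmp (%y. ?D (fst y) \<and> arg3 (fst y) \<noteq> 0 \<and> snd y = ?F (?s1 (fst y))) ?s2 (%y. ?W (fst y))"
  apply (rule cmp_le'[where K = 60])
  apply (rule cmp_intros)+
  subgoal for y
  proof -
   assume a: "?D (fst y) \<and> arg3 (fst y) \<noteq> 0 \<and> snd y = ?F (?s1 (fst y))"
   obtain h where h: "arg4 (fst y) div 2 = h" by blast
   obtain k where k: "length (rst5 (fst y)) div 2 = k" by blast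
   have hk: "h <= arg4 (fst y)" "k <= length (rst5 (fst y))" using h k by auto
   show ?thesis using a ml[of "fst y"] hk unfolding h k by simp
  qed
  done
 have po: "cmp (%y. ?D (fst (fst y)) \<and> arg3 (fst (fst y)) \<noteq> 0 \<and> snd (fst y) = ?F (?s1 (fst (fst y)))
    \<and> snd y = ?F (?s2 (fst y))) ?po (%y. ?W (fst (fst y)))"
  apply (rule cmp_le'[where K = 100])
  apply (rule cmp_intros)+
  subgoal for y
  proof -
   assume a: "?D (fst (fst y)) \<and> arg3 (fst (fst y)) \<noteq> 0 \<and> snd (fst y) = ?F (?s1 (fst (fst y)))
    \<and> snd y = ?F (?s2 (fst y))"
   obtain x r1 r2 where y: "y = ((x, r1), r2)" by (metis prod.collapse)
   obtain w m l' e F where x: "x = (w, m, Suc l', e, F)" using a y by (metis not0_implies_Suc prod.collapse fst_conv)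
   have D: "?D x" "arg3 x \<noteq> 0" using a y by auto
   have em: "e <= 2 * m" "1 <= m" using D x by auto
   have f1: "family (2 ^ l') (2 * m) (w + l') r1" "family (2 ^ l') (2 * m) (w + l') r2"
    using a D1[OF D] D2[OF D, of r1] family_ifft[of l' "2 * m" w] unfolding x y by (auto simp: x y)
   obtain Z where Z: "2 ^ Suc l' * (m * (w + Suc l' + 1)) = Z" by blast
   obtain h where h: "e div 2 = h" by blast
   have he: "h <= e" using h by auto
   have c: "2 ^ l' * (m * (w + l' + 1)) <= Z" "2 ^ l' * (m * (Suc (w + l') + 1)) <= Z"
    unfolding Z[symmetric] by (intro mult_le_mono; simp)+
   have f2: "family (2 ^ l') (2 * m) (w + l') (map (rotr m) r2)" by (rule family_rotr[OF f1(2)])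
   have f3: "family (2 ^ l') (2 * m) (Suc (w + l')) (madd r1 r2)"
    "family (2 ^ l') (2 * m) (Suc (w + l')) (madd r1 (map (rotr m) r2))"
    by (intro family_madd f1 f2)+
   have b1: "sz2 r1 <= 3 * Z" using family_bounds(1)[OF f1(1) em(2) order_refl] c(1) by linarith
   have b2: "sz2 r2 <= 3 * Z" using family_bounds(1)[OF f1(2) em(2) order_refl] c(1) by linarith
   have m2: "m <= 2 * m" "2 * m - h <= 2 * m" by auto
   have b3: "(\<Sum>u\<leftarrow>r2. m + length u + 1) <= 5 * Z"
    using family_bounds(3)[OF f1(2) em(2) m2(1) subset_refl order_refl] c(1) by linarith
   have b4: "length (madd r1 r2) <= Z" using family_bounds(2)[OF f3(1) em(2) order_refl] c(2) by linarith
   have b5: "(\<Sum>u\<leftarrow>madd r1 (map (rotr m) r2). (2 * m - h) + length u + 1) <= 5 * Z"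
    using family_bounds(3)[OF f3(2) em(2) m2(2) subset_refl order_refl] c(2) by linarith
   have "1 * (m * 1) <= Z" unfolding Z[symmetric] by (intro mult_le_mono) auto
   then have mZ: "m <= Z" "e <= 2 * Z" using em(1) by auto
   show ?thesis
    using mZ b1 b2 b3 b4 b5 he unfolding y x fst_conv snd_conv h Z by simp
  qed
  done
 show ?thesis
 proof (rule cmp_rec2[where p = "%x. arg3 x = 0" and base = "%x. rst5 x" and W = ?W, OF _ D1 D2 _ _ s1 s2 po])
  fix x assume D: "?D x"
  show "?F x = (if arg3 x = 0 then rst5 x else ?po ((x, ?F (?s1 x)), ?F (?s2 (x, ?F (?s1 x)))))"
   by (cases "arg3 x") (auto simp: Let_def)
  assume l: "arg3 x \<noteq> 0"
  obtain w m l' e F where x: "x = (w, m, Suc l', e, F)" using l by (metis not0_implies_Suc prod.collapse)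
  let ?Q = "m * (w + Suc l' + 1) + 2" and ?Q' = "m * (w + l' + 1) + 2"
  have "m * (w + l' + 1) <= m * (w + Suc l' + 1)" by (intro mult_le_mono2) simp
  then have "2 ^ Suc l' * (?Q' * Suc l') <= 2 ^ Suc l' * (?Q * Suc l')" by (intro mult_le_mono) auto
  moreover have "2 ^ Suc l' * (m * (w + Suc l' + 1)) + 2 <= 2 ^ Suc l' * ?Q"
   using mult_le_mono[of 1 "2 ^ Suc l'" "2" 2] by (simp add: algebra_simps)
  moreover have "2 ^ Suc l' * (?Q * (Suc l' + 1)) = 2 ^ Suc l' * (?Q * Suc l') + 2 ^ Suc l' * ?Q"
   by (simp only: distrib_left mult_1_right)
  ultimately have "2 ^ Suc l' * (m * (w + Suc l' + 1)) + 2 ^ Suc l' * (?Q' * Suc l') + 2 <= 2 ^ Suc l' * (?Q * (Suc l' + 1))"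
   by linarith
  then show "?W x + ?S (?s1 x) + ?S (?s2 (x, ?F (?s1 x))) + 2 <= ?S x"
   unfolding x by (simp add: algebra_simps)
 qed ((rule cmp_le'[where K = 1], (rule cmp_intros)+, force) | force)+
qed

lemma sum_zip_fst: "(\<Sum>p\<leftarrow>zip A B. length (fst p) + l + 1) <= sz A + length A * l"
proof (induction A arbitrary: B)
 case (Cons u A)
 show ?case using Cons[of "tl B"] by (cases B) auto
qed simp

lemma sz_take: "sz (take k f) <= sz f" and sz_drop: "sz (drop k f) <= sz f"
proof -
 have *: "sz (A @ B) = sz A + sz B" for A B by (simp add: sz_def)
 show "sz (take k f) <= sz f" "sz (drop k f) <= sz f"
  using *[of "take k f" "drop k f"] by simp_all
qed

lemma length_le_sz: "length f <= sz f" by (induction f) auto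

lemma cmp_fin:
 "cmp (%_. True) (%x. fin (fst (fst x)) (snd (fst x)) (snd x))
  (%x. snd (fst x) + sz (snd x) + length (snd x) * fst (fst x))"
proof -
 have "cmp (%_. True) (%q. drop (fst q) (subb False (fst (snd q)) (snd (snd q)))) (%q. length (fst (snd q)) + fst q)"
  by (rule cmp_le'[where K = 2], (rule cmp_intros)+, force)
 note mp = cmp_map[of _ "%l p. drop l (subb False (fst p) (snd p))", OF this]
 show ?thesis unfolding fin_def
  apply (rule cmp_le'[where K = 4])
  apply (rule cmp_intros TrueI mp)+
  subgoal for x
  proof -
   obtain l m u where x: "x = ((l, m), u)" by (metis prod.collapse)
   have "length (take m u) * l <= length u * l" by (intro mult_le_mono1) simp
   then have "(\<Sum>p\<leftarrow>zip (take m u) (drop m u). length (fst p) + l + 1) <= sz u + length u * l"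
    using sum_zip_fst[where A = "take m u" and B = "drop m u" and l = l] sz_take[of m u] by linarith
   then show ?thesis using length_le_sz[of u] unfolding x by simp
  qed
  done
qed

lemma cmp_chunks: "cmp (%_. True) (%x. chunks (arg1 x) (arg2 x) (rst3 x)) (%x. arg1 x * (arg2 x + 1))"
 apply (rule cmp_rec1'[where p = "%x. arg1 x = 0" and base = "%x. []" and s = "%x. (arg1 x - Suc 0, arg2 x, drop (arg2 x) (rst3 x))"
  and post = "%y. take (arg2 (fst y)) (rst3 (fst y)) # snd y" and W = "%x. if arg1 x = 0 then 0 else arg2 x" and K = 1])
      apply (case_tac "arg1 x"; simp)
      apply ((rule cmp_intros | force)+)
 subgoal for x by (cases "arg1 x") auto
 done

lemmas [cmp_intros] = cmp_app3[where E = "%_. True", OF cmp_chunks, OF _ _ _ TrueI, unfolded fst_conv snd_conv]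

lemma cmp_prep: "cmp (%x. length (rst3 x) = arg1 x * arg2 x) (%x. prep (arg1 x) (arg2 x) (rst3 x)) (%x. (arg1 x + 1) * (arg2 x + 1))"
proof -
 have "cmp (%_. True) (%q. (snd q :: bool list list) @ replicate (3 * fst q) []) (%q. length (snd q) + fst q)"
  by (rule cmp_le'[where K = 10], (rule cmp_intros)+, force)
 note mp = cmp_map[of _ "%s u. u @ replicate (3 * s) []", OF this]
 show ?thesis unfolding prep_def
  apply (rule cmp_le'[where K = 40])
  apply (rule cmp_intros TrueI mp)+
  subgoal for x
  proof -
   assume a: "length (rst3 x) = arg1 x * arg2 x"
   obtain r s f where x: "x = (r, s, f)" by (metis prod.collapse)
   have "(\<Sum>u\<leftarrow>chunks r s f. length u + s + 1) <= length (chunks r s f) * (2 * s + 1)"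
   proof (rule sum_list_bound)
    fix u assume "u \<in> set (chunks r s f)"
    then have "length u = s" using chunks_elems[of f r s "Max (insert 0 (length ` set f))" u] a x
     by (auto simp: narrow_def)
    then show "length u + s + 1 <= 2 * s + 1" by simp
   qed
   then show ?thesis unfolding x by (simp add: algebra_simps)
  qed
  done
qed

lemma cmp_recomb: "cmp (%_. True) (%x. recomb (arg1 x) (arg2 x) (rst3 x))
 (%x. 2 * sz (arg2 x) + (\<Sum>u\<leftarrow>rst3 x. 4 * sz u + arg1 x + 1))"
proof -
 let ?W = "%x. if rst3 x = [] then 0 else arg1 x + 2 * sz (hd (rst3 x)) + 2 * sz (arg2 x)"
 have po: "cmp (%y. True \<and> \<not> rst3 (fst y) = [] \<and> snd y = recomb (arg1 (arg1 (fst y), drop (arg1 (fst y)) (hd (rst3 (fst y))), tl (rst3 (fst y))))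
   (arg2 (arg1 (fst y), drop (arg1 (fst y)) (hd (rst3 (fst y))), tl (rst3 (fst y)))) (rst3 (arg1 (fst y), drop (arg1 (fst y)) (hd (rst3 (fst y))), tl (rst3 (fst y)))))
  (%y. padd (take (arg1 (fst y)) (hd (rst3 (fst y)))) (arg2 (fst y)) @ snd y) (%y. ?W (fst y))"
  apply (rule cmp_le'[where K = 4])
  apply (rule cmp_intros | force)+
  subgoal for y
   using sz_take[of "arg1 (fst y)" "hd (rst3 (fst y))"] length_le_sz[of "take (arg1 (fst y)) (hd (rst3 (fst y)))"] length_le_sz[of "arg2 (fst y)"]
   by (simp add: max_def)
  done
 show ?thesis
  apply (rule cmp_rec1[where p = "%x. rst3 x = []" and base = "%x. arg2 x" and s = "%x. (arg1 x, drop (arg1 x) (hd (rst3 x)), tl (rst3 x))", OF _ _ _ _ _ po])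
    apply (case_tac "rst3 x"; simp)
    apply force
   apply (rule cmp_le'[where K = 1], (rule cmp_intros)+, force)
   apply (rule cmp_le'[where K = 1], (rule cmp_intros)+, force)
  apply (rule cmp_le'[where K = 1], (rule cmp_intros | force)+)
  subgoal for x using sz_drop[of "arg1 x" "hd (rst3 x)"] by (cases "rst3 x") auto
  done
qed

lemma length_pmul_le: "length (pmul f g) <= length f + length g"
 by (induction f) auto

lemma cmp_pmul: "cmp (%x. narrow (arg1 x) (arg2 x) \<and> narrow (arg1 x) (rst3 x) \<and> length (arg2 x) <= 600 \<and> length (rst3 x) <= 600)
 (%x. pmul (arg2 x) (rst3 x)) (%x. length (arg2 x) * ((arg1 x + 1)^2 + 1))" (is "cmp ?D ?F ?S")
proof -
 let ?W = "%x. if arg2 x = [] then 0 else (arg1 x + 1)^2"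
 let ?s = "%x. (arg1 x, tl (arg2 x), rst3 x)"
 have mp: "cmp (%y. ?D (fst y) \<and> \<not> arg2 (fst y) = [] \<and> snd y = ?F (?s (fst y))) (%y. map (nmul (hd (arg2 (fst y)))) (rst3 (fst y)))
  (%y. ?W (fst y))"
  apply (rule cmp_le'[where K = 6000])
  apply (rule cmp_map[of "%_. True" nmul])
    apply (rule cmp_nmul)
   apply (rule cmp_intros | force)+
  subgoal for y
  proof -
   assume a: "?D (fst y) \<and> \<not> arg2 (fst y) = [] \<and> snd y = ?F (?s (fst y))"
   obtain w f g r where y: "y = ((w, f, g), r)" by (metis prod.collapse)
   have w: "length (hd f) <= w" "\<And>c. c \<in> set g ==> length c <= w" using a y by (auto simp: narrow_def)
   have "(\<Sum>c\<leftarrow>g. length (hd f) * (2 * length c + 2 * length (hd f) + 3) + 1) <= length g * (w * (4 * w + 3) + 1)"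
   proof (rule sum_list_bound)
    fix c assume "c \<in> set g"
    then have "length c <= w" by (rule w(2))
    then show "length (hd f) * (2 * length c + 2 * length (hd f) + 3) + 1 <= w * (4 * w + 3) + 1"
     using w(1) by (intro add_mono mult_le_mono) auto
   qed
   also have "... <= 600 * (7 * (w + 1)^2)"
    by (intro mult_le_mono) (use a y in \<open>auto simp: power2_eq_square algebra_simps\<close>)
   finally show ?thesis using a unfolding y by simp
  qed
  done
 have po: "cmp (%y. ?D (fst y) \<and> \<not> arg2 (fst y) = [] \<and> snd y = ?F (?s (fst y)))
  (%y. padd (map (nmul (hd (arg2 (fst y)))) (rst3 (fst y))) ([] # snd y)) (%y. ?W (fst y))"
  apply (rule cmp_le'[where K = 10000000])
  apply (rule true_app2[OF cmp_padd, unfolded fst_conv snd_conv])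
   apply (rule mp)
  apply (rule cmp_intros)+
  subgoal for y
  proof -
   assume a: "?D (fst y) \<and> \<not> arg2 (fst y) = [] \<and> snd y = ?F (?s (fst y))"
   obtain w f g r where y: "y = ((w, f, g), r)" by (metis prod.collapse)
   have n: "narrow w (tl f)" "narrow w g" "length (tl f) <= 600" using a y by (auto simp: narrow_def dest: list.set_sel(2))
   have "narrow (3 * w + 600) (pmul (tl f) g)" using narrow_pmul[OF n(1,2)] n(3) by (auto intro: narrow_mono)
   then have "sz (pmul (tl f) g) <= length (pmul (tl f) g) * (3 * w + 600 + 1)" by (rule sz_narrow)
   also have "... <= 1200 * (601 * (w + 1))"
    by (intro mult_le_mono) (use length_pmul_le[of "tl f" g] n a y in auto)
   finally have s1: "sz r <= 721200 * (w + 1)" using a y by simp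
   have hw: "length (hd f) <= w" using a y by (auto simp: narrow_def)
   have "sz (map (nmul (hd f)) g) <= length (map (nmul (hd f)) g) * (3 * w + 1)"
   proof (rule sz_narrow, unfold narrow_def, clarsimp)
    fix c assume "c \<in> set g"
    then show "length (nmul (hd f) c) <= 3 * w" using length_nmul[of "hd f" c] hw n(2) by (auto simp: narrow_def)
   qed
   also have "... <= 600 * (3 * (w + 1))" by (intro mult_le_mono) (use a y in auto)
   finally have s2: "sz (map (nmul (hd f)) g) <= 1800 * (w + 1)" by simp
   have "w + 1 <= (w + 1)^2" by (simp add: power2_eq_square)
   then show ?thesis using s1 s2 a unfolding y by simp
  qed
  done
 show ?thesis
  apply (rule cmp_rec1[where p = "%x. arg2 x = []" and base = "%x. []" and s = ?s, OF _ _ _ _ _ po])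
    apply (case_tac "arg2 x"; simp)
    apply (force simp: narrow_def dest: list.set_sel(2))
   apply (rule cmp_le'[where K = 1], (rule cmp_intros)+, force)
   apply (rule cmp_le'[where K = 1], (rule cmp_intros)+, force)
  apply (rule cmp_le'[where K = 1], (rule cmp_intros | force)+)
  subgoal for x by (cases "arg2 x") auto
  done
qed

text \<open>\<open>polymul\<close> calls itself through \<open>map\<close>, a pattern that
  \<open>cmp_rec2\<close> does not cover. The program is therefore run on lists of tasks: the first
  call solves the list of subtasks of the head, the second call solves the tail.\<close>

type_synonym task = "nat \<times> nat \<times> bool list list \<times> bool list list"

definition subs :: "nat => nat => nat => nat => nat => bool list list => bool list list => task list" where
 "subs k w a s r f g = map (%p. (k, w, p)) (zip
  (fft (2 * s) (Suc a) (4 * s) (prep r s f)) (fft (2 * s) (Suc a) (4 * s) (prep r s g)))"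

definition fold_ring :: "nat => bool list list => bool list list" where
 "fold_ring n p = padd (take n p) (drop n p)"

definition assemble :: "nat => nat => nat => bool list list list => bool list list" where
 "assemble a s r ps = recomb s (replicate s []) (take (2 * r - 1)
  (map (fin (Suc a) (2 * s)) (ifft (2 * s) (Suc a) (4 * s) (map (fold_ring (4 * s)) ps))))"

definition run_task :: "task => bool list list" where
 "run_task z = polymul (arg1 z) (arg2 z) (arg3 z) (rst4 z)"

lemma polymul_unfold:
 "polymul k w f g = (if k < 10 then pmul f g @ [[]] else
  assemble (k div 2) (2 ^ (k - k div 2)) (2 ^ (k div 2))
   (map run_task (subs (k - k div 2 + 2) (w + Suc (k div 2)) (k div 2) (2 ^ (k - k div 2)) (2 ^ (k div 2)) f g)))"
 by (subst polymul.simps) (simp add: Let_def assemble_def subs_def fold_ring_def run_task_def comp_def del: fft.simps ifft.simps)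

text \<open>All lower-order terms in the cost of one splitting or assembling step lie below the unit
  \<open>U\<close>, so that the later estimates become linear in \<open>U\<close>.\<close>

lemma unit_bounds:
 fixes r s V a :: nat
 assumes "1 <= r" "1 <= s"
 defines "U \<equiv> r * (s * ((V + a + 2) * (a + 2)))"
 shows "r * (s * (V + a + 2)) <= U" "r * s <= U" "r * V <= U" "r * a <= U" "r <= U" "s <= U" "V <= U" "a <= U"
proof -
 have "r * (s * ((V + a + 2) * 1)) <= U" unfolding U_def by (intro mult_le_mono) auto
 then show 1: "r * (s * (V + a + 2)) <= U" by simp
 have "r * (s * 1) <= r * (s * (V + a + 2))" by (intro mult_le_mono) auto
 from order_trans[OF this 1] show 2: "r * s <= U" by simp
 have "r * (1 * V) <= r * (s * (V + a + 2))" "r * (1 * a) <= r * (s * (V + a + 2))"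
  using assms by (intro mult_le_mono; simp)+
 from order_trans[OF this(1) 1] order_trans[OF this(2) 1] show 3: "r * V <= U" "r * a <= U" by simp_all
 have "r * 1 <= r * s" "1 * s <= r * s" using assms by (intro mult_le_mono; simp)+
 from order_trans[OF this(1) 2] order_trans[OF this(2) 2] show "r <= U" "s <= U" by simp_all
 have "1 * V <= r * V" "1 * a <= r * a" using assms by (intro mult_le_mono; simp)+
 from order_trans[OF this(1) 3(1)] order_trans[OF this(2) 3(2)] show "V <= U" "a <= U" by simp_all
qed

lemma fft_cost_bound:
 fixes s a V r :: nat
 assumes "1 <= s" "r = 2 ^ a"
 shows "2 ^ Suc a * ((2 * s * (V + Suc a + 1) + 2) * (Suc a + 1)) <= 8 * (r * (s * ((V + a + 2) * (a + 2))))"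
proof -
 have "2 * s * (V + Suc a + 1) + 2 <= 4 * (s * (V + a + 2))"
  using assms(1) mult_le_mono[of 1 s 1 "V + a + 2"] by (simp add: algebra_simps)
 then have "2 * r * ((2 * s * (V + Suc a + 1) + 2) * (Suc a + 1)) <= 2 * r * (4 * (s * (V + a + 2)) * (a + 2))"
  by (intro mult_le_mono) auto
 then show ?thesis by (simp add: assms(2) algebra_simps)
qed

text \<open>The first component of the argument is only a bound on the coefficient widths.\<close>
lemma cmp_subs:
 "cmp (%x::nat \<times> nat \<times> nat \<times> nat \<times> nat \<times> bool list list \<times> bool list list.
  case x of (V, k, a, s, r, f, g) => length f = r * s \<and> length g = r * s \<and> narrow V f \<and> narrow V g \<and> r = 2 ^ a \<and> 1 <= s)
 (%x. subs (arg2 x) (arg1 x + Suc (arg3 x)) (arg3 x) (arg4 x) (fst (rst5 x)) (fst (snd (rst5 x))) (snd (snd (rst5 x))))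
 (%x. case x of (V, k, a, s, r, f, g) => r * (s * ((V + a + 2) * (a + 2))))" (is "cmp ?D ?F ?T")
proof -
 let ?f = "%x. fst (snd (rst5 x))" and ?g = "%x. snd (snd (rst5 x))"
 have D: "family (2 ^ Suc (arg3 x)) (2 * (2 * arg4 x)) (arg1 x) (prep (fst (rst5 x)) (arg4 x) (?f x))"
   "family (2 ^ Suc (arg3 x)) (2 * (2 * arg4 x)) (arg1 x) (prep (fst (rst5 x)) (arg4 x) (?g x))"
   "length (?f x) = fst (rst5 x) * arg4 x" "length (?g x) = fst (rst5 x) * arg4 x" "1 <= arg4 x"
  if "?D x" for x
  using that family_prep[of "?f x" "fst (rst5 x)" "arg4 x" "arg1 x"] family_prep[of "?g x" "fst (rst5 x)" "arg4 x" "arg1 x"]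
  by (auto split: prod.splits)
 note prep = cmp_app3[OF cmp_prep, unfolded fst_conv snd_conv]
 have fft: "cmp ?D (%x. fft (2 * arg4 x) (Suc (arg3 x)) (4 * arg4 x) (prep (fst (rst5 x)) (arg4 x) (h x))) ?T"
  if h: "cmp ?D h (%_. 0)" "\<And>x. ?D x ==> h x = ?f x \<or> h x = ?g x" for h
 proof -
  have hl: "length (h x) = fst (rst5 x) * arg4 x"
   "family (2 ^ Suc (arg3 x)) (2 * (2 * arg4 x)) (arg1 x) (prep (fst (rst5 x)) (arg4 x) (h x))" if "?D x" for x
   using h(2)[OF that] D[OF that] by auto
  have p: "cmp ?D (%x. prep (fst (rst5 x)) (arg4 x) (h x)) (%x. 0 + 0 + 0 + (fst (rst5 x) + 1) * (arg4 x + 1))"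
   by (rule prep) (rule cmp_intros h(1) | erule hl)+
  have t: "cmp ?D (%x. (arg1 x, 2 * arg4 x, Suc (arg3 x), 4 * arg4 x, prep (fst (rst5 x)) (arg4 x) (h x))) ?T"
   apply (rule cmp_le'[where K = 30])
   apply (rule cmp_Pair cmp_Suc p true_app2[OF cmp_nat_mult, unfolded fst_conv snd_conv] cmp_fst cmp_snd cmp_const cmp_id)+
   subgoal for x
   proof -
    assume a: "?D x"
    obtain V k a s r f g where x: "x = (V, k, a, s, r, f, g)" by (metis prod.collapse)
    obtain U where U: "r * (s * ((V + a + 2) * (a + 2))) = U" by blast
    have "1 <= r" "1 <= s" using a x by auto
    note b = unit_bounds[OF this, where V = V and a = a, unfolded U]
    show ?thesis using b \<open>1 <= r\<close> \<open>1 <= s\<close> unfolding x prod.case fst_conv snd_conv U by (simp add: algebra_simps)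
   qed
   done
  have "cmp ?D (%x. (%x. fft (arg2 x) (arg3 x) (arg4 x) (rst5 x)) (arg1 x, 2 * arg4 x, Suc (arg3 x), 4 * arg4 x, prep (fst (rst5 x)) (arg4 x) (h x))) ?T"
   apply (rule cmp_le'[where K = 10])
   apply (rule cmp_app[OF cmp_fft t])
   subgoal for x using hl(2)[of x] D(5)[of x] by simp
   subgoal for x
   proof -
    assume a: "?D x"
    obtain V k a s r f g where x: "x = (V, k, a, s, r, f, g)" by (metis prod.collapse)
    have "1 <= s" "r = 2 ^ a" using a x by auto
    from fft_cost_bound[OF this, of V] show ?thesis unfolding x by simp
   qed
   done
  then show ?thesis by simp
 qed
 have fA: "cmp ?D (%x. fft (2 * arg4 x) (Suc (arg3 x)) (4 * arg4 x) (prep (fst (rst5 x)) (arg4 x) (?f x))) ?T"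
  by (rule fft) (rule cmp_intros | simp)+
 have fB: "cmp ?D (%x. fft (2 * arg4 x) (Suc (arg3 x)) (4 * arg4 x) (prep (fst (rst5 x)) (arg4 x) (?g x))) ?T"
  by (rule fft) (rule cmp_intros | simp)+
 have "cmp (%_. True) (%q::(nat \<times> nat) \<times> bool list list \<times> bool list list. (fst (fst q), snd (fst q), snd q)) (%_. 0)"
  by (rule cmp_le'[where K = 1], (rule cmp_intros)+, force)
 note mp = cmp_map[of _ "%c p. (fst c, snd c, p)", OF this]
 have "cmp ?D (%x. map ((%c p. (fst c, snd c, p)) (arg2 x, arg1 x + Suc (arg3 x))) (zip
  (fft (2 * arg4 x) (Suc (arg3 x)) (4 * arg4 x) (prep (fst (rst5 x)) (arg4 x) (?f x)))
  (fft (2 * arg4 x) (Suc (arg3 x)) (4 * arg4 x) (prep (fst (rst5 x)) (arg4 x) (?g x))))) ?T"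
  apply (rule cmp_le'[where K = 20])
  apply (rule mp)
   apply (rule cmp_Pair cmp_Suc fA fB true_app2[OF cmp_nat_add, unfolded fst_conv snd_conv]
    true_app2[OF cmp_zip, unfolded fst_conv snd_conv] cmp_fst cmp_snd cmp_const cmp_id TrueI)+
  subgoal for x
  proof -
   assume a: "?D x"
   obtain V k a s r f g where x: "x = (V, k, a, s, r, f, g)" by (metis prod.collapse)
   obtain U where U: "r * (s * ((V + a + 2) * (a + 2))) = U" by blast
   have r: "1 <= r" "1 <= s" "r = 2 ^ a" using a x by auto
   note b = unit_bounds[OF r(1,2), where V = V and a = a, unfolded U]
   have l: "length (fft (2 * s) (Suc a) (4 * s) (prep r s f)) = 2 * r" "length (fft (2 * s) (Suc a) (4 * s) (prep r s g)) = 2 * r"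
    using family_fft[OF D(1)[OF a], of "2 * s" "4 * s"] family_fft[OF D(2)[OF a], of "2 * s" "4 * s"] r
    unfolding x family_def by (simp_all del: fft.simps)
   show ?thesis using b r(1) unfolding x prod.case fst_conv snd_conv l U
    by (simp add: l sum_list_triv del: fft.simps)
  qed
  done
 then show ?thesis unfolding subs_def by simp
qed

lemma cmp_fold_ring: "cmp (%_. True) (%q. fold_ring (fst q) (snd q)) (%q. fst q + sz (snd q))"
 unfolding fold_ring_def
 apply (rule cmp_le'[where K = 5])
 apply (rule cmp_intros)+
 subgoal for x using sz_take[of "fst x" "snd x"] sz_drop[of "fst x" "snd x"] by simp
 done

lemma narrow_fold_ring: "narrow V p ==> narrow (Suc V) (fold_ring n p)"
 unfolding fold_ring_def by (intro narrow_padd narrow_take narrow_drop)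

lemma cmp_assemble:
 "cmp (%x::nat \<times> nat \<times> nat \<times> nat \<times> bool list list list.
  case x of (V, a, s, r, ps) => length ps = 2 * r \<and> (\<forall>p\<in>set ps. length p = 8 * s \<and> narrow V p) \<and> r = 2 ^ a \<and> 1 <= s)
 (%x. assemble (arg2 x) (arg3 x) (arg4 x) (rst5 x))
 (%x. case x of (V, a, s, r, ps) => r * (s * ((V + a + 2) * (a + 2))))" (is "cmp ?D ?F ?T")
proof -
 let ?U = "%V a s r. r * (s * ((V + a + 2) * (a + 2)))"
 let ?A = "%x. map (fold_ring (4 * arg3 x)) (rst5 x)"
 let ?B = "%x. ifft (2 * arg3 x) (Suc (arg2 x)) (4 * arg3 x) (?A x)"
 let ?C = "%x. map ((%c. fin (fst c) (snd c)) (Suc (arg2 x), 2 * arg3 x)) (?B x)"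
 have f1: "family (2 ^ Suc (arg2 x)) (2 * (2 * arg3 x)) (Suc (arg1 x)) (?A x)" if "?D x" for x
  using that narrow_fold_ring unfolding family_def by (auto simp: fold_ring_def split: prod.splits)
 have f2: "family (2 ^ Suc (arg2 x)) (2 * (2 * arg3 x)) (Suc (arg1 x) + Suc (arg2 x)) (?B x)" if "?D x" for x
  by (rule family_ifft[OF f1[OF that]])
 have A: "cmp ?D ?A ?T"
  apply (rule cmp_le'[where K = 40])
  apply (rule cmp_map[OF cmp_fold_ring] cmp_intros TrueI)+
  subgoal for x
  proof -
   assume a: "?D x"
   obtain V a s r ps where x: "x = (V, a, s, r, ps)" by (metis prod.collapse)
   obtain U where U: "?U V a s r = U" by blast
   have r: "1 <= r" "1 <= s" using a x by auto
   note b = unit_bounds[OF r, where V = V and a = a, unfolded U]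
   have "(\<Sum>p\<leftarrow>ps. 4 * s + sz p + 1) <= length ps * (13 * (s * (V + a + 2)))"
   proof (rule sum_list_bound)
    fix p assume "p \<in> set ps"
    then have p: "length p = 8 * s" "narrow V p" using a x by auto
    have "sz p <= 8 * s * (V + 1)" using sz_narrow[OF p(2)] p(1) by simp
    also have "... <= 8 * (s * (V + a + 2))" by (simp only: mult.assoc) (intro mult_le_mono; simp)
    finally have "sz p <= 8 * (s * (V + a + 2))" .
    moreover have "s * 1 <= s * (V + a + 2)" by (intro mult_le_mono) auto
    ultimately show "4 * s + sz p + 1 <= 13 * (s * (V + a + 2))" using r by linarith
   qed
   also have "... = 26 * (r * (s * (V + a + 2)))" using a x by simp
   finally have "(\<Sum>p\<leftarrow>ps. 4 * s + sz p + 1) <= 26 * U" using b(1) by linarith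
   then show ?thesis using b unfolding x prod.case fst_conv snd_conv U by simp
  qed
  done
 have B: "cmp ?D ?B ?T"
 proof -
  have "cmp ?D (%x. (%x. ifft (arg2 x) (arg3 x) (arg4 x) (rst5 x)) (Suc (arg1 x), 2 * arg3 x, Suc (arg2 x), 4 * arg3 x, ?A x)) ?T"
   apply (rule cmp_le'[where K = 40])
   apply (rule cmp_app[OF cmp_ifft])
    apply (rule cmp_Pair cmp_Suc A true_app2[OF cmp_nat_mult, unfolded fst_conv snd_conv] cmp_fst cmp_snd cmp_const cmp_id)+
   subgoal for x using f1[of x] by (auto split: prod.splits)
   subgoal for x
   proof -
    assume a: "?D x"
    obtain V a s r ps where x: "x = (V, a, s, r, ps)" by (metis prod.collapse)
    obtain U where U: "?U V a s r = U" by blast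
    have r: "1 <= r" "1 <= s" "r = 2 ^ a" using a x by auto
    note b = unit_bounds[OF r(1,2), where V = V and a = a, unfolded U]
    have "?U (Suc V) a s r <= r * (s * ((2 * (V + a + 2)) * (a + 2)))" by (intro mult_le_mono) auto
    also have "... = 2 * U" unfolding U[symmetric] by simp
    finally have g: "2 ^ Suc a * ((2 * s * (Suc V + Suc a + 1) + 2) * (Suc a + 1)) <= 16 * U"
     using fft_cost_bound[OF r(2,3), of "Suc V"] by linarith
    obtain G where G: "2 ^ Suc a * ((2 * s * (Suc V + Suc a + 1) + 2) * (Suc a + 1)) = G" by blast
    show ?thesis using b g unfolding x prod.case fst_conv snd_conv U G by simp
   qed
   done
  then show ?thesis by simp
 qed
 have szB: "sz u <= 4 * (s * (V + a + 3))" if "?D x" "x = (V, a, s, r, ps)" "u \<in> set (?B x)" for x V a s r ps u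
 proof -
  have u: "length u = 2 * (2 * s)" "narrow (Suc V + Suc a) u"
   using f2[OF that(1)] that(3) unfolding that(2) family_def by (auto simp del: ifft.simps)
  have "sz u <= 2 * (2 * s) * (Suc V + Suc a + 1)" using sz_narrow[OF u(2)] u(1) by simp
  also have "... = 4 * (s * (V + a + 3))" by (simp add: algebra_simps)
  finally show ?thesis .
 qed
 have C: "cmp ?D ?C ?T"
  apply (rule cmp_le'[where K = 60])
  apply (rule cmp_map[where h = "%c. fin (fst c) (snd c)", OF cmp_fin])
   apply (rule cmp_Pair cmp_Suc B true_app2[OF cmp_nat_mult, unfolded fst_conv snd_conv] cmp_fst cmp_snd cmp_const cmp_id TrueI)+
  subgoal for x
  proof -
   assume a: "?D x"
   obtain V a s r ps where x: "x = (V, a, s, r, ps)" by (metis prod.collapse)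
   obtain U where U: "?U V a s r = U" by blast
   have r: "1 <= r" "1 <= s" "r = 2 ^ a" using a x by auto
   note b = unit_bounds[OF r(1,2), where V = V and a = a, unfolded U]
   have lB: "length (?B x) = 2 * r" "\<And>u. u \<in> set (?B x) ==> length u = 4 * s"
    using f2[OF a] r(3) unfolding x family_def by (simp_all del: ifft.simps)
   have "(\<Sum>u\<leftarrow>?B x. 2 * s + sz u + length u * Suc a + 1) <= length (?B x) * (15 * (s * (V + a + 2)))"
   proof (rule sum_list_bound)
    fix u assume u: "u \<in> set (?B x)"
    have "sz u <= 4 * (s * (V + a + 3))" by (rule szB[OF a x u])
    also have "... <= 4 * (s * (2 * (V + a + 2)))" by (intro mult_le_mono) auto
    finally have "sz u <= 8 * (s * (V + a + 2))" by (simp add: algebra_simps)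
    moreover have "s * 1 <= s * (V + a + 2)" by (intro mult_le_mono) auto
    moreover have "s * Suc a <= s * (V + a + 2)" by (intro mult_le_mono) auto
    moreover have "length u * Suc a = 4 * (s * Suc a)" using lB(2)[OF u] by simp
    ultimately show "2 * s + sz u + length u * Suc a + 1 <= 15 * (s * (V + a + 2))" using r(2) by linarith
   qed
   also have "... = 30 * (r * (s * (V + a + 2)))" using lB by simp
   finally have "(\<Sum>u\<leftarrow>?B x. 2 * s + sz u + length u * Suc a + 1) <= 30 * U" using b(1) by linarith
   then show ?thesis using b unfolding x prod.case fst_conv snd_conv U by (simp del: ifft.simps)
  qed
  done
 have "cmp ?D (%x. recomb (arg3 x) (replicate (arg3 x) []) (take (2 * arg4 x - 1) (?C x))) ?T"
  apply (rule cmp_le'[where K = 200])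
  apply (rule cmp_app3[OF cmp_recomb, OF _ _ _ TrueI, unfolded fst_conv snd_conv])
   apply (rule C true_app2[OF cmp_take, unfolded fst_conv snd_conv] true_app2[OF cmp_nat_sub, unfolded fst_conv snd_conv]
    true_app2[OF cmp_replicate, unfolded fst_conv snd_conv]
    true_app2[OF cmp_nat_mult, unfolded fst_conv snd_conv] cmp_fst cmp_snd cmp_const cmp_id TrueI)+
  subgoal for x
  proof -
   assume a: "?D x"
   obtain V a s r ps where x: "x = (V, a, s, r, ps)" by (metis prod.collapse)
   obtain U where U: "?U V a s r = U" by blast
   have r: "1 <= r" "1 <= s" "r = 2 ^ a" using a x by auto
   note b = unit_bounds[OF r(1,2), where V = V and a = a, unfolded U]
   have lB: "length (?B x) = 2 * r" "\<And>u. u \<in> set (?B x) ==> length u = 4 * s \<and> narrow (Suc V + Suc a) u"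
    using f2[OF a] r(3) unfolding x family_def by (simp_all del: ifft.simps)
   have "(\<Sum>u\<leftarrow>take (2 * r - 1) (?C x). 4 * sz u + s + 1) <= length (take (2 * r - 1) (?C x)) * (20 * (s * (V + a + 2)))"
   proof (rule sum_list_bound)
    fix u assume "u \<in> set (take (2 * r - 1) (?C x))"
    then have "u \<in> set (?C x)" by (rule in_set_takeD)
    then obtain v where v: "v \<in> set (?B x)" "u = fin (Suc a) (2 * s) v" using x by auto
    have "narrow (Suc V + Suc a) u" unfolding v(2) fin_def narrow_def
     using lB(2)[OF v(1)] by (fastforce simp: narrow_def dest: set_zip_leftD in_set_takeD intro: diff_le_self[THEN order_trans])
    moreover have "length u = 2 * s" using lB(2)[OF v(1)] v(2) by (simp add: fin_def)
    ultimately have "sz u <= 2 * s * (Suc V + Suc a + 1)" using sz_narrow[of "Suc V + Suc a" u] by simp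
    also have "... = 2 * (s * (V + a + 3))" by (simp add: algebra_simps)
    also have "... <= 2 * (s * (2 * (V + a + 2)))" by (intro mult_le_mono) auto
    finally have "sz u <= 4 * (s * (V + a + 2))" by (simp add: algebra_simps)
    moreover have "s * 1 <= s * (V + a + 2)" by (intro mult_le_mono) auto
    ultimately show "4 * sz u + s + 1 <= 20 * (s * (V + a + 2))" using r(2) by linarith
   qed
   also have "... <= (2 * r) * (20 * (s * (V + a + 2)))" by (intro mult_le_mono) auto
   also have "... = 40 * (r * (s * (V + a + 2)))" by simp
   finally have S: "(\<Sum>u\<leftarrow>take (2 * r - 1) (?C x). 4 * sz u + s + 1) <= 40 * U" using b(1) by linarith
   have "sz (replicate s []) = s" by (induction s) auto
   then show ?thesis using b S unfolding x prod.case fst_conv snd_conv U by (simp del: ifft.simps)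
  qed
  done
 then show ?thesis unfolding assemble_def by simp
qed

definition task_ok :: "task => bool" where
 "task_ok z \<longleftrightarrow> (case z of (k, w, f, g) => length f = 2 ^ k \<and> length g = 2 ^ k \<and> narrow w f \<and> narrow w g)"

definition task_work :: "task => nat" where
 "task_work z = 2 ^ arg1 z * ((arg1 z + 1) * (arg2 z + arg1 z + 1)\<^sup>2)"

text \<open>The subtasks have total length 8 * 2^k, but their index k' is only about k/2: k' + 1 <=
  (4/5)(k + 1) and (5/4)^13 > 16, so the power 13 turns the factor 8 into at most 1/2. The summand
  20 k leaves room for the bits that the transform adds to the width; the square accounts for school
  multiplication in the base case.\<close>

definition task_cost :: "task => nat" where
 "task_cost z = 2 ^ arg1 z * ((arg1 z + 1) ^ 13 * (arg2 z + 20 * arg1 z + 1)\<^sup>2)"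

definition split_task :: "task => task list" where
 "split_task z = subs (arg1 z - arg1 z div 2 + 2) (arg2 z + Suc (arg1 z div 2)) (arg1 z div 2)
  (2 ^ (arg1 z - arg1 z div 2)) (2 ^ (arg1 z div 2)) (arg3 z) (rst4 z)"

definition join_task :: "task => bool list list list => bool list list" where
 "join_task z ps = assemble (arg1 z div 2) (2 ^ (arg1 z - arg1 z div 2)) (2 ^ (arg1 z div 2)) ps"

lemma run_task_rec: "run_task z = (if arg1 z < 10 then pmul (arg3 z) (rst4 z) @ [[]] else join_task z (map run_task (split_task z)))"
 unfolding run_task_def[of z] join_task_def split_task_def by (subst polymul_unfold) simp

lemma split_task_ok:
 assumes "task_ok z" "\<not> arg1 z < 10"
 shows "length (split_task z) = 2 * 2 ^ (arg1 z div 2)"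
  "y \<in> set (split_task z) ==> task_ok y \<and> arg1 y = arg1 z - arg1 z div 2 + 2 \<and> arg2 y = arg2 z + Suc (arg1 z div 2)"
proof -
 obtain k w f g where z: "z = (k, w, f, g)" by (metis prod.collapse)
 let ?a = "k div 2" let ?s = "2 ^ (k - ?a) :: nat" let ?r = "2 ^ ?a :: nat"
 have rs: "?r * ?s = 2 ^ k" by (simp add: power_add[symmetric])
 have "family (2 * ?r) (4 * ?s) w (prep ?r ?s f)" "family (2 * ?r) (4 * ?s) w (prep ?r ?s g)"
  using assms z rs by (auto simp: task_ok_def intro!: family_prep)
 then have pf: "family (2 ^ Suc ?a) (4 * ?s) w (prep ?r ?s f)" "family (2 ^ Suc ?a) (4 * ?s) w (prep ?r ?s g)" by simp_all
 define A where "A = fft (2 * ?s) (Suc ?a) (4 * ?s) (prep ?r ?s f)"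
 define B where "B = fft (2 * ?s) (Suc ?a) (4 * ?s) (prep ?r ?s g)"
 have fA: "family (2 ^ Suc ?a) (2 ^ (k - ?a + 2)) (w + Suc ?a) A" "family (2 ^ Suc ?a) (2 ^ (k - ?a + 2)) (w + Suc ?a) B"
  using family_fft[OF pf(1), of "2 * ?s" "4 * ?s"] family_fft[OF pf(2), of "2 * ?s" "4 * ?s"]
  unfolding A_def[symmetric] B_def[symmetric] by simp_all
 have sp: "split_task z = map (%p. (k - ?a + 2, w + Suc ?a, p)) (zip A B)"
  unfolding split_task_def subs_def z fst_conv snd_conv A_def B_def by (rule refl)
 show "length (split_task z) = 2 * 2 ^ (arg1 z div 2)"
  unfolding sp using fA unfolding family_def by (simp add: z)
 assume "y \<in> set (split_task z)"
 then obtain u v where uv: "(u, v) \<in> set (zip A B)" "y = (k - ?a + 2, w + Suc ?a, u, v)" unfolding sp by auto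
 then have "u \<in> set A" "v \<in> set B" by (auto dest: set_zip_leftD set_zip_rightD)
 then show "task_ok y \<and> arg1 y = arg1 z - arg1 z div 2 + 2 \<and> arg2 y = arg2 z + Suc (arg1 z div 2)"
  using fA uv(2) unfolding family_def task_ok_def z by auto
qed

lemma task_cost_rec:
 assumes k: "\<not> arg1 z < 10" and ok: "task_ok z"
 shows "task_work z + (\<Sum>y\<leftarrow>split_task z. task_cost y + 3) + 5 <= task_cost z"
proof -
 obtain k w f g where z: "z = (k, w, f, g)" by (metis prod.collapse)
 have k: "10 <= k" using k z by simp
 define a where "a = k div 2"
 define k' where "k' = k - a + 2"
 have ak: "5 <= a" "k = 2 * a \<or> k = 2 * a + 1" using k by (auto simp: a_def)
 define X where "X = (k' + 1) ^ 13"
 define Y where "Y = (k + 1) ^ 13"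
 define Q where "Q = (w + 20 * k + 1)\<^sup>2"
 define E where "E = 2 ^ k * Q"
 have "5 * (k' + 1) <= 4 * (k + 1)" using ak by (auto simp: k'_def)
 then have "(5 * (k' + 1)) ^ 13 <= (4 * (k + 1)) ^ 13" by (rule power_mono) simp
 then have "5 ^ 13 * X <= 4 ^ 13 * Y" by (simp only: power_mult_distrib X_def Y_def)
 then have XY: "16 * X <= Y" by simp
 have EXY: "E * (16 * X) <= E * Y" using XY by (rule mult_le_mono2)
 have "(w + Suc a + 20 * k' + 1)\<^sup>2 <= Q" unfolding Q_def using ak by (intro power_mono) (auto simp: k'_def)
 then have "2 * 2 ^ a * (2 ^ k' * (X * (w + Suc a + 20 * k' + 1)\<^sup>2)) <= 2 * 2 ^ a * (2 ^ k' * (X * Q))" by (intro mult_le_mono) auto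
 also have "... = 2 * (2 ^ a * 2 ^ k') * (X * Q)" by (simp add: algebra_simps)
 also have "2 ^ a * 2 ^ k' = 4 * (2::nat) ^ k"
 proof -
  have "a + k' = k + 2" using ak by (auto simp: k'_def)
  then have "(2::nat) ^ a * 2 ^ k' = 2 ^ (k + 2)" by (simp add: power_add[symmetric])
  then show ?thesis by simp
 qed
 also have "2 * (4 * 2 ^ k) * (X * Q) = E * (8 * X)" by (simp add: E_def algebra_simps)
 finally have s1: "2 * 2 ^ a * (2 ^ k' * (X * (w + Suc a + 20 * k' + 1)\<^sup>2)) <= E * (8 * X)" .
 have s2: "task_work z <= E * (k + 1)"
 proof -
  have "(w + k + 1)\<^sup>2 <= Q" unfolding Q_def by (intro power_mono) auto
  then have "2 ^ k * ((k + 1) * (w + k + 1)\<^sup>2) <= 2 ^ k * ((k + 1) * Q)" by (intro mult_le_mono) auto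
  then show ?thesis by (simp add: task_work_def z E_def algebra_simps)
 qed
 have Q1: "1 <= Q" by (simp add: Q_def)
 have "2 ^ a * 1 <= E" unfolding E_def using Q1 by (intro mult_le_mono) (auto simp: a_def)
 then have s3: "2 * 2 ^ a * 3 <= E * 6" "1 <= E" by (simp_all, use one_le_power[of "2::nat" a] in linarith)
 have "(k + 1) ^ 2 <= Y" unfolding Y_def by (intro power_increasing) auto
 moreover have "2 * k + 24 <= (k + 1)^2" using mult_le_mono[OF k k] by (simp add: power2_eq_square)
 ultimately have "2 * k + 24 <= Y" by simp
 then have EY: "E * (2 * k + 24) <= E * Y" by (rule mult_le_mono2)
 have sum: "(\<Sum>y\<leftarrow>split_task z. task_cost y + 3) = 2 * 2 ^ a * (2 ^ k' * (X * (w + Suc a + 20 * k' + 1)\<^sup>2) + 3)"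
 proof -
  have "map (%y. task_cost y + 3) (split_task z) = map (%_. 2 ^ k' * (X * (w + Suc a + 20 * k' + 1)\<^sup>2) + 3) (split_task z)"
   using split_task_ok(2)[OF ok] k z by (auto simp: task_cost_def X_def k'_def a_def)
  note eq = arg_cong[OF this, of sum_list]
  have "length (split_task z) = 2 * 2 ^ a" using split_task_ok(1)[OF ok] k z by (simp add: a_def)
  then show ?thesis unfolding eq by (simp only: sum_list_triv of_nat_id)
 qed
 have tc: "task_cost z = E * Y" by (simp add: task_cost_def z E_def Y_def Q_def algebra_simps)
 obtain G where G: "2 * 2 ^ a * (2 ^ k' * (X * (w + Suc a + 20 * k' + 1)\<^sup>2)) = G" by blast
 have e: "E * (8 * X) = 8 * (E * X)" "E * (16 * X) = 16 * (E * X)" "E * (2 * k + 24) = 2 * (E * k) + 24 * E"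
  "E * (k + 1) = E * k + E" by (simp_all add: algebra_simps)
 show ?thesis unfolding sum distrib_left tc G
  using s1[unfolded G e] s2[unfolded e] s3 EXY[unfolded e] EY[unfolded e] by linarith
qed

lemma task_bounds:
 assumes "task_ok z"
 shows "2 ^ arg1 z * (arg1 z + 1) <= task_work z" "2 ^ arg1 z <= task_work z" "arg1 z + 1 <= task_work z" "arg2 z <= task_work z"
  "2 ^ arg1 z * (arg2 z + 1)\<^sup>2 <= task_work z"
  "2 ^ arg1 z * ((arg2 z + arg1 z + 1) * (arg1 z + 1)) <= task_work z"
proof -
 obtain k w f g where z: "z = (k, w, f, g)" by (metis prod.collapse)
 have sq: "w + k + 1 <= (w + k + 1)\<^sup>2" "(w + 1)\<^sup>2 <= (w + k + 1)\<^sup>2" by (simp add: power2_eq_square, intro power_mono, auto)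
 have "2 ^ k * ((k + 1) * (w + k + 1)) <= task_work z" unfolding task_work_def z fst_conv snd_conv
  using sq by (intro mult_le_mono) auto
 then show 1: "2 ^ arg1 z * ((arg2 z + arg1 z + 1) * (arg1 z + 1)) <= task_work z" by (simp add: z mult.commute)
 have "2 ^ k * (1 * (k + 1)) <= 2 ^ k * ((w + k + 1) * (k + 1))" "1 * ((w + k + 1) * 1) <= 2 ^ k * ((w + k + 1) * (k + 1))"
  by (intro mult_le_mono; simp)+
 from order_trans[OF this(1) 1[unfolded z fst_conv snd_conv]] order_trans[OF this(2) 1[unfolded z fst_conv snd_conv]]
 show 2: "2 ^ arg1 z * (arg1 z + 1) <= task_work z" "arg1 z + 1 <= task_work z" "arg2 z <= task_work z" by (simp_all add: z)
 have "2 ^ k * 1 <= 2 ^ k * (k + 1)" by (intro mult_le_mono) auto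
 from order_trans[OF this 2(1)[unfolded z fst_conv]] show "2 ^ arg1 z <= task_work z" by (simp add: z)
 have "2 ^ k * (1 * (w + 1)\<^sup>2) <= task_work z" unfolding task_work_def z fst_conv snd_conv
  using sq by (intro mult_le_mono) auto
 then show "2 ^ arg1 z * (arg2 z + 1)\<^sup>2 <= task_work z" by (simp add: z)
qed

text \<open>The left side is what computing 2^c in unary costs according to
  \<open>cmp_nat_power\<close>; it is within the work of a task of index k.\<close>

lemma pow_cost_bound: "c <= k ==> c * (2 ^ c + 2 + 3) <= 6 * (2 ^ k * (k + 1))" for c k :: nat
proof -
 assume "c <= k"
 then have "(2::nat) ^ c <= 2 ^ k" by (intro power_increasing) auto
 moreover have "(1::nat) <= 2 ^ k" by simp
 ultimately have "2 ^ c + 2 + 3 <= 6 * (2::nat) ^ k" by linarith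
 then have "c * (2 ^ c + 2 + 3) <= (k + 1) * (6 * 2 ^ k)" using \<open>c <= k\<close> by (intro mult_le_mono) auto
 then show ?thesis by (simp add: algebra_simps)
qed

lemma cmp_split_task: "cmp (%z. task_ok z \<and> \<not> arg1 z < 10) split_task task_work"
proof -
 have pre: "cmp (%z. task_ok z \<and> \<not> arg1 z < 10)
  (%z. (arg2 z, arg1 z - arg1 z div 2 + 2, arg1 z div 2, 2 ^ (arg1 z - arg1 z div 2) :: nat, 2 ^ (arg1 z div 2) :: nat, arg3 z, rst4 z)) task_work"
  apply (rule cmp_le'[where K = 50])
  apply (rule cmp_intros)+
  subgoal for z
  proof -
   assume a: "task_ok z \<and> \<not> arg1 z < 10"
   obtain a where ka: "arg1 z div 2 = a" by blast
   have "a <= arg1 z" using ka by auto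
   obtain c where kc: "arg1 z - a = c" by blast
   have "c <= arg1 z" using kc by auto
   note b = task_bounds[OF conjunct1[OF a]]
   have pw: "e * (2 ^ e + 2 + 3) <= 6 * task_work z" if "e <= arg1 z" for e
    using order_trans[OF pow_cost_bound[OF that] mult_le_mono2[OF b(1)]] .
   obtain A where A: "a * (2 ^ a + 2 + 3) = A" by blast
   obtain C where C: "c * (2 ^ c + 2 + 3) = C" by blast
   show ?thesis using b(3,4) pw[OF \<open>a <= arg1 z\<close>] pw[OF \<open>c <= arg1 z\<close>] \<open>a <= arg1 z\<close> \<open>c <= arg1 z\<close>
    unfolding ka kc A C by simp
  qed
  done
 show ?thesis unfolding split_task_def
  apply (rule cmp_le'[OF cmp_cong[OF cmp_app[OF cmp_subs pre]], where K = 10])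
   apply (auto simp: task_ok_def power_add[symmetric] split: prod.splits)[1]
  apply simp
  subgoal for z
  proof -
   assume a: "task_ok z \<and> \<not> arg1 z < 10"
   obtain k w f g where z: "z = (k, w, f, g)" by (metis prod.collapse)
   define a where "a = k div 2"
   have "a <= k" by (simp add: a_def)
   have "2 ^ a * (2 ^ (k - a) * ((w + a + 2) * (a + 2))) = 2 ^ k * ((w + a + 2) * (a + 2))"
   proof -
    have "2 ^ a * 2 ^ (k - a) = (2::nat) ^ k" using \<open>a <= k\<close> by (simp add: power_add[symmetric])
    then show ?thesis by (simp only: mult.assoc[symmetric])
   qed
   also have "... <= 2 ^ k * ((2 * (w + k + 1)) * (2 * (k + 1)))" using \<open>a <= k\<close> by (intro mult_le_mono) auto
   also have "... = 4 * (2 ^ k * ((w + k + 1) * (k + 1)))" by (simp add: algebra_simps)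
   also have "... <= 4 * task_work z" using task_bounds(6)[of z] a z by simp
   finally show ?thesis unfolding z prod.case fst_conv snd_conv a_def by simp
  qed
  done
qed

lemma cmp_join_task:
 "cmp (%q. task_ok (fst q) \<and> \<not> arg1 (fst q) < 10 \<and> snd q = map run_task (split_task (fst q)))
  (%q. join_task (fst q) (snd q)) (%q. task_work (fst q))" (is "cmp ?D _ _")
proof -
 let ?V = "%z. 3 * (arg2 z + Suc (arg1 z div 2)) + 600 + 10 * (arg1 z - arg1 z div 2 + 2)"
 have pre: "cmp ?D
  (%q. (?V (fst q), arg1 (fst q) div 2, 2 ^ (arg1 (fst q) - arg1 (fst q) div 2) :: nat, 2 ^ (arg1 (fst q) div 2) :: nat, snd q)) (%q. task_work (fst q))"
  apply (rule cmp_le'[where K = 2000])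
  apply (rule cmp_intros)+
  subgoal for q
  proof -
   assume a: "?D q"
   obtain a where ka: "arg1 (fst q) div 2 = a" by blast
   have "a <= arg1 (fst q)" using ka by auto
   obtain c where kc: "arg1 (fst q) - a = c" by blast
   have "c <= arg1 (fst q)" using kc by auto
   note b = task_bounds[OF conjunct1[OF a]]
   have pw: "e * (2 ^ e + 2 + 3) <= 6 * task_work (fst q)" if "e <= arg1 (fst q)" for e
    using order_trans[OF pow_cost_bound[OF that] mult_le_mono2[OF b(1)]] .
   obtain A where A: "a * (2 ^ a + 2 + 3) = A" by blast
   obtain C where C: "c * (2 ^ c + 2 + 3) = C" by blast
   show ?thesis using b(3,4) pw[OF \<open>a <= arg1 (fst q)\<close>] pw[OF \<open>c <= arg1 (fst q)\<close>] \<open>a <= arg1 (fst q)\<close> \<open>c <= arg1 (fst q)\<close>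
    unfolding ka kc A C by simp
  qed
  done
 show ?thesis unfolding join_task_def
  apply (rule cmp_le'[OF cmp_cong[OF cmp_app[OF cmp_assemble pre]], where K = 5000])
  subgoal for q
  proof -
   assume a: "?D q"
   obtain k w f g ps where q: "q = ((k, w, f, g), ps)" by (metis prod.collapse)
   have z: "task_ok (k, w, f, g)" "\<not> arg1 (k, w, f, g) < 10" using a q by auto
   have "length p = 8 * 2 ^ (k - k div 2) \<and> narrow (3 * (w + Suc (k div 2)) + 600 + 10 * (k - k div 2 + 2)) p" if pp: "p \<in> set ps" for p
   proof -
    obtain y where y: "y \<in> set (split_task (k, w, f, g))" "p = run_task y" using pp a q by auto
    obtain k2 w2 f2 g2 where y2: "y = (k2, w2, f2, g2)" by (metis prod.collapse)
    have "task_ok y" "k2 = k - k div 2 + 2" "w2 = w + Suc (k div 2)" using split_task_ok(2)[OF z y(1)] y2 by auto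
    then show ?thesis using polymul_correct(2,3)[of f2 k2 g2 w2] y(2) y2 by (simp add: task_ok_def run_task_def)
   qed
   then show ?thesis using split_task_ok(1)[OF z] a q by simp
  qed
  apply simp
  subgoal for q
  proof -
   assume a: "?D q"
   obtain k w f g ps where q: "q = ((k, w, f, g), ps)" by (metis prod.collapse)
   define a where "a = k div 2"
   define c where "c = k - a"
   have ac: "a <= k" "c <= k" by (auto simp: a_def c_def)
   let ?v = "3 * (w + Suc a) + 600 + 10 * (c + 2)"
   have "2 ^ a * (2 ^ c * ((?v + a + 2) * (a + 2))) = 2 ^ k * ((?v + a + 2) * (a + 2))"
   proof -
    have "2 ^ a * 2 ^ c = (2::nat) ^ k" using ac(1) by (simp add: c_def power_add[symmetric])
    then show ?thesis by (simp only: mult.assoc[symmetric])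
   qed
   also have "... <= 2 ^ k * ((1000 * (w + k + 1)) * (2 * (k + 1)))" using ac by (intro mult_le_mono) auto
   also have "... = 2000 * (2 ^ k * ((w + k + 1) * (k + 1)))" by (simp add: algebra_simps)
   also have "... <= 2000 * task_work (k, w, f, g)" using task_bounds(6)[of "(k, w, f, g)"] a q by simp
   finally show ?thesis unfolding q prod.case fst_conv snd_conv a_def c_def by simp
  qed
  done
qed

lemma cmp_base_task: "cmp (%z. task_ok z \<and> arg1 z < 10) (%z. pmul (arg3 z) (rst4 z) @ [[]]) task_work"
proof -
 have b: "length f <= 600 \<and> length g <= 600" if "task_ok (k, w, f, g) \<and> k < 10" for k w f g
 proof -
  have "(2::nat) ^ k <= 2 ^ 9" using that by (intro power_increasing) auto
  then show ?thesis using that by (simp add: task_ok_def)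
 qed
 have "cmp (%z. task_ok z \<and> arg1 z < 10) (%z. (%x. pmul (arg2 x) (rst3 x)) (snd z)) task_work"
  apply (rule cmp_le'[where K = 2])
  apply (rule cmp_app[OF cmp_pmul], (rule cmp_intros)+)
  subgoal for z using b[of "arg1 z" "arg2 z" "arg3 z" "rst4 z"] by (auto simp: task_ok_def split: prod.splits)
  subgoal for z
  proof -
   assume a: "task_ok z \<and> arg1 z < 10"
   obtain k w f g where z: "z = (k, w, f, g)" by (metis prod.collapse)
   have "length f * ((w + 1)\<^sup>2 + 1) <= 2 ^ k * (2 * (w + 1)\<^sup>2)" using a z by (intro mult_le_mono) (auto simp: task_ok_def)
   then show ?thesis using task_bounds(5)[of z] a unfolding z by simp
  qed
  done
 then have p: "cmp (%z. task_ok z \<and> arg1 z < 10) (%z. pmul (arg3 z) (rst4 z)) task_work" by simp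
 show ?thesis
  apply (rule cmp_le'[where K = 5])
  apply (rule p true_app2[OF cmp_append, unfolded fst_conv snd_conv] cmp_const)+
  subgoal for z using length_pmul_le[of "arg3 z" "rst4 z"] task_bounds(2)[of z] by (auto simp: task_ok_def split: prod.splits)
  done
qed

lemma cmp_tasks: "cmp (%zs. \<forall>z\<in>set zs. task_ok z) (map run_task) (%zs. \<Sum>z\<leftarrow>zs. task_cost z + 3)" (is "cmp ?D ?F ?S")
proof -
 \<comment> \<open>A small task gets the empty list of subtasks and is solved by \<open>pmul\<close>
   in the combining step, so that both cases fit the same recursion scheme.\<close>
 let ?s1 = "%zs. if arg1 (hd zs) < 10 then [] else split_task (hd zs)"
 let ?s2 = "%y. tl (fst y)"
 let ?po = "%y. (if arg1 (hd (fst (fst y))) < 10 then pmul (arg3 (hd (fst (fst y)))) (rst4 (hd (fst (fst y)))) @ [[]]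
  else join_task (hd (fst (fst y))) (snd (fst y))) # snd y"
 let ?W = "%zs. if zs = [] then 0 else task_work (hd zs)"
 have hd: "task_ok (hd zs)" if "?D zs" "zs \<noteq> []" for zs using that by auto
 have s1: "cmp (%zs. ?D zs \<and> zs \<noteq> []) ?s1 ?W"
  apply (rule cmp_le'[where K = 30])
  apply (rule cmp_app[OF cmp_split_task] cmp_intros | force)+
  done
 have po: "cmp (%y. ?D (fst (fst y)) \<and> fst (fst y) \<noteq> [] \<and> snd (fst y) = ?F (?s1 (fst (fst y))) \<and> snd y = ?F (?s2 (fst y))) ?po (%y. ?W (fst (fst y)))"
  (is "cmp ?Dy _ _")
 proof -
  have c1: "cmp ?Dy (%y. arg1 (hd (fst (fst y))) < 10) (%_. 0)"
   by (rule cmp_le'[where K = 20], (rule cmp_intros | force)+)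
  have hz: "cmp E (%y. hd (fst (fst y))) (%_. 0)" if "\<And>y. E y ==> ?Dy y" for E
   by (rule cmp_le'[where K = 20], (rule cmp_intros | (use that in force))+)
  have c2: "cmp (%y. ?Dy y \<and> arg1 (hd (fst (fst y))) < 10) (%y. pmul (arg3 (hd (fst (fst y)))) (rst4 (hd (fst (fst y)))) @ [[]]) (%y. 0 + task_work (hd (fst (fst y))))"
   by (rule cmp_app[OF cmp_base_task hz]) auto
  have c3: "cmp (%y. ?Dy y \<and> \<not> arg1 (hd (fst (fst y))) < 10) (%y. join_task (hd (fst (fst y))) (snd (fst y))) (%y. 0 + 0 + task_work (fst (hd (fst (fst y)), snd (fst y))))"
   by (rule cmp_app2[OF cmp_join_task hz]) (auto intro!: cmp_snd cmp_fst cmp_id)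
  show ?thesis
   by (rule cmp_le'[OF cmp_Cons[OF cmp_if[OF c1 c2 c3] cmp_snd[OF cmp_id]], where K = 1]) auto
 qed
 show ?thesis
  apply (rule cmp_rec2[where p = "%zs. zs = []" and base = "%zs. []" and W = ?W, OF _ _ _ _ _ s1 _ po])
     apply (case_tac x; simp add: run_task_rec)
  subgoal for zs using split_task_ok(2)[of "hd zs"] by (cases zs) auto
    apply (auto dest: list.set_sel(2))[1]
   apply (rule cmp_le'[where K = 1], (rule cmp_intros)+, force)
   apply (rule cmp_le'[where K = 1], (rule cmp_intros)+, force)
  apply (rule cmp_le'[where K = 1], (rule cmp_intros)+, force)
  apply simp
  subgoal for zs
  proof -
   assume a: "?D zs" "zs \<noteq> []"
   then obtain z zs' where zs: "zs = z # zs'" "task_ok z" by (cases zs) auto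
   show ?thesis
   proof (cases "arg1 z < 10")
    case True
    have "task_work z <= task_cost z"
     unfolding task_work_def task_cost_def
     by (intro mult_le_mono power_mono self_le_power) auto
    then show ?thesis using zs True by simp
   next
    case False
    then show ?thesis using task_cost_rec[OF False zs(2)] zs by simp
   qed
  qed
  done
qed

section \<open>From polynomials to integers: evaluation at 2 with carries\<close>

primrec carry :: "bool list => bool list list => bool list" where
 "carry acc [] = acc"
| "carry acc (c # cs) = hd (addb False acc c) # carry (tl (addb False acc c)) cs"

lemma addb_nonempty [simp]: "addb c xs ys \<noteq> []"
 using length_addb[of c xs ys] by (metis list.size(3) nat.distinct(1))

lemma val_carry: "of_nat (val (carry acc cs)) = of_nat (val acc) + ev 2 cs"
proof (induction cs arbitrary: acc)
 case (Cons c cs)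
 obtain t ts where t: "addb False acc c = t # ts" using addb_nonempty by (metis neq_Nil_conv)
 have "of_bool t + 2 * val ts = val acc + val c" using val_addb[of False acc c] by (simp add: t)
 then have "(of_nat (of_bool t + 2 * val ts) :: complex) = of_nat (val acc + val c)" by simp
 then show ?case by (simp add: t Cons algebra_simps)
qed simp

lemma length_carry: "length cs <= length (carry acc cs)"
 by (induction cs arbitrary: acc) auto

definition digits_list :: "nat => bool list => bool list list" where
 "digits_list n xs = map (%b. [b]) (xs @ replicate (n - length xs) False)"

text \<open>Bits become coefficients of width 1, whence the argument 1 of \<open>polymul\<close>.
  The final \<open>take\<close> only removes zeros, because the product of two numbers of 2^k bits
  has at most 2 * 2^k bits.\<close>

definition mulb :: "nat => bool list => bool list => bool list" where
 "mulb k xs ys = take (2 * 2 ^ k) (carry [] (polymul k 1 (digits_list (2 ^ k) xs) (digits_list (2 ^ k) ys)))"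

lemma ev_digits_list: "ev 2 (digits_list n xs) = of_nat (val xs)"
proof -
 have "ev 2 (map (%b. [b]) ys) = of_nat (val ys)" for ys by (induction ys) auto
 then show ?thesis by (simp add: digits_list_def del: map_append)
qed

lemma digits_list_ok: "length xs <= n ==> length (digits_list n xs) = n" "narrow 1 (digits_list n xs)"
 by (auto simp: digits_list_def narrow_def)

lemma mulb:
 assumes "length xs <= 2 ^ k" "length ys <= 2 ^ k"
 shows "val (mulb k xs ys) = val xs * val ys" "length (mulb k xs ys) = 2 * 2 ^ k"
proof -
 let ?f = "digits_list (2 ^ k) xs" and ?g = "digits_list (2 ^ k) ys"
 note p = polymul_correct[OF digits_list_ok(1)[OF assms(1)] digits_list_ok(1)[OF assms(2)] digits_list_ok(2) digits_list_ok(2)]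
 have "(of_nat (val (carry [] (polymul k 1 ?f ?g))) :: complex) = of_nat (val xs * val ys)"
  using val_carry[of "[]" "polymul k 1 ?f ?g"] p(1)[of 2] by (simp add: ev_digits_list)
 then have v: "val (carry [] (polymul k 1 ?f ?g)) = val xs * val ys" by (simp only: of_nat_eq_iff)
 have "val xs < 2 ^ 2 ^ k" by (rule less_le_trans[OF val_less power_increasing[OF assms(1)]]) simp
 moreover have "val ys < 2 ^ 2 ^ k" by (rule less_le_trans[OF val_less power_increasing[OF assms(2)]]) simp
 ultimately have "val xs * val ys < 2 ^ 2 ^ k * 2 ^ 2 ^ k" by (intro mult_strict_mono) auto
 then have "val xs * val ys < 2 ^ (2 * 2 ^ k)" by (simp add: power_add[symmetric] mult_2)
 then show "val (mulb k xs ys) = val xs * val ys" unfolding mulb_def val_take v by simp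
 show "length (mulb k xs ys) = 2 * 2 ^ k"
  using length_carry[of "polymul k 1 ?f ?g" "[]"] p(2) by (simp add: mulb_def)
qed

lemma cmp_carry: "cmp (%x. length (arg2 x) <= arg1 x \<and> narrow (arg1 x) (rst3 x)) (%x. carry (arg2 x) (rst3 x))
 (%x. length (rst3 x) * (2 * arg1 x + 1))"
 apply (rule cmp_rec1'[where p = "%x. rst3 x = []" and base = "%x. arg2 x" and s = "%x. (arg1 x, tl (addb False (arg2 x) (hd (rst3 x))), tl (rst3 x))"
  and post = "%y. hd (addb False (arg2 (fst y)) (hd (rst3 (fst y)))) # snd y" and W = "%x. if rst3 x = [] then 0 else 2 * arg1 x" and K = 2])
      apply (case_tac "rst3 x"; simp)
      apply (case_tac "rst3 x"; simp)
     apply ((rule cmp_intros | force)+)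
  apply (case_tac "rst3 x"; simp)+
 done

text \<open>The exponent 15 is the 13 of \<open>task_cost\<close> plus 2 for the square of the width
  term, which is linear in k for coefficients of width 1.\<close>

lemma cmp_mulb: "cmp (%x. length (arg2 x) <= 2 ^ arg1 x \<and> length (rst3 x) <= 2 ^ arg1 x)
 (%x. mulb (arg1 x) (arg2 x) (rst3 x)) (%x. 2 ^ arg1 x * (arg1 x + 1) ^ 15)" (is "cmp ?D _ ?T")
proof -
 have T: "2 ^ k * (k + 1) <= 2 ^ k * (k + 1) ^ 15" "k <= 2 ^ k * (k + 1) ^ 15" "2 ^ k <= 2 ^ k * (k + 1) ^ 15" for k :: nat
 proof -
  show 1: "2 ^ k * (k + 1) <= 2 ^ k * (k + 1) ^ 15" by (intro mult_le_mono2 self_le_power) auto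
  have "1 * k <= 2 ^ k * (k + 1)" "2 ^ k * 1 <= 2 ^ k * (k + 1)" by (intro mult_le_mono; simp)+
  from order_trans[OF this(1) 1] order_trans[OF this(2) 1]
  show "k <= 2 ^ k * (k + 1) ^ 15" "2 ^ k <= 2 ^ k * (k + 1) ^ 15" by simp_all
 qed
 have "cmp (%_. True) (%q::nat \<times> bool. [snd q]) (%_. 0)" by (rule cmp_le'[where K = 1], (rule cmp_intros)+, force)
 note mp = cmp_map[of _ "%c b. [b]", OF this]
 have dl: "cmp ?D (%x. digits_list (2 ^ arg1 x) (h x)) ?T"
  if h: "cmp ?D h (%_. 0)" "\<And>x. ?D x ==> length (h x) <= 2 ^ arg1 x" for h
  unfolding digits_list_def
  apply (rule cmp_le'[where K = 50])
  apply (rule mp, rule cmp_const[of _ 0], (rule h(1) cmp_intros TrueI)+)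
  subgoal for x
  proof -
   assume a: "?D x"
   obtain U where U: "2 ^ arg1 x * (arg1 x + 1) ^ 15 = U" by blast
   note b = T[of "arg1 x", unfolded U]
   have "arg1 x * (2 ^ arg1 x + 2 + 3) <= 6 * (2 ^ arg1 x * (arg1 x + 1))" by (rule pow_cost_bound) simp
   then show ?thesis using h(2)[OF a] b unfolding U by (simp add: sum_list_triv sum_list_replicate)
  qed
  done
 let ?f = "%x. digits_list (2 ^ arg1 x) (arg2 x)" and ?g = "%x. digits_list (2 ^ arg1 x) (rst3 x)"
 have df: "cmp ?D ?f ?T" by (rule dl) (rule cmp_intros | simp)+
 have dg: "cmp ?D ?g ?T" by (rule dl) (rule cmp_intros | simp)+
 have ok: "task_ok (arg1 x, 1, ?f x, ?g x)" if "?D x" for x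
  using that digits_list_ok by (simp add: task_ok_def)
 have "cmp ?D (%x. hd (map run_task [(arg1 x, 1, ?f x, ?g x)])) ?T"
  apply (rule cmp_le'[where K = 600])
  apply (rule cmp_hd)
   apply (rule cmp_app[OF cmp_tasks])
   apply (rule df dg cmp_Cons cmp_Pair cmp_fst cmp_snd cmp_const cmp_id)+
  subgoal for x using ok[of x] by simp
  apply simp
  subgoal for x
  proof -
   let ?k = "arg1 x"
   have "task_cost (?k, 1, ?f x, ?g x) = 2 ^ ?k * ((?k + 1) ^ 13 * (1 + 20 * ?k + 1)\<^sup>2)" by (simp add: task_cost_def)
   also have "... <= 2 ^ ?k * ((?k + 1) ^ 13 * (20 * (?k + 1))\<^sup>2)" by (intro mult_le_mono power_mono) auto
   also have "... = 400 * (2 ^ ?k * ((?k + 1) ^ 13 * (?k + 1)\<^sup>2))" by (simp only: power_mult_distrib) simp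
   also have "(?k + 1) ^ 13 * (?k + 1)\<^sup>2 = (?k + 1) ^ 15" using power_add[of "?k + 1" 13 2] by simp
   finally show ?thesis by simp
  qed
  done
 then have pm: "cmp ?D (%x. polymul (arg1 x) 1 (?f x) (?g x)) ?T" by (simp add: run_task_def)
 have pt: "cmp ?D (%x. (3 * 1 + 600 + 10 * arg1 x, [], polymul (arg1 x) 1 (?f x) (?g x))) ?T"
  apply (rule cmp_le'[where K = 1000])
  apply (rule pm cmp_Pair true_app2[OF cmp_nat_add, unfolded fst_conv snd_conv] true_app2[OF cmp_nat_mult, unfolded fst_conv snd_conv] cmp_fst cmp_snd cmp_const cmp_id)+
  subgoal for x using T(2)[of "arg1 x"] by (simp, linarith?)
  done
 have "cmp ?D (%x. (%y. carry (arg2 y) (rst3 y)) (3 * 1 + 600 + 10 * arg1 x, [], polymul (arg1 x) 1 (?f x) (?g x))) ?T"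
  apply (rule cmp_le'[where K = 5000])
  apply (rule cmp_app[OF cmp_carry pt])
  subgoal for x using polymul_correct(3)[of "?f x" "arg1 x" "?g x" 1] ok[of x] by (simp add: task_ok_def)
  subgoal for x
  proof -
   assume a: "?D x"
   have "length (polymul (arg1 x) 1 (?f x) (?g x)) = 2 * 2 ^ arg1 x"
    using polymul_correct(2)[of "?f x" "arg1 x" "?g x" 1] ok[OF a] by (simp add: task_ok_def)
   moreover have "2 * 2 ^ arg1 x * (2 * (3 * 1 + 600 + 10 * arg1 x) + 1) <= 2 * 2 ^ arg1 x * (1300 * (arg1 x + 1))"
    by (intro mult_le_mono2) simp
   moreover obtain U where U: "2 ^ arg1 x * (arg1 x + 1) ^ 15 = U" by blast
   ultimately have "length (polymul (arg1 x) 1 (?f x) (?g x)) * (2 * (3 * 1 + 600 + 10 * arg1 x) + 1) <= 2600 * U"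
    using T(1)[of "arg1 x", unfolded U] by (simp add: algebra_simps)
   from add_left_mono[OF this, of U] show ?thesis unfolding fst_conv snd_conv U by (rule order_trans) simp
  qed
  done
 then have c: "cmp ?D (%x. carry [] (polymul (arg1 x) 1 (?f x) (?g x))) ?T" by simp
 show ?thesis unfolding mulb_def
  apply (rule cmp_le'[where K = 50])
  apply (rule c true_app2[OF cmp_take, unfolded fst_conv snd_conv] true_app2[OF cmp_nat_mult, unfolded fst_conv snd_conv]
    true_app2[OF cmp_nat_power, unfolded fst_conv snd_conv] cmp_fst cmp_snd cmp_const cmp_id)+
  subgoal for x
  proof -
   obtain U where U: "2 ^ arg1 x * (arg1 x + 1) ^ 15 = U" by blast
   note b = T[of "arg1 x", unfolded U]
   have "arg1 x * (2 ^ arg1 x + 2 + 3) <= 6 * (2 ^ arg1 x * (arg1 x + 1))" by (rule pow_cost_bound) simp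
   then show ?thesis using b unfolding U by (simp, linarith?)
  qed
  done
qed

section \<open>Digit counts of blocks\<close>

primrec cnt :: "nat => nat => nat => nat => nat" where
 "cnt b d 0 s = 0"
| "cnt b d (Suc M) s = (if s mod b = d then Suc (cnt b d M (s div b)) else cnt b d M (s div b))"

lemma cnt_le: "cnt b d M s <= M"
 by (induction M arbitrary: s) (auto simp: le_SucI)

lemma cnt_mod: "0 < b ==> cnt b d M (s mod b ^ M) = cnt b d M s"
proof (induction M arbitrary: s)
 case (Suc M)
 have "s mod b ^ Suc M mod b = s mod b" by (simp add: mod_mod_cancel)
 moreover have "s mod b ^ Suc M div b = s div b mod b ^ M"
  using Suc.prems by (simp add: mod_mult2_eq)
 ultimately show ?case using Suc by simp
qed simp

lemma sum_digit_split:
 fixes g :: "nat => real"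
 assumes "0 < b"
 shows "(\<Sum>s<b * n. g s) = (\<Sum>u<n. \<Sum>e<b. g (u * b + e))"
proof -
 have "sum g {m * b..<m * b + b} = (\<Sum>e<b. g (m * b + e))" for m
  using sum.shift_bounds_nat_ivl[of g 0 "m * b" b] by (simp add: lessThan_atLeast0 add.commute)
 then show ?thesis using sum.nat_group[of g b n] by (simp add: mult.commute)
qed

text \<open>For uniform s below b^M the digits are independent, and f is a sum of M centred
  variables of variance b - 1. The induction splits off the last digit; the cross terms vanish
  because the contribution \<open>g\<close> of one digit sums to 0.\<close>

lemma cnt_moments:
 fixes b d :: nat
 assumes b: "0 < b" "d < b"
 defines "f M s \<equiv> real b * real (cnt b d M s) - real M"
 shows "(\<Sum>s<b ^ M. f M s) = 0" "(\<Sum>s<b ^ M. (f M s)\<^sup>2) = real b ^ M * (real M * (real b - 1))"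
proof -
 have "(\<Sum>s<b ^ M. f M s) = 0 \<and> (\<Sum>s<b ^ M. (f M s)\<^sup>2) = real b ^ M * (real M * (real b - 1))"
 proof (induction M)
  case 0
  then show ?case by (simp add: f_def)
 next
  case (Suc M)
  define g :: "nat => real" where "g e = (if e = d then real b else 0) - 1" for e
  have fs: "f (Suc M) (u * b + e) = g e + f M u" if "e < b" for u e
   using that b by (simp add: f_def g_def algebra_simps)
  have g1: "(\<Sum>e<b. g e) = 0" using b by (simp add: g_def sum_subtractf)
  have g2: "(\<Sum>e<b. (g e)\<^sup>2) = real b * (real b - 1)"
  proof -
   have "(\<Sum>e<b. (g e)\<^sup>2) = (\<Sum>e<b. (if e = d then (real b)\<^sup>2 - 2 * real b else 0) + 1)"
    by (intro sum.cong) (auto simp: g_def power2_eq_square algebra_simps)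
   also have "... = (real b)\<^sup>2 - 2 * real b + real b" using b by (simp add: sum.distrib)
   finally show ?thesis by (simp add: power2_eq_square algebra_simps)
  qed
  have 1: "(\<Sum>s<b ^ Suc M. f (Suc M) s) = (\<Sum>u<b ^ M. \<Sum>e<b. g e + f M u)"
   using sum_digit_split[OF b(1), of "f (Suc M)" "b ^ M"] by (simp add: fs)
  have 2: "(\<Sum>s<b ^ Suc M. (f (Suc M) s)\<^sup>2) = (\<Sum>u<b ^ M. \<Sum>e<b. (g e + f M u)\<^sup>2)"
   using sum_digit_split[OF b(1), of "%s. (f (Suc M) s)\<^sup>2" "b ^ M"] by (simp add: fs)
  have "(\<Sum>e<b. (g e + f M u)\<^sup>2) = real b * (real b - 1) + real b * (f M u)\<^sup>2" for u
  proof -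
   have "(\<Sum>e<b. (g e + f M u)\<^sup>2) = (\<Sum>e<b. (g e)\<^sup>2 + 2 * f M u * g e + (f M u)\<^sup>2)"
    by (intro sum.cong) (auto simp: power2_eq_square algebra_simps)
   then show ?thesis by (simp add: sum.distrib g1 g2 sum_distrib_left[symmetric])
  qed
  then have "(\<Sum>s<b ^ Suc M. (f (Suc M) s)\<^sup>2) = real b ^ M * (real b * (real b - 1)) + real b * (\<Sum>u<b ^ M. (f M u)\<^sup>2)"
   unfolding 2 by (simp add: sum.distrib sum_distrib_left)
  also have "... = real b ^ Suc M * (real (Suc M) * (real b - 1))" unfolding conjunct2[OF Suc] by (simp add: algebra_simps)
  finally have "(\<Sum>s<b ^ Suc M. (f (Suc M) s)\<^sup>2) = real b ^ Suc M * (real (Suc M) * (real b - 1))" .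
  moreover have "(\<Sum>s<b ^ Suc M. f (Suc M) s) = 0"
   unfolding 1 by (simp add: sum.distrib g1 sum_distrib_left[symmetric] Suc)
  ultimately show ?case by blast
 qed
 then show "(\<Sum>s<b ^ M. f M s) = 0" "(\<Sum>s<b ^ M. (f M s)\<^sup>2) = real b ^ M * (real M * (real b - 1))" by auto
qed

text \<open>Every digit has frequency at most (1 + 1/B)/b. The condition is one-sided and free of
  divisions, so that the program can test it on natural numbers.\<close>

definition good :: "nat => nat => nat => nat => bool" where
 "good b M B s \<longleftrightarrow> (\<forall>d<b. B * b * cnt b d M s <= (B + 1) * M)"

text \<open>Chebyshev's inequality for each digit, where a bad string has deviation B * (b * cnt -
  M) >= M, and a union bound over the b digits.\<close>

lemma card_bad_strings:
 assumes "0 < b" "0 < M"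
 shows "real (card {s. s < b ^ M \<and> \<not> good b M B s}) * real M <= real b ^ M * (real b)\<^sup>2 * (real B)\<^sup>2"
proof -
 define A where "A d = {s. s < b ^ M \<and> B * b * cnt b d M s > (B + 1) * M}" for d
 have "real (card (A d)) * (real M)\<^sup>2 <= (real B)\<^sup>2 * (real b ^ M * (real M * real b))" if d: "d < b" for d
 proof -
  have "real (card (A d)) * (real M)\<^sup>2 = (\<Sum>s\<in>A d. (real M)\<^sup>2)" by simp
  also have "... <= (\<Sum>s\<in>A d. (real B * (real b * real (cnt b d M s) - real M))\<^sup>2)"
  proof (rule sum_mono, rule power_mono)
   fix s assume "s \<in> A d"
   then have "(B + 1) * M < B * b * cnt b d M s" by (simp add: A_def)
   then have "real ((B + 1) * M) < real (B * b * cnt b d M s)" by (simp only: of_nat_less_iff)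
   then show "real M <= real B * (real b * real (cnt b d M s) - real M)" by (simp add: algebra_simps)
  qed simp
  also have "... <= (\<Sum>s<b ^ M. (real B * (real b * real (cnt b d M s) - real M))\<^sup>2)"
   by (rule sum_mono2) (auto simp: A_def)
  also have "... = (real B)\<^sup>2 * (real b ^ M * (real M * (real b - 1)))"
   using cnt_moments(2)[OF assms(1) d, of M] by (simp add: power_mult_distrib sum_distrib_left[symmetric])
  also have "... <= (real B)\<^sup>2 * (real b ^ M * (real M * real b))" by (intro mult_left_mono) auto
  finally show ?thesis .
 qed
 then have "real (card (A d)) * real M <= (real B)\<^sup>2 * (real b ^ M * real b)" if "d < b" for d
  using that assms(2) by (simp add: power2_eq_square mult.assoc)
 then have "(\<Sum>d<b. real (card (A d)) * real M) <= (\<Sum>d<b. (real B)\<^sup>2 * (real b ^ M * real b))" by (intro sum_mono) auto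
 moreover have "real (card {s. s < b ^ M \<and> \<not> good b M B s}) <= (\<Sum>d<b. real (card (A d)))"
 proof -
  have "{s. s < b ^ M \<and> \<not> good b M B s} \<subseteq> (\<Union>d<b. A d)" by (auto simp: good_def A_def not_le)
  then have "card {s. s < b ^ M \<and> \<not> good b M B s} <= card (\<Union>d<b. A d)"
   by (intro card_mono finite_UN_I) (auto simp: A_def)
  also have "... <= (\<Sum>d<b. card (A d))" by (rule card_UN_le) simp
  finally show ?thesis by (metis of_nat_le_iff of_nat_sum)
 qed
 then have "real (card {s. s < b ^ M \<and> \<not> good b M B s}) * real M <= (\<Sum>d<b. real (card (A d)) * real M)"
  by (simp add: sum_distrib_right[symmetric] mult_right_mono)
 ultimately show ?thesis by (simp add: power2_eq_square algebra_simps)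
qed

text \<open>The map from the choices y to the strings they produce has small fibres, so that few
 choices are bad.\<close>
lemma card_bad_choices:
 fixes b M B R C K Z :: nat
 assumes b: "2 <= b" "0 < M" and ZC: "Z < C" and K: "K <= C" "C <= 2 * b * K" and R: "b ^ M <= R"
 defines "s y \<equiv> b ^ M * (Z * R + K * y) div (C * R)"
 shows "real (card {y. y < R \<and> \<not> good b M B (s y + \<delta>)}) * real M <= 6 * (real b) ^ 3 * (real B)\<^sup>2 * real R"
proof -
 have pos: "0 < C" "0 < R" "0 < K" "0 < b ^ M" using assms b by (auto intro: gr0I)
 have fib: "real (card {y. y < R \<and> s y = v}) * real b ^ M <= 3 * real b * real R" for v
 proof -
  let ?Y = "{y. y < R \<and> s y = v}"
  show ?thesis
  proof (cases "?Y = {}")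
   case True then show ?thesis by (simp only: True) simp
  next
   case False
   define y0 where "y0 = Min ?Y"
   have fin: "finite ?Y" by simp
   have y0: "y0 \<in> ?Y" unfolding y0_def by (rule Min_in[OF fin False])
   \<comment> \<open>Changing y by more than \<open>L\<close> moves the numerator of
     \<open>s\<close> by at least C * R, because C <= 2 b K; so a fibre lies in an interval of
     length \<open>L\<close>.\<close>
   define L where "L = 2 * b * R div b ^ M"
   have "?Y \<subseteq> {y0..y0 + L}"
   proof
    fix y assume y: "y \<in> ?Y"
    have ge: "y0 <= y" unfolding y0_def using y fin by (intro Min_le)
    have "b ^ M * (Z * R + K * y) < (v + 1) * (C * R)"
     using y pos dividend_less_div_times[of "C * R" "b ^ M * (Z * R + K * y)"] by (auto simp: s_def algebra_simps)
    moreover have "v * (C * R) <= b ^ M * (Z * R + K * y0)"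
     using y0 div_times_less_eq_dividend[of "b ^ M * (Z * R + K * y0)" "C * R"] by (auto simp: s_def)
    ultimately have "b ^ M * (K * y) < C * R + b ^ M * (K * y0)" by (simp add: algebra_simps)
    then have "b ^ M * (K * (y - y0)) < C * R" using ge by (auto simp: le_iff_add algebra_simps)
    also have "... <= 2 * b * K * R" using K(2) by simp
    finally have "K * (b ^ M * (y - y0)) < K * (2 * b * R)" by (simp add: algebra_simps)
    then have "b ^ M * (y - y0) < 2 * b * R" by simp
    then have "y - y0 <= L" unfolding L_def using pos by (simp add: less_eq_div_iff_mult_less_eq mult.commute)
    then show "y \<in> {y0..y0 + L}" using ge by simp
   qed
   then have "card ?Y <= L + 1" using card_mono[of "{y0..y0 + L}" ?Y] by simp
   then have "card ?Y * b ^ M <= (L + 1) * b ^ M" by (rule mult_le_mono1)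
   also have "... <= 2 * b * R + b ^ M" unfolding L_def by (simp add: add_mult_distrib)
   also have "... <= 3 * b * R"
   proof -
    have "b ^ M <= R * b" using b by (intro order_trans[OF R]) simp
    then show ?thesis by simp
   qed
   finally have "real (card ?Y * b ^ M) <= real (3 * b * R)" by (simp only: of_nat_le_iff)
   then show ?thesis by simp
  qed
 qed
 have range: "s y < 2 * b ^ M" if "y < R" for y
 proof -
  have "Z * R + K * y < C * R + C * R" using ZC K that pos by (intro add_less_le_mono mult_less_mono1 mult_le_mono) auto
  then have "b ^ M * (Z * R + K * y) < b ^ M * (2 * (C * R))" using pos by simp
  then show ?thesis unfolding s_def using pos by (simp add: less_mult_imp_div_less algebra_simps)
 qed
 define Bad where "Bad = {v. v < 2 * b ^ M \<and> \<not> good b M B (v + \<delta>)}"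
 \<comment> \<open>\<open>s\<close> takes values in two periods of length b^M. Within one period the
   shift by \<open>\<delta>\<close> is injective modulo b^M, and goodness depends only on the
   residue by \<open>cnt_mod\<close>.\<close>
 have "card Bad <= 2 * card {v. v < b ^ M \<and> \<not> good b M B v}"
 proof -
  have gm: "good b M B v \<longleftrightarrow> good b M B (v mod b ^ M)" for v
   using cnt_mod[of b _ M v] b by (simp add: good_def)
  let ?G = "{v. v < b ^ M \<and> \<not> good b M B v}"
  have "inj_on (%v. (v div b ^ M, (v + \<delta>) mod b ^ M)) Bad"
  proof (rule inj_onI)
   fix v v' assume e: "(v div b ^ M, (v + \<delta>) mod b ^ M) = (v' div b ^ M, (v' + \<delta>) mod b ^ M)"
   then have "v mod b ^ M = v' mod b ^ M" by (auto simp: nat_mod_eq_iff)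
   then show "v = v'" using e by (metis Pair_inject div_mult_mod_eq)
  qed
  moreover have "(%v. (v div b ^ M, (v + \<delta>) mod b ^ M)) ` Bad \<subseteq> {0, 1} \<times> ?G"
  proof (rule image_subsetI)
   fix v assume v: "v \<in> Bad"
   then have "v div b ^ M < 2" by (auto simp: Bad_def less_mult_imp_div_less)
   moreover have "(v + \<delta>) mod b ^ M \<in> ?G" using v gm[of "v + \<delta>"] pos by (simp add: Bad_def)
   ultimately show "(v div b ^ M, (v + \<delta>) mod b ^ M) \<in> {0, 1} \<times> ?G" by (auto simp: less_2_cases_iff)
  qed
  ultimately have "card Bad <= card ({0::nat, 1} \<times> ?G)" by (intro card_inj_on_le) auto
  then show ?thesis by (simp add: card_cartesian_product)
 qed
 then have Bd: "real (card Bad) <= 2 * real (card {v. v < b ^ M \<and> \<not> good b M B v})" by linarith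
 have "{y. y < R \<and> \<not> good b M B (s y + \<delta>)} \<subseteq> (\<Union>v\<in>Bad. {y. y < R \<and> s y = v})"
  using range by (auto simp: Bad_def)
 then have "card {y. y < R \<and> \<not> good b M B (s y + \<delta>)} <= card (\<Union>v\<in>Bad. {y. y < R \<and> s y = v})"
  by (intro card_mono finite_UN_I) (auto simp: Bad_def)
 also have "... <= (\<Sum>v\<in>Bad. card {y. y < R \<and> s y = v})" by (rule card_UN_le) (simp add: Bad_def)
 finally have "real (card {y. y < R \<and> \<not> good b M B (s y + \<delta>)}) <= real (\<Sum>v\<in>Bad. card {y. y < R \<and> s y = v})"
  by (simp only: of_nat_le_iff)
 then have "real (card {y. y < R \<and> \<not> good b M B (s y + \<delta>)}) <= (\<Sum>v\<in>Bad. real (card {y. y < R \<and> s y = v}))"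
  by (simp only: of_nat_sum)
 then have "real (card {y. y < R \<and> \<not> good b M B (s y + \<delta>)}) * real b ^ M <= (\<Sum>v\<in>Bad. real (card {y. y < R \<and> s y = v}) * real b ^ M)"
  by (simp add: sum_distrib_right[symmetric] mult_right_mono)
 also have "... <= (\<Sum>v\<in>Bad. 3 * real b * real R)" by (rule sum_mono[OF fib])
 also have "... = real (card Bad) * (3 * real b * real R)" by simp
 also have "... <= 2 * real (card {v. v < b ^ M \<and> \<not> good b M B v}) * (3 * real b * real R)" by (rule mult_right_mono[OF Bd]) simp
 finally have fi: "real (card {y. y < R \<and> \<not> good b M B (s y + \<delta>)}) * real b ^ M <= 2 * real (card {v. v < b ^ M \<and> \<not> good b M B v}) * (3 * real b * real R)" .
 have "real (card {y. y < R \<and> \<not> good b M B (s y + \<delta>)}) * real b ^ M * real M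
  <= 6 * real b * real R * (real (card {v. v < b ^ M \<and> \<not> good b M B v}) * real M)"
  using mult_right_mono[OF fi, of "real M"] by (simp add: algebra_simps)
 also have "... <= 6 * real b * real R * (real b ^ M * (real b)\<^sup>2 * (real B)\<^sup>2)"
  using card_bad_strings[of b M B] b by (intro mult_left_mono) auto
 finally have "real b ^ M * (real (card {y. y < R \<and> \<not> good b M B (s y + \<delta>)}) * real M) <= real b ^ M * (6 * (real b) ^ 3 * (real B)\<^sup>2 * real R)"
  by (simp add: algebra_simps power2_eq_square power3_eq_cube)
 then show ?thesis using b by simp
qed

section \<open>Simple normality in all bases implies absolute normality\<close>

text \<open>The deviations from 1/M sum to 0, so a one-sided bound on all of them bounds each from
  the other side as well. The sign \<open>\<sigma>\<close> selects which side is given: upper bounds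
  for the constructed number, lower bounds for words.\<close>

lemma frequencies_tend_to:
 fixes f :: "nat => nat => real"
 assumes M: "0 < M" and sum: "\<And>N. 0 < N ==> (\<Sum>W<M. f W N) = 1"
  and bd: "\<And>W \<epsilon>. W < M ==> 0 < \<epsilon> ==> \<forall>\<^sub>F N in sequentially. \<sigma> * (f W N - 1 / M) <= \<epsilon>"
  and s: "\<sigma> = 1 \<or> \<sigma> = -1" and W: "W < M"
 shows "f W \<longlonglongrightarrow> 1 / M"
proof (rule tendstoI)
 fix \<epsilon> :: real assume e: "0 < \<epsilon>"
 define \<eta> where "\<eta> = \<epsilon> / (2 * M)"
 have eta: "0 < \<eta>" "real M * \<eta> < \<epsilon>" using e M by (auto simp: \<eta>_def)
 have "\<forall>\<^sub>F N in sequentially. \<forall>V\<in>{..<M}. \<sigma> * (f V N - 1 / M) <= \<eta>"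
  using bd eta(1) by (intro eventually_ball_finite) auto
 then show "\<forall>\<^sub>F N in sequentially. dist (f W N) (1 / M) < \<epsilon>"
  using eventually_gt_at_top[of 0]
 proof eventually_elim
  case (elim N)
  have "(\<Sum>V<M. \<sigma> * (f V N - 1 / M)) = 0"
   using sum[OF elim(2)] M by (simp add: sum_distrib_left[symmetric] sum_subtractf)
  moreover have "(\<Sum>V<M. \<sigma> * (f V N - 1 / M)) = \<sigma> * (f W N - 1 / M) + (\<Sum>V\<in>{..<M} - {W}. \<sigma> * (f V N - 1 / M))"
   using W by (subst sum.remove[of _ W]) auto
  moreover have "(\<Sum>V\<in>{..<M} - {W}. \<sigma> * (f V N - 1 / M)) <= real (card ({..<M} - {W})) * \<eta>"
   by (rule sum_bounded_above) (use elim in auto)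
  moreover have "real (card ({..<M} - {W})) * \<eta> <= real M * \<eta>"
   using eta by (intro mult_right_mono) (auto intro: order_trans[OF card_Diff1_le])
  moreover have "\<sigma> * (f W N - 1 / M) <= \<eta>" using elim W by auto
  moreover have "\<eta> <= real M * \<eta>" using eta M by simp
  ultimately have "\<bar>\<sigma> * (f W N - 1 / M)\<bar> < \<epsilon>" using eta(2) by linarith
  then show ?case using s by (auto simp: dist_real_def)
 qed
qed

definition wordval :: "nat => nat list => nat" where
 "wordval b w = foldl (%a d. a * b + d) 0 w"

lemma wordval_snoc: "wordval b (w @ [d]) = wordval b w * b + d"
 by (simp add: wordval_def)

lemma wordval_less: "0 < b ==> \<forall>d\<in>set w. d < b ==> wordval b w < b ^ length w"
proof (induction w rule: rev_induct)
 case (snoc d w)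
 then have "wordval b w + 1 <= b ^ length w" by auto
 then have "(wordval b w + 1) * b <= b ^ length w * b" by (rule mult_le_mono1)
 then show ?case using snoc.prems by (simp add: wordval_snoc mult.commute)
qed (simp add: wordval_def)

lemma floor_scale:
 fixes x :: real and b :: nat
 assumes "0 < b"
 shows "\<lfloor>x * real b ^ n\<rfloor> = \<lfloor>x * real b ^ (n + s)\<rfloor> div int (b ^ s)"
proof -
 have "x * real b ^ n = x * real b ^ (n + s) / real_of_int (int (b ^ s))" using assms by (simp add: power_add)
 then show ?thesis using floor_divide_real_eq_div[of "int (b ^ s)" "x * real b ^ (n + s)"] by simp
qed

lemma word_at_iff:
 assumes b: "0 < b" and w: "\<forall>d\<in>set w. d < b"
 shows "(\<forall>j<length w. digit b x (p + j) = w ! j) \<longleftrightarrow> \<lfloor>x * real b ^ (p + length w)\<rfloor> mod int (b ^ length w) = int (wordval b w)"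
 using w
proof (induction w rule: rev_induct)
 case Nil
 then show ?case by (simp add: wordval_def)
next
 case (snoc d w)
 let ?L = "length w"
 define Q where "Q = \<lfloor>x * real b ^ (p + ?L + 1)\<rfloor>"
 have q: "\<lfloor>x * real b ^ (p + ?L)\<rfloor> = Q div int b"
  using floor_scale[OF b, of x "p + ?L" 1] by (simp add: Q_def)
 have dg: "digit b x (p + ?L) = nat (Q mod int b)" by (simp add: digit_def Q_def)
 have m: "Q mod int (b ^ (?L + 1)) = (Q div int b mod int (b ^ ?L)) * int b + Q mod int b"
  using b by (simp add: zmod_zmult2_eq mult.commute)
 have "(\<forall>j<length (w @ [d]). digit b x (p + j) = (w @ [d]) ! j) \<longleftrightarrow>
  (\<forall>j<?L. digit b x (p + j) = w ! j) \<and> digit b x (p + ?L) = d"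
  by (auto simp: nth_append less_Suc_eq)
 also have "... \<longleftrightarrow> Q div int b mod int (b ^ ?L) = int (wordval b w) \<and> Q mod int b = int d"
  using snoc b by (simp add: q dg nat_eq_iff)
 also have "... \<longleftrightarrow> (Q div int b mod int (b ^ ?L)) * int b + Q mod int b = int (wordval b w) * int b + int d"
 proof
  assume e: "(Q div int b mod int (b ^ ?L)) * int b + Q mod int b = int (wordval b w) * int b + int d"
  have "d < b" using snoc.prems by simp
  have "Q mod int b = ((Q div int b mod int (b ^ ?L)) * int b + Q mod int b) mod int b" by simp
  also have "... = int d" unfolding e using \<open>d < b\<close> by (simp add: zmod_int[symmetric])
  finally have "Q mod int b = int d" .
  then show "Q div int b mod int (b ^ ?L) = int (wordval b w) \<and> Q mod int b = int d" using e b by simp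
 qed simp
 also have "... \<longleftrightarrow> Q mod int (b ^ length (w @ [d])) = int (wordval b (w @ [d]))"
  using m by (simp add: wordval_snoc)
 finally show ?case by (simp add: Q_def add.assoc)
qed

definition block_occ :: "nat => real => nat => nat => nat => nat" where
 "block_occ b x L W N = card {p. p < N \<and> \<lfloor>x * real b ^ (p + L)\<rfloor> mod int (b ^ L) = int W}"

lemma sum_block_occ: "0 < b ==> (\<Sum>W<b ^ L. block_occ b x L W N) = N"
proof -
 assume b: "0 < b"
 let ?g = "%p. nat (\<lfloor>x * real b ^ (p + L)\<rfloor> mod int (b ^ L))"
 have g: "?g p < b ^ L" for p using b by (simp add: nat_less_iff)
 have "block_occ b x L W N = card {p \<in> {..<N}. ?g p = W}" for W
  unfolding block_occ_def using b by (intro arg_cong[where f = card]) (auto simp: nat_eq_iff)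
 then have "(\<Sum>W<b ^ L. block_occ b x L W N) = (\<Sum>W<b ^ L. \<Sum>p\<in>{p \<in> {..<N}. ?g p = W}. 1)" by simp
 also have "... = (\<Sum>p<N. 1)" by (rule sum.group) (use g in auto)
 finally show ?thesis by simp
qed

text \<open>The t digits above and the s digits below the prescribed ones are free.\<close>

lemma card_block_strings:
 fixes b t L s W :: nat
 assumes b: "0 < b" and W: "W < b ^ L"
 shows "card {u. u < b ^ (t + L + s) \<and> u div b ^ s mod b ^ L = W} = b ^ t * b ^ s"
proof -
 have "bij_betw (%(h, l). (h * b ^ L + W) * b ^ s + l) ({..<b ^ t} \<times> {..<b ^ s}) {u. u < b ^ (t + L + s) \<and> u div b ^ s mod b ^ L = W}"
 proof (rule bij_betw_byWitness[where f' = "%u. (u div b ^ s div b ^ L, u mod b ^ s)"])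
  show "\<forall>a\<in>{..<b ^ t} \<times> {..<b ^ s}. (%u. (u div b ^ s div b ^ L, u mod b ^ s)) ((%(h, l). (h * b ^ L + W) * b ^ s + l) a) = a"
   using W b by auto
  show "\<forall>u\<in>{u. u < b ^ (t + L + s) \<and> u div b ^ s mod b ^ L = W}. (%(h, l). (h * b ^ L + W) * b ^ s + l) ((%u. (u div b ^ s div b ^ L, u mod b ^ s)) u) = u"
   by (auto simp: div_mult_mod_eq)
  show "(%(h, l). (h * b ^ L + W) * b ^ s + l) ` ({..<b ^ t} \<times> {..<b ^ s}) \<subseteq> {u. u < b ^ (t + L + s) \<and> u div b ^ s mod b ^ L = W}"
  proof
   fix u assume "u \<in> (%(h, l). (h * b ^ L + W) * b ^ s + l) ` ({..<b ^ t} \<times> {..<b ^ s})"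
   then obtain h l where h: "h < b ^ t" and l: "l < b ^ s" and u: "u = (h * b ^ L + W) * b ^ s + l" by auto
   have "(h + 1) * b ^ L <= b ^ t * b ^ L" using h by (intro mult_le_mono1) simp
   then have "h * b ^ L + W + 1 <= b ^ t * b ^ L" using W by simp
   then have "(h * b ^ L + W + 1) * b ^ s <= b ^ t * b ^ L * b ^ s" by (rule mult_le_mono1)
   then have "u < b ^ (t + L + s)" using l by (simp add: u power_add add_mult_distrib)
   moreover have "u div b ^ s = h * b ^ L + W" using l b by (simp add: u)
   ultimately show "u \<in> {u. u < b ^ (t + L + s) \<and> u div b ^ s mod b ^ L = W}" using W by simp
  qed
  show "(%u. (u div b ^ s div b ^ L, u mod b ^ s)) ` {u. u < b ^ (t + L + s) \<and> u div b ^ s mod b ^ L = W} \<subseteq> {..<b ^ t} \<times> {..<b ^ s}"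
   using b by (auto simp: power_add less_mult_imp_div_less algebra_simps)
 qed
 from bij_betw_same_card[OF this] show ?thesis by (simp add: card_cartesian_product)
qed

text \<open>An occurrence of a word inside an aligned block of length r is visible in the digit in base
 b^r; only the fraction (L - 1)/r of the positions is lost.\<close>
theorem absolutely_normal_if_simply_normal:
 assumes sn: "\<And>b d. 2 <= b ==> d < b ==> (%N. real (card {i. i < N \<and> digit b x i = d}) / real N) \<longlonglongrightarrow> 1 / real b"
 shows "absolutely_normal x"
 unfolding absolutely_normal_def normal_in_base_def
proof (intro allI impI)
 fix b :: nat and w :: "nat list"
 assume b: "2 <= b" and w: "w \<noteq> [] \<and> (\<forall>d\<in>set w. d < b)"
 define L where "L = length w"
 have L: "0 < L" using w by (simp add: L_def)
 have b0: "0 < b" using b by simp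
 \<comment> \<open>Occurrences inside aligned blocks give only a lower bound for the frequency of
   each word; \<open>frequencies_tend_to\<close> with sign -1 turns these into limits.\<close>
 have lower: "\<forall>\<^sub>F N in sequentially. - 1 * (real (block_occ b x L W N) / real N - 1 / real (b ^ L)) <= \<epsilon>"
  if W: "W < b ^ L" and e: "0 < \<epsilon>" for W \<epsilon>
 proof -
  \<comment> \<open>The block length r is chosen so large that the lost fraction L/r is at most
    \<open>\<epsilon>\<close>.\<close>
  obtain q :: nat where q: "real L / \<epsilon> < real q" using reals_Archimedean2 by blast
  define r where "r = q + L + 1"
  have r: "L <= r" "0 < r" by (auto simp: r_def)
  have rL: "real L / real r <= \<epsilon> / 2 + \<epsilon> / 2"
  proof -
   have "real L < \<epsilon> * real q" using q e by (simp add: divide_less_eq mult.commute)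
   also have "... <= \<epsilon> * real r" using e by (intro mult_left_mono) (auto simp: r_def)
   finally show ?thesis using r by (simp add: divide_le_eq)
  qed
  define B where "B = b ^ r"
  have B: "2 <= B" unfolding B_def using b r power_increasing[of 1 r b] by simp
  \<comment> \<open>\<open>m u\<close> counts how often the word occurs inside the base-b^r digit
    \<open>u\<close>; its average over all \<open>u\<close> is known exactly from
    \<open>card_block_strings\<close>.\<close>
  define m where "m u = card {t. t + L <= r \<and> u div b ^ (r - t - L) mod b ^ L = W}" for u
  have summ: "(\<Sum>u<B. real (m u)) = real (r - L + 1) * real (b ^ (r - L))"
  proof -
   have "(\<Sum>u<B. m u) = (\<Sum>u<B. \<Sum>t\<le>r - L. if u div b ^ (r - t - L) mod b ^ L = W then 1 else 0)"
   proof (rule sum.cong[OF refl])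
    fix u
    have "{t. t + L <= r \<and> u div b ^ (r - t - L) mod b ^ L = W} = {t \<in> {..r - L}. u div b ^ (r - t - L) mod b ^ L = W}" using r by auto
    then show "m u = (\<Sum>t\<le>r - L. if u div b ^ (r - t - L) mod b ^ L = W then 1 else 0)"
     unfolding m_def by (simp add: sum.If_cases Int_def)
   qed
   also have "... = (\<Sum>t\<le>r - L. \<Sum>u<B. if u div b ^ (r - t - L) mod b ^ L = W then 1 else 0)" by (rule sum.swap)
   also have "... = (\<Sum>t\<le>r - L. b ^ (r - L))"
   proof (rule sum.cong[OF refl])
    fix t assume "t \<in> {..r - L}"
    then have t: "t + L + (r - t - L) = r" using r by simp
    have "(\<Sum>u<B. if u div b ^ (r - t - L) mod b ^ L = W then 1 else 0) = card {u. u < B \<and> u div b ^ (r - t - L) mod b ^ L = W}"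
     by (simp add: sum.If_cases Int_def)
    also have "... = b ^ t * b ^ (r - t - L)" using card_block_strings[OF b0 W, of t "r - t - L"] t by (simp add: B_def)
    also have "... = b ^ (r - L)" using t by (simp add: power_add[symmetric])
    finally show "(\<Sum>u<B. if u div b ^ (r - t - L) mod b ^ L = W then 1 else 0) = b ^ (r - L)" .
   qed
   finally have "(\<Sum>u<B. m u) = (r - L + 1) * b ^ (r - L)" by simp
   then show ?thesis by (metis of_nat_mult of_nat_sum)
  qed
  have occ: "(\<Sum>u<B. m u * card {i. i < n \<and> digit B x i = u}) <= block_occ b x L W N" if nN: "n * r <= N" for n N
  proof -
   let ?S = "SIGMA i:{..<n}. {t. t + L <= r \<and> digit B x i div b ^ (r - t - L) mod b ^ L = W}"
   have dB: "digit B x i < B" for i unfolding digit_def using B by (simp add: nat_less_iff)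
   have fin: "finite {t. t + L <= r \<and> u div b ^ (r - t - L) mod b ^ L = W}" for u
    by (rule finite_subset[of _ "{..r}"]) auto
   have "(\<Sum>u<B. m u * card {i. i < n \<and> digit B x i = u}) = (\<Sum>u<B. \<Sum>i\<in>{i \<in> {..<n}. digit B x i = u}. m (digit B x i))"
    by (intro sum.cong) (auto simp: mult.commute)
   also have "... = (\<Sum>i<n. m (digit B x i))" by (rule sum.group) (use dB in auto)
   also have "... = card ?S" unfolding m_def using fin by (subst card_SigmaI) auto
   also have "... <= block_occ b x L W N"
    unfolding block_occ_def
   proof (rule card_inj_on_le[where f = "%(i, t). i * r + t"])
    show "inj_on (%(i, t). i * r + t) ?S"
    proof (rule inj_onI, clarsimp)
     fix i t i' t' assume "t + L <= r" "t' + L <= r" and e: "i * r + t = i' * r + t'"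
     then have "t < r" "t' < r" using L by auto
     then have "i = (i * r + t) div r" "i' = (i' * r + t') div r" by auto
     then have "i = i'" using e by simp
     then show "i = i' \<and> t = t'" using e by simp
    qed
    show "(%(i, t). i * r + t) ` ?S \<subseteq> {p. p < N \<and> \<lfloor>x * real b ^ (p + L)\<rfloor> mod int (b ^ L) = int W}"
    proof
     fix v assume "v \<in> (%(i, t). i * r + t) ` ?S"
     then obtain i t where i: "i < n" and t: "t + L <= r" and u: "digit B x i div b ^ (r - t - L) mod b ^ L = W"
      and v: "v = i * r + t" by auto
     define Q where "Q = \<lfloor>x * real B ^ (i + 1)\<rfloor>"
     define s where "s = r - t - L"
     have rr: "r = t + L + s" using t by (simp add: s_def)
     have "real B ^ (i + 1) = real b ^ (r * (i + 1))" by (simp only: B_def of_nat_power power_mult)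
     also have "r * (i + 1) = i * r + t + L + s" using rr by (simp add: algebra_simps)
     finally have "real B ^ (i + 1) = real b ^ (i * r + t + L + s)" .
     then have f: "\<lfloor>x * real b ^ (i * r + t + L)\<rfloor> = Q div int (b ^ s)"
      using floor_scale[OF b0, of x "i * r + t + L" s] by (simp add: Q_def)
     have "int (digit B x i) = Q mod int B" unfolding digit_def Q_def using B by simp
     then have "int W = Q mod int B div int (b ^ s) mod int (b ^ L)"
      using u unfolding s_def[symmetric] by (metis zdiv_int zmod_int)
     also have "Q mod int B = Q mod (int (b ^ s) * int (b ^ (t + L)))"
      by (simp add: B_def rr power_add algebra_simps)
     also have "... div int (b ^ s) = Q div int (b ^ s) mod int (b ^ (t + L))"
      using b0 by (simp add: zmod_zmult2_eq)
     also have "... mod int (b ^ L) = Q div int (b ^ s) mod int (b ^ L)"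
      by (rule mod_mod_cancel) (simp add: power_add)
     finally have "Q div int (b ^ s) mod int (b ^ L) = int W" by simp
     moreover have "i * r + t < N"
     proof -
      have "i * r + t < (i + 1) * r" using t L by simp
      also have "... <= n * r" using i by (intro mult_le_mono1) simp
      finally show ?thesis using nN by simp
     qed
     ultimately show "v \<in> {p. p < N \<and> \<lfloor>x * real b ^ (p + L)\<rfloor> mod int (b ^ L) = int W}" using f by (simp add: v)
    qed
   qed simp
   finally show ?thesis .
  qed
  have lim: "(%n. \<Sum>u<B. real (m u) * (real (card {i. i < n \<and> digit B x i = u}) / real n)) \<longlonglongrightarrow> (\<Sum>u<B. real (m u) * (1 / real B))"
   by (intro tendsto_sum tendsto_mult tendsto_const sn B) auto
  have val: "(\<Sum>u<B. real (m u) * (1 / real B)) = real (r - L + 1) / real (b ^ L)"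
  proof -
   have "(\<Sum>u<B. real (m u) * (1 / real B)) = (\<Sum>u<B. real (m u)) / real B" by (simp add: sum_divide_distrib)
   also have "... = real (r - L + 1) * real (b ^ (r - L)) / real (b ^ (L + (r - L)))" using r summ by (simp add: B_def)
   also have "... = real (r - L + 1) / real (b ^ L)" using b0 by (simp add: power_add)
   finally show ?thesis .
  qed
  define G where "G n = (\<Sum>u<B. real (m u) * (real (card {i. i < n \<and> digit B x i = u}) / real n))" for n
  have "filterlim (%N. N div r) at_top sequentially"
   unfolding filterlim_at_top
  proof
   fix Z show "\<forall>\<^sub>F N in sequentially. Z <= N div r"
    using eventually_ge_at_top[of "Z * r"] by eventually_elim (use r in \<open>simp add: less_eq_div_iff_mult_less_eq\<close>)
  qed
  then have lim2: "(%N. G (N div r)) \<longlonglongrightarrow> real (r - L + 1) / real (b ^ L)"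
   using filterlim_compose[OF lim[folded G_def], of "%N. N div r" sequentially] val by simp
  have lim3: "(%N. real (N div r) / real N) \<longlonglongrightarrow> 1 / real r"
  proof (rule real_tendsto_sandwich)
   show "\<forall>\<^sub>F N in sequentially. 1 / real r - 1 / real N <= real (N div r) / real N"
    using eventually_gt_at_top[of 0]
   proof eventually_elim
    case (elim N)
    have "N < (N div r + 1) * r" using r dividend_less_div_times[of r N] by simp
    then have "real N <= (real (N div r) + 1) * real r" by (metis of_nat_1 of_nat_add of_nat_le_iff of_nat_mult less_imp_le)
    then have "real N / real r <= real (N div r) + 1" using r by (simp add: divide_le_eq)
    then have "(real N / real r - 1) / real N <= real (N div r) / real N" by (intro divide_right_mono) auto
    then show ?case using elim by (simp add: diff_divide_distrib)
   qed
   show "\<forall>\<^sub>F N in sequentially. real (N div r) / real N <= 1 / real r"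
    using eventually_gt_at_top[of 0]
   proof eventually_elim
    case (elim N)
    have "real (N div r) * real r <= real N" by (metis div_times_less_eq_dividend of_nat_le_iff of_nat_mult)
    then show ?case using elim r by (simp add: field_simps)
   qed
   show "(%N. 1 / real r - 1 / real N) \<longlonglongrightarrow> 1 / real r"
    using tendsto_diff[OF tendsto_const lim_1_over_n, of "1 / real r"] by simp
  qed simp
  have lim4: "(%N. G (N div r) * (real (N div r) / real N)) \<longlonglongrightarrow> real (r - L + 1) / real (b ^ L) * (1 / real r)"
   by (rule tendsto_mult[OF lim2 lim3])
  have le: "1 / real (b ^ L) - \<epsilon> < real (r - L + 1) / real (b ^ L) * (1 / real r)"
  proof -
   have "real (r - L + 1) = real r - real L + 1" using r by (simp add: of_nat_diff)
   then have "real (r - L + 1) * (1 / real r) > 1 - real L / real r" using r by (simp add: field_simps)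
   then have "real (r - L + 1) * (1 / real r) > 1 - \<epsilon>" using rL by simp
   moreover have "(1 - \<epsilon>) / real (b ^ L) \<ge> 1 / real (b ^ L) - \<epsilon>"
   proof -
    have "1 <= real (b ^ L)" using b0 by (metis of_nat_1 of_nat_le_iff one_le_power Suc_leI One_nat_def)
    then have "\<epsilon> / real (b ^ L) <= \<epsilon>" using e by (simp add: divide_le_eq)
    then show ?thesis by (simp add: diff_divide_distrib)
   qed
   moreover have "(1 - \<epsilon>) / real (b ^ L) < real (r - L + 1) * (1 / real r) / real (b ^ L)"
    using calculation(1) b0 by (intro divide_strict_right_mono) auto
   ultimately show ?thesis by (simp add: mult.commute)
  qed
  from order_tendstoD(1)[OF lim4 le] eventually_gt_at_top[of r] show ?thesis
  proof eventually_elim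
   case (elim N)
   have n: "0 < N div r" using elim r by (simp add: div_greater_zero_iff)
   have "G (N div r) * real (N div r) = real (\<Sum>u<B. m u * card {i. i < N div r \<and> digit B x i = u})"
    using n unfolding G_def sum_distrib_right by (simp add: of_nat_sum)
   also have "... <= real (block_occ b x L W N)" using occ[of "N div r" N] by (simp only: of_nat_le_iff) simp
   finally have "G (N div r) * (real (N div r) / real N) <= real (block_occ b x L W N) / real N"
    by (simp add: divide_right_mono)
   then show ?case using elim by simp
  qed
 qed
 have "(%N. real (block_occ b x L (wordval b w) N) / real N) \<longlonglongrightarrow> 1 / real (b ^ L)"
 proof (rule frequencies_tend_to[where \<sigma> = "-1" and M = "b ^ L"])
  show "(\<Sum>W<b ^ L. real (block_occ b x L W N) / real N) = 1" if "0 < N" for N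
   using sum_block_occ[OF b0, of x L N] that by (metis of_nat_sum sum_divide_distrib divide_self of_nat_0_less_iff less_irrefl)
  show "wordval b w < b ^ L" using wordval_less[OF b0] w by (simp add: L_def)
 qed (use b0 lower in auto)
 moreover have "occ b x w N = block_occ b x L (wordval b w) N" for N
  unfolding occ_def block_occ_def L_def using word_at_iff[OF b0] w by simp
 ultimately show "(%N. real (occ b x w N) / real N) \<longlonglongrightarrow> 1 / real b ^ length w" by (simp add: L_def)
qed

section \<open>The algorithm and its correctness\<close>

function mlog :: "nat => nat => nat" where
 "mlog b X = (if b < 2 \<or> X < b then 0 else Suc (mlog b (X div b)))"
 by pat_completeness auto
termination by (relation "measure snd") auto

declare mlog.simps [simp del]

lemma mlog_bounds: "2 <= b ==> 0 < X ==> b ^ mlog b X <= X \<and> X < b ^ Suc (mlog b X)"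
proof (induction b X rule: mlog.induct)
 case (1 b X)
 show ?case
 proof (cases "X < b")
  case True
  then show ?thesis using 1 by (simp add: mlog.simps[of b X])
 next
  case False
  then have "0 < X div b" using 1 by (simp add: div_greater_zero_iff)
  then have IH: "b ^ mlog b (X div b) <= X div b \<and> X div b < b ^ Suc (mlog b (X div b))" using 1 False by auto
  have e: "mlog b X = Suc (mlog b (X div b))" using 1 False by (simp add: mlog.simps[of b X])
  have "b * b ^ mlog b (X div b) <= b * (X div b)" using IH by simp
  also have "... <= X" by simp
  finally have l: "b ^ mlog b X <= X" by (simp add: e)
  have "X < b * (X div b + 1)" using 1 dividend_less_times_div[of b X] by simp
  also have "... <= b * b ^ Suc (mlog b (X div b))" using IH by (intro mult_le_mono2) simp
  finally show ?thesis using l e by simp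
 qed
qed

text \<open>The summand 3 makes 2^j more than 4 and at most 8 times \<open>mlog 2 k\<close>. The
  same j serves three purposes: blocks have 2^j bits, the bases are 2 to j + 1, and the tolerance is
  1/j.\<close>

definition stages_depth :: "nat => nat" where
 "stages_depth k = mlog 2 (mlog 2 k) + 3"

text \<open>With R = 2^l for a block of l bits, Z/R^2 is the fractional part and K/R^2 the slope of
  the state, and y/R is the block read as a fraction; so \<open>s\<close> is the string of the next
  M digits. \<open>Suc s\<close> is tested too because truncation leaves the last place uncertain by
  one, and \<open>R div 4\<close> keeps b^M small enough for that.\<close>

definition ok1 :: "nat => nat => nat => nat => nat \<times> nat => bool" where
 "ok1 R B y b v = (let M = mlog b (R div 4); s = b ^ M * (fst v * R + snd v * y) div (R * R * R)
  in good b M B s \<and> good b M B (Suc s))"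

primrec okall :: "nat => nat => nat => nat => (nat \<times> nat) list => bool" where
 "okall R B y b [] = True"
| "okall R B y b (v # vs) = (ok1 R B y b v \<and> okall R B y (Suc b) vs)"

text \<open>If no candidate passes, the answer is 0. The correctness argument uses only stages with
  j >= 100, where \<open>leaf_exists\<close> supplies a candidate.\<close>

primrec srch :: "nat => nat => (nat \<times> nat) list => nat => nat" where
 "srch R B vs 0 = 0"
| "srch R B vs (Suc y) = (if okall R B y 2 vs then y else srch R B vs y)"

primrec nbits :: "nat => nat => bool list" where
 "nbits 0 y = []"
| "nbits (Suc l) y = (y mod 2 = 1) # nbits l (y div 2)"

definition leaf :: "nat => (bool list \<times> bool list) list => bool list" where
 "leaf lam sts = nbits lam (srch (2 ^ lam) (length sts) (map (%w. (val (fst w), val (snd w))) sts) (2 ^ lam))"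

type_synonym entry = "bool list \<times> bool list \<times> bool list"

definition zero :: "bool list => bool" where "zero xs \<longleftrightarrow> True \<notin> set xs"

text \<open>From the largest power T of b below 2^h to the largest one below 2^(2h): it is T^2 or b
  * T^2. The entry also keeps b times the power, which the right halves need.\<close>

definition nxt :: "nat => nat => entry => entry" where
 "nxt j h e = (let bb = fst e; Q = mulb j (fst (snd e)) (fst (snd e)); Qb = nmul bb Q;
  T = (if zero (drop (2 * h) Qb) then take (2 * h) Qb else Q) in (bb, T, nmul bb T))"

primrec tower :: "bool list list => nat => (nat \<times> nat \<times> entry list) list" where
 "tower bbs 0 = [(0, 1, map (%bb. (bb, [True], bb)) bbs)]"
| "tower bbs (Suc j) = (let t = tower bbs j; h = fst (snd (hd t)) in
  (Suc j, 2 * h, map (nxt j h) (snd (snd (hd t)))) # t)"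

definition lft :: "nat => bool list \<times> bool list => bool list \<times> bool list" where
 "lft h w = (drop (2 * h) (fst w), drop (2 * h) (snd w))"

text \<open>Let H = 2^h. Appending the h bits y moves the fractional part to (Z H + K y)/H^5, and
  multiplying by a power T' of b near H moves the digit point past the digits now fixed. The flag
  \<open>c\<close> selects b * T if the new slope stays below 1, otherwise T. Dropping 3h bits
  rescales to a precision of 2h bits; keeping only the low 2h bits discards the integer
  part.\<close>

definition rgt :: "nat => nat => bool list => entry \<times> bool list \<times> bool list => bool list \<times> bool list" where
 "rgt j h y q = (let T = fst (snd (fst q)); Tb = snd (snd (fst q)); Z = fst (snd q); K = snd (snd q);
  KB = mulb (j + 2) K Tb; c = zero (drop (5 * h) KB);
  KT = (if c then KB else mulb (j + 2) K T); T' = (if c then Tb else T);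
  X = take (8 * h) (addb False (replicate h False @ Z) (mulb (j + 2) K y))
  in (take (2 * h) (drop (3 * h) (mulb (j + 3) X T')), take (2 * h) (drop (3 * h) KT)))"

text \<open>Bit lists start with the least significant bit, so the right half, although chosen
  second, stands in front.\<close>

primrec solve :: "nat => (nat \<times> nat \<times> entry list) list => (bool list \<times> bool list) list => bool list" where
 "solve lam [] sts = leaf lam sts"
| "solve lam (e # tab) sts = (let h = fst (snd e);
  y1 = solve lam tab (map (lft h) sts);
  y2 = solve lam tab (map (rgt (fst e) h y1) (zip (snd (snd e)) sts)) in y2 @ y1)"

primrec bases :: "nat => bool list => bool list list" where
 "bases 0 bb = []"
| "bases (Suc n) bb = bb # bases n (addb False bb [True])"

definition start :: "nat => nat => bool list => entry => bool list \<times> bool list" where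
 "start k n P e = (replicate n False @ take n (mulb k (fst (snd e)) P), replicate n False @ fst (snd e))"

text \<open>The top level k of the table provides the powers for the root. Of the rest,
  \<open>take (k - j)\<close> keeps the levels k - 1 down to j, so the tree has 2^(k-j) leaves of
  2^j bits each.\<close>

definition stage :: "nat => bool list => bool list" where
 "stage k P = (let j = stages_depth k; t = tower (bases j [False, True]) k in
  solve (2 ^ j) (take (k - j) (tl t)) (map (start k (fst (snd (hd t))) P) (snd (snd (hd t)))))"

text \<open>Stage k extends 2^k bits; beginning with 16 bits means k >= 4, as
  \<open>depth_le\<close> requires. The leading zeros also keep the number below 1.\<close>

primrec prefix_bits :: "nat => bool list" where
 "prefix_bits 0 = replicate 16 False"
| "prefix_bits (Suc t) = stage (t + 4) (prefix_bits t) @ prefix_bits t"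

section \<open>Existence of a good block\<close>

lemma zero_val: "zero xs \<longleftrightarrow> val xs = 0"
 unfolding zero_def by (induction xs) auto

lemma zero_drop: "zero (drop n xs) \<longleftrightarrow> val xs < 2 ^ n"
 by (simp add: zero_val val_drop div_eq_0_iff)

lemma nbits: "length (nbits l y) = l" "val (nbits l y) = y mod 2 ^ l"
proof -
 show "length (nbits l y) = l" by (induction l arbitrary: y) auto
 show "val (nbits l y) = y mod 2 ^ l"
 proof (induction l arbitrary: y)
  case (Suc l)
  have "y mod 2 ^ Suc l = y mod 2 + 2 * (y div 2 mod 2 ^ l)" by (simp add: mod_mult2_eq)
  moreover have "of_bool (y mod 2 = 1) = y mod 2" by (simp add: of_bool_def)
  ultimately show ?case using Suc by simp
 qed simp
qed

lemma okall_iff: "okall R B y b vs \<longleftrightarrow> (\<forall>i<length vs. ok1 R B y (b + i) (vs ! i))"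
proof (induction vs arbitrary: b)
 case (Cons v vs)
 have "(\<forall>i<length (v # vs). ok1 R B y (b + i) ((v # vs) ! i)) \<longleftrightarrow>
  ok1 R B y b v \<and> (\<forall>i<length vs. ok1 R B y (Suc b + i) (vs ! i))"
  unfolding length_Cons All_less_Suc2 by simp
 then show ?case using Cons by simp
qed simp

lemma srch_less: "0 < n ==> srch R B vs n < n"
proof (induction n)
 case (Suc n)
 then show ?case by (cases n) auto
qed simp

lemma srch_ok: "y < n ==> okall R B y 2 vs ==> okall R B (srch R B vs n) 2 vs"
 by (induction n) (auto simp: less_Suc_eq)

lemma power_beats_poly: "100 <= j ==> 13 * (j + 1) ^ 7 <= (2::nat) ^ j"
proof (induction j rule: nat_induct_at_least)
 case base
 then show ?case by simp
next
 case (Suc j)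
 have "100 * (j + 2) <= 101 * (j + 1)" using Suc by simp
 then have "(100 * (j + 2)) ^ 7 <= (101 * (j + 1)) ^ 7" by (rule power_mono) simp
 then have "100 ^ 7 * (j + 2) ^ 7 <= 101 ^ 7 * (j + 1) ^ 7" unfolding power_mult_distrib .
 also have "... <= (2 * 100 ^ 7) * (j + 1) ^ 7" by (rule mult_le_mono1) simp
 finally have "100 ^ 7 * (j + 2) ^ 7 <= 100 ^ 7 * (2 * (j + 1) ^ 7)" by (simp only: mult.assoc mult.left_commute)
 then have "(j + 2) ^ 7 <= 2 * (j + 1) ^ 7" by (subst (asm) mult_le_cancel1) simp
 then have "13 * (j + 2) ^ 7 <= 2 * (13 * (j + 1) ^ 7)" by linarith
 also have "... <= 2 * 2 ^ j" using Suc by simp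
 finally show ?case by simp
qed

text \<open>As b < 2^b, the number M of tested digits is at least about 2^j / (j + 1), which
  outgrows every polynomial in j. The particular bound 12 (j + 1)^6 is what the union bound of
  \<open>leaf_exists\<close> asks for.\<close>

lemma leaf_size:
 assumes j: "100 <= j" and b: "2 <= b" "b <= j + 1"
 defines "M \<equiv> mlog b (2 ^ 2 ^ j div 4)"
 shows "12 * (j + 1) ^ 6 < M" "M <= 2 ^ j" "4 * b ^ M <= 2 ^ 2 ^ j" "(2::nat) ^ 2 ^ j < 4 * b ^ Suc M"
proof -
 define E :: nat where "E = 2 ^ j - 2"
 have j2: "(2::nat) <= 2 ^ j" using j by (metis one_le_numeral power_increasing power_one_right order_trans le_trans numeral_le_iff semiring_norm(68))
 then have Ee: "2 ^ j = E + 2" by (simp add: E_def)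
 have R: "(2::nat) ^ 2 ^ j = 4 * 2 ^ E" unfolding Ee by simp
 have m: "b ^ M <= 2 ^ E" "2 ^ E < b ^ Suc M" using mlog_bounds[OF b(1), of "2 ^ E"] by (auto simp: M_def R)
 show "4 * b ^ M <= 2 ^ 2 ^ j" "(2::nat) ^ 2 ^ j < 4 * b ^ Suc M" using m by (simp_all add: R)
 have "(2::nat) ^ M <= b ^ M" using b by (intro power_mono) auto
 also have "... <= 2 ^ E" by (rule m)
 finally have "M <= E" by simp
 then show "M <= 2 ^ j" by (simp add: Ee)
 have "2 ^ E < b ^ Suc M" by (rule m)
 also have "... <= (2 ^ b) ^ Suc M" by (rule power_mono) (simp_all add: less_imp_le)
 also have "... = 2 ^ (b * Suc M)" by (simp only: power_mult)
 finally have "E < b * Suc M" by simp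
 also have "... <= (j + 1) * Suc M" using b by (intro mult_le_mono1)
 finally have E: "2 ^ j < (j + 1) * (M + 1) + 2" by (simp add: Ee)
 show "12 * (j + 1) ^ 6 < M"
 proof (rule ccontr)
  assume "\<not> ?thesis"
  then have "(j + 1) * (M + 1) <= (j + 1) * (12 * (j + 1) ^ 6 + 1)" by (intro mult_le_mono2) simp
  also have "... = 12 * (j + 1) ^ 7 + (j + 1)" by (simp add: power_Suc[of "j + 1" 6, simplified] algebra_simps del: power_Suc)
  finally have "13 * (j + 1) ^ 7 < 12 * (j + 1) ^ 7 + (j + 1) + 2" using E power_beats_poly[OF j] by linarith
  moreover have "(j + 1) * 100 <= (j + 1) ^ 7"
  proof -
   have "(j + 1) * 100 <= (j + 1) * (j + 1)" using j by (intro mult_le_mono2) simp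
   also have "... = (j + 1) ^ 2" by (simp add: power2_eq_square)
   also have "... <= (j + 1) ^ 7" by (rule power_increasing) auto
   finally show ?thesis .
  qed
  moreover obtain U where U: "(j + 1) ^ 7 = U" by blast
  ultimately show False unfolding U by presburger
 qed
qed

text \<open>There are 2j bad sets, one for each base and each of the two neighbouring strings. By
  \<open>card_bad_choices\<close> and \<open>leaf_size\<close> each has fewer than R / (2j)
  elements, so together they cannot cover all R candidates.\<close>

lemma leaf_exists:
 fixes j :: nat
 assumes j: "100 <= j" and l: "length vs = j" and R: "R = 2 ^ 2 ^ j"
  and v: "\<And>i. i < j ==> fst (vs ! i) < R * R \<and> snd (vs ! i) <= R * R \<and> R * R <= 2 * (i + 2) * snd (vs ! i)"
 shows "\<exists>y<R. okall R j y 2 vs"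
proof (rule ccontr)
 assume "\<not> ?thesis"
 then have n: "\<exists>i<j. \<not> ok1 R j y (2 + i) (vs ! i)" if "y < R" for y using that l by (auto simp: okall_iff)
 define M where "M i = mlog (i + 2) (R div 4)" for i
 define s where "s i y = (i + 2) ^ M i * (fst (vs ! i) * R + snd (vs ! i) * y) div (R * R * R)" for i y
 define Bd where "Bd i \<delta> = {y. y < R \<and> \<not> good (i + 2) (M i) j (s i y + \<delta>)}" for i \<delta>
 have R0: "0 < R" by (simp add: R)
 have bd: "real (card (Bd i \<delta>)) * (2 * real j) < real R" if i: "i < j" for i \<delta>
 proof -
  have sz: "12 * (j + 1) ^ 6 < M i" "4 * (i + 2) ^ M i <= R" using leaf_size[OF j, of "i + 2"] i by (auto simp: M_def R)
  have "real (card (Bd i \<delta>)) * real (M i) <= 6 * (real (i + 2)) ^ 3 * (real j)\<^sup>2 * real R"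
   unfolding Bd_def s_def by (rule card_bad_choices) (use v[OF i] sz in \<open>auto simp: algebra_simps\<close>)
  also have "... <= 6 * (real (j + 1)) ^ 3 * (real (j + 1))\<^sup>2 * real R"
   using i by (intro mult_mono power_mono) auto
  also have "... = 6 * real (j + 1) ^ 5 * real R" by (simp only: mult.assoc power_add[symmetric]) simp
  finally have A: "real (card (Bd i \<delta>)) * real (M i) <= 6 * real (j + 1) ^ 5 * real R" .
  show ?thesis
  proof (rule ccontr)
   assume "\<not> ?thesis"
   then have "real R * real (M i) <= real (card (Bd i \<delta>)) * (2 * real j) * real (M i)" by (intro mult_right_mono) auto
   also have "... = (real (card (Bd i \<delta>)) * real (M i)) * (2 * real j)" by simp
   also have "... <= (6 * real (j + 1) ^ 5 * real R) * (2 * real (j + 1))" by (rule mult_mono[OF A]) auto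
   also have "... = real R * (12 * real (j + 1) ^ 6)" by (simp add: power_Suc[of "1 + real j" 5, simplified] algebra_simps del: power_Suc)
   finally have "real (M i) <= 12 * real (j + 1) ^ 6" using R0 by (subst (asm) mult_le_cancel_left_pos) auto
   moreover have "real (12 * (j + 1) ^ 6) < real (M i)" using sz by (simp only: of_nat_less_iff)
   ultimately show False by simp
  qed
 qed
 have "{..<R} \<subseteq> (\<Union>i<j. Bd i 0 \<union> Bd i 1)"
 proof
  fix y assume "y \<in> {..<R}"
  then have y: "y < R" by simp
  from n[OF y] obtain i where "i < j" "\<not> ok1 R j y (2 + i) (vs ! i)" by blast
  then have "y \<in> Bd i 0 \<union> Bd i 1" using y by (auto simp: ok1_def Bd_def s_def M_def Let_def add.commute)
  then show "y \<in> (\<Union>i<j. Bd i 0 \<union> Bd i 1)" using \<open>i < j\<close> by blast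
 qed
 then have "card {..<R} <= card (\<Union>i<j. Bd i 0 \<union> Bd i 1)" by (intro card_mono finite_UN_I) (auto simp: Bd_def)
 also have "... <= (\<Sum>i<j. card (Bd i 0 \<union> Bd i 1))" by (rule card_UN_le) simp
 also have "... <= (\<Sum>i<j. card (Bd i 0) + card (Bd i 1))" by (intro sum_mono card_Un_le)
 finally have "real R <= real (\<Sum>i<j. card (Bd i 0) + card (Bd i 1))" by (simp only: of_nat_le_iff card_lessThan)
 also have "... = (\<Sum>i<j. real (card (Bd i 0)) + real (card (Bd i 1)))" by simp
 also have "... < (\<Sum>i<j. real R / (2 * real j) + real R / (2 * real j))"
  using j bd by (intro sum_strict_mono add_strict_mono) (auto simp: less_divide_eq lessThan_empty_iff)
 also have "... = real R" using j by (simp add: field_simps)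
 finally show False by simp
qed

section \<open>Tables of powers of the bases\<close>

definition lvl_ok :: "nat => nat => bool list => entry => bool" where
 "lvl_ok b h bb e \<longleftrightarrow> fst e = bb \<and> val bb = b \<and>
  (\<exists>m. val (fst (snd e)) = b ^ m) \<and> val (fst (snd e)) < 2 ^ h \<and> 2 ^ h <= b * val (fst (snd e)) \<and>
  val (snd (snd e)) = b * val (fst (snd e)) \<and> length (fst (snd e)) <= h \<and> length (snd (snd e)) <= h + 2 * length bb"

lemma lvl_ok_nxt:
 assumes ok: "lvl_ok b (2 ^ j) bb e" and b: "2 <= b"
 shows "lvl_ok b (2 * 2 ^ j) bb (nxt j (2 ^ j) e)"
proof -
 define h :: nat where "h = 2 ^ j"
 define T where "T = fst (snd e)"
 obtain m where m: "val T = b ^ m" using ok by (auto simp: lvl_ok_def T_def)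
 have e: "fst e = bb" "val bb = b" "val T < 2 ^ h" "2 ^ h <= b * val T" "length T <= h"
  using ok by (auto simp: lvl_ok_def T_def h_def)
 define Q where "Q = mulb j T T"
 have Q: "val Q = val T * val T" "length Q = 2 * h" using mulb[of T j T] e by (auto simp: Q_def h_def)
 define Qb where "Qb = nmul bb Q"
 have Qb: "val Qb = b * (val T * val T)" using Q e by (simp add: Qb_def)
 have H: "(2::nat) ^ (2 * h) = 2 ^ h * 2 ^ h" by (simp add: power_add mult_2)
 define U where "U = (if val Qb < 2 ^ (2 * h) then take (2 * h) Qb else Q)"
 have nx: "nxt j h e = (bb, U, nmul bb U)" using e by (simp add: nxt_def Let_def U_def Qb_def Q_def T_def zero_drop)
 have "(\<exists>m. val U = b ^ m) \<and> val U < 2 ^ (2 * h) \<and> 2 ^ (2 * h) <= b * val U \<and> length U <= 2 * h"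
 proof (cases "val Qb < 2 ^ (2 * h)")
  case True
  have "2 ^ h * 2 ^ h <= (b * val T) * (b * val T)" using e by (intro mult_le_mono)
  moreover have "val U = b * (val T * val T)" using True Qb by (simp add: U_def val_take)
  moreover have "\<exists>k. b * (val T * val T) = b ^ k" by (rule exI[of _ "Suc (m + m)"]) (simp add: m power_add)
  ultimately show ?thesis using True Qb H by (simp add: U_def algebra_simps)
 next
  case False
  have "val T * val T < 2 ^ h * 2 ^ h" using e by (intro mult_strict_mono) auto
  moreover have "\<exists>k. val T * val T = b ^ k" by (rule exI[of _ "m + m"]) (simp add: m power_add)
  ultimately show ?thesis using False Q Qb H by (simp add: U_def)
 qed
 then show ?thesis using e nx length_nmul[of bb U] unfolding lvl_ok_def h_def[symmetric] by auto
qed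

definition levels :: "bool list list => nat => entry list" where
 "levels bbs j = snd (snd (hd (tower bbs j)))"

lemma tower_hd: "tower bbs j \<noteq> [] \<and> hd (tower bbs j) = (j, 2 ^ j, levels bbs j)"
proof (induction j)
 case (Suc j)
 then obtain l where "hd (tower bbs j) = (j, 2 ^ j, l)" by blast
 then show ?case by (simp add: levels_def Let_def)
qed (simp add: levels_def)

lemma levels_0: "levels bbs 0 = map (%bb. (bb, [True], bb)) bbs"
 by (simp add: levels_def)

lemma levels_Suc: "levels bbs (Suc j) = map (nxt j (2 ^ j)) (levels bbs j)"
proof -
 obtain l where "hd (tower bbs j) = (j, 2 ^ j, l)" using tower_hd[of bbs j] by blast
 then show ?thesis by (simp add: levels_def Let_def)
qed

lemma levels_ok:
 assumes "\<And>bb. bb \<in> set bbs ==> 2 <= val bb"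
 shows "length (levels bbs j) = length bbs \<and> (\<forall>i<length bbs. lvl_ok (val (bbs ! i)) (2 ^ j) (bbs ! i) (levels bbs j ! i))"
proof (induction j)
 case 0
 have "lvl_ok (val bb) 1 bb (bb, [True], bb)" if "bb \<in> set bbs" for bb
  using assms[OF that] by (auto simp: lvl_ok_def intro: exI[of _ 0])
 then show ?case by (simp add: levels_0)
next
 case (Suc j)
 then show ?case using assms lvl_ok_nxt by (auto simp: levels_Suc)
qed

text \<open>Peels one level off the table, in the shape in which \<open>solve\<close> consumes it
  during the induction on the depth.\<close>

lemma tower_take:
 "take (Suc t) (tl (tower bbs (j + Suc t))) = (j + t, 2 ^ (j + t), levels bbs (j + t)) # take t (tl (tower bbs (j + t)))"
 using tower_hd[of bbs "j + t"] by (cases "tower bbs (j + t)") (auto simp: Let_def)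

lemma bases:
 "length (bases n bb) = n" "i < n ==> val (bases n bb ! i) = val bb + i"
 "i < n ==> bb \<noteq> [] ==> length (bases n bb ! i) = length bb + i"
proof -
 show "length (bases n bb) = n" by (induction n arbitrary: bb) auto
 show "i < n ==> val (bases n bb ! i) = val bb + i" by (induction n arbitrary: bb i) (auto simp: nth_Cons split: nat.split)
 show "i < n ==> bb \<noteq> [] ==> length (bases n bb ! i) = length bb + i"
 proof (induction n arbitrary: bb i)
  case (Suc n)
  have "max (length bb) 1 = length bb" using Suc.prems by (cases bb) auto
  then show ?case using Suc.prems Suc.IH[of _ "addb False bb [True]"] by (auto simp: nth_Cons split: nat.split)
 qed simp
qed

lemma length_solve: "length (solve lam tab sts) = lam * 2 ^ length tab"
 by (induction tab arbitrary: sts) (auto simp: leaf_def nbits Let_def)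

section \<open>Truncated states and their propagation\<close>

definition near :: "nat => nat => nat => bool" where
 "near b m n \<longleftrightarrow> 2 ^ n <= b ^ Suc m \<and> b ^ m <= 2 * 2 ^ n"

text \<open>The state of a node that extends the prefix p of n bits by l bits holds the fractional part of
 b^m p/2^n and the slope b^m/2^n with 2l bits of precision.\<close>
definition st_ok :: "nat => nat => nat => nat => nat => nat => bool list \<times> bool list => bool" where
 "st_ok b p n l m I w \<longleftrightarrow> length (fst w) <= 2 * l \<and> length (snd w) <= 2 * l \<and> 2 ^ n <= b ^ Suc m \<and>
  val (snd w) * 2 ^ n <= 2 ^ (2 * l) * b ^ m \<and> 2 ^ (2 * l) * b ^ m <= (val (snd w) + 2) * 2 ^ n \<and>
  (I * 2 ^ (2 * l) + val (fst w)) * 2 ^ n <= 2 ^ (2 * l) * (b ^ m * p) \<and>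
  2 ^ (2 * l) * (b ^ m * p) <= (I * 2 ^ (2 * l) + val (fst w) + 2) * 2 ^ n"

lemma val_less_power: "length xs <= n ==> val xs < 2 ^ n"
 by (rule less_le_trans[OF val_less power_increasing]) auto

text \<open>The stored slope has 2l bits and so is below 1; together with the truncation error this
  bounds b^m by 2 * 2^n.\<close>

lemma st_ok_near: "st_ok b p n l m I w ==> near b m n"
proof -
 assume ok: "st_ok b p n l m I w"
 then have "val (snd w) < 2 ^ (2 * l)" by (intro val_less_power) (simp add: st_ok_def)
 then have k: "val (snd w) + 2 <= 2 ^ (2 * l) * 2" by simp
 have "2 ^ (2 * l) * b ^ m <= (val (snd w) + 2) * 2 ^ n" using ok by (simp add: st_ok_def)
 also have "... <= 2 ^ (2 * l) * 2 * 2 ^ n" using k by (rule mult_le_mono1)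
 finally have "2 ^ (2 * l) * b ^ m <= 2 ^ (2 * l) * (2 * 2 ^ n)" by (simp only: mult.assoc)
 then have "b ^ m <= 2 * 2 ^ n" by (subst (asm) mult_le_cancel1) simp
 then show "near b m n" using ok by (simp add: near_def st_ok_def)
qed

text \<open>An error of two units survives truncation unchanged, since X + 2 <= D * (X div D + 1) +
  1 <= D * (X div D + 2). This is the reason for the constant 2 in \<open>st_ok\<close>.\<close>

lemma trunc_bounds:
 fixes X Y Z D :: nat
 assumes D: "0 < D" and l: "X * Y <= D * D * Z" and u: "D * D * Z <= (X + 2) * Y"
 shows "X div D * Y <= D * Z" "D * Z <= (X div D + 2) * Y"
proof -
 have "D * (X div D * Y) = (D * (X div D)) * Y" by simp
 also have "... <= X * Y" by (intro mult_le_mono1) simp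
 also have "... <= D * (D * Z)" using l by (simp add: mult.assoc)
 finally show "X div D * Y <= D * Z" using D by simp
 have "X < D * (X div D + 1)" using D dividend_less_times_div[of D X] by simp
 then have "X + 2 <= D * (X div D + 2)" using D by simp
 then have "(X + 2) * Y <= D * (X div D + 2) * Y" by (rule mult_le_mono1)
 then have "D * (D * Z) <= D * ((X div D + 2) * Y)" using u by (simp only: mult.assoc)
 then show "D * Z <= (X div D + 2) * Y" using D by simp
qed

lemma st_ok_lft:
 assumes "st_ok b p n (2 * h) m I w"
 shows "st_ok b p n h m I (lft h w)"
proof -
 define D :: nat where "D = 2 ^ (2 * h)"
 have D: "0 < D" "2 ^ (2 * (2 * h)) = D * D" by (auto simp: D_def power_add[symmetric])
 have a: "val (snd w) * 2 ^ n <= D * D * b ^ m" "D * D * b ^ m <= (val (snd w) + 2) * 2 ^ n"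
  "(I * (D * D) + val (fst w)) * 2 ^ n <= D * D * (b ^ m * p)"
  "D * D * (b ^ m * p) <= (I * (D * D) + val (fst w) + 2) * 2 ^ n"
  using assms unfolding st_ok_def D(2) by blast+
 have d: "(I * (D * D) + val (fst w)) div D = I * D + val (fst w) div D"
  using D(1) div_mult_self3[of D "I * D" "val (fst w)"] by (simp add: mult.assoc)
 show ?thesis using assms trunc_bounds[OF D(1) a(1,2)] trunc_bounds[OF D(1) a(3,4)]
  unfolding d by (auto simp: st_ok_def lft_def val_drop D_def[symmetric])
qed

text \<open>The two units of error in K become 2 T after multiplication, and 2 T <= 2 b H <= H^3 is
  at most one new unit; the floor adds the other.\<close>

lemma rgt_slope:
 fixes K N \<beta> T H b :: nat
 assumes H: "0 < H" and K: "K * N <= H ^ 4 * \<beta>" "H ^ 4 * \<beta> <= (K + 2) * N" and T: "T <= b * H" "4 * b <= H"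
 shows "K * T div H ^ 3 * (N * H) <= H ^ 2 * (\<beta> * T)" "H ^ 2 * (\<beta> * T) <= (K * T div H ^ 3 + 2) * (N * H)"
proof -
 define Q where "Q = K * T div H ^ 3"
 have Q: "H ^ 3 * Q <= K * T" "K * T < H ^ 3 * (Q + 1)"
  using H dividend_less_times_div[of "H ^ 3" "K * T"] by (auto simp: Q_def)
 have "H ^ 2 * (Q * (N * H)) = (H ^ 3 * Q) * N" by (simp add: power2_eq_square power3_eq_cube)
 also have "... <= K * T * N" using Q by (intro mult_le_mono1)
 also have "... = T * (K * N)" by simp
 also have "... <= T * (H ^ 4 * \<beta>)" using K by (intro mult_le_mono2)
 also have "... = H ^ 2 * (H ^ 2 * (\<beta> * T))" by (simp add: power2_eq_square power4_eq_xxxx)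
 finally show "Q * (N * H) <= H ^ 2 * (\<beta> * T)" using H by (subst (asm) mult_le_cancel1) simp
 have "2 * T <= H ^ 3"
 proof -
  have "2 * T <= 2 * (b * H)" using T(1) by (rule mult_le_mono2)
  also have "... <= (4 * b) * H" by simp
  also have "... <= H * H" using T by (intro mult_le_mono1)
  also have "... <= H ^ 3" using H by (simp add: power3_eq_cube)
  finally show ?thesis .
 qed
 then have Q2: "(K + 2) * T <= H ^ 3 * (Q + 2)" using Q by (simp add: algebra_simps)
 have "H ^ 2 * (H ^ 2 * (\<beta> * T)) = T * (H ^ 4 * \<beta>)" by (simp add: power2_eq_square power4_eq_xxxx)
 also have "... <= T * ((K + 2) * N)" using K by (intro mult_le_mono2)
 also have "... = ((K + 2) * T) * N" by (simp only: ac_simps)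
 also have "... <= H ^ 3 * (Q + 2) * N" using Q2 by (rule mult_le_mono1)
 also have "... = H ^ 2 * ((Q + 2) * (N * H))" by (simp add: power2_eq_square power3_eq_cube algebra_simps)
 finally show "H ^ 2 * (\<beta> * T) <= (Q + 2) * (N * H)" using H by (subst (asm) mult_le_cancel1) simp
qed

text \<open>As for the slope, but with errors inherited from both Z and K. They add up to at most 4
  H T <= 4 b H^2 <= H^3, one new unit, which is where \<open>4 * b <= H\<close> comes from.\<close>

lemma rgt_offset:
 fixes K N \<beta> T H b Z I y p :: nat
 assumes H: "0 < H" and K: "K * N <= H ^ 4 * \<beta>" "H ^ 4 * \<beta> <= (K + 2) * N" and T: "T <= b * H" "4 * b <= H"
  and Z: "(I * H ^ 4 + Z) * N <= H ^ 4 * (\<beta> * p)" "H ^ 4 * (\<beta> * p) <= (I * H ^ 4 + Z + 2) * N" and y: "y <= H"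
 defines "X \<equiv> (Z * H + K * y) * T div H ^ 3"
 shows "(I * T * H ^ 2 + X) * (N * H) <= H ^ 2 * (\<beta> * T * (p * H + y))"
  "H ^ 2 * (\<beta> * T * (p * H + y)) <= (I * T * H ^ 2 + X + 2) * (N * H)"
proof -
 define W where "W = Z * H + K * y"
 have X: "H ^ 3 * X <= W * T" "W * T < H ^ 3 * (X + 1)"
  using H dividend_less_times_div[of "H ^ 3" "W * T"] by (auto simp: X_def W_def)
 have e: "H ^ 2 * (H ^ 2 * (\<beta> * T * (p * H + y))) = T * (H * (H ^ 4 * (\<beta> * p)) + y * (H ^ 4 * \<beta>))"
  by (simp add: power2_eq_square power4_eq_xxxx algebra_simps)
 have "H ^ 2 * ((I * T * H ^ 2 + X) * (N * H)) = (I * T * H ^ 5 + H ^ 3 * X) * N"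
  by (simp add: power2_eq_square power3_eq_cube eval_nat_numeral algebra_simps)
 also have "... <= (I * T * H ^ 5 + W * T) * N" using X by (intro mult_le_mono1 add_left_mono)
 also have "... = T * (H * ((I * H ^ 4 + Z) * N) + y * (K * N))"
  by (simp add: W_def eval_nat_numeral algebra_simps)
 also have "... <= T * (H * (H ^ 4 * (\<beta> * p)) + y * (H ^ 4 * \<beta>))"
  using K Z by (intro mult_le_mono2 add_mono) auto
 also have "... = H ^ 2 * (H ^ 2 * (\<beta> * T * (p * H + y)))" by (simp only: e)
 finally show "(I * T * H ^ 2 + X) * (N * H) <= H ^ 2 * (\<beta> * T * (p * H + y))" using H by (subst (asm) mult_le_cancel1) simp
 have "2 * H * T + 2 * y * T <= H ^ 3"
 proof -
  have "2 * H * T + 2 * y * T <= 2 * H * T + 2 * H * T" using y by (intro add_mono mult_le_mono) auto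
  also have "... = (4 * H) * T" by simp
  also have "... <= (4 * H) * (b * H)" using T by (intro mult_le_mono2)
  also have "... = (4 * b) * (H * H)" by simp
  also have "... <= H * (H * H)" using T by (intro mult_le_mono1)
  finally show ?thesis by (simp add: power3_eq_cube)
 qed
 then have X2: "W * T + 2 * H * T + 2 * y * T <= H ^ 3 * (X + 2)" using X by (simp add: algebra_simps)
 have "H ^ 2 * (H ^ 2 * (\<beta> * T * (p * H + y))) <= T * (H * ((I * H ^ 4 + Z + 2) * N) + y * ((K + 2) * N))"
  unfolding e using K Z by (intro mult_le_mono2 add_mono) auto
 also have "... = (I * T * H ^ 5 + (W * T + 2 * H * T + 2 * y * T)) * N" by (simp add: W_def eval_nat_numeral algebra_simps)
 also have "... <= (I * T * H ^ 5 + H ^ 3 * (X + 2)) * N" using X2 by (intro mult_le_mono1 add_left_mono)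
 also have "... = H ^ 2 * ((I * T * H ^ 2 + X + 2) * (N * H))"
  by (simp add: eval_nat_numeral algebra_simps)
 finally show "H ^ 2 * (\<beta> * T * (p * H + y)) <= (I * T * H ^ 2 + X + 2) * (N * H)" using H by (subst (asm) mult_le_cancel1) simp
qed

lemma st_ok_rgt:
 assumes h: "h = 2 ^ j" and ok: "st_ok b p n (2 * h) m I w" and e: "lvl_ok b h bb e" and b: "2 <= b" "4 * b <= 2 ^ h"
  and bb: "2 * length bb <= 3 * h" and y: "length y = h"
 shows "\<exists>m' I'. st_ok b (p * 2 ^ h + val y) (n + h) h m' I' (rgt j h y (e, w))"
proof -
 define H :: nat where "H = 2 ^ h"
 define N :: nat where "N = 2 ^ n"
 define Z where "Z = fst w"
 define K where "K = snd w"
 define T where "T = fst (snd e)"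
 define Tb where "Tb = snd (snd e)"
 have H: "0 < H" "2 ^ (2 * (2 * h)) = H ^ 4" "2 ^ (2 * h) = H ^ 2" "2 ^ (3 * h) = H ^ 3" "2 ^ (5 * h) = H ^ 5" "2 ^ (8 * h) = H ^ 8"
  by (auto simp: H_def power_mult[symmetric] mult.commute)
 have w: "length Z <= 4 * h" "length K <= 4 * h" "N <= b ^ Suc m"
  "val K * N <= H ^ 4 * b ^ m" "H ^ 4 * b ^ m <= (val K + 2) * N"
  "(I * H ^ 4 + val Z) * N <= H ^ 4 * (b ^ m * p)" "H ^ 4 * (b ^ m * p) <= (I * H ^ 4 + val Z + 2) * N"
  using ok unfolding st_ok_def H(2) N_def Z_def K_def by auto
 obtain q where q: "val T = b ^ q" using e by (auto simp: lvl_ok_def T_def)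
 have t: "val T < H" "H <= b * val T" "val Tb = b * val T" "length T <= h" "length Tb <= h + 2 * length bb"
  using e by (auto simp: lvl_ok_def T_def Tb_def H_def)
 have h4: "(2::nat) ^ (j + 2) = 4 * h" "(2::nat) ^ (j + 3) = 8 * h" by (simp_all add: h power_add)
 have lens: "length K <= 2 ^ (j + 2)" "length Tb <= 2 ^ (j + 2)" "length T <= 2 ^ (j + 2)" "length y <= 2 ^ (j + 2)"
  using w(1,2) t(4,5) bb y unfolding h4 by auto
 have KB: "val (mulb (j + 2) K Tb) = val K * val Tb" and KT: "val (mulb (j + 2) K T) = val K * val T"
  and Ky: "val (mulb (j + 2) K y) = val K * val y"
  and lKB: "length (mulb (j + 2) K Tb) = 8 * h" "length (mulb (j + 2) K T) = 8 * h" "length (mulb (j + 2) K y) = 8 * h"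
  using mulb[OF lens(1,2)] mulb[OF lens(1,3)] mulb[OF lens(1,4)] unfolding h4 by simp_all
 define c where "c = (val K * val Tb < H ^ 5)"
 define T' where "T' = (if c then Tb else T)"
 define X where "X = take (8 * h) (addb False (replicate h False @ Z) (mulb (j + 2) K y))"
 have vK: "val K < H ^ 4" using val_less_power[of K "4 * h"] w by (simp add: H_def power_mult[symmetric] mult.commute)
 have vZ: "val Z < H ^ 4" using val_less_power[of Z "4 * h"] w by (simp add: H_def power_mult[symmetric] mult.commute)
 have vy: "val y < H" using val_less[of y] y by (simp add: H_def)
 have H2: "2 <= H" using b unfolding H_def by linarith
 \<comment> \<open>The sum fits into 8h bits, so the \<open>take\<close> in the definition of
   \<open>X\<close> loses nothing; it only normalises the length for the next
   multiplication.\<close>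
 have vX: "val X = val Z * H + val K * val y"
 proof -
  have "val Z * H < H ^ 4 * H" using vZ H(1) by simp
  moreover have "val K * val y <= H ^ 4 * H" using vK vy by (intro mult_le_mono) auto
  ultimately have "val Z * H + val K * val y < H ^ 4 * H + H ^ 4 * H" by linarith
  also have "... = 2 * H ^ 5" by (simp add: eval_nat_numeral)
  also have "... <= H * H ^ 5" using H2 by (intro mult_le_mono1)
  also have "... <= H ^ 8" using H power_increasing[of 6 8 H] by (simp add: eval_nat_numeral)
  finally have "val Z * H + val K * val y < H ^ 8" .
  then show ?thesis unfolding X_def val_take val_addb Ky H(6) by (simp add: H_def[symmetric] mult.commute)
 qed
 have lX: "length X = 8 * h" unfolding X_def length_take length_addb lKB length_append length_replicate using w(1) by linarith
 have T': "val T' <= b * H" "length T' <= 8 * h"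
  using t bb b by (auto simp: T'_def intro: order_trans[OF less_imp_le[of "val T" H]])
 have XT: "val (mulb (j + 3) X T') = (val Z * H + val K * val y) * val T'"
  and lXT: "length (mulb (j + 3) X T') = 16 * h"
  using mulb[of X "j + 3" T'] lX T' vX unfolding h4 by simp_all
 have r: "rgt j h y (e, w) = (take (2 * h) (drop (3 * h) (mulb (j + 3) X T')),
   take (2 * h) (drop (3 * h) (if c then mulb (j + 2) K Tb else mulb (j + 2) K T)))"
  unfolding rgt_def Let_def fst_conv snd_conv zero_drop
  unfolding T_def[symmetric] Tb_def[symmetric] K_def[symmetric] Z_def[symmetric] KB H(5) c_def[symmetric]
   T'_def[symmetric] X_def[symmetric] by simp
 obtain q' where q': "val T' = b ^ q'"
 proof (cases c)
  case True then show thesis using t q that[of "Suc q"] by (simp add: T'_def)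
 next
  case False then show thesis using q that[of q] by (simp add: T'_def)
 qed
 have KT5: "val K * val T' < H ^ 5"
 proof (cases c)
  case True then show ?thesis by (simp add: T'_def c_def)
 next
  case False
  have "val K * val T < H ^ 4 * H" using vK t by (intro mult_strict_mono) auto
  then show ?thesis using False by (simp add: T'_def eval_nat_numeral)
 qed
 have vK': "val (take (2 * h) (drop (3 * h) (if c then mulb (j + 2) K Tb else mulb (j + 2) K T))) = val K * val T' div H ^ 3"
 proof -
  have "val K * val T' div H ^ 3 < H ^ 2"
   using KT5 H by (intro less_mult_imp_div_less) (simp add: power_add[symmetric])
  then show ?thesis unfolding val_take val_drop H(3,4) T'_def by (cases c) (simp_all only: if_True if_False KB KT mod_less)
 qed
 define Y where "Y = (val Z * H + val K * val y) * val T' div H ^ 3"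
 have vZ': "val (take (2 * h) (drop (3 * h) (mulb (j + 3) X T'))) = Y mod H ^ 2"
  by (simp add: val_take val_drop XT H Y_def)
 \<comment> \<open>If \<open>c\<close> holds, the lower bounds for b^m and for T multiply. If it
   fails, K * (b * T) >= H^5, and K * N <= H^4 * b^m turns this into the bound directly.\<close>
 have low: "N * H <= b * (b ^ m * val T')"
 proof (cases c)
  case True
  have "N * H <= b ^ Suc m * (b * val T)" using w t by (intro mult_le_mono) auto
  then show ?thesis using True t by (simp add: T'_def algebra_simps)
 next
  case False
  then have "H ^ 5 * N <= val K * (b * val T) * N" using t by (intro mult_le_mono1) (simp add: c_def)
  also have "... = (b * val T) * (val K * N)" by simp
  also have "... <= (b * val T) * (H ^ 4 * b ^ m)" using w by (intro mult_le_mono2)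
  finally have "H ^ 4 * (N * H) <= H ^ 4 * (b * (b ^ m * val T))" by (simp add: eval_nat_numeral algebra_simps)
  then show ?thesis using False H by (simp add: T'_def)
 qed
 have 4: "4 * b <= H" using b by (simp add: H_def)
 have N': "(2::nat) ^ (n + h) = N * H" by (simp add: N_def H_def power_add)
 have m': "b ^ (m + q') = b ^ m * val T'" by (simp add: power_add q')
 have Ys: "(I * val T' + Y div H ^ 2) * H ^ 2 + Y mod H ^ 2 = I * val T' * H ^ 2 + Y" by (simp only: add_mult_distrib add.assoc div_mult_mod_eq)
 have "st_ok b (p * H + val y) (n + h) h (m + q') (I * val T' + Y div H ^ 2) (rgt j h y (e, w))"
  unfolding st_ok_def r fst_conv snd_conv vK' vZ' N' power_Suc m' H(3) Ys
  using rgt_slope[OF H(1) w(4,5) T'(1) 4] rgt_offset[OF H(1) w(4,5) T'(1) 4 w(6,7) less_imp_le[OF vy]] low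
  by (simp add: Y_def)
 then show ?thesis unfolding H_def by blast
qed

text \<open>A block tests M digits while the position advances by at least M and at most M + 5. The
  excess collects the rounding of both exponents and of M.\<close>

lemma near_window:
 assumes b: "2 <= b" and m: "near b m n" and m': "near b m' (n + l)" and M: "4 * b ^ M <= 2 ^ l" "2 ^ l < 4 * b ^ Suc M"
 shows "m + M <= m'" "m' <= m + M + 5"
proof -
 have "4 * b ^ M * b ^ m <= 2 ^ l * (2 * 2 ^ n)" using M m by (intro mult_le_mono) (auto simp: near_def)
 also have "... = 2 * 2 ^ (n + l)" by (simp add: power_add)
 also have "... <= 2 * b ^ Suc m'" using m' by (simp only: near_def mult_le_mono2)
 finally have "4 * b ^ (m + M) <= 2 * b ^ Suc m'" by (simp add: power_add mult_ac)
 moreover have "0 < b ^ (m + M)" using b by simp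
 ultimately have "b ^ (m + M) < b ^ Suc m'" by linarith
 then have "m + M < Suc m'" by (rule power_less_imp_less_exp[rotated]) (use b in simp)
 then show "m + M <= m'" by simp
 have "b ^ m' <= 2 * 2 ^ (n + l)" using m' by (simp add: near_def)
 also have "... = 2 * 2 ^ n * 2 ^ l" by (simp add: power_add)
 also have "... <= 2 * b ^ Suc m * (4 * b ^ Suc M)" using M m by (intro mult_le_mono) (auto simp: near_def)
 also have "... = 2 ^ 3 * b ^ (m + M + 2)" by (simp add: power_add)
 also have "... <= b ^ 3 * b ^ (m + M + 2)" using b by (intro mult_le_mono1 power_mono) auto
 also have "... = b ^ (m + M + 5)" by (simp only: power_add[symmetric]) (simp add: add.commute)
 finally show "m' <= m + M + 5" by (rule power_le_imp_le_exp[rotated]) (use b in simp)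
qed

section \<open>Digit counts along the blocks\<close>

definition dcount :: "nat => nat => real => nat => nat => nat" where
 "dcount b d z m N = card {i. m <= i \<and> i < N \<and> digit b z i = d}"

lemma dcount_le: "dcount b d z m N <= N - m"
proof -
 have "dcount b d z m N <= card {m..<N}" unfolding dcount_def by (rule card_mono) auto
 then show ?thesis by simp
qed

lemma dcount_split: "m <= k ==> k <= N ==> dcount b d z m N = dcount b d z m k + dcount b d z k N"
proof -
 assume "m <= k" "k <= N"
 then have "{i. m <= i \<and> i < N \<and> digit b z i = d} = {i. m <= i \<and> i < k \<and> digit b z i = d} \<union> {i. k <= i \<and> i < N \<and> digit b z i = d}" by auto
 then have "dcount b d z m N = card ({i. m <= i \<and> i < k \<and> digit b z i = d} \<union> {i. k <= i \<and> i < N \<and> digit b z i = d})"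
  by (simp only: dcount_def)
 also have "... = dcount b d z m k + dcount b d z k N" unfolding dcount_def by (rule card_Un_disjoint) auto
 finally show ?thesis .
qed

lemma dcount_cnt:
 assumes "0 <= z" "0 < b"
 shows "dcount b d z m (m + M) = cnt b d M (nat \<lfloor>z * real b ^ (m + M)\<rfloor>)"
proof (induction M)
 case 0
 then show ?case by (simp add: dcount_def)
next
 case (Suc M)
 define s where "s = nat \<lfloor>z * real b ^ (m + Suc M)\<rfloor>"
 have s: "\<lfloor>z * real b ^ (m + Suc M)\<rfloor> = int s" using assms by (simp add: s_def)
 have sd: "nat \<lfloor>z * real b ^ (m + M)\<rfloor> = s div b"
 proof -
  have "\<lfloor>z * real b ^ (m + M)\<rfloor> = int s div int b" using floor_scale[OF assms(2), of z "m + M" 1] s by simp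
  then show ?thesis by (simp add: zdiv_int[symmetric])
 qed
 have dg: "digit b z (m + M) = s mod b"
  using s by (simp add: digit_def zmod_int[symmetric])
 have "dcount b d z m (m + Suc M) = dcount b d z m (m + M) + dcount b d z (m + M) (m + Suc M)"
  by (rule dcount_split) auto
 also have "dcount b d z (m + M) (m + Suc M) = (if s mod b = d then 1 else 0)"
 proof -
  have "{i. m + M <= i \<and> i < m + Suc M \<and> digit b z i = d} = (if s mod b = d then {m + M} else {})"
   using dg by (auto simp: less_Suc_eq)
  then show ?thesis by (simp add: dcount_def)
 qed
 finally show ?case unfolding s_def[symmetric] using Suc sd by simp
qed

text \<open>The state and the interval for z confine z * b^m, minus the integer I, to an interval of
  length 2/R. Since 4 * b^M <= R, scaling by b^M leaves a length below one, so the floor can only be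
  the computed value or its successor.\<close>

lemma leaf_digits:
 fixes z :: real and y :: nat
 assumes st: "st_ok b p n l m I w" and l: "2 <= l" and M: "4 * b ^ M <= 2 ^ l" and b: "0 < b"
  and z: "real (p * 2 ^ l + y) <= z * 2 ^ (n + l)" "z * 2 ^ (n + l) <= real (p * 2 ^ l + y + 1)" and y: "y < 2 ^ l"
 defines "s \<equiv> b ^ M * (val (fst w) * 2 ^ l + val (snd w) * y) div (2 ^ l * 2 ^ l * 2 ^ l)"
 shows "\<lfloor>z * real b ^ (m + M)\<rfloor> = int (I * b ^ M + s) \<or> \<lfloor>z * real b ^ (m + M)\<rfloor> = int (I * b ^ M + Suc s)"
proof -
 define R :: nat where "R = 2 ^ l"
 define C where "C = R * R"
 define N :: nat where "N = 2 ^ n"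
 define A where "A = b ^ M"
 define \<beta> where "\<beta> = b ^ m"
 define Z where "Z = val (fst w)"
 define K where "K = val (snd w)"
 define Q where "Q = Z * R + K * y"
 have R4: "4 <= R" using l power_increasing[of 2 l "2::nat"] by (simp add: R_def)
 have C: "2 ^ (2 * l) = C" by (simp add: C_def R_def power_add[symmetric] mult_2)
 have st': "K * N <= C * \<beta>" "C * \<beta> <= (K + 2) * N" "(I * C + Z) * N <= C * (\<beta> * p)" "C * (\<beta> * p) <= (I * C + Z + 2) * N" "K <= C"
  using st val_less_power[of "snd w" "2 * l"] unfolding st_ok_def C N_def[symmetric] \<beta>_def[symmetric] Z_def[symmetric] K_def[symmetric] by auto
 have pos: "0 < real N" "0 < real R" "0 < real C" "0 < real A" "0 < real \<beta>" using R4 b by (auto simp: N_def C_def A_def \<beta>_def)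
 have zz: "real (p * R + y) <= z * (real N * real R)" "z * (real N * real R) <= real (p * R + y + 1)"
  using z by (simp_all add: R_def N_def power_add)
 have lo: "real (I * C * R + Q) <= real C * real R * (z * real \<beta>)"
 proof -
  have "(I * C * R + Q) * N = R * ((I * C + Z) * N) + y * (K * N)" by (simp add: Q_def algebra_simps)
  also have "... <= R * (C * (\<beta> * p)) + y * (C * \<beta>)" using st' by (intro add_mono mult_le_mono2)
  also have "... = C * \<beta> * (p * R + y)" by (simp add: algebra_simps)
  finally have "real ((I * C * R + Q) * N) <= real (C * \<beta> * (p * R + y))" by (simp only: of_nat_le_iff)
  also have "... = real (C * \<beta>) * real (p * R + y)" by simp
  also have "... <= real (C * \<beta>) * (z * (real N * real R))" using zz by (intro mult_left_mono) auto
  finally have "real (I * C * R + Q) * real N <= (real C * real R * (z * real \<beta>)) * real N" by (simp add: ac_simps)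
  then show ?thesis using pos by (simp only: mult_le_cancel_right_pos)
 qed
 have hi: "real C * real R * (z * real \<beta>) <= real (I * C * R + Q + 2 * C)"
 proof -
  have RC: "4 * R <= C" using R4 by (simp add: C_def)
  have yR: "y + 1 <= R" using y by (simp add: R_def)
  have "(I * C + Z + 2) * R + (K + 2) * (y + 1) = I * C * R + Q + (2 * R + K + 2 * (y + 1))" by (simp add: Q_def algebra_simps)
  also have "... <= I * C * R + Q + 2 * C" using RC yR st'(5) by simp
  finally have e: "(I * C + Z + 2) * R + (K + 2) * (y + 1) <= I * C * R + Q + 2 * C" .
  have "C * \<beta> * (p * R + y + 1) = R * (C * (\<beta> * p)) + (y + 1) * (C * \<beta>)" by (simp add: algebra_simps)
  also have "... <= R * ((I * C + Z + 2) * N) + (y + 1) * ((K + 2) * N)" using st' by (intro add_mono mult_le_mono2)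
  also have "... = ((I * C + Z + 2) * R + (K + 2) * (y + 1)) * N" by (simp add: algebra_simps)
  also have "... <= (I * C * R + Q + 2 * C) * N" by (rule mult_le_mono1[OF e])
  finally have u: "real (C * \<beta> * (p * R + y + 1)) <= real ((I * C * R + Q + 2 * C) * N)" by (simp only: of_nat_le_iff)
  have "real (C * \<beta>) * (z * (real N * real R)) <= real (C * \<beta>) * real (p * R + y + 1)" using zz by (intro mult_left_mono) auto
  also have "... <= real ((I * C * R + Q + 2 * C) * N)" using u by (simp only: of_nat_mult)
  finally have "(real C * real R * (z * real \<beta>)) * real N <= real (I * C * R + Q + 2 * C) * real N"
   by (simp only: of_nat_mult ac_simps)
  then show ?thesis using pos by (simp only: mult_le_cancel_right_pos)
 qed
 define w' where "w' = z * real b ^ (m + M)"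
 have w': "w' = real A * (z * real \<beta>)" by (simp add: w'_def A_def \<beta>_def power_add)
 have sQ: "s = A * Q div (C * R)" by (simp add: s_def A_def Q_def C_def R_def Z_def K_def)
 have s1: "s * (C * R) <= A * Q" "A * Q < (s + 1) * (C * R)"
  using R4 dividend_less_div_times[of "C * R" "A * Q"] by (auto simp: sQ C_def)
 have CR: "0 < real C * real R" using pos by simp
 have "real (I * A + s) * (real C * real R) = real (I * A * C * R + s * (C * R))" by (simp add: algebra_simps)
 also have "... <= real (I * A * C * R + A * Q)" using s1 by (simp only: of_nat_le_iff add_left_mono)
 also have "... = real A * real (I * C * R + Q)" by (simp add: algebra_simps)
 also have "... <= real A * (real C * real R * (z * real \<beta>))" using lo by (intro mult_left_mono) auto
 also have "... = w' * (real C * real R)" by (simp add: w')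
 finally have L: "real (I * A + s) <= w'" using CR by (simp only: mult_le_cancel_right_pos)
 have "w' * (real C * real R) = real A * (real C * real R * (z * real \<beta>))" by (simp add: w')
 also have "... <= real A * real (I * C * R + Q + 2 * C)" using hi by (intro mult_left_mono) auto
 also have "... = real (I * A * C * R + A * Q + 2 * A * C)" by (simp add: algebra_simps)
 also have "... < real (I * A * C * R + (s + 1) * (C * R) + R * C)"
 proof -
  have "2 * A <= R" using M by (simp add: A_def R_def)
  then have "2 * A * C <= R * C" by (rule mult_le_mono1)
  then show ?thesis using s1(2) by (simp only: of_nat_less_iff)
 qed
 also have "... = real (I * A + s + 2) * (real C * real R)" by (simp add: algebra_simps)
 finally have U: "w' < real (I * A + s + 2)" using CR by (simp only: mult_less_cancel_right_pos)
 have "int (I * A + s) <= \<lfloor>w'\<rfloor>" using L by (simp add: le_floor_iff)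
 moreover have "\<lfloor>w'\<rfloor> < int (I * A + s + 2)" using U by (simp add: floor_less_iff)
 ultimately show ?thesis unfolding w'_def[symmetric] A_def[symmetric] by linarith
qed

text \<open>(j + 6)/j is 1 + 1/j + 5/j: the tolerance of \<open>good\<close> plus five uncontrolled
  digits, each of weight j * b <= M. The additive term in the last clause pays for a position N in
  the middle of a block, which spans at most 2^j + 5 digits.\<close>

definition fair :: "nat => nat => real => nat => nat => bool" where
 "fair j b z m m' \<longleftrightarrow> m <= m' \<and> (\<forall>d<b. j * b * dcount b d z m m' <= (j + 6) * (m' - m) \<and>
  (\<forall>N. m <= N \<and> N <= m' \<longrightarrow> j * b * dcount b d z m N <= (j + 6) * (N - m) + j * b * (2 ^ j + 5)))"

text \<open>Completed blocks obey the clean bound, so the additive error of a partial count is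
  incurred once, by the block that contains N, and does not accumulate.\<close>

lemma fair_trans:
 assumes "fair j b z m k" "fair j b z k m'"
 shows "fair j b z m m'"
 unfolding fair_def
proof (intro conjI allI impI)
 have le: "m <= k" "k <= m'" using assms by (auto simp: fair_def)
 then show "m <= m'" by simp
 fix d assume d: "d < b"
 have 1: "j * b * dcount b d z m k <= (j + 6) * (k - m)" using assms d by (simp add: fair_def)
 have "j * b * dcount b d z k m' <= (j + 6) * (m' - k)" using assms d by (simp add: fair_def)
 then have "j * b * dcount b d z m m' <= (j + 6) * (k - m) + (j + 6) * (m' - k)"
  using 1 dcount_split[OF le, of b d z] by (simp add: distrib_left)
 also have "... = (j + 6) * (m' - m)" using le by (simp only: add_mult_distrib2[symmetric]) simp
 finally show "j * b * dcount b d z m m' <= (j + 6) * (m' - m)" .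
 fix N assume N: "m <= N \<and> N <= m'"
 show "j * b * dcount b d z m N <= (j + 6) * (N - m) + j * b * (2 ^ j + 5)"
 proof (cases "N <= k")
  case True
  then show ?thesis using assms(1) d N unfolding fair_def by blast
 next
  case False
  then have kN: "k <= N" by simp
  have "j * b * dcount b d z k N <= (j + 6) * (N - k) + j * b * (2 ^ j + 5)"
   using assms(2) d N kN unfolding fair_def by blast
  then have "j * b * dcount b d z m N <= (j + 6) * (k - m) + (j + 6) * (N - k) + j * b * (2 ^ j + 5)"
   using 1 dcount_split[OF le(1) kN, of b d z] by (simp only: distrib_left)
  also have "(j + 6) * (k - m) + (j + 6) * (N - k) = (j + 6) * (N - m)" using le kN by (simp only: add_mult_distrib2[symmetric]) simp
  finally show ?thesis .
 qed
qed

lemma fair_leaf: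
 assumes j: "100 <= j" and b: "2 <= b" "b <= j + 1" and z: "0 <= z"
  and st: "st_ok b p n (2 ^ j) m I w" and ne: "near b m' (n + 2 ^ j)"
  and zy: "real (p * 2 ^ 2 ^ j + y) <= z * 2 ^ (n + 2 ^ j)" "z * 2 ^ (n + 2 ^ j) <= real (p * 2 ^ 2 ^ j + y + 1)"
  and y: "y < 2 ^ 2 ^ j" and ok: "ok1 (2 ^ 2 ^ j) j y b (val (fst w), val (snd w))"
 shows "fair j b z m m'"
proof -
 define M where "M = mlog b (2 ^ 2 ^ j div 4)"
 have sz: "12 * (j + 1) ^ 6 < M" "M <= 2 ^ j" "4 * b ^ M <= 2 ^ 2 ^ j" "(2::nat) ^ 2 ^ j < 4 * b ^ Suc M"
  using leaf_size[OF j b] by (auto simp: M_def)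
 have win: "m + M <= m'" "m' <= m + M + 5" using near_window[OF b(1) st_ok_near[OF st] ne sz(3,4)] by auto
 define s where "s = b ^ M * (val (fst w) * 2 ^ 2 ^ j + val (snd w) * y) div (2 ^ 2 ^ j * 2 ^ 2 ^ j * 2 ^ 2 ^ j)"
 have gd: "good b M j s" "good b M j (Suc s)" using ok by (auto simp: ok1_def Let_def s_def M_def)
 have j2: "2 <= (2::nat) ^ j" using j power_increasing[of 1 j "2::nat"] by simp
 have jb: "j * b <= M"
 proof -
  have "j * b <= (j + 1) * (j + 1)" using b by (intro mult_le_mono) auto
  also have "... = (j + 1) ^ 2" by (simp add: power2_eq_square)
  also have "... <= (j + 1) ^ 6" by (rule power_increasing) auto
  finally show ?thesis using sz(1) by linarith
 qed
 have b0: "0 < b" using b by simp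
 have cn: "j * b * dcount b d z m (m + M) <= (j + 1) * M" if d: "d < b" for d
 proof -
  have "nat \<lfloor>z * real b ^ (m + M)\<rfloor> = I * b ^ M + s \<or> nat \<lfloor>z * real b ^ (m + M)\<rfloor> = I * b ^ M + Suc s"
   using leaf_digits[OF st j2 sz(3) _ zy y] b unfolding s_def[symmetric] by (metis nat_int less_le_trans zero_less_numeral)
  moreover have "cnt b d M (I * b ^ M + s') = cnt b d M s'" for s'
   using cnt_mod[of b d M "I * b ^ M + s'"] cnt_mod[of b d M s'] b by simp
  ultimately have "dcount b d z m (m + M) = cnt b d M s \<or> dcount b d z m (m + M) = cnt b d M (Suc s)"
   unfolding dcount_cnt[OF z b0] by metis
  then show ?thesis using gd d unfolding good_def by metis
 qed
 show ?thesis unfolding fair_def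
 proof (intro conjI allI impI)
  show "m <= m'" using win by simp
  fix d assume d: "d < b"
  have "dcount b d z m m' <= dcount b d z m (m + M) + 5"
   using dcount_split[of m "m + M" m' b d z] dcount_le[of b d z "m + M" m'] win by simp
  then have "j * b * dcount b d z m m' <= j * b * (dcount b d z m (m + M) + 5)" by (rule mult_le_mono2)
  also have "... = j * b * dcount b d z m (m + M) + 5 * (j * b)" by (simp only: distrib_left mult.commute)
  also have "... <= (j + 1) * M + 5 * M" using cn[OF d] jb by (intro add_mono mult_le_mono2)
  also have "... = (j + 6) * M" by (simp add: algebra_simps)
  also have "... <= (j + 6) * (m' - m)" using win by (intro mult_le_mono2) simp
  finally show "j * b * dcount b d z m m' <= (j + 6) * (m' - m)" .
  fix N assume N: "m <= N \<and> N <= m'"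
  have "dcount b d z m N <= 2 ^ j + 5" using dcount_le[of b d z m N] N win sz(2) by linarith
  then show "j * b * dcount b d z m N <= (j + 6) * (N - m) + j * b * (2 ^ j + 5)" by (rule trans_le_add2[OF mult_le_mono2])
 qed
qed

lemma lvl_ok_bases:
 assumes "i < j"
 shows "lvl_ok (i + 2) (2 ^ k) (bases j [False, True] ! i) (levels (bases j [False, True]) k ! i)"
  "length (bases j [False, True] ! i) = i + 2" "length (levels (bases j [False, True]) k) = j"
proof -
 have v: "2 <= val bb" if "bb \<in> set (bases j [False, True])" for bb
  using that by (auto simp: in_set_conv_nth bases)
 show "lvl_ok (i + 2) (2 ^ k) (bases j [False, True] ! i) (levels (bases j [False, True]) k ! i)"
  using levels_ok[of "bases j [False, True]" k, OF v] assms by (auto simp: bases add.commute)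
 show "length (levels (bases j [False, True]) k) = j" using levels_ok[of "bases j [False, True]" k, OF v] by (simp add: bases)
 show "length (bases j [False, True] ! i) = i + 2" using assms by (simp add: bases)
qed

lemma size_facts:
 assumes "100 <= j" "b <= j + 1"
 shows "4 * b <= 2 ^ 2 ^ (j + t)" "2 * b <= 3 * 2 ^ (j + t)" "4 * b <= 2 ^ j"
proof -
 obtain U where U: "(j + 1) ^ 7 = U" by blast
 have "j + 1 <= U" unfolding U[symmetric] by (rule self_le_power) auto
 then show 1: "4 * b <= 2 ^ j" using power_beats_poly[OF assms(1), unfolded U] assms(2) by linarith
 have 2: "(2::nat) ^ j <= 2 ^ (j + t)" by (rule power_increasing) auto
 then show "2 * b <= 3 * 2 ^ (j + t)" using 1 by linarith
 have "(2::nat) ^ (j + t) < 2 ^ 2 ^ (j + t)" by (rule less_exp)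
 then show "4 * b <= 2 ^ 2 ^ (j + t)" using 1 2 by linarith
qed

text \<open>The clause 2^n <= b^(m+1) of the state makes the slope at least 1/b up to truncation.
  This yields R^2 <= 2 b K, the condition of \<open>card_bad_choices\<close> under which the fibres
  are small.\<close>

lemma leaf_ok:
 assumes j: "100 <= j" and l: "length sts = j" and st: "\<And>i. i < j ==> \<exists>m I. st_ok (i + 2) p n (2 ^ j) m I (sts ! i)"
 shows "val (leaf (2 ^ j) sts) < 2 ^ 2 ^ j"
  "i < j ==> ok1 (2 ^ 2 ^ j) j (val (leaf (2 ^ j) sts)) (i + 2) (val (fst (sts ! i)), val (snd (sts ! i)))"
proof -
 define R :: nat where "R = 2 ^ 2 ^ j"
 define vs where "vs = map (%w. (val (fst w), val (snd w))) sts"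
 have C: "(2::nat) ^ (2 * 2 ^ j) = R * R" by (simp add: R_def power_add[symmetric] mult_2)
 have v: "fst (vs ! i) < R * R \<and> snd (vs ! i) <= R * R \<and> R * R <= 2 * (i + 2) * snd (vs ! i)" if i: "i < j" for i
 proof -
  obtain m I where ok: "st_ok (i + 2) p n (2 ^ j) m I (sts ! i)" using st[OF i] by blast
  define K where "K = val (snd (sts ! i))"
  have len: "length (fst (sts ! i)) <= 2 * 2 ^ j" "length (snd (sts ! i)) <= 2 * 2 ^ j" using ok by (auto simp: st_ok_def)
  have "R * R * (i + 2) ^ m <= (K + 2) * 2 ^ n" using ok by (simp only: st_ok_def C K_def)
  also have "... <= (K + 2) * (i + 2) ^ Suc m" using ok by (intro mult_le_mono2) (simp only: st_ok_def)
  finally have "(i + 2) ^ m * (R * R) <= (i + 2) ^ m * ((K + 2) * (i + 2))" by (simp only: power_Suc ac_simps)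
  then have "R * R <= (K + 2) * (i + 2)" by (subst (asm) mult_le_cancel1) simp
  then have 1: "R * R <= (i + 2) * K + 2 * (i + 2)" by (simp add: algebra_simps)
  have "4 * (i + 2) <= R" using size_facts(1)[OF j, of "i + 2" 0] i by (simp add: R_def)
  also have "... <= R * R" by (simp add: R_def)
  finally have "R * R <= 2 * ((i + 2) * K)" using 1 by linarith
  then show ?thesis using i l val_less_power[OF len(1)] val_less_power[OF len(2)]
   by (simp add: vs_def C K_def mult.assoc less_imp_le)
 qed
 obtain y where y: "y < R" "okall R j y 2 vs" using leaf_exists[OF j _ R_def v] l by (auto simp: vs_def)
 have lf: "val (leaf (2 ^ j) sts) = srch R j vs R"
  using srch_less[of R R j vs] l by (simp add: leaf_def nbits vs_def R_def)
 show "val (leaf (2 ^ j) sts) < 2 ^ 2 ^ j" using srch_less[of R R j vs] unfolding lf by (simp add: R_def)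
 show "ok1 (2 ^ 2 ^ j) j (val (leaf (2 ^ j) sts)) (i + 2) (val (fst (sts ! i)), val (snd (sts ! i)))" if "i < j"
  using srch_ok[OF y] that l unfolding lf okall_iff R_def[symmetric] by (auto simp: vs_def add.commute)
qed

text \<open>The end position m' is left open up to \<open>near\<close>: for a left half it is the
  exponent in the state of the right half, for the root it is where the next stage starts. This is
  what makes the intervals of digits fit together without gaps.\<close>

lemma solve_fair:
 fixes z :: real
 assumes j: "100 <= j" and z: "0 <= z"
 shows "length sts = j ==> (\<And>i. i < j ==> \<exists>m I. st_ok (i + 2) p n (2 ^ (j + t)) m I (sts ! i)) ==>
  y = val (solve (2 ^ j) (take t (tl (tower (bases j [False, True]) (j + t)))) sts) ==>
  real (p * 2 ^ 2 ^ (j + t) + y) <= z * 2 ^ (n + 2 ^ (j + t)) ==>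
  z * 2 ^ (n + 2 ^ (j + t)) <= real (p * 2 ^ 2 ^ (j + t) + y + 1) ==>
  i < j ==> st_ok (i + 2) p n (2 ^ (j + t)) m I (sts ! i) ==> near (i + 2) m' (n + 2 ^ (j + t)) ==>
  fair j (i + 2) z m m'"
proof (induction t arbitrary: sts p n y m I m')
 case 0
 have ya: "y = val (leaf (2 ^ j) sts)" using 0 by simp
 have st: "\<exists>m I. st_ok (i + 2) p n (2 ^ j) m I (sts ! i)" if "i < j" for i using 0(2)[OF that] by simp
 show ?case
  by (rule fair_leaf[OF j, where y = y and w = "sts ! i"])
   (use 0 z leaf_ok[OF j 0(1) st] in \<open>auto simp: ya\<close>)
next
 case (Suc t)
 define bbs where "bbs = bases j [False, True]"
 define h :: nat where "h = 2 ^ (j + t)"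
 define lv where "lv = levels bbs (j + t)"
 define tab where "tab = take t (tl (tower bbs (j + t)))"
 define y1 where "y1 = solve (2 ^ j) tab (map (lft h) sts)"
 define s2 where "s2 = map (rgt (j + t) h y1) (zip lv sts)"
 define y2 where "y2 = solve (2 ^ j) tab s2"
 define H :: nat where "H = 2 ^ h"
 have hh: "2 ^ (j + Suc t) = 2 * h" by (simp add: h_def)
 have tb: "take (Suc t) (tl (tower bbs (j + Suc t))) = (j + t, h, lv) # tab" unfolding tower_take by (simp add: h_def lv_def tab_def)
 have y: "y = val (y2 @ y1)" using Suc.prems(3) unfolding bbs_def[symmetric] tb
  by (simp add: Let_def y1_def y2_def s2_def)
 have ltab: "length tab = t"
 proof -
  have "length (tower bbs k) = Suc k" for k by (induction k) (auto simp: Let_def)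
  then show ?thesis by (simp add: tab_def)
 qed
 have ly: "length y1 = h" "length y2 = h" by (simp_all add: y1_def y2_def length_solve ltab h_def power_add)
 have yv: "y = val y2 + H * val y1" by (simp add: y ly H_def)
 have v2: "val y2 < H" using val_less[of y2] by (simp add: ly H_def)
 have H: "real H > 0" "2 ^ (2 * h) = H * H" by (auto simp: H_def power_add[symmetric] mult_2)
 have llv: "length lv = j" using lvl_ok_bases(3)[OF Suc.prems(6)] by (simp add: lv_def bbs_def)
 have right: "\<exists>m1 I1. st_ok (i + 2) (p * H + val y1) (n + h) h m1 I1 (s2 ! i)"
  if i: "i < j" and st: "st_ok (i + 2) p n (2 * h) m I (sts ! i)" for i m I
 proof -
  have "s2 ! i = rgt (j + t) h y1 (lv ! i, sts ! i)" using i llv Suc.prems(1) by (simp add: s2_def)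
  then show ?thesis
   using st_ok_rgt[OF h_def st lvl_ok_bases(1)[OF i, of "j + t", folded h_def bbs_def lv_def], where y = y1]
    size_facts(1,2)[OF j, of "i + 2" t] i ly lvl_ok_bases(2)[OF i] by (simp add: H_def h_def bbs_def)
 qed
 define W where "W = z * 2 ^ (n + h)"
 have W2: "z * 2 ^ (n + 2 * h) = W * real H" by (simp add: W_def H_def power_add mult_2)
 have zz: "real ((p * H + val y1) * H + val y2) <= W * real H" "W * real H <= real ((p * H + val y1) * H + val y2 + 1)"
  using Suc.prems(4,5) unfolding hh H(2) W2 yv by (simp_all add: algebra_simps)
 have zl: "real (p * H + val y1) <= W" "W <= real (p * H + val y1 + 1)"
 proof -
  have "real (p * H + val y1) * real H <= real ((p * H + val y1) * H + val y2)" by simp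
  then have "real (p * H + val y1) * real H <= W * real H" using zz by linarith
  then show "real (p * H + val y1) <= W" using H by (simp only: mult_le_cancel_right_pos)
  have "(p * H + val y1) * H + val y2 + 1 <= (p * H + val y1 + 1) * H" using v2 by simp
  then have "real ((p * H + val y1) * H + val y2 + 1) <= real ((p * H + val y1 + 1) * H)" by (simp only: of_nat_le_iff)
  then have "W * real H <= real (p * H + val y1 + 1) * real H" using zz by (simp only: of_nat_mult)
  then show "W <= real (p * H + val y1 + 1)" using H by (simp only: mult_le_cancel_right_pos)
 qed
 note i = Suc.prems(6)
 have st: "st_ok (i + 2) p n (2 * h) m I (sts ! i)" using Suc.prems(7) by (simp only: hh)
 have sts: "\<exists>m I. st_ok (i + 2) p n (2 * h) m I (sts ! i)" if "i < j" for i using Suc.prems(2)[OF that] by (simp only: hh)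
 obtain m1 I1 where r1: "st_ok (i + 2) (p * H + val y1) (n + h) h m1 I1 (s2 ! i)" using right[OF i st] by blast
 note defs = h_def tab_def bbs_def
 have "length (map (lft h) sts) = j" using Suc.prems(1) by simp
 moreover have "\<exists>m I. st_ok (k + 2) p n h m I (map (lft h) sts ! k)" if "k < j" for k
  using sts[OF that] st_ok_lft that Suc.prems(1) by fastforce
 moreover have "val y1 = val (solve (2 ^ j) tab (map (lft h) sts))" by (simp only: y1_def)
 moreover have "real (p * 2 ^ h + val y1) <= z * 2 ^ (n + h)" "z * 2 ^ (n + h) <= real (p * 2 ^ h + val y1 + 1)"
  using zl by (simp_all add: H_def W_def)
 moreover have "st_ok (i + 2) p n h m I (map (lft h) sts ! i)" using st_ok_lft[OF st] i Suc.prems(1) by simp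
 moreover have "near (i + 2) m1 (n + h)" by (rule st_ok_near[OF r1])
 ultimately have 1: "fair j (i + 2) z m m1" using i unfolding defs by (intro Suc.IH) assumption+
 have "length s2 = j" using Suc.prems(1) llv by (simp add: s2_def)
 moreover have "\<exists>m I. st_ok (k + 2) (p * H + val y1) (n + h) h m I (s2 ! k)" if "k < j" for k
  using sts[OF that] right[OF that] by blast
 moreover have "val y2 = val (solve (2 ^ j) tab s2)" by (simp only: y2_def)
 moreover have nh: "n + h + h = n + 2 * h" by simp
 moreover have "real ((p * H + val y1) * 2 ^ h + val y2) <= z * 2 ^ (n + h + h)"
  "z * 2 ^ (n + h + h) <= real ((p * H + val y1) * 2 ^ h + val y2 + 1)"
  using zz unfolding nh W2 H_def by simp_all
 moreover have "near (i + 2) m' (n + h + h)" using Suc.prems(8) unfolding nh hh .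
 ultimately have 2: "fair j (i + 2) z m1 m'" using i r1 unfolding defs by (intro Suc.IH) assumption+
 show ?case by (rule fair_trans[OF 1 2])
qed

section \<open>Cost of the algorithm\<close>

lemma cmp_zero: "cmp (%_. True) zero (%x. length x)"
 apply (rule cmp_rec1'[where p = "%x. x = []" and base = "%x. True" and s = tl
  and post = "%y. snd y \<and> \<not> hd (fst y)" and W = "%_. 0" and K = 1])
 subgoal for x by (cases x) (auto simp: zero_def)
 subgoal by simp
 apply (rule cmp_intros | simp; fail)+
 done

lemmas [cmp_intros] = true_app[OF cmp_zero, unfolded fst_conv snd_conv]

lemma cmp_mlog: "cmp (%_. True) (%x. mlog (fst x) (snd x)) (%x. 8 * snd x + fst x)"
 apply (rule cmp_rec1'[where p = "%x. fst x < 2 \<or> snd x < fst x" and base = "%x. 0" and s = "%x. (fst x, snd x div fst x)"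
  and post = "%y. Suc (snd y)" and W = "%x. snd x + fst x" and K = 10])
 subgoal for x using mlog.simps[of "fst x" "snd x"] by simp
 subgoal by simp
 apply (rule cmp_intros)+
 subgoal by simp
 subgoal by simp
 subgoal by simp
 subgoal by simp
 subgoal by simp
 subgoal for x
 proof -
  assume a: "\<not> (fst x < 2 \<or> snd x < fst x)"
  obtain q where q: "snd x div fst x = q" by blast
  have "2 * q <= fst x * q" using a by (intro mult_le_mono1) simp
  also have "... <= snd x" unfolding q[symmetric] by simp
  finally show ?thesis using a by (simp add: q)
 qed
 done

lemmas [cmp_intros] = true_app2[OF cmp_mlog, unfolded fst_conv snd_conv]

lemma cmp_cnt: "cmp (%_. True) (%x. cnt (arg1 x) (arg2 x) (arg3 x) (rst4 x)) (%x. arg3 x * (rst4 x + arg1 x + arg2 x + 1))"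
 apply (rule cmp_rec1'[where p = "%x. arg3 x = 0" and base = "%x. 0" and s = "%x. (arg1 x, arg2 x, arg3 x - Suc 0, rst4 x div arg1 x)"
  and post = "%y. if rst4 (fst y) mod arg1 (fst y) <= arg2 (fst y) \<and> arg2 (fst y) <= rst4 (fst y) mod arg1 (fst y) then Suc (snd y) else snd y"
  and W = "%x. if arg3 x = 0 then 0 else rst4 x + arg1 x + arg2 x" and K = 10])
 subgoal for x by (cases "arg3 x") auto
 subgoal by simp
 apply (rule cmp_intros)+
 subgoal by simp
 subgoal by simp
 subgoal by simp
 subgoal for x
 proof -
  have "rst4 x mod arg1 x <= rst4 x" by (rule mod_less_eq_dividend)
  then obtain r where "rst4 x mod arg1 x = r" "r <= rst4 x" by blast
  then show "arg3 x \<noteq> 0 ==> ?thesis" by simp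
 qed
 subgoal by simp
 subgoal for x
 proof -
  assume "arg3 x \<noteq> 0"
  then obtain n where n: "arg3 x = Suc n" by (cases "arg3 x") auto
  have "rst4 x div arg1 x <= rst4 x" by (rule div_le_dividend)
  then have "n * (rst4 x div arg1 x + arg1 x + arg2 x + 1) <= n * (rst4 x + arg1 x + arg2 x + 1)" by (intro mult_le_mono2) simp
  then show ?thesis by (simp add: n)
 qed
 done

lemmas cmp_cnt' = cmp_app[OF cmp_cnt cmp_Pair[OF _ cmp_Pair[OF _ cmp_Pair]] TrueI, unfolded fst_conv snd_conv]

text \<open>The quantifier over digits is computed by recursion on its upper limit, kept apart from
  the base, which stays fixed.\<close>

lemma cmp_good_upto:
 "cmp (%x. arg1 x <= arg2 x) (%x. \<forall>d<arg1 x. arg4 x * arg2 x * cnt (arg2 x) d (arg3 x) (rst5 x) <= (arg4 x + 1) * arg3 x)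
  (%x. (arg1 x + 1) * ((arg2 x + arg3 x + arg4 x + rst5 x + 2) ^ 3 + 1))"
proof -
 let ?A = "%x. arg2 x + arg3 x + arg4 x + rst5 x + 2"
 let ?c = "%x. arg4 x * arg2 x * cnt (arg2 x) (arg1 x - Suc 0) (arg3 x) (rst5 x) <= (arg4 x + 1) * arg3 x"
 have c: "cmp (%x. arg1 x <= arg2 x) ?c (%x. ?A x ^ 3)"
  apply (rule cmp_le'[where K = 10])
  apply (rule cmp_intros cmp_cnt')+
  subgoal for x
  proof -
   assume "arg1 x <= arg2 x"
   moreover obtain b M B s d where x: "x = (d, b, M, B, s)" by (cases x) auto
   ultimately have d: "d <= b" by simp
   define A where "A = b + M + B + s + 2"
   have cn: "cnt b (d - Suc 0) M s + 1 <= A" "cnt b (d - Suc 0) M s <= A" using cnt_le[of b "d - Suc 0" M s] by (auto simp: A_def)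
   have AA: "A * A <= A ^ 3" by (simp add: power3_eq_cube A_def)
   have A3: "A <= A * A * A" by (simp add: A_def)
   have "B * (b + 1) <= A * A" "(B + 1) * (M + 1) <= A * A" "M * (s + b + (d - Suc 0) + 1) <= A * (2 * A)"
    using d by (intro mult_le_mono; simp add: A_def)+
   moreover have "A * (2 * A) = 2 * (A * A)" by simp
   moreover have "B * b * (cnt b (d - Suc 0) M s + 1) <= A * A * A" "B * b * cnt b (d - Suc 0) M s <= A * A * A"
    using cn by (intro mult_le_mono; simp add: A_def)+
   moreover have "B <= A" by (simp add: A_def)
   moreover obtain x1 x2 x3 x4 x5 x6 where X: "B * (b + 1) = x1" "(B + 1) * (M + 1) = x2" "M * (s + b + (d - Suc 0) + 1) = x3"
    "B * b * (cnt b (d - Suc 0) M s + 1) = x4" "B * b * cnt b (d - Suc 0) M s = x5" "A * A * A = x6" by blast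
   ultimately show ?thesis using AA A3 unfolding x fst_conv snd_conv power3_eq_cube A_def[symmetric] X by simp
  qed
  done
 have c': "cmp (%y. arg1 (fst y) <= arg2 (fst y) \<and> arg1 (fst y) \<noteq> 0 \<and> snd y = h y) (%y. ?c (fst y)) (%y. ?A (fst y) ^ 3)" for h :: "_ => bool"
  by (rule cmp_le[where K = 1 and D = "%y. arg1 (fst y) <= arg2 (fst y)"], rule cmp_app[OF c cmp_fst[OF cmp_id]]) auto
 show ?thesis
  apply (rule cmp_rec1'[where p = "%x. arg1 x = 0" and base = "%x. True" and s = "%x. (arg1 x - Suc 0, snd x)"
   and post = "%y. ?c (fst y) \<and> snd y" and W = "%x. ?A x ^ 3" and K = 1])
  subgoal for x by (cases "arg1 x") (auto simp: All_less_Suc)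
  subgoal by simp
  apply (rule c' cmp_intros)+
  subgoal by simp
  subgoal by simp
  subgoal by simp
  subgoal by simp
  subgoal by simp
  subgoal for x by (cases "arg1 x") (auto simp: algebra_simps)
  done
qed

lemma cmp_good: "cmp (%_. True) (%x. good (arg1 x) (arg2 x) (arg3 x) (rst4 x))
  (%x. (arg1 x + 1) * ((arg1 x + arg2 x + arg3 x + rst4 x + 2) ^ 3 + 1))"
 unfolding good_def
 apply (rule cmp_le'[where K = 1])
 apply (rule cmp_app[OF cmp_good_upto, of _ "%x. (arg1 x, x)", unfolded fst_conv snd_conv])
  apply (rule cmp_intros)+
 by auto

abbreviation leaf_dom :: "nat => nat => nat => nat => nat \<times> nat => bool" where
 "leaf_dom R B y b v \<equiv> 4 <= R \<and> B <= R \<and> y <= R \<and> 2 <= b \<and> b <= R \<and> fst v <= R * R \<and> snd v <= R * R"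

text \<open>The arithmetic is unary, with numbers up to order R^4. \<open>good\<close> is charged
  the cube of that for each of at most R digits, hence the exponent 3 * 4 + 1.\<close>

lemma cmp_ok1: "cmp (%x. leaf_dom (arg1 x) (arg2 x) (arg3 x) (arg4 x) (rst5 x))
 (%x. ok1 (arg1 x) (arg2 x) (arg3 x) (arg4 x) (rst5 x)) (%x. arg1 x ^ 13)"
proof -
 let ?D = "%x. leaf_dom (arg1 x) (arg2 x) (arg3 x) (arg4 x) (rst5 x)"
 let ?M = "%x. mlog (arg4 x) (arg1 x div 4)"
 let ?E = "%q. ?D (fst q) \<and> snd q = ?M (fst q)"
 let ?n = "%q. arg4 (fst q) ^ snd q * (fst (rst5 (fst q)) * arg1 (fst q) + snd (rst5 (fst q)) * arg3 (fst q))"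
 let ?s = "%q. ?n q div (arg1 (fst q) * arg1 (fst q) * arg1 (fst q))"
 let ?G = "%q. \<exists>R. 4 <= R \<and> snd q = R \<and> arg1 (fst q) <= R \<and> arg2 (fst q) <= R \<and> arg3 (fst q) <= R \<and> rst4 (fst q) <= 2 * R ^ 4 + 1"
 have M: "b ^ mlog b (R div 4) <= R" "mlog b (R div 4) <= R" if "4 <= R" "2 <= b" for b R
 proof -
  have "0 < R div 4" using that by simp
  then have 1: "b ^ mlog b (R div 4) <= R div 4" using mlog_bounds[OF that(2)] by blast
  then show "b ^ mlog b (R div 4) <= R" by simp
  have "mlog b (R div 4) < b ^ mlog b (R div 4)" using that(2) by (intro power_gt_expt) auto
  then show "mlog b (R div 4) <= R" using 1 by simp
 qed
 have R4: "R <= R ^ 4" "R * R <= R ^ 4" "R * R * R <= R ^ 4" "1 <= R ^ 4" if "4 <= R" for R :: nat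
 proof -
  have "R ^ 1 <= R ^ 4" "R ^ 2 <= R ^ 4" "R ^ 3 <= R ^ 4" "R ^ 0 <= R ^ 4" using that by (intro power_increasing; simp)+
  then show "R <= R ^ 4" "R * R <= R ^ 4" "R * R * R <= R ^ 4" "1 <= R ^ 4" by (simp_all add: power2_eq_square power3_eq_cube)
 qed
 have g1: "cmp ?D (%x. (x, ?M x)) (%x. arg1 x)"
  apply (rule cmp_le'[where K = 20])
  apply (rule cmp_intros)+
  subgoal for x
  proof -
   obtain q where q: "arg1 x div 4 = q" by blast
   have "q <= arg1 x" unfolding q[symmetric] by (rule div_le_dividend)
   then show "?D x ==> ?thesis" unfolding q by simp
  qed
  done
 have num: "?n q <= 2 * arg1 (fst q) ^ 4" if E: "?E q" for q
 proof -
  obtain R B y b o1 k1 m where q: "q = ((R, B, y, b, o1, k1), m)" by (cases q) auto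
  have h: "o1 <= R * R" "k1 <= R * R" "y <= R" "b ^ m <= R" using E M[of R b] unfolding q by auto
  have "o1 * R <= R * R * R" "k1 * y <= R * R * R" using h by (intro mult_le_mono; simp)+
  then have "o1 * R + k1 * y <= 2 * (R * R * R)" by linarith
  then have "b ^ m * (o1 * R + k1 * y) <= R * (2 * (R * R * R))" by (rule mult_le_mono[OF h(4)])
  then show ?thesis unfolding q by (simp add: power4_eq_xxxx)
 qed
 have g2: "cmp ?E (%q. ((arg4 (fst q), snd q, arg2 (fst q), ?s q), arg1 (fst q))) (%q. arg1 (fst q) ^ 4)"
  apply (rule cmp_le'[where K = 60])
  apply (rule cmp_intros)+
  subgoal for q
  proof -
   assume E: "?E q"
   obtain R B y b o1 k1 m where q: "q = ((R, B, y, b, o1, k1), m)" by (cases q) auto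
   have h: "4 <= R" "o1 <= R * R" "k1 <= R * R" "y <= R" "b <= R" "b ^ m <= R" "m <= R" using E M[of R b] unfolding q by auto
   note r = R4[OF h(1)]
   define U where "U = R ^ 4"
   have U3: "R * R * (2 * R) = 2 * (R * R * R)" "R * (5 * R) = 5 * (R * R)" "R * (2 * R) = 2 * (R * R)" "R * (3 * (R * R * R)) = 3 * U"
    by (simp_all add: U_def power4_eq_xxxx)
   have o: "o1 * R <= R * R * R" "k1 * y <= R * R * R" using h by (intro mult_le_mono; simp)+
   have "1 <= R * R * R" using h by (simp add: Suc_le_eq)
   then have "o1 * R + k1 * y + 1 <= 3 * (R * R * R)" using o by linarith
   then have n': "b ^ m * (o1 * R + k1 * y + 1) <= R * (3 * (R * R * R))" using h by (intro mult_le_mono) auto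
   have t: "m * (b ^ m + b + 3) <= R * (5 * R)" "o1 * (R + 1) <= R * R * (2 * R)" "k1 * (y + 1) <= R * R * (2 * R)"
    "R * (R + 1) <= R * (2 * R)" "R * R * (R + 1) <= R * R * (2 * R)"
    using h by (intro mult_le_mono; simp)+
   have nn: "b ^ m * (o1 * R + k1 * y) <= 2 * U" using num[OF E] unfolding q U_def by simp
   obtain x1 x2 x3 x4 x5 x6 x7 where x: "m * (b ^ m + b + 3) = x1" "o1 * (R + 1) = x2" "k1 * (y + 1) = x3" "R * (R + 1) = x4" "R * R * (R + 1) = x5"
    "b ^ m * (o1 * R + k1 * y + 1) = x6" "b ^ m * (o1 * R + k1 * y) = x7" by blast
   obtain z1 z2 where z: "o1 * R = z1" "R * R * R = z2" by blast
   have "x1 <= 5 * U" "x2 <= 2 * U" "x3 <= 2 * U" "x4 <= 2 * U" "x5 <= 2 * U" "x6 <= 3 * U" "x7 <= 2 * U" "z1 <= U" "z2 <= U" "1 <= U"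
    using t n' nn r o(1) unfolding U3 unfolding x unfolding z U_def[symmetric] by linarith+
   then show ?thesis unfolding q fst_conv snd_conv unfolding x unfolding z U_def[symmetric] by simp
  qed
  done
 have gd: "cmp ?G (%q. good (arg1 (fst q)) (arg2 (fst q)) (arg3 (fst q)) (rst4 (fst q)) \<and>
   good (arg1 (fst q)) (arg2 (fst q)) (arg3 (fst q)) (Suc (rst4 (fst q)))) (%q. snd q ^ 13)"
 proof -
  have bd: "(b + 1) * ((b + m + B + s + 2) ^ 3 + 1) <= 2000 * R ^ 13"
   if "4 <= R" "b <= R" "m <= R" "B <= R" "s <= 2 * R ^ 4 + 2" for R b m B s :: nat
  proof -
   have "b + m + B + s + 2 <= 9 * R ^ 4" using that R4[OF that(1)] by linarith
   then have "(b + m + B + s + 2) ^ 3 <= (9 * R ^ 4) ^ 3" by (rule power_mono) simp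
   also have "... = 729 * R ^ 12" by (simp add: power_mult_distrib power_mult[symmetric])
   finally have "(b + m + B + s + 2) ^ 3 + 1 <= 730 * R ^ 12" using that(1) one_le_power[of R 12] by linarith
   moreover have "b + 1 <= 2 * R" using that by simp
   ultimately have "(b + 1) * ((b + m + B + s + 2) ^ 3 + 1) <= (2 * R) * (730 * R ^ 12)" by (intro mult_le_mono)
   also have "... = 1460 * R ^ 13" by (simp add: power_Suc[of R 12, simplified] del: power_Suc)
   finally show ?thesis by linarith
  qed
  show ?thesis
   apply (rule cmp_le'[where K = 5000])
   apply (rule cmp_and)
    apply (rule cmp_app[OF cmp_good cmp_fst[OF cmp_id]], simp)
   apply (rule cmp_app[OF cmp_good, of _ "%q. (arg1 (fst q), arg2 (fst q), arg3 (fst q), Suc (rst4 (fst q)))", unfolded fst_conv snd_conv])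
    apply (rule cmp_intros)+
   apply simp
   subgoal for q
   proof -
    assume "?G q"
    then obtain R where R: "4 <= R" "snd q = R" "arg1 (fst q) <= R" "arg2 (fst q) <= R" "arg3 (fst q) <= R" "rst4 (fst q) <= 2 * R ^ 4 + 1" by blast
    have 1: "(arg1 (fst q) + 1) * ((arg1 (fst q) + arg2 (fst q) + arg3 (fst q) + rst4 (fst q) + 2) ^ 3 + 1) <= 2000 * R ^ 13"
     by (rule bd) (use R in auto)
    have 2: "(arg1 (fst q) + 1) * ((arg1 (fst q) + arg2 (fst q) + arg3 (fst q) + Suc (rst4 (fst q)) + 2) ^ 3 + 1) <= 2000 * R ^ 13"
     by (rule bd) (use R in auto)
    obtain u v U where u: "(arg1 (fst q) + 1) * ((arg1 (fst q) + arg2 (fst q) + arg3 (fst q) + rst4 (fst q) + 2) ^ 3 + 1) = u"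
     "(arg1 (fst q) + 1) * ((arg1 (fst q) + arg2 (fst q) + arg3 (fst q) + Suc (rst4 (fst q)) + 2) ^ 3 + 1) = v" "R ^ 13 = U" by blast
    show ?thesis using 1 2 unfolding R(2) u by simp
   qed
   done
 qed
 have fin: "?G ((arg4 x, ?M x, arg2 x, ?s (x, ?M x)), arg1 x)" if "?D x" for x
 proof -
  have "?s (x, ?M x) <= ?n (x, ?M x)" by (rule div_le_dividend)
  also have "... <= 2 * arg1 x ^ 4" using num[of "(x, ?M x)"] that by simp
  finally show ?thesis using that M(2)[of "arg1 x" "arg4 x"] by auto
 qed
 have "cmp ?D (%x. (%q. ((arg4 (fst q), snd q, arg2 (fst q), ?s q), arg1 (fst q))) (x, ?M x)) (%x. arg1 x + arg1 x ^ 4)"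
  using cmp_app[OF g2 g1] by simp
 from cmp_app[OF gd this] fin
 have "cmp ?D (%x. ok1 (arg1 x) (arg2 x) (arg3 x) (arg4 x) (rst5 x)) (%x. arg1 x + arg1 x ^ 4 + arg1 x ^ 13)"
  by (simp add: ok1_def Let_def)
 then show ?thesis
  apply (rule cmp_le'[where K = 3])
  subgoal for x
  proof -
   assume "?D x"
   then have "arg1 x ^ 1 <= arg1 x ^ 13" "arg1 x ^ 4 <= arg1 x ^ 13" by (intro power_increasing; simp)+
   then show ?thesis unfolding power_one_right by simp
  qed
  done
qed

lemma cmp_okall: "cmp (%x. (\<forall>v\<in>set (rst5 x). leaf_dom (arg1 x) (arg2 x) (arg3 x) (arg4 x) v) \<and> arg4 x + length (rst5 x) <= arg1 x + 1)
 (%x. okall (arg1 x) (arg2 x) (arg3 x) (arg4 x) (rst5 x)) (%x. length (rst5 x) * (arg1 x ^ 13 + 1))" (is "cmp ?D ?F ?S")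
proof -
 let ?s = "%x. (arg1 x, arg2 x, arg3 x, Suc (arg4 x), tl (rst5 x))"
 let ?W = "%x. if rst5 x = [] then 0 else arg1 x ^ 13"
 let ?E = "%y. ?D (fst y) \<and> rst5 (fst y) \<noteq> [] \<and> snd y = ?F (?s (fst y))"
 have o1: "cmp ?E (%y. ok1 (arg1 (fst y)) (arg2 (fst y)) (arg3 (fst y)) (arg4 (fst y)) (hd (rst5 (fst y)))) (%y. arg1 (fst y) ^ 13)"
  apply (rule cmp_le'[where K = 1])
  apply (rule cmp_app[OF cmp_ok1, of _ "%y. (arg1 (fst y), arg2 (fst y), arg3 (fst y), arg4 (fst y), hd (rst5 (fst y)))", unfolded fst_conv snd_conv])
   apply (rule cmp_intros | simp; fail)+
  subgoal for y by (cases "rst5 (fst y)") auto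
  by simp
 have po: "cmp ?E
  (%y. ok1 (arg1 (fst y)) (arg2 (fst y)) (arg3 (fst y)) (arg4 (fst y)) (hd (rst5 (fst y))) \<and> snd y) (%y. ?W (fst y))"
  apply (rule cmp_le'[where K = 1])
  apply (rule o1 cmp_intros)+
  by simp
 show ?thesis
 proof (rule cmp_rec1[where p = "%x. rst5 x = []" and base = "%x. True" and s = ?s, OF _ _ _ _ _ po])
  fix x :: "nat \<times> nat \<times> nat \<times> nat \<times> (nat \<times> nat) list"
  show "?F x = (if rst5 x = [] then True else ok1 (arg1 (fst (x, ?F (?s x)))) (arg2 (fst (x, ?F (?s x)))) (arg3 (fst (x, ?F (?s x)))) (arg4 (fst (x, ?F (?s x)))) (hd (rst5 (fst (x, ?F (?s x))))) \<and> snd (x, ?F (?s x)))"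
   by (cases "rst5 x") auto
  assume D: "?D x"
  show "?D (?s x)" if "rst5 x \<noteq> []" using D that by (cases "rst5 x"; cases "tl (rst5 x)") auto
  show "?W x + ?S (?s x) + 1 <= ?S x" if "rst5 x \<noteq> []" using that by (cases "rst5 x") auto
 qed ((rule cmp_le'[where K = 1], (rule cmp_intros)+, force) | force)+
qed

lemma cmp_srch: "cmp (%x. 4 <= arg1 x \<and> arg2 x <= arg1 x \<and> rst4 x <= arg1 x \<and> length (arg3 x) + 1 <= arg1 x \<and>
  (\<forall>v\<in>set (arg3 x). fst v <= arg1 x * arg1 x \<and> snd v <= arg1 x * arg1 x))
 (%x. srch (arg1 x) (arg2 x) (arg3 x) (rst4 x)) (%x. rst4 x * (length (arg3 x) * (arg1 x ^ 13 + 1) + 1))" (is "cmp ?D ?F ?S")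
proof -
 let ?s = "%x. (arg1 x, arg2 x, arg3 x, rst4 x - Suc 0)"
 let ?W = "%x. if rst4 x = 0 then 0 else length (arg3 x) * (arg1 x ^ 13 + 1)"
 let ?E = "%y. ?D (fst y) \<and> rst4 (fst y) \<noteq> 0 \<and> snd y = ?F (?s (fst y))"
 have o1: "cmp ?E (%y. okall (arg1 (fst y)) (arg2 (fst y)) (rst4 (fst y) - Suc 0) 2 (arg3 (fst y))) (%y. length (arg3 (fst y)) * (arg1 (fst y) ^ 13 + 1))"
  apply (rule cmp_le'[where K = 1])
  apply (rule cmp_app[OF cmp_okall, of _ "%y. (arg1 (fst y), arg2 (fst y), rst4 (fst y) - Suc 0, 2, arg3 (fst y))", unfolded fst_conv snd_conv])
   apply (rule cmp_intros)+
  subgoal for y by auto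
  by simp
 have po: "cmp ?E
  (%y. if okall (arg1 (fst y)) (arg2 (fst y)) (rst4 (fst y) - Suc 0) 2 (arg3 (fst y)) then rst4 (fst y) - Suc 0 else snd y) (%y. ?W (fst y))"
  apply (rule cmp_le'[where K = 1])
  apply (rule o1 cmp_intros)+
  by simp
 show ?thesis
 proof (rule cmp_rec1[where p = "%x. rst4 x = 0" and base = "%x. 0" and s = ?s, OF _ _ _ _ _ po])
  fix x :: "nat \<times> nat \<times> (nat \<times> nat) list \<times> nat"
  show "?F x = (if rst4 x = 0 then 0 else if okall (arg1 (fst (x, ?F (?s x)))) (arg2 (fst (x, ?F (?s x)))) (rst4 (fst (x, ?F (?s x))) - Suc 0) 2 (arg3 (fst (x, ?F (?s x)))) then rst4 (fst (x, ?F (?s x))) - Suc 0 else snd (x, ?F (?s x)))"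
   by (cases "rst4 x") auto
  show "?W x + ?S (?s x) + 1 <= ?S x" if "rst4 x \<noteq> 0" using that by (cases "rst4 x") auto
 qed ((rule cmp_le'[where K = 1], (rule cmp_intros)+, force) | force)+
qed

lemma cmp_val: "cmp (%_. True) val (%x. 2 * 2 ^ length x)"
 apply (rule cmp_rec1'[where p = "%x. x = []" and base = "%x. 0" and s = tl
  and post = "%y. if hd (fst y) then Suc (snd y + snd y) else snd y + snd y" and W = "%x. 2 ^ length (tl x)" and K = 3])
 subgoal for x by (cases x) auto
 subgoal by simp
 apply (rule cmp_intros | simp; fail)+
 subgoal for x using val_less[of "tl x"] by simp
 subgoal by simp
 subgoal for x by (cases x) (auto simp: Suc_le_eq)
 done

lemma cmp_nbits: "cmp (%_. True) (%x. nbits (fst x) (snd x)) (%x. fst x * (snd x + 1))"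
 apply (rule cmp_rec1'[where p = "%x. fst x = 0" and base = "%x. []" and s = "%x. (fst x - Suc 0, snd x div 2)"
  and post = "%y. (\<not> snd (fst y) mod 2 = 0) # snd y" and W = "%x. if fst x = 0 then 0 else snd x" and K = 10])
 subgoal for x by (cases "fst x") auto
 subgoal by simp
 apply (rule cmp_intros)+
 subgoal by simp
 subgoal by simp
 subgoal by simp
 subgoal by simp
 subgoal by simp
 subgoal for x
 proof -
  assume "fst x \<noteq> 0"
  then obtain n where n: "fst x = Suc n" by (cases "fst x") auto
  have "n * (snd x div 2 + 1) <= n * (snd x + 1)" by (intro mult_le_mono2) simp
  then show ?thesis by (simp add: n)
 qed
 done

lemma sum_list_le_length: "(\<And>y. y \<in> set ys ==> f y <= (c::nat)) ==> (\<Sum>y\<leftarrow>ys. f y) <= length ys * c"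
 by (induction ys) (auto intro: add_mono)

text \<open>R = 2^l candidates for a block of l bits, fewer than R bases for each, and R^13 per test
  make R^15; the exponent 16 leaves room for the remaining terms.\<close>

lemma cmp_leaf: "cmp (%x. 2 <= fst x \<and> length (snd x) + 1 <= 2 ^ fst x \<and> (\<forall>w\<in>set (snd x). length (fst w) <= 2 * fst x \<and> length (snd w) <= 2 * fst x))
 (%x. leaf (fst x) (snd x)) (%x. (2 ^ fst x) ^ 16)" (is "cmp ?D _ ?T")
proof -
 define vals :: "bool => bool list \<times> bool list => nat \<times> nat" where "vals u w = (val (fst w), val (snd w))" for u w
 let ?a = "%x. (2 ^ fst x :: nat, length (snd x), map (vals True) (snd x), 2 ^ fst x :: nat)"
 have vl: "cmp (%_. True) (%p. vals (fst p) (snd p)) (%p. 2 * 2 ^ length (fst (snd p)) + 2 * 2 ^ length (snd (snd p)))"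
  unfolding vals_def
  apply (rule cmp_le'[where K = 1])
  apply (rule cmp_Pair)
   apply (rule cmp_app[OF cmp_val cmp_fst[OF cmp_snd[OF cmp_id]]], simp)
  apply (rule cmp_app[OF cmp_val cmp_snd[OF cmp_snd[OF cmp_id]]], simp)
  by simp
 have bnd: "4 <= R" "R <= R ^ 16" "l <= R" "l * R <= R ^ 16" "R * R * R <= R ^ 16" "R * (R * (R ^ 13 + 1) + 1) <= 3 * R ^ 16"
  if "R = 2 ^ l" "2 <= l" for R l :: nat
 proof -
  show R: "4 <= R" using power_increasing[of 2 l "2::nat"] that by simp
  have "R ^ 1 <= R ^ 16" "R ^ 2 <= R ^ 16" "R ^ 3 <= R ^ 16" "R ^ 15 <= R ^ 16" using R by (intro power_increasing; simp)+
  then show R1: "R <= R ^ 16" and R3: "R * R * R <= R ^ 16" by (simp_all add: power3_eq_cube)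
  show l: "l <= R" unfolding that(1) by (rule less_imp_le, rule less_exp)
  have "l * R <= R * R" using l by (rule mult_le_mono1)
  also have "... <= R ^ 16" using \<open>R ^ 2 <= R ^ 16\<close> by (simp add: power2_eq_square)
  finally show "l * R <= R ^ 16" .
  have "R * (R * (R ^ 13 + 1) + 1) = R ^ 15 + R ^ 2 + R" by (simp add: power2_eq_square algebra_simps power_Suc[symmetric] del: power_Suc)
  then show "R * (R * (R ^ 13 + 1) + 1) <= 3 * R ^ 16" using \<open>R ^ 15 <= R ^ 16\<close> \<open>R ^ 2 <= R ^ 16\<close> R1 by linarith
 qed
 have a: "cmp ?D ?a ?T"
  apply (rule cmp_le'[where K = 40])
  apply (rule cmp_map[OF vl] cmp_intros TrueI)+
  subgoal for x
  proof -
   assume D: "?D x"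
   define R :: nat where "R = 2 ^ fst x"
   have l2: "2 <= fst x" and ls: "length (snd x) + 1 <= R" using D by (auto simp: R_def)
   have b: "4 <= R" "R <= R ^ 16" "fst x * R <= R ^ 16" "R * R * R <= R ^ 16" "fst x <= R" using bnd[OF R_def l2] by auto
   have "(\<Sum>y\<leftarrow>snd x. 2 * 2 ^ length (fst y) + 2 * 2 ^ length (snd y) + 1) <= length (snd x) * (5 * (R * R))"
   proof (rule sum_list_le_length)
    fix y assume "y \<in> set (snd x)"
    then have "length (fst y) <= 2 * fst x" "length (snd y) <= 2 * fst x" using D by auto
    then have "(2::nat) ^ length (fst y) <= 2 ^ (2 * fst x)" "(2::nat) ^ length (snd y) <= 2 ^ (2 * fst x)" by (intro power_increasing; simp)+
    moreover have "(2::nat) ^ (2 * fst x) = R * R" by (simp add: R_def power_add[symmetric] mult_2)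
    moreover have "1 <= R * R" using b by (simp add: Suc_le_eq)
    ultimately show "2 * 2 ^ length (fst y) + 2 * 2 ^ length (snd y) + 1 <= 5 * (R * R)" by linarith
   qed
   also have "... <= R * (5 * (R * R))" using ls by (intro mult_le_mono1) simp
   also have "... = 5 * (R * R * R)" by simp
   finally have s: "(\<Sum>y\<leftarrow>snd x. 2 * 2 ^ length (fst y) + 2 * 2 ^ length (snd y) + 1) <= 5 * R ^ 16" using b by linarith
   have p: "fst x * (2 ^ fst x + 2 + 3) <= 6 * R ^ 16"
   proof -
    have "2 ^ fst x + 2 + 3 <= 3 * R" using b by (simp add: R_def[symmetric])
    then have "fst x * (2 ^ fst x + 2 + 3) <= fst x * (3 * R)" by (rule mult_le_mono2)
    also have "... = 3 * (fst x * R)" by simp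
    also have "... <= 6 * R ^ 16" by (rule order_trans[OF mult_le_mono2[OF b(3)]]) simp
    finally show ?thesis .
   qed
   obtain U where U: "R ^ 16 = U" by blast
   obtain S :: nat where S: "(\<Sum>y\<leftarrow>snd x. 2 * 2 ^ length (fst y) + 2 * 2 ^ length (snd y) + 1) = S" by blast
   obtain p' where p': "fst x * (2 ^ fst x + 2 + 3) = p'" by blast
   show ?thesis using s p b(2) ls unfolding snd_conv fst_conv S p' unfolding R_def[symmetric] U by simp
  qed
  done
 have sr: "cmp ?D (%x. srch (2 ^ fst x) (length (snd x)) (map (vals True) (snd x)) (2 ^ fst x)) ?T"
  apply (rule cmp_le'[where K = 6])
  apply (rule cmp_app[OF cmp_srch a, unfolded fst_conv snd_conv])
  subgoal for x
  proof -
   assume D: "?D x"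
   have "val (fst w) <= 2 ^ fst x * 2 ^ fst x" "val (snd w) <= 2 ^ fst x * 2 ^ fst x" if "w \<in> set (snd x)" for w
    using D that val_less_power[of "fst w" "2 * fst x"] val_less_power[of "snd w" "2 * fst x"] by (auto simp: power_add[symmetric] mult_2)
   then show ?thesis using D bnd(1)[OF refl, of "fst x"] by (auto simp: vals_def)
  qed
  subgoal for x
  proof -
   assume D: "?D x"
   define R :: nat where "R = 2 ^ fst x"
   have l2: "2 <= fst x" and ls: "length (snd x) <= R" using D by (auto simp: R_def)
   have "R * (length (snd x) * (R ^ 13 + 1) + 1) <= R * (R * (R ^ 13 + 1) + 1)" using ls by (intro mult_le_mono2 add_mono mult_le_mono1) auto
   also have "... <= 3 * R ^ 16" by (rule bnd[OF R_def l2])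
   finally show ?thesis unfolding R_def[symmetric] by simp
  qed
  done
 show ?thesis
  unfolding leaf_def
  apply (rule cmp_le'[where K = 4])
  apply (rule cmp_app[OF cmp_nbits cmp_Pair[OF cmp_fst[OF cmp_id] sr[unfolded vals_def]], unfolded fst_conv snd_conv])
  apply simp
  subgoal for x
  proof -
   assume D: "?D x"
   define R :: nat where "R = 2 ^ fst x"
   have l2: "2 <= fst x" using D by auto
   have "srch R (length (snd x)) (map (%w. (val (fst w), val (snd w))) (snd x)) R < R" by (rule srch_less) (simp add: R_def)
   then have "fst x * (srch R (length (snd x)) (map (%w. (val (fst w), val (snd w))) (snd x)) R + 1) <= fst x * R" by (intro mult_le_mono2) simp
   also have "... <= R ^ 16" by (rule bnd[OF R_def l2])
   finally show ?thesis unfolding R_def[symmetric] by simp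
  qed
  done
qed

lemmas cmp_mulb' = cmp_app[OF cmp_mulb cmp_Pair[OF _ cmp_Pair], unfolded fst_conv snd_conv]

lemma mulb_cost_mono: "i <= j ==> 2 ^ i * (i + 1) ^ 15 <= 2 ^ j * (j + 1 :: nat) ^ 15"
 by (intro mult_le_mono power_increasing power_mono) auto

lemma cmp_nxt:
 "cmp (%x. arg2 (fst x) = 2 ^ fst (fst x) \<and> length (arg2 (snd x)) <= 2 ^ fst (fst x) \<and> length (arg1 (snd x)) <= rst3 (fst x))
  (%x. nxt (fst (fst x)) (arg2 (fst x)) (snd x)) (%x. 2 ^ fst (fst x) * (fst (fst x) + 1) ^ 15 * (rst3 (fst x) + 2) ^ 2)" (is "cmp ?D _ ?T")
proof -
 let ?Q = "%x. mulb (fst (fst x)) (arg2 (snd x)) (arg2 (snd x))"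
 let ?h = "%x. arg2 (fst x)" and ?bb = "%x. arg1 (snd x)"
 have bd: "H <= V * (g + 2) ^ 2" "V <= V * (g + 2) ^ 2" "l * (2 * (2 * H) + 2 * l + 3) <= 9 * (V * (g + 2) ^ 2)" "l * (2 * (2 * H + 2 * l) + 2 * l + 3) <= 13 * (V * (g + 2) ^ 2)"
  "l <= V * (g + 2) ^ 2"
  if "H <= V" "1 <= H" "l <= g" for H V g l :: nat
 proof -
  define G where "G = (g + 2) ^ 2"
  have G: "1 <= G" "l <= G" "l * l <= G"
  proof -
   have "(g + 2) * 1 <= (g + 2) * (g + 2)" "l * l <= (g + 2) * (g + 2)" using that by (intro mult_le_mono; simp)+
   then show "1 <= G" "l <= G" "l * l <= G" using that by (auto simp: G_def power2_eq_square)
  qed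
  have 1: "H * 1 <= V * G" "V * 1 <= V * G" "1 * l <= V * G" "l * H <= G * V" "1 * (l * l) <= V * G" using that G by (intro mult_le_mono; simp)+
  then show "H <= V * (g + 2) ^ 2" "V <= V * (g + 2) ^ 2" "l <= V * (g + 2) ^ 2" by (simp_all add: G_def)
  have e: "l * (2 * (2 * H) + 2 * l + 3) = 4 * (l * H) + 2 * (l * l) + 3 * l" "l * (2 * (2 * H + 2 * l) + 2 * l + 3) = 4 * (l * H) + 6 * (l * l) + 3 * l"
   by (simp_all add: algebra_simps)
  have c: "G * V = V * G" by simp
  obtain a1 a2 W where a: "l * H = a1" "l * l = a2" "V * G = W" by blast
  show "l * (2 * (2 * H) + 2 * l + 3) <= 9 * (V * (g + 2) ^ 2)" "l * (2 * (2 * H + 2 * l) + 2 * l + 3) <= 13 * (V * (g + 2) ^ 2)"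
   unfolding e G_def[symmetric] using 1 unfolding c a by simp_all
 qed
 have sh: "2 ^ j <= 2 ^ j * (j + 1 :: nat) ^ 15" for j by simp
 have q: "cmp ?D (%x. (x, ?Q x)) ?T"
  apply (rule cmp_le'[where K = 1])
  apply (rule cmp_mulb' cmp_intros)+
  apply simp
  subgoal for x
  proof -
   have "2 ^ fst (fst x) * (fst (fst x) + 1) ^ 15 * 1 <= 2 ^ fst (fst x) * (fst (fst x) + 1) ^ 15 * (rst3 (fst x) + 2) ^ 2" by (intro mult_le_mono2) simp
   then show ?thesis unfolding mult_1 mult_1_right by linarith
  qed
  done
 let ?D1 = "%y. ?D (fst y) \<and> length (snd y) = 2 * 2 ^ fst (fst (fst y))"
 have u: "cmp ?D1 (%y. (?bb (fst y), if zero (drop (2 * ?h (fst y)) (nmul (?bb (fst y)) (snd y))) then take (2 * ?h (fst y)) (nmul (?bb (fst y)) (snd y)) else snd y)) (%y. ?T (fst y))"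
  apply (rule cmp_le'[where K = 60])
  apply (rule cmp_intros)+
  subgoal for y
  proof -
   assume D: "?D1 y"
   obtain j h g bb T Tb Q where y: "y = (((j, h, g), (bb, T, Tb)), Q)" by (cases y) auto
   have f: "h = 2 ^ j" "length Q = 2 * h" "length bb <= g" using D unfolding y by auto
   define V where "V = 2 ^ j * (j + 1) ^ 15"
   have b': "h <= V * (g + 2) ^ 2" "length bb * (2 * (2 * h) + 2 * length bb + 3) <= 9 * (V * (g + 2) ^ 2)" "length bb <= V * (g + 2) ^ 2"
    using bd[of h V "length bb" g] sh[of j] f by (auto simp: V_def)
   obtain W where W: "V * (g + 2) ^ 2 = W" by blast
   obtain n where n: "length (nmul bb Q) = n" "n <= 2 * h + 2 * length bb" using length_nmul[of bb Q] f(2) by auto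
   obtain c where c: "length bb * (2 * (2 * h) + 2 * length bb + 3) = c" by blast
   have "n - 2 * h <= 2 * length bb" using n by simp
   then show ?thesis using b' n(2) unfolding y fst_conv snd_conv V_def[symmetric] length_drop n(1) f(2) W c by simp
  qed
  done
 have v: "cmp ?D1 (%y. (%z. (fst z, snd z, nmul (fst z) (snd z))) (?bb (fst y), if zero (drop (2 * ?h (fst y)) (nmul (?bb (fst y)) (snd y))) then take (2 * ?h (fst y)) (nmul (?bb (fst y)) (snd y)) else snd y)) (%y. ?T (fst y))"
  apply (rule cmp_le'[where K = 20])
  apply (rule cmp_app[OF _ u, where E = "%_. True"])
   apply (rule cmp_intros)+
  apply simp
  subgoal for y
  proof -
   assume D: "?D1 y"
   obtain j h g bb T Tb Q where y: "y = (((j, h, g), (bb, T, Tb)), Q)" by (cases y) auto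
   have f: "h = 2 ^ j" "length Q = 2 * h" "length bb <= g" using D unfolding y by auto
   define V where "V = 2 ^ j * (j + 1) ^ 15"
   have b': "length bb * (2 * (2 * h) + 2 * length bb + 3) <= 9 * (V * (g + 2) ^ 2)"
    using bd[of h V "length bb" g] sh[of j] f by (auto simp: V_def)
   define U where "U = (if zero (drop (2 * h) (nmul bb Q)) then take (2 * h) (nmul bb Q) else Q)"
   have "length U <= 2 * h" using f by (simp add: U_def)
   then have "length bb * (2 * length U + 2 * length bb + 3) <= length bb * (2 * (2 * h) + 2 * length bb + 3)" by (intro mult_le_mono2) simp
   from order_trans[OF this b'] show ?thesis unfolding y fst_conv snd_conv V_def[symmetric] U_def[symmetric] by simp
  qed
  done
 show ?thesis
  unfolding nxt_def Let_def
  apply (rule cmp_le'[where K = 2])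
  apply (rule cmp_app[OF v q, unfolded fst_conv snd_conv])
  subgoal for x using mulb(2)[of "arg2 (snd x)" "fst (fst x)" "arg2 (snd x)"] by simp
  by simp
qed

lemma levels_entry:
 assumes "\<And>bb. bb \<in> set bbs ==> 2 <= val bb" "e \<in> set (levels bbs j)"
 shows "length (fst (snd e)) <= 2 ^ j \<and> fst e \<in> set bbs \<and> length (snd (snd e)) <= 2 ^ j + 2 * length (fst e)"
proof -
 obtain i where i: "i < length bbs" "e = levels bbs j ! i" using assms(2) levels_ok[of bbs j, OF assms(1)] by (auto simp: in_set_conv_nth)
 then have "lvl_ok (val (bbs ! i)) (2 ^ j) (bbs ! i) e" using levels_ok[of bbs j, OF assms(1)] by auto
 then show ?thesis using i(1) by (auto simp: lvl_ok_def)
qed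

text \<open>The sizes double from level to level, so the top level dominates the geometric sum;
  hence the constant 4 in place of the number of levels.\<close>

lemma cmp_tower: "cmp (%x. \<forall>bb\<in>set (fst x). 2 <= val bb \<and> length bb <= length (fst x) + 1)
  (%x. tower (fst x) (snd x)) (%x. 4 * (2 ^ snd x * (snd x + 1) ^ 15 * (length (fst x) + 3) ^ 3))" (is "cmp ?D ?F ?S")
proof -
 let ?W = "%x. 2 ^ snd x * (snd x + 1) ^ 15 * (length (fst x) + 3) ^ 3"
 let ?s = "%x. (fst x, snd x - Suc 0)"
 define first :: "bool => bool list => entry" where "first u bb = (bb, [True], bb)" for u bb
 have fi: "cmp (%_. True) (%p. first (fst p) (snd p)) (%_. 0)"
  unfolding first_def by (rule cmp_le'[where K = 1], (rule cmp_intros)+, simp)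
 have ft: "first True = (%bb. (bb, [True], bb))" by (rule ext) (simp add: first_def)
 have lW: "length (fst x) + 3 <= ?W x" for x :: "bool list list \<times> nat"
 proof -
  have "1 * 1 * (length (fst x) + 3) <= ?W x" by (intro mult_le_mono self_le_power) auto
  then show ?thesis by simp
 qed
 have ba: "cmp (%x. ?D x \<and> snd x = 0) (%x. [(0, 1, map (first True) (fst x))]) ?W"
  apply (rule cmp_le'[where K = 3])
  apply (rule cmp_map[OF fi] cmp_intros TrueI)+
  subgoal for x using lW[of x] by (simp add: sum_list_triv)
  done
 let ?po = "%y. (snd (fst y), 2 * fst (snd (hd (snd y))), map ((%c. nxt (fst c) (fst (snd c))) (snd (fst y) - Suc 0, fst (snd (hd (snd y))), length (fst (fst y)) + 1)) (snd (snd (hd (snd y))))) # snd y"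
 have po: "cmp (%y. ?D (fst y) \<and> snd (fst y) \<noteq> 0 \<and> snd y = ?F (?s (fst y))) ?po (%y. ?W (fst y))"
  apply (rule cmp_le'[where K = 20])
  apply (rule cmp_map[OF cmp_nxt] cmp_intros | simp add: tower_hd; fail)+
  subgoal for y e
  proof -
   assume a: "?D (fst y) \<and> snd (fst y) \<noteq> 0 \<and> snd y = ?F (?s (fst y))" and e: "e \<in> set (snd (snd (hd (snd y))))"
   have h: "hd (snd y) = (snd (fst y) - Suc 0, 2 ^ (snd (fst y) - Suc 0), levels (fst (fst y)) (snd (fst y) - Suc 0))"
    using a tower_hd[of "fst (fst y)" "snd (fst y) - Suc 0"] by simp
   then show ?thesis using a e levels_entry[of "fst (fst y)" e "snd (fst y) - Suc 0"] by auto
  qed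
  apply (rule cmp_intros)+
  subgoal for y
  proof -
   assume a: "?D (fst y) \<and> snd (fst y) \<noteq> 0 \<and> snd y = ?F (?s (fst y))"
   then obtain j where j: "snd (fst y) = Suc j" by (cases "snd (fst y)") auto
   define g where "g = length (fst (fst y))"
   have h: "hd (snd y) = (j, 2 ^ j, levels (fst (fst y)) j)" using a tower_hd[of "fst (fst y)" j] j by simp
   have l: "length (levels (fst (fst y)) j) = g" using a levels_ok[of "fst (fst y)" j] by (simp add: g_def)
   define V where "V = 2 ^ j * (j + 1) ^ 15"
   define W where "W = 2 ^ Suc j * (Suc j + 1) ^ 15 * (g + 3) ^ 3"
   have "V * (g + 3) ^ 3 <= W" unfolding V_def W_def by (intro mult_le_mono mulb_cost_mono) auto
   moreover have "g * (V * (g + 1 + 2) ^ 2 + 1) <= 2 * (V * (g + 3) ^ 3)"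
   proof -
    obtain X where X: "V * (g + 3) ^ 2 = X" by blast
    have "1 <= X" unfolding X[symmetric] by (simp add: V_def Suc_le_eq)
    moreover have g3: "g + 1 + 2 = g + 3" by simp
    ultimately have "V * (g + 1 + 2) ^ 2 + 1 <= 2 * (V * (g + 3) ^ 2)" unfolding g3 X by linarith
    then have "g * (V * (g + 1 + 2) ^ 2 + 1) <= (g + 3) * (2 * (V * (g + 3) ^ 2))" by (intro mult_le_mono) auto
    also have "... = 2 * (V * (g + 3) ^ 3)" by (simp add: power2_eq_square power3_eq_cube)
    finally show ?thesis .
   qed
   moreover have "g + 3 <= W" using lW[of "fst y"] by (simp add: W_def g_def j)
   moreover have "2 ^ j * 1 * 1 <= W" unfolding W_def by (intro mult_le_mono power_increasing) auto
   ultimately show ?thesis unfolding h j fst_conv snd_conv diff_Suc_Suc diff_zero V_def[symmetric] W_def[symmetric] g_def[symmetric]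
    by (simp add: sum_list_triv l V_def[symmetric] g_def[symmetric])
  qed
  done
 show ?thesis
 proof (rule cmp_rec1[where p = "%x. snd x = 0" and base = "%x. [(0, 1, map (first True) (fst x))]" and s = ?s, OF _ _ _ ba _ po])
  fix x :: "bool list list \<times> nat"
  show "?F x = (if snd x = 0 then [(0, 1, map (first True) (fst x))] else ?po (x, ?F (?s x)))"
   using tower_hd[of "fst x" "snd x - 1"] by (cases "snd x") (auto simp: ft Let_def)
  show "?W x + ?S (?s x) + 1 <= ?S x" if nz: "snd x \<noteq> 0"
  proof -
   obtain j where j: "snd x = Suc j" using nz by (cases "snd x") auto
   define g where "g = length (fst x)"
   have "2 * (2 ^ j * (j + 1) ^ 15 * (g + 3) ^ 3) <= 2 * (2 ^ j * (Suc j + 1) ^ 15 * (g + 3) ^ 3)"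
    by (intro mult_le_mono power_mono) auto
   also have "... = 2 ^ Suc j * (Suc j + 1) ^ 15 * (g + 3) ^ 3" by simp
   finally have "2 * (2 ^ j * (j + 1) ^ 15 * (g + 3) ^ 3) <= ?W x" by (simp only: j g_def)
   moreover have "1 <= ?W x" using lW[of x] by linarith
   moreover have "?S (?s x) = 4 * (2 ^ j * (j + 1) ^ 15 * (g + 3) ^ 3)" by (simp add: j g_def)
   ultimately show ?thesis by linarith
  qed
 qed ((rule cmp_le'[where K = 1], (rule cmp_intros)+, force) | force)+
qed


lemma cmp_lft: "cmp (%_. True) (%p. lft (fst p) (snd p)) (%p. fst p)"
 unfolding lft_def
 apply (rule cmp_le'[where K = 20])
 apply (rule cmp_intros)+
 by simp

lemma cmp_rgt:
 "cmp (%p. arg2 (fst p) = 2 ^ fst (fst p) \<and> length (rst3 (fst p)) <= arg2 (fst p) \<and>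
   length (arg2 (fst (snd p))) <= arg2 (fst p) \<and> length (rst3 (fst (snd p))) <= 4 * arg2 (fst p) \<and>
   length (arg2 (snd p)) <= 4 * arg2 (fst p) \<and> length (rst3 (snd p)) <= 4 * arg2 (fst p))
  (%p. rgt (fst (fst p)) (arg2 (fst p)) (rst3 (fst p)) (snd p)) (%p. 2 ^ (fst (fst p) + 3) * (fst (fst p) + 4) ^ 15)" (is "cmp ?D _ ?T")
proof -
 let ?j = "%p. fst (fst p)" and ?h = "%p. arg2 (fst p)" and ?y = "%p. rst3 (fst p)"
 let ?e = "%p. fst (snd p)" and ?Z = "%p. arg2 (snd p)" and ?K = "%p. rst3 (snd p)"
 let ?T1 = "%p. arg2 (?e p)" and ?Tb = "%p. rst3 (?e p)"
 have h4: "(2::nat) ^ (j + 2) = 4 * 2 ^ j" "(2::nat) ^ (j + 3) = 8 * 2 ^ j" for j by (simp_all add: power_add)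
 have cost: "2 ^ (j + 2) * (j + 2 + 1) ^ 15 <= 2 ^ (j + 3) * (j + 4) ^ 15" "2 ^ (j + 3) * (j + 3 + 1) ^ 15 = 2 ^ (j + 3) * (j + 4) ^ 15"
  "8 * 2 ^ j <= 2 ^ (j + 3) * (j + 4) ^ 15" "j <= 2 ^ (j + 3) * (j + 4) ^ 15" for j :: nat
 proof -
  show "2 ^ (j + 2) * (j + 2 + 1) ^ 15 <= 2 ^ (j + 3) * (j + 4) ^ 15" using mulb_cost_mono[of "j + 2" "j + 3"] by (simp add: add.commute)
  show "2 ^ (j + 3) * (j + 3 + 1) ^ 15 = 2 ^ (j + 3) * (j + 4) ^ 15" by (simp add: add.commute)
  have "2 ^ (j + 3) * 1 <= 2 ^ (j + 3) * (j + 4) ^ 15" by (intro mult_le_mono2) simp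
  then show 1: "8 * 2 ^ j <= 2 ^ (j + 3) * (j + 4) ^ 15" unfolding h4 by simp
  have "j < 2 ^ j" by (rule less_exp)
  then show "j <= 2 ^ (j + 3) * (j + 4) ^ 15" using 1 by linarith
 qed
 have mul2: "cmp ?D (%p. mulb (?j p + 2) (?K p) (f p)) ?T"
  if f: "cmp ?D f (%_. 0)" "\<And>p. ?D p ==> length (f p) <= 4 * ?h p" for f
  apply (rule cmp_le'[where K = 3])
  apply (rule cmp_mulb' f(1) cmp_intros)+
  subgoal for p using f(2)[of p] unfolding h4 by simp
  subgoal for p
  proof -
   obtain U where U: "2 ^ (?j p + 3) * (?j p + 4) ^ 15 = U" by blast
   obtain V where V: "2 ^ (?j p + 2) * (?j p + 2 + 1) ^ 15 = V" by blast
   show ?thesis using cost(1,4)[of "?j p"] unfolding U V by simp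
  qed
  done
 have KB: "cmp ?D (%p. mulb (?j p + 2) (?K p) (?Tb p)) ?T" by (rule mul2) (rule cmp_intros | simp)+
 have KT: "cmp ?D (%p. mulb (?j p + 2) (?K p) (?T1 p)) ?T" by (rule mul2) (rule cmp_intros | simp)+
 have Ky: "cmp ?D (%p. mulb (?j p + 2) (?K p) (?y p)) ?T" by (rule mul2) (rule cmp_intros | simp)+
 have len: "length (mulb (?j p + 2) (?K p) (f p)) = 8 * ?h p" if "?D p" "length (f p) <= 4 * ?h p" for p f
  using mulb(2)[of "?K p" "?j p + 2" "f p"] that unfolding h4 by simp
 let ?c = "%p. zero (drop (5 * ?h p) (mulb (?j p + 2) (?K p) (?Tb p)))"
 let ?X = "%p. take (8 * ?h p) (addb False (replicate (?h p) False @ ?Z p) (mulb (?j p + 2) (?K p) (?y p)))"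
 let ?KT = "%p. if ?c p then mulb (?j p + 2) (?K p) (?Tb p) else mulb (?j p + 2) (?K p) (?T1 p)"
 have KB': "cmp (%p. ?D p \<and> ?c p) (%p. mulb (?j p + 2) (?K p) (?Tb p)) ?T" by (rule cmp_le[OF KB, where K = 1]) auto
 have KT': "cmp (%p. ?D p \<and> \<not> ?c p) (%p. mulb (?j p + 2) (?K p) (?T1 p)) ?T" by (rule cmp_le[OF KT, where K = 1]) auto
 have c: "cmp ?D ?c ?T"
  apply (rule cmp_le'[where K = 30])
  apply (rule KB cmp_intros)+
  subgoal for p
  proof -
   assume D: "?D p"
   obtain U where U: "2 ^ (?j p + 3) * (?j p + 4) ^ 15 = U" by blast
   have "8 * ?h p <= U" using cost(3)[of "?j p"] D unfolding U by simp
   then show ?thesis using len[OF D, of "%p. ?Tb p"] D unfolding U by simp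
  qed
  done
 have first: "cmp ?D (%p. ((?j p, ?h p), (?X p, ?KT p), if ?c p then ?Tb p else ?T1 p)) ?T"
  apply (rule cmp_le'[where K = 60])
  apply (rule c KB' KT' Ky cmp_intros)+
  subgoal for p
  proof -
   assume D: "?D p"
   obtain U where U: "2 ^ (?j p + 3) * (?j p + 4) ^ 15 = U" by blast
   have "8 * ?h p <= U" using cost(3)[of "?j p"] D unfolding U by simp
   then show ?thesis using len[OF D, of "%p. ?y p"] D unfolding U by simp
  qed
  done
 let ?D2 = "%q. snd (fst q) = 2 ^ fst (fst q) \<and> length (arg1 (fst (snd q))) <= 8 * snd (fst q) \<and> length (snd (snd q)) <= 8 * snd (fst q)"
 have second: "cmp ?D2 (%q. (take (2 * snd (fst q)) (drop (3 * snd (fst q)) (mulb (fst (fst q) + 3) (fst (fst (snd q))) (snd (snd q)))),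
   take (2 * snd (fst q)) (drop (3 * snd (fst q)) (snd (fst (snd q)))))) (%q. 2 ^ (fst (fst q) + 3) * (fst (fst q) + 4) ^ 15)"
  apply (rule cmp_le'[where K = 30])
  apply (rule cmp_mulb' cmp_intros)+
  subgoal for q unfolding h4 by simp
  apply (rule cmp_intros)+
  subgoal for q
  proof -
   assume D: "?D2 q"
   obtain U where U: "2 ^ (fst (fst q) + 3) * (fst (fst q) + 4) ^ 15 = U" by blast
   have "8 * snd (fst q) <= U" "fst (fst q) <= U" using cost(3,4)[of "fst (fst q)"] D unfolding U by simp_all
   then show ?thesis unfolding cost(2) U by simp
  qed
  done
 show ?thesis
  unfolding rgt_def Let_def
  apply (rule cmp_le'[where K = 2])
  apply (rule cmp_app[OF second first, unfolded fst_conv snd_conv])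
  subgoal for p using len[of p "%p. ?y p"] by auto
  by simp
qed

fun table_ok :: "nat => nat => (nat \<times> nat \<times> entry list) list => bool" where
 "table_ok lam g [] = True"
| "table_ok lam g (e # tab) \<longleftrightarrow> fst (snd e) = 2 ^ fst e \<and> fst (snd e) = lam * 2 ^ length tab \<and> length (snd (snd e)) <= g \<and>
  (\<forall>q\<in>set (snd (snd e)). length (fst (snd q)) <= fst (snd e) \<and> length (snd (snd q)) <= 4 * fst (snd e)) \<and> table_ok lam g tab"

text \<open>On every level of the tree the numbers of all nodes together have, for each base, length
  of the order of the whole output, so each level contributes the same term. The leaves contribute
  the cost of one exhaustive search each.\<close>

lemma cmp_solve:
 "cmp (%x. 2 <= fst x \<and> table_ok (fst x) (fst (snd x)) (arg3 x) \<and> length (rst4 x) <= fst (snd x) \<and> fst (snd x) + 1 <= 2 ^ fst x \<and>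
   (\<forall>w\<in>set (rst4 x). length (fst w) <= 2 * (fst x * 2 ^ length (arg3 x)) \<and> length (snd w) <= 2 * (fst x * 2 ^ length (arg3 x))))
  (%x. solve (fst x) (arg3 x) (rst4 x))
  (%x. 2 ^ length (arg3 x) * ((2 ^ fst x) ^ 16 + 2 + length (arg3 x) * ((fst (snd x) + 1) * fst x * (fst x + length (arg3 x) + 4) ^ 15 + 2)))"
 (is "cmp ?D ?F ?S")
proof -
 let ?t = "%x. length (arg3 x)"
 let ?Q = "%x. (fst (snd x) + 1) * fst x * (fst x + ?t x + 4) ^ 15"
 let ?W = "%x. if arg3 x = [] then (2 ^ fst x) ^ 16 else 2 ^ ?t x * ?Q x"
 let ?h = "%x. fst (snd (hd (arg3 x)))"
 let ?s1 = "%x. (fst x, fst (snd x), tl (arg3 x), map (lft (?h x)) (rst4 x))"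
 let ?s2 = "%y. (fst (fst y), fst (snd (fst y)), tl (arg3 (fst y)),
  map ((%c. rgt (fst c) (fst (snd c)) (snd (snd c))) (fst (hd (arg3 (fst y))), ?h (fst y), snd y)) (zip (snd (snd (hd (arg3 (fst y))))) (rst4 (fst y))))"
 have node: "\<exists>j h ps tab. arg3 x = (j, h, ps) # tab \<and> h = 2 ^ j \<and> h = fst x * 2 ^ length tab \<and> length ps <= fst (snd x) \<and>
   (\<forall>q\<in>set ps. length (fst (snd q)) <= h \<and> length (snd (snd q)) <= 4 * h) \<and> table_ok (fst x) (fst (snd x)) tab \<and>
   (\<forall>w\<in>set (rst4 x). length (fst w) <= 4 * h \<and> length (snd w) <= 4 * h) \<and>
   (length (rst4 x) + 1) * (2 ^ (j + 3) * (j + 4) ^ 15) <= 8 * ?W x \<and> (length (rst4 x) + 1) * h <= ?W x \<and> fst (snd x) + 1 <= ?W x"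
  if D: "?D x" and ne: "arg3 x \<noteq> []" for x
 proof -
  obtain j h ps tab where a: "arg3 x = (j, h, ps) # tab" using ne by (cases "arg3 x") auto
  have 1: "h = 2 ^ j" "h = fst x * 2 ^ length tab" "length ps <= fst (snd x)" "\<forall>q\<in>set ps. length (fst (snd q)) <= h \<and> length (snd (snd q)) <= 4 * h"
   "table_ok (fst x) (fst (snd x)) tab" using D unfolding a by auto
  have 2: "\<forall>w\<in>set (rst4 x). length (fst w) <= 4 * h \<and> length (snd w) <= 4 * h" using D 1(2) unfolding a by auto
  have W: "?W x = 2 * h * ((fst (snd x) + 1) * (fst x + Suc (length tab) + 4) ^ 15)" unfolding 1(2) by (simp add: a algebra_simps)
  have jle: "j <= fst x + length tab"
  proof -
   have "(2::nat) ^ j <= 2 ^ fst x * 2 ^ length tab" unfolding 1(1)[symmetric] 1(2) by (intro mult_le_mono1) (simp add: less_imp_le)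
   then have "(2::nat) ^ j <= 2 ^ (fst x + length tab)" by (simp add: power_add)
   then show ?thesis by simp
  qed
  have "(length (rst4 x) + 1) * (2 ^ (j + 3) * (j + 4) ^ 15) = 8 * (h * ((length (rst4 x) + 1) * (j + 4) ^ 15))" by (simp add: 1(1) power_add algebra_simps)
  also have "... <= 8 * (h * ((fst (snd x) + 1) * (fst x + Suc (length tab) + 4) ^ 15))"
   using D jle by (intro mult_le_mono power_mono) auto
  also have "... <= 8 * ?W x" unfolding W by simp
  finally have 3: "(length (rst4 x) + 1) * (2 ^ (j + 3) * (j + 4) ^ 15) <= 8 * ?W x" .
  have "(length (rst4 x) + 1) * h = h * ((length (rst4 x) + 1) * 1)" by simp
  also have "... <= 2 * h * ((fst (snd x) + 1) * (fst x + Suc (length tab) + 4) ^ 15)"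
   using D by (intro mult_le_mono) auto
  finally have 4: "(length (rst4 x) + 1) * h <= ?W x" unfolding W .
  have "1 * ((fst (snd x) + 1) * 1) <= 2 * h * ((fst (snd x) + 1) * (fst x + Suc (length tab) + 4) ^ 15)"
   using 1(1) by (intro mult_le_mono) (auto simp: Suc_le_eq)
  then have 5: "fst (snd x) + 1 <= ?W x" unfolding W by simp
  show ?thesis using a 1 2 3 4 5 by blast
 qed
 have D1: "?D (?s1 x)" if D: "?D x" and ne: "arg3 x \<noteq> []" for x
  using node[OF D ne] D by (auto simp: lft_def)
 have D2: "?D (?s2 (x, r))" if D: "?D x" and ne: "arg3 x \<noteq> []" for x r
  using node[OF D ne] D by (auto simp: rgt_def Let_def)
 have s1: "cmp (%x. ?D x \<and> arg3 x \<noteq> []) ?s1 ?W"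
  apply (rule cmp_le'[where K = 20])
  apply (rule cmp_map[OF cmp_lft] cmp_intros TrueI | simp; fail)+
  subgoal for x
  proof -
   assume a: "?D x \<and> arg3 x \<noteq> []"
   then obtain j h ps tab where t: "arg3 x = (j, h, ps) # tab" and b: "(length (rst4 x) + 1) * h <= ?W x" "fst (snd x) + 1 <= ?W x" using node[of x] by blast
   obtain W where W: "?W x = W" by blast
   have "length (rst4 x) * (h + 1) <= (length (rst4 x) + 1) * h + fst (snd x)" using a by simp
   then show ?thesis using b unfolding W t by (simp add: sum_list_triv)
  qed
  done
 have s2: "cmp (%y. ?D (fst y) \<and> arg3 (fst y) \<noteq> [] \<and> snd y = ?F (?s1 (fst y))) ?s2 (%y. ?W (fst y))"
  apply (rule cmp_le'[where K = 40])
  apply (rule cmp_map[OF cmp_rgt] cmp_intros | simp; fail)+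
  subgoal for y q
  proof -
   assume a: "?D (fst y) \<and> arg3 (fst y) \<noteq> [] \<and> snd y = ?F (?s1 (fst y))" and q: "q \<in> set (zip (snd (snd (hd (arg3 (fst y))))) (rst4 (fst y)))"
   then obtain j h ps tab where t: "arg3 (fst y) = (j, h, ps) # tab" "h = 2 ^ j" "h = fst (fst y) * 2 ^ length tab"
    "\<forall>q\<in>set ps. length (fst (snd q)) <= h \<and> length (snd (snd q)) <= 4 * h" "\<forall>w\<in>set (rst4 (fst y)). length (fst w) <= 4 * h \<and> length (snd w) <= 4 * h"
    using node[of "fst y"] by blast
   have "length (snd y) = h" using a t(1,3) by (simp add: length_solve)
   moreover have "fst q \<in> set ps" "snd q \<in> set (rst4 (fst y))" using q t(1) set_zip_leftD[of "fst q" "snd q"] set_zip_rightD[of "fst q" "snd q"] by auto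
   ultimately show ?thesis using t by auto
  qed
  subgoal for y
  proof -
   assume a: "?D (fst y) \<and> arg3 (fst y) \<noteq> [] \<and> snd y = ?F (?s1 (fst y))"
   then obtain j h ps tab where t: "arg3 (fst y) = (j, h, ps) # tab" "length ps <= fst (snd (fst y))"
    and b: "(length (rst4 (fst y)) + 1) * (2 ^ (j + 3) * (j + 4) ^ 15) <= 8 * ?W (fst y)" "fst (snd (fst y)) + 1 <= ?W (fst y)" using node[of "fst y"] by blast
   obtain W where W: "?W (fst y) = W" by blast
   obtain V where V: "2 ^ (j + 3) * (j + 4) ^ 15 = V" by blast
   define n where "n = length (zip ps (rst4 (fst y)))"
   have n: "n <= length (rst4 (fst y))" by (simp add: n_def)
   have "n * (V + 1) = n * V + n" by simp
   also have "... <= (length (rst4 (fst y)) + 1) * V + fst (snd (fst y))" using n a by (intro add_mono mult_le_mono1) auto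
   finally have "n * (V + 1) <= 9 * W" using b unfolding W V by simp
   then show ?thesis using b(2) t(2) unfolding W unfolding t(1) list.sel fst_conv snd_conv V by (simp add: sum_list_triv n_def)
  qed
  done
 have po: "cmp (%y. ?D (fst (fst y)) \<and> arg3 (fst (fst y)) \<noteq> [] \<and> snd (fst y) = ?F (?s1 (fst (fst y))) \<and> snd y = ?F (?s2 (fst y)))
  (%y. snd y @ snd (fst y)) (%y. ?W (fst (fst y)))"
  apply (rule cmp_le'[where K = 1])
  apply (rule cmp_intros)+
  subgoal for y
  proof -
   assume a: "?D (fst (fst y)) \<and> arg3 (fst (fst y)) \<noteq> [] \<and> snd (fst y) = ?F (?s1 (fst (fst y))) \<and> snd y = ?F (?s2 (fst y))"
   then obtain j h ps tab where t: "arg3 (fst (fst y)) = (j, h, ps) # tab" "h = fst (fst (fst y)) * 2 ^ length tab"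
    and b: "(length (rst4 (fst (fst y))) + 1) * h <= ?W (fst (fst y))" using node[of "fst (fst y)"] by blast
   have "length (snd y) = h" using a t by (simp add: length_solve)
   then show ?thesis using b by simp
  qed
  done
 have ba: "cmp (%x. ?D x \<and> arg3 x = []) (%x. leaf (fst x) (rst4 x)) ?W"
  apply (rule cmp_le'[where K = 1])
  apply (rule cmp_app[OF cmp_leaf, of _ "%x. (fst x, rst4 x)", unfolded fst_conv snd_conv])
   apply (rule cmp_intros)+
  by auto
 show ?thesis
 proof (rule cmp_rec2[where p = "%x. arg3 x = []" and base = "%x. leaf (fst x) (rst4 x)" and post = "%y. snd y @ snd (fst y)", OF _ D1 D2 _ ba s1 s2 po])
  fix x :: "nat \<times> nat \<times> (nat \<times> nat \<times> entry list) list \<times> (bool list \<times> bool list) list"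
  show "?F x = (if arg3 x = [] then leaf (fst x) (rst4 x) else snd ((x, ?F (?s1 x)), ?F (?s2 (x, ?F (?s1 x)))) @ snd (fst ((x, ?F (?s1 x)), ?F (?s2 (x, ?F (?s1 x))))))"
   by (cases "arg3 x") (auto simp: Let_def)
  show "?W x <= ?S x" if "arg3 x = []" using that by simp
  show "?W x + ?S (?s1 x) + ?S (?s2 (x, ?F (?s1 x))) + 2 <= ?S x" if ne: "arg3 x \<noteq> []"
  proof -
   obtain t where t: "length (arg3 x) = Suc t" "length (tl (arg3 x)) = t" using ne by (cases "arg3 x") auto
   define L where "L = (2 ^ fst x) ^ 16 + (2::nat)"
   define Q where "Q = ?Q x"
   have "(fst (snd x) + 1) * fst x * (fst x + t + 4) ^ 15 + 2 <= Q + 2" unfolding Q_def t(1) by (intro add_mono mult_le_mono power_mono) auto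
   then have le: "L + t * ((fst (snd x) + 1) * fst x * (fst x + t + 4) ^ 15 + 2) <= L + t * (Q + 2)" by (intro add_mono mult_le_mono2) auto
   define N :: nat where "N = 2 ^ t"
   have N1: "1 <= N" by (simp add: N_def)
   have "N * (L + t * ((fst (snd x) + 1) * fst x * (fst x + t + 4) ^ 15 + 2)) <= N * (L + t * (Q + 2))" by (rule mult_le_mono2[OF le])
   then have S: "?S (?s1 x) <= N * (L + t * (Q + 2))" "?S (?s2 (x, ?F (?s1 x))) <= N * (L + t * (Q + 2))"
    by (simp_all add: t N_def L_def)
   have W: "?W x = 2 * N * Q" using ne by (simp add: t N_def Q_def)
   have S': "?S x = 2 * (N * (L + t * (Q + 2))) + 2 * N * Q + 4 * N" by (simp add: t N_def Q_def L_def algebra_simps)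
   show ?thesis unfolding W S' using S N1 by linarith
  qed
 qed ((rule cmp_le'[where K = 1], (rule cmp_intros)+, force) | force)+
qed

section \<open>Digit frequencies of the constructed number\<close>

text \<open>At the root the state is exact: slope and fractional part are multiples of 1/2^n, and n
  further zero bits bring them to the prescribed precision.\<close>

lemma start_ok:
 assumes e: "lvl_ok b (2 ^ k) bb e" and m: "val (fst (snd e)) = b ^ m" and P: "length P <= 2 ^ k"
 shows "st_ok b (val P) (2 ^ k) (2 ^ k) m (b ^ m * val P div 2 ^ 2 ^ k) (start k (2 ^ k) P e)"
proof -
 define n :: nat where "n = 2 ^ k"
 define N :: nat where "N = 2 ^ n"
 define T where "T = fst (snd e)"
 have t: "length T <= n" "val T = b ^ m" "N <= b * b ^ m" using e m by (auto simp: lvl_ok_def T_def n_def N_def)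
 have mu: "val (mulb k T P) = b ^ m * val P" using mulb[of T k P] t P by (auto simp: n_def)
 have N2: "2 ^ (2 * n) = N * N" by (simp add: N_def power_add mult_2)
 define Q where "Q = b ^ m * val P"
 have "N * Q = N * (Q div N * N + Q mod N)" by simp
 also have "... = Q div N * (N * N) + N * (Q mod N)" by (simp only: distrib_left ac_simps)
 finally have Q: "Q div N * (N * N) + N * (Q mod N) = N * Q" by simp
 have s: "val (fst (start k n P e)) = N * (Q mod N)" "val (snd (start k n P e)) = N * b ^ m"
  "length (fst (start k n P e)) <= 2 * n" "length (snd (start k n P e)) <= 2 * n"
  using t mu unfolding start_def T_def[symmetric] by (auto simp: val_take N_def[symmetric] Q_def)
 show ?thesis unfolding st_ok_def n_def[symmetric] N_def[symmetric] N2 s Q_def[symmetric] Q power_Suc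
  using s(3,4) t(3) by (simp add: Q_def algebra_simps)
qed

text \<open>The position in base b at which stage k starts. It depends only on b and k and not on
  the bits produced, so the end of one stage is the start of the next; subtracting 1 makes the
  inequality b^m < 2^(2^k) strict.\<close>

definition expo :: "nat => nat => nat" where "expo b k = mlog b (2 ^ 2 ^ k - 1)"

lemma expo: "2 <= b ==> b ^ expo b k < 2 ^ 2 ^ k \<and> 2 ^ 2 ^ k <= b ^ Suc (expo b k)"
proof -
 assume b: "2 <= b"
 have "(1::nat) < 2 ^ 2 ^ k" by (rule one_less_power) auto
 then show ?thesis using mlog_bounds[OF b, of "2 ^ 2 ^ k - 1"] unfolding expo_def by linarith
qed

lemma expo_unique:
 assumes b: "2 <= b" and m: "b ^ m < 2 ^ 2 ^ k" "2 ^ 2 ^ k <= b * b ^ m"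
 shows "m = expo b k"
proof -
 have "b ^ m < b ^ Suc (expo b k)" using m expo[OF b, of k] by linarith
 then have "m < Suc (expo b k)" by (rule power_less_imp_less_exp[rotated]) (use b in simp)
 moreover have "b ^ expo b k < b ^ Suc m" using m expo[OF b, of k] unfolding power_Suc by linarith
 then have "expo b k < Suc m" by (rule power_less_imp_less_exp[rotated]) (use b in simp)
 ultimately show ?thesis by simp
qed

lemma mlog_ge: "2 ^ a <= X ==> a <= mlog 2 X"
proof -
 assume a: "2 ^ a <= X"
 then have "0 < X" by (rule less_le_trans[rotated]) simp
 then have "2 ^ a < (2::nat) ^ Suc (mlog 2 X)" using a mlog_bounds[of 2 X] by linarith
 then have "a < Suc (mlog 2 X)" by (rule power_less_imp_less_exp[rotated]) simp
 then show ?thesis by simp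
qed

lemma depth_ge: "2 ^ 2 ^ a <= k ==> a + 3 <= stages_depth k"
 unfolding stages_depth_def by (intro add_mono mlog_ge) auto

lemma depth_le:
 assumes k: "4 <= k"
 shows "2 ^ stages_depth k <= 8 * k" "stages_depth k <= k" "4 <= stages_depth k" "2 ^ stages_depth k <= 8 * mlog 2 k"
proof -
 define l where "l = mlog 2 k"
 define a where "a = mlog 2 l"
 have l: "2 <= l" using mlog_ge[of 2 k] k by (simp add: l_def)
 have a: "1 <= a" using mlog_ge[of 1 l] l by (simp add: a_def)
 have al: "2 ^ a <= l" using mlog_bounds[of 2 l] l by (simp add: a_def)
 have lk: "2 ^ l <= k" using mlog_bounds[of 2 k] k by (simp add: l_def)
 have d: "stages_depth k = a + 3" by (simp add: stages_depth_def a_def l_def)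
 have ll: "l < 2 ^ l" by (rule less_exp)
 show "4 <= stages_depth k" using a d by simp
 show "2 ^ stages_depth k <= 8 * mlog 2 k" using al by (simp add: d power_add l_def)
 then show "2 ^ stages_depth k <= 8 * k" using ll lk unfolding l_def by linarith
 have "a + 3 <= 2 ^ (a + 1)" using a
 proof (induction a rule: nat_induct_at_least)
  case base
  then show ?case by simp
 next
  case (Suc n)
  then show ?case by simp
 qed
 also have "... <= 2 ^ l"
 proof (rule power_increasing)
  have "a < 2 ^ a" by (rule less_exp)
  then show "a + 1 <= l" using al by linarith
 qed simp
 finally show "stages_depth k <= k" using lk d by linarith
qed

lemma length_tower: "length (tower bbs k) = Suc k"
 by (induction k) (auto simp: Let_def)

lemma length_stage: "4 <= k ==> length (stage k P) = 2 ^ k"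
 using depth_le(2)[of k] by (simp add: stage_def Let_def length_solve length_tower power_add[symmetric])

lemma length_prefix_bits: "length (prefix_bits t) = 2 ^ (t + 4)"
 by (induction t) (auto simp: length_stage power_add)

lemma stage_fair:
 fixes z :: real
 assumes k: "4 <= k" and j: "j = stages_depth k" "100 <= j" and b: "2 <= b" "b <= j + 1" and P: "length P = 2 ^ k" and z: "0 <= z"
  and zy: "real (val P * 2 ^ 2 ^ k + val (stage k P)) <= z * 2 ^ (2 ^ k + 2 ^ k)"
   "z * 2 ^ (2 ^ k + 2 ^ k) <= real (val P * 2 ^ 2 ^ k + val (stage k P) + 1)"
 shows "fair j b z (expo b k) (expo b (Suc k))"
proof -
 define bbs where "bbs = bases j [False, True]"
 define t where "t = k - j"
 have kt: "k = j + t" using depth_le(2)[OF k] j by (simp add: t_def)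
 define sts where "sts = map (start k (2 ^ k) P) (levels bbs k)"
 have sg: "stage k P = solve (2 ^ j) (take t (tl (tower bbs (j + t)))) sts"
  using tower_hd[of bbs k] by (simp add: stage_def Let_def j(1)[symmetric] bbs_def[symmetric] t_def[symmetric] sts_def kt[symmetric])
 have st: "\<exists>I. st_ok (i + 2) (val P) (2 ^ k) (2 ^ k) (expo (i + 2) k) I (sts ! i)" if i: "i < j" for i
 proof -
  note lv = lvl_ok_bases(1)[OF i, of k, folded bbs_def]
  obtain m where m: "val (fst (snd (levels bbs k ! i))) = (i + 2) ^ m" using lv by (auto simp: lvl_ok_def)
  have "m = expo (i + 2) k" using lv m by (intro expo_unique) (auto simp: lvl_ok_def)
  moreover have "sts ! i = start k (2 ^ k) P (levels bbs k ! i)"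
   using i lvl_ok_bases(3)[OF i, of k] by (simp add: sts_def bbs_def)
  ultimately show ?thesis using start_ok[OF lv m eq_refl[OF P]] by metis
 qed
 define i where "i = b - 2"
 have i: "b = i + 2" "i < j" using b by (auto simp: i_def)
 obtain I where I: "st_ok (i + 2) (val P) (2 ^ k) (2 ^ k) (expo (i + 2) k) I (sts ! i)" using st[OF i(2)] by blast
 have ne: "near (i + 2) (expo (i + 2) (Suc k)) (2 ^ k + 2 ^ k)"
  using expo[of "i + 2" "Suc k"] by (simp add: near_def mult_2)
 have ls: "length sts = j" using lvl_ok_bases(3)[OF i(2), of k] by (simp add: sts_def bbs_def)
 have st': "\<exists>m I. st_ok (i + 2) (val P) (2 ^ k) (2 ^ k) m I (sts ! i)" if "i < j" for i using st[OF that] by blast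
 note sf = solve_fair[OF j(2) z ls, where t = t, folded kt bbs_def]
 show ?thesis unfolding i(1) by (rule sf[OF st' arg_cong[OF sg[folded kt], of val] zy i(2) I ne])
qed

lemma square_le_power: "4 <= k ==> k * k <= (2::nat) ^ k"
proof (induction k rule: nat_induct_at_least)
 case (Suc k)
 have "4 * k <= k * k" using Suc(1) by (rule mult_le_mono1)
 moreover have "Suc k * Suc k = k * k + 2 * k + 1" by simp
 ultimately have "Suc k * Suc k <= 2 * (k * k)" using Suc(1) by linarith
 then show ?case using Suc by simp
qed simp

text \<open>Far below the true size, but quadratic growth already makes the O(k) digits of an
  unfinished block negligible against the position reached.\<close>

lemma expo_growth:
 assumes "2 <= b" "4 <= k"
 shows "k * k <= b * Suc (expo b k)"
proof -
 have "(2::nat) ^ 2 ^ k <= b ^ Suc (expo b k)" using expo assms by blast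
 also have "... <= (2 ^ b) ^ Suc (expo b k)" by (rule power_mono) (simp_all add: less_imp_le)
 also have "... = 2 ^ (b * Suc (expo b k))" by (simp only: power_mult)
 finally have "2 ^ k <= b * Suc (expo b k)" by (simp only: power_increasing_iff)
 then show ?thesis using square_le_power[OF assms(2)] by linarith
qed

text \<open>The factor 1 + \<open>\<epsilon>\<close> comes from 1 + 6/j. There remain the digits
  before the first usable stage, a constant, and the unfinished block of O(k) digits, where N is at
  least of order k^2; each is eventually at most \<open>\<epsilon>\<close> N.\<close>

lemma limsup_frequency:
 fixes z :: real and b :: nat
 assumes b: "2 <= b" and d: "d < b" and e: "0 < \<epsilon>"
  and fair: "\<And>k. 4 <= k ==> 100 <= stages_depth k ==> b <= stages_depth k + 1 ==>
   fair (stages_depth k) b z (expo b k) (expo b (Suc k))"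
 shows "\<forall>\<^sub>F N in sequentially. real b * real (dcount b d z 0 N) <= (1 + 3 * \<epsilon>) * real N"
proof -
 \<comment> \<open>\<open>a0\<close> makes 6/j at most \<open>\<epsilon>\<close>; the
   \<open>q\<close> obtained next makes 8 b k at most \<open>\<epsilon>\<close> N by way of k^2 <= b
   (N + 1).\<close>
 obtain a0 :: nat where a0: "6 / \<epsilon> < real a0" using reals_Archimedean2 by blast
 obtain q :: nat where q: "16 * (real b)\<^sup>2 / \<epsilon> < real q" using reals_Archimedean2 by blast
 define a where "a = a0 + 100 + b"
 define k2 :: nat where "k2 = 2 ^ 2 ^ a + q + 4"
 define x where "x k = expo b k" for k
 define D where "D m N = real b * real (dcount b d z m N)" for m N
 have dep: "100 <= stages_depth k" "b <= stages_depth k + 1" "6 <= \<epsilon> * real (stages_depth k)" if "k2 <= k" for k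
 proof -
  have 1: "a + 3 <= stages_depth k" using that by (intro depth_ge) (simp add: k2_def)
  then show "100 <= stages_depth k" "b <= stages_depth k + 1" by (auto simp: a_def)
  have "6 < \<epsilon> * real a0" using a0 e by (simp add: divide_less_eq mult.commute)
  also have "... <= \<epsilon> * real (stages_depth k)" using 1 e by (intro mult_left_mono) (auto simp: a_def)
  finally show "6 <= \<epsilon> * real (stages_depth k)" by simp
 qed
 have fk: "fair (stages_depth k) b z (x k) (x (Suc k))" if "k2 <= k" for k
  unfolding x_def using dep[OF that] that by (intro fair) (auto simp: k2_def)
 have mono: "x k <= x (Suc k)" if "k2 <= k" for k using fk[OF that] by (simp add: fair_def)
 have scale: "D m N <= (1 + \<epsilon>) * real L + real b * real c"
  if "j * b * dcount b d z m N <= (j + 6) * L + j * b * c" "6 <= \<epsilon> * real j" for m N L c j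
 proof -
  have j: "0 < real j" using that(2) e by (cases "j = 0") auto
  have "real (j * b * dcount b d z m N) <= real ((j + 6) * L + j * b * c)" using that(1) by (simp only: of_nat_le_iff)
  then have "real j * D m N <= (real j + 6) * real L + real j * (real b * real c)" by (simp add: D_def algebra_simps)
  also have "... <= (real j + \<epsilon> * real j) * real L + real j * (real b * real c)" using that(2) by (intro add_mono mult_right_mono) auto
  also have "... = real j * ((1 + \<epsilon>) * real L + real b * real c)" by (simp add: algebra_simps)
  finally show ?thesis using j by (simp only: mult_le_cancel_left_pos)
 qed
 have step: "D (x k) (x (Suc k)) <= (1 + \<epsilon>) * real (x (Suc k) - x k)" if "k2 <= k" for k
  using scale[of "stages_depth k" "x k" "x (Suc k)" "x (Suc k) - x k" 0] fk[OF that] dep[OF that] d by (simp add: fair_def)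
 have part: "D (x k) N <= (1 + \<epsilon>) * real (N - x k) + real b * real (2 ^ stages_depth k + 5)"
  if "k2 <= k" "x k <= N" "N <= x (Suc k)" for k N
  using scale[of "stages_depth k" "x k" N "N - x k" "2 ^ stages_depth k + 5"] fk[OF that(1)] dep[OF that(1)] d that by (simp add: fair_def)
 have spl: "D m N = D m k + D k N" if "m <= k" "k <= N" for m k N
  using dcount_split[OF that, of b d z] by (simp add: D_def distrib_left)
 have tot: "x k2 <= x k \<and> D (x k2) (x k) <= (1 + \<epsilon>) * real (x k - x k2)" if "k2 <= k" for k
  using that
 proof (induction k rule: nat_induct_at_least)
  case base
  then show ?case using dcount_le[of b d z "x k2" "x k2"] by (simp add: D_def)
 next
  case (Suc k)
  have "D (x k2) (x (Suc k)) <= (1 + \<epsilon>) * real (x k - x k2) + (1 + \<epsilon>) * real (x (Suc k) - x k)"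
   using spl[OF conjunct1[OF Suc(2)] mono[OF Suc(1)]] conjunct2[OF Suc(2)] step[OF Suc(1)] by linarith
  also have "... = (1 + \<epsilon>) * real (x (Suc k) - x k2)" using Suc mono[of k] by (simp add: of_nat_diff algebra_simps)
  finally show ?case using Suc mono[of k] by simp
 qed
 define c where "c = real b * real (x k2) + 5 * real b"
 obtain n0 :: nat where n0: "c / \<epsilon> < real n0" using reals_Archimedean2 by blast
 show ?thesis using eventually_ge_at_top[of "n0 + x k2 + 1"]
 proof eventually_elim
  case (elim N)
  \<comment> \<open>Growth of the starting positions guarantees a stage that ends beyond N; the
    least such stage contains N.\<close>
  have "\<exists>k. k2 <= k \<and> N < x (Suc k)"
  proof -
   define k where "k = k2 + b * (N + 2)"
   have "b * (N + 2) * 1 <= Suc k * Suc k" by (intro mult_le_mono) (auto simp: k_def)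
   also have "... <= b * Suc (x (Suc k))" unfolding x_def by (rule expo_growth[OF b]) (simp add: k_def k2_def)
   finally have "N + 2 <= Suc (x (Suc k))" unfolding mult_1_right mult_le_cancel1 using b by simp
   then show ?thesis by (intro exI[of _ k]) (auto simp: k_def)
  qed
  then obtain k where k: "k2 <= k \<and> N < x (Suc k)" and lst: "\<And>i. i < k ==> \<not> (k2 <= i \<and> N < x (Suc i))"
   using exists_least_iff[of "%k. k2 <= k \<and> N < x (Suc k)"] by blast
  have xk: "x k <= N"
  proof (cases "k = k2")
   case True
   then show ?thesis using elim by simp
  next
   case False
   then have "k2 <= k - 1" "Suc (k - 1) = k" "k - 1 < k" using k by auto
   then show ?thesis using lst[of "k - 1"] by auto
  qed
  have kk: "8 * real b * real k <= \<epsilon> * real N"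
  proof -
   have "16 * (real b)\<^sup>2 <= \<epsilon> * real q" using q e by (simp add: divide_less_eq mult.commute)
   also have "... <= \<epsilon> * real k" using k e by (intro mult_left_mono) (auto simp: k2_def)
   finally have "16 * (real b)\<^sup>2 * real k <= \<epsilon> * real k * real k" by (rule mult_right_mono) simp
   moreover have "k * k <= b * (N + 1)"
   proof -
    have "k * k <= b * Suc (x k)" unfolding x_def using k by (intro expo_growth[OF b]) (auto simp: k2_def)
    also have "... <= b * (N + 1)" using xk by (intro mult_le_mono2) simp
    finally show ?thesis .
   qed
   then have "real (k * k) <= real (b * (N + 1))" by (simp only: of_nat_le_iff)
   then have "\<epsilon> * (real k * real k) <= \<epsilon> * (real b * (real N + 1))" using e by (intro mult_left_mono) (auto simp: algebra_simps)
   ultimately have "real b * (16 * real b * real k) <= real b * (\<epsilon> * (real N + 1))" by (simp add: power2_eq_square algebra_simps)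
   then have "16 * real b * real k <= \<epsilon> * (real N + 1)" using b by simp
   also have "... <= \<epsilon> * (2 * real N)" using e elim by (intro mult_left_mono) auto
   finally show ?thesis by simp
  qed
  have "2 ^ stages_depth k <= 8 * k" using k by (intro depth_le) (simp add: k2_def)
  then have "real (2 ^ stages_depth k + 5) <= real (8 * k + 5)" by (simp only: of_nat_le_iff add_right_mono)
  then have dk: "real b * real (2 ^ stages_depth k + 5) <= real b * real (8 * k + 5)" by (rule mult_left_mono) simp
  have tk: "x k2 <= x k" "D (x k2) (x k) <= (1 + \<epsilon>) * real (x k - x k2)" using tot[of k] k by auto
  have s1: "D 0 N = D 0 (x k2) + (D (x k2) (x k) + D (x k) N)"
   using spl[of 0 "x k2" N] spl[of "x k2" "x k" N] tk(1) xk by simp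
  have s2: "D 0 (x k2) <= real b * real (x k2)" unfolding D_def
   using dcount_le[of b d z 0 "x k2"] by (intro mult_left_mono) auto
  have s3: "(1 + \<epsilon>) * real (x k - x k2) + (1 + \<epsilon>) * real (N - x k) <= (1 + \<epsilon>) * real N"
   unfolding distrib_left[symmetric] using e tk(1) xk by (intro mult_left_mono) auto
  have s4: "D (x k) N <= (1 + \<epsilon>) * real (N - x k) + real b * real (8 * k + 5)"
   using part[of k N] k xk dk by simp
  have s5: "c <= \<epsilon> * real N"
  proof -
   have "c <= \<epsilon> * real n0" using n0 e by (simp add: divide_less_eq mult.commute)
   also have "... <= \<epsilon> * real N" using elim e by (intro mult_left_mono) auto
   finally show ?thesis .
  qed
  have s6: "real b * real (8 * k + 5) = 8 * real b * real k + 5 * real b" by (simp add: algebra_simps)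
  have "D 0 N <= (1 + \<epsilon>) * real N + \<epsilon> * real N + \<epsilon> * real N"
   using s1 s2 s3 s4 s5 tk(2) kk unfolding s6 c_def by linarith
  also have "... = (1 + 3 * \<epsilon>) * real N" by (simp add: algebra_simps)
  finally show ?case by (simp add: D_def)
 qed
qed

text \<open>Closed at both ends because z is obtained as a supremum; strictness on the right is
  recovered in \<open>encodes_digits\<close>.\<close>

definition encodes :: "real => bool" where
 "encodes z \<longleftrightarrow> (\<forall>t. real (val (prefix_bits t)) <= z * 2 ^ 2 ^ (t + 4) \<and> z * 2 ^ 2 ^ (t + 4) <= real (val (prefix_bits t) + 1))"

theorem encodes_absolutely_normal:
 assumes z: "0 <= z" and en: "encodes z"
 shows "absolutely_normal z"
proof (rule absolutely_normal_if_simply_normal)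
 fix b d :: nat
 assume b: "2 <= b" and d: "d < b"
 have fk: "fair (stages_depth k) b z (expo b k) (expo b (Suc k))"
  if k: "4 <= k" "100 <= stages_depth k" "b <= stages_depth k + 1" for k
 proof -
  obtain t where t: "k = t + 4" using k(1) by (metis le_add_diff_inverse2)
  have lp: "length (prefix_bits t) = 2 ^ k" by (simp add: length_prefix_bits t)
  have s: "(2::nat) ^ (Suc t + 4) = 2 ^ k + 2 ^ k" by (simp add: t power_add)
  have v: "val (prefix_bits (Suc t)) = val (prefix_bits t) * 2 ^ 2 ^ k + val (stage k (prefix_bits t))"
   using length_stage[OF k(1), of "prefix_bits t"] by (simp add: t)
  have zy: "real (val (prefix_bits t) * 2 ^ 2 ^ k + val (stage k (prefix_bits t))) <= z * 2 ^ (2 ^ k + 2 ^ k)"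
   "z * 2 ^ (2 ^ k + 2 ^ k) <= real (val (prefix_bits t) * 2 ^ 2 ^ k + val (stage k (prefix_bits t)) + 1)"
   using en[unfolded encodes_def, rule_format, of "Suc t"] unfolding s v by blast+
  show ?thesis by (rule stage_fair[OF k(1) refl k(2) b k(3) lp z zy])
 qed
 have eq: "card {i. i < N \<and> digit b z i = e} = dcount b e z 0 N" for e N by (simp add: dcount_def)
 show "(%N. real (card {i. i < N \<and> digit b z i = d}) / real N) \<longlonglongrightarrow> 1 / real b"
  unfolding eq
 proof (rule frequencies_tend_to[where \<sigma> = 1 and M = b and f = "%d N. real (dcount b d z 0 N) / real N"])
  show "(\<Sum>W<b. real (dcount b W z 0 N) / real N) = 1" if N: "0 < N" for N
  proof -
   have dB: "digit b z i < b" for i unfolding digit_def using b by (simp add: nat_less_iff)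
   have "(\<Sum>W<b. dcount b W z 0 N) = (\<Sum>W<b. \<Sum>i\<in>{i \<in> {..<N}. digit b z i = W}. 1)" by (simp add: dcount_def)
   also have "... = (\<Sum>i<N. 1)" by (rule sum.group) (use dB in auto)
   finally have "(\<Sum>W<b. dcount b W z 0 N) = N" by simp
   then have "(\<Sum>W<b. real (dcount b W z 0 N)) = real N" by (metis of_nat_sum)
   then show ?thesis using N by (simp add: sum_divide_distrib[symmetric])
  qed
  fix W \<epsilon> :: real and V :: nat assume V: "V < b" and e: "0 < \<epsilon>"
  have "\<forall>\<^sub>F N in sequentially. real b * real (dcount b V z 0 N) <= (1 + 3 * (\<epsilon> / 3)) * real N"
   using e by (intro limsup_frequency[OF b V _ fk]) auto
  then show "\<forall>\<^sub>F N in sequentially. 1 * (real (dcount b V z 0 N) / real N - 1 / real b) <= \<epsilon>"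
   using eventually_gt_at_top[of 0]
  proof eventually_elim
   case (elim N)
   have "real (dcount b V z 0 N) <= (1 + \<epsilon>) / real b * real N" using elim(1) b by (simp add: field_simps)
   then have "real (dcount b V z 0 N) / real N <= (1 + \<epsilon>) / real b" using elim(2) by (simp add: divide_le_eq)
   also have "... = 1 / real b + \<epsilon> / real b" by (simp add: add_divide_distrib)
   also have "... <= 1 / real b + \<epsilon>" using b e by (simp add: divide_le_eq)
   finally show ?case by simp
  qed
 qed (use b d in auto)
qed

text \<open>Each stage puts its bits below the old ones, so the dyadic intervals of the prefixes are
  nested; z is the supremum of their left end points.\<close>

lemma encodes_exists: "\<exists>z. 0 <= z \<and> z < 1 \<and> encodes z"
proof -
 define L :: "nat => real" where "L t = 2 ^ 2 ^ (t + 4)" for t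
 define x where "x t = real (val (prefix_bits t)) / L t" for t
 define u where "u t = real (val (prefix_bits t) + 1) / L t" for t
 have L: "0 < L t" "L (Suc t) = L t * L t" for t
 proof -
  show "0 < L t" by (simp add: L_def)
  have e: "(2::nat) ^ (Suc t + 4) = 2 ^ (t + 4) + 2 ^ (t + 4)" by (simp add: power_add)
  show "L (Suc t) = L t * L t" unfolding L_def e by (rule power_add)
 qed
 have v: "val (prefix_bits (Suc t)) = val (stage (t + 4) (prefix_bits t)) + 2 ^ 2 ^ (t + 4) * val (prefix_bits t)" for t
  by (simp add: length_stage)
 have xs: "x t <= x (Suc t)" for t
 proof -
  have "L t * real (val (prefix_bits t)) <= real (val (prefix_bits (Suc t)))" unfolding v by (simp add: L_def)
  then show ?thesis using L(1)[of t] unfolding x_def L(2) by (simp add: field_simps)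
 qed
 have us: "u (Suc t) <= u t" for t
 proof -
  have "val (stage (t + 4) (prefix_bits t)) < 2 ^ 2 ^ (t + 4)" using val_less[of "stage (t + 4) (prefix_bits t)"] by (simp add: length_stage)
  then have "val (prefix_bits (Suc t)) + 1 <= 2 ^ 2 ^ (t + 4) * (val (prefix_bits t) + 1)" unfolding v by simp
  then have "real (val (prefix_bits (Suc t)) + 1) <= real (2 ^ 2 ^ (t + 4) * (val (prefix_bits t) + 1))" by (simp only: of_nat_le_iff)
  then have "real (val (prefix_bits (Suc t)) + 1) <= L t * real (val (prefix_bits t) + 1)"
   by (simp only: of_nat_mult of_nat_power of_nat_numeral L_def)
  then have "real (val (prefix_bits (Suc t)) + 1) / (L t * L t) <= L t * real (val (prefix_bits t) + 1) / (L t * L t)"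
   by (rule divide_right_mono) simp
  then show ?thesis using L(1)[of t] unfolding u_def L(2) by (simp del: prefix_bits.simps)
 qed
 have xu: "x s <= u t" for s t
 proof -
  have "x s <= x (max s t)" by (rule lift_Suc_mono_le[of x]) (auto intro: xs)
  also have "... <= u (max s t)" unfolding x_def u_def using L(1)[of "max s t"] by (intro divide_right_mono) auto
  also have "... <= u t" by (rule lift_Suc_antimono_le[of u]) (auto intro: us)
  finally show ?thesis .
 qed
 define z where "z = Sup (range x)"
 have up: "x t <= z" for t unfolding z_def by (rule cSup_upper) (auto intro!: bdd_aboveI[of _ "u 0"] xu)
 have lo: "z <= u t" for t unfolding z_def by (rule cSup_least) (auto intro: xu)
 have "0 <= z" using up[of 0] by (simp add: x_def)
 moreover have "z < 1" using lo[of 0] by (simp add: u_def L_def)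
 moreover have "encodes z" unfolding encodes_def
 proof (intro allI conjI)
  fix t
  show "real (val (prefix_bits t)) <= z * 2 ^ 2 ^ (t + 4)" using up[of t] L(1)[of t] by (simp add: x_def L_def divide_le_eq)
  show "z * 2 ^ 2 ^ (t + 4) <= real (val (prefix_bits t) + 1)" using lo[of t] L(1)[of t] by (simp add: u_def L_def le_divide_eq)
 qed
 ultimately show ?thesis by blast
qed

lemma nth_val: "i < length xs ==> xs ! i \<longleftrightarrow> val xs div 2 ^ i mod 2 = 1"
proof -
 assume "i < length xs"
 then have "val (drop i xs) = of_bool (xs ! i) + 2 * val (drop (Suc i) xs)" by (simp flip: Cons_nth_drop_Suc)
 then show ?thesis unfolding val_drop by (cases "xs ! i") auto
qed

text \<open>If z were the right end point of one of its intervals, all later binary digits would be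
  0, which contradicts normality in base 2. Hence the floor of the scaled z is the prefix
  itself.\<close>

lemma encodes_digits:
 assumes z: "0 <= z" and en: "encodes z" and n: "n < 2 ^ (t + 4)"
 shows "rev (prefix_bits t) ! n \<longleftrightarrow> digit 2 z n = 1"
proof -
 define L :: nat where "L = 2 ^ (t + 4)"
 define a where "a = val (prefix_bits t)"
 have a: "real a <= z * 2 ^ L" "z * 2 ^ L <= real a + 1" using en by (auto simp: encodes_def a_def L_def add.commute)
 have "z * 2 ^ L \<noteq> real a + 1"
 proof
  assume eq: "z * 2 ^ L = real a + 1"
  have dz: "digit 2 z i = 0" if "L <= i" for i
  proof -
   have "z * 2 ^ (i + 1) = z * 2 ^ L * 2 ^ (i + 1 - L)" using that by (simp add: power_add[symmetric] mult.assoc)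
   also have "... = real ((a + 1) * 2 ^ (i + 1 - L))" unfolding eq by (simp add: algebra_simps)
   also have "i + 1 - L = Suc (i - L)" using that by simp
   finally have "\<lfloor>z * 2 ^ (i + 1)\<rfloor> = int ((a + 1) * 2 ^ Suc (i - L))" by (simp only: floor_of_nat)
   then show ?thesis by (simp add: digit_def)
  qed
  have "(%N. real (occ 2 z [1] N) / real N) \<longlonglongrightarrow> 1 / real 2 ^ length [1::nat]"
   using encodes_absolutely_normal[OF z en] unfolding absolutely_normal_def normal_in_base_def by (metis list.distinct(1) list.set_cases one_less_numeral_iff order_refl semiring_norm(76) empty_set singletonD list.simps(15) empty_iff insertE set_ConsD)
  moreover have "(%N. real (occ 2 z [1] N) / real N) \<longlonglongrightarrow> 0"
  proof (rule real_tendsto_sandwich[of "%_. 0"])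
   have "occ 2 z [1] N <= L" for N
   proof -
    have "occ 2 z [1] N <= card {..<L}" unfolding occ_def
    proof (rule card_mono)
     show "{i. i < N \<and> (\<forall>j<length [1]. digit 2 z (i + j) = [1] ! j)} \<subseteq> {..<L}"
     proof
      fix i assume "i \<in> {i. i < N \<and> (\<forall>j<length [1]. digit 2 z (i + j) = [1] ! j)}"
      then have "digit 2 z i = 1" by simp
      then show "i \<in> {..<L}" using dz[of i] by (cases "L <= i") auto
     qed
    qed simp
    then show ?thesis by simp
   qed
   then show "\<forall>\<^sub>F N in sequentially. real (occ 2 z [1] N) / real N <= real L / real N"
    by (intro always_eventually allI divide_right_mono) auto
   show "(%N. real L / real N) \<longlonglongrightarrow> 0" using tendsto_mult_right_zero[OF lim_1_over_n, of "real L"] by simp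
  qed auto
  ultimately have "1 / real 2 ^ length [1::nat] = 0" by (rule LIMSEQ_unique)
  then show False by simp
 qed
 then have "z * 2 ^ L < real a + 1" using a by linarith
 then have fl: "\<lfloor>z * 2 ^ L\<rfloor> = int a" using a(1) by (simp add: floor_eq_iff)
 define s where "s = L - Suc n"
 have nL: "n + 1 + s = L" using n by (simp add: s_def L_def)
 have "\<lfloor>z * real 2 ^ (n + 1)\<rfloor> = int a div int (2 ^ s)" using floor_scale[of 2 z "n + 1" s] fl unfolding nL by simp
 then have "digit 2 z n = a div 2 ^ s mod 2" unfolding digit_def
  by (metis nat_int of_nat_numeral zdiv_int zmod_int)
 moreover have "rev (prefix_bits t) ! n = prefix_bits t ! s" using n by (simp add: rev_nth length_prefix_bits s_def L_def)
 moreover have "s < length (prefix_bits t)" using nL by (simp add: length_prefix_bits L_def)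
 ultimately show ?thesis using nth_val[of s "prefix_bits t"] by (simp add: a_def)
qed

section \<open>Cost of a stage\<close>

lemma cmp_bases: "cmp (%x. snd x \<noteq> []) (%x. bases (fst x) (snd x)) (%x. fst x * (length (snd x) + fst x + 3))"
 apply (rule cmp_rec1'[where p = "%x. fst x = 0" and base = "%x. []" and s = "%x. (fst x - Suc 0, addb False (snd x) [True])"
  and post = "%y. snd (fst y) # snd y" and W = "%x. if fst x = 0 then 0 else length (snd x) + 1" and K = 3])
 subgoal for x by (cases "fst x") auto
 subgoal by simp
 apply (rule cmp_intros)+
 subgoal by simp
 subgoal by simp
 subgoal by simp
 subgoal by simp
 subgoal by simp
 subgoal for x
 proof -
  assume a: "snd x \<noteq> []" "fst x \<noteq> 0"
  then obtain n where n: "fst x = Suc n" by (cases "fst x") auto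
  have "max (length (snd x)) (Suc 0) = length (snd x)" using a(1) by (cases "snd x") auto
  then show ?thesis by (simp add: n)
 qed
 done

lemma cmp_start:
 "cmp (%p. arg2 (fst p) = 2 ^ fst (fst p) \<and> length (rst3 (fst p)) <= 2 ^ fst (fst p) \<and> length (arg2 (snd p)) <= 2 ^ fst (fst p))
  (%p. start (fst (fst p)) (arg2 (fst p)) (rst3 (fst p)) (snd p)) (%p. 2 ^ fst (fst p) * (fst (fst p) + 1) ^ 15)"
 unfolding start_def
 apply (rule cmp_le'[where K = 20])
 apply (rule cmp_mulb' cmp_intros)+
 apply simp
 apply (rule cmp_intros)+
 subgoal for p
 proof -
  assume a: "arg2 (fst p) = 2 ^ fst (fst p) \<and> length (rst3 (fst p)) <= 2 ^ fst (fst p) \<and> length (arg2 (snd p)) <= 2 ^ fst (fst p)"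
  have "2 ^ fst (fst p) * 1 <= 2 ^ fst (fst p) * (fst (fst p) + 1) ^ 15" by (intro mult_le_mono2) simp
  then have "arg2 (fst p) <= 2 ^ fst (fst p) * (fst (fst p) + 1) ^ 15" using a by simp
  moreover obtain U where U: "2 ^ fst (fst p) * (fst (fst p) + 1) ^ 15 = U" by blast
  ultimately show ?thesis unfolding U by simp
 qed
 done

lemma table_ok_tower: "table_ok (2 ^ j) j (take t (tl (tower (bases j [False, True]) (j + t))))"
proof (induction t)
 case (Suc t)
 let ?bbs = "bases j [False, True]"
 have v: "2 <= val bb \<and> length bb <= j + 1" if "bb \<in> set ?bbs" for bb
  using that by (auto simp: in_set_conv_nth bases)
 have e: "length (fst (snd q)) <= 2 ^ (j + t) \<and> length (snd (snd q)) <= 4 * 2 ^ (j + t)" if q: "q \<in> set (levels ?bbs (j + t))" for q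
 proof -
  have 1: "length (fst (snd q)) <= 2 ^ (j + t)" "fst q \<in> set ?bbs" "length (snd (snd q)) <= 2 ^ (j + t) + 2 * length (fst q)"
   using levels_entry[of ?bbs q "j + t"] v q by auto
  have "j < 2 ^ j" by (rule less_exp)
  moreover have "(2::nat) ^ j <= 2 ^ (j + t)" by (rule power_increasing) auto
  moreover have "length (fst q) <= j + 1" using v[OF 1(2)] by simp
  ultimately have "length (snd (snd q)) <= 4 * 2 ^ (j + t)" using 1(3) by linarith
  then show ?thesis using 1(1) by simp
 qed
 have "length (levels ?bbs (j + t)) = j" using levels_ok[of ?bbs "j + t"] v by (simp add: bases)
 then show ?case unfolding tower_take using Suc e by (auto simp: power_add length_tower min_def)
qed simp

lemma cmp_depth: "cmp (%_. True) stages_depth (%k. k)"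
 unfolding stages_depth_def
 apply (rule cmp_le'[where K = 40])
 apply (rule cmp_intros)+
 subgoal for k
 proof -
  have m: "mlog 2 X <= X" for X
  proof (cases "X = 0")
   case True
   then show ?thesis by (simp add: mlog.simps[of 2 0])
  next
   case False
   then have "2 ^ mlog 2 X <= X" using mlog_bounds[of 2 X] by simp
   then show ?thesis using less_exp[of "mlog 2 X"] by linarith
  qed
  then have "mlog 2 k <= k" "mlog 2 (mlog 2 k) <= mlog 2 k" by blast+
  then show ?thesis by simp
 qed
 done

text \<open>The exhaustive search dominates: a block has at most 8 log k bits, so 2^(block length)
  <= (k + 1)^8, and the 16th power of \<open>cmp_leaf\<close> gives (k + 1)^128. Tables and tree
  levels stay within the exponent 18.\<close>

lemma cmp_stage: "cmp (%x. 4 <= fst x \<and> length (snd x) = 2 ^ fst x) (%x. stage (fst x) (snd x)) (%x. 2 ^ fst x * (fst x + 1) ^ 128)"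
 (is "cmp ?D _ ?T")
proof -
 let ?j = "%x. stages_depth (fst x)"
 let ?t = "%x. tower (bases (?j x) [False, True]) (fst x)"
 let ?G = "%x. 2 ^ fst x * (fst x + 1) ^ 18"
 have G: "k <= 2 ^ k * (k + 1) ^ 18" "2 ^ k * (k + 1) ^ 16 <= 2 ^ k * (k + 1) ^ 18" "2 ^ k <= 2 ^ k * (k + 1) ^ 18" "k * k <= 2 ^ k * (k + 1) ^ 18"
  "2 ^ k * (k + 1) ^ 15 <= 2 ^ k * (k + 1) ^ 18" for k :: nat
 proof -
  have "1 * (k + 1) <= 2 ^ k * (k + 1) ^ 18" by (intro mult_le_mono self_le_power) auto
  then show "k <= 2 ^ k * (k + 1) ^ 18" by simp
  show "2 ^ k * (k + 1) ^ 16 <= 2 ^ k * (k + 1) ^ 18" "2 ^ k * (k + 1) ^ 15 <= 2 ^ k * (k + 1) ^ 18" by (intro mult_le_mono2 power_increasing; simp)+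
  have "2 ^ k * 1 <= 2 ^ k * (k + 1) ^ 18" by (intro mult_le_mono2) simp
  then show "2 ^ k <= 2 ^ k * (k + 1) ^ 18" by simp
  have "1 * (k + 1) ^ 2 <= 2 ^ k * (k + 1) ^ 18" by (intro mult_le_mono power_increasing) auto
  then show "k * k <= 2 ^ k * (k + 1) ^ 18" by (simp add: power2_eq_square)
 qed
 have v: "2 <= val bb \<and> length bb <= j + 1" if "bb \<in> set (bases j [False, True])" for bb j
  using that by (auto simp: in_set_conv_nth bases)
 have f1: "cmp ?D (%x. (x, ?j x)) ?G"
  apply (rule cmp_le'[where K = 2])
  apply (rule true_app[OF cmp_depth] cmp_intros)+
  subgoal for x using G(1)[of "fst x"] by simp
  done
 let ?D1 = "%y. ?D (fst y) \<and> snd y = ?j (fst y)"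
 have bs: "cmp ?D1 (%y. (bases (snd y) [False, True], fst (fst y))) (%y. ?G (fst y))"
  apply (rule cmp_le'[where K = 20])
  apply (rule cmp_Pair)
   apply (rule cmp_app[OF cmp_bases, of _ "%y. (snd y, [False, True])", unfolded fst_conv snd_conv])
   apply (rule cmp_intros)+
   apply simp
  apply (rule cmp_intros)+
  subgoal for y
  proof -
   assume a: "?D1 y"
   define k where "k = fst (fst y)"
   have j: "snd y <= k" "4 <= k" using a depth_le(2)[of "fst (fst y)"] by (auto simp: k_def)
   have "snd y * (length [False, True] + snd y + 3) <= k * (k + 5)" using j by (intro mult_le_mono) auto
   also have "... <= k * (3 * k)" using j by (intro mult_le_mono2) simp
   finally have "snd y * (length [False, True] + snd y + 3) <= 3 * (k * k)" by simp
   moreover obtain U where U: "2 ^ k * (k + 1) ^ 18 = U" by blast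
   moreover obtain u where u: "snd y * (length [False, True] + snd y + 3) = u" by blast
   ultimately show ?thesis using G(4)[of k] unfolding k_def[symmetric] U u by simp
  qed
  done
 have f2: "cmp ?D1 (%y. (y, tower (bases (snd y) [False, True]) (fst (fst y)))) (%y. ?G (fst y))"
  apply (rule cmp_le'[where K = 200])
  apply (rule cmp_Pair[OF cmp_id])
  apply (rule cmp_app[OF cmp_tower bs, unfolded fst_conv snd_conv])
  subgoal for y using v[of _ "snd y"] by (auto simp: bases)
  subgoal for y
  proof -
   assume a: "?D1 y"
   define k where "k = fst (fst y)"
   have j: "snd y <= k" "4 <= k" using a depth_le(2)[of "fst (fst y)"] by (auto simp: k_def)
   have "(snd y + 3) ^ 3 <= (3 * (k + 1)) ^ 3" using j by (intro power_mono) auto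
   also have "... = 27 * (k + 1) ^ 3" by (simp only: power_mult_distrib) simp
   finally have "2 ^ k * (k + 1) ^ 15 * (snd y + 3) ^ 3 <= 2 ^ k * (k + 1) ^ 15 * (27 * (k + 1) ^ 3)" by (rule mult_le_mono2)
   also have "... = 27 * (2 ^ k * ((k + 1) ^ 15 * (k + 1) ^ 3))" by (simp only: ac_simps)
   also have "(k + 1) ^ 15 * (k + 1) ^ 3 = (k + 1) ^ 18" by (simp only: power_add[symmetric]) simp
   finally have 1: "2 ^ k * (k + 1) ^ 15 * (snd y + 3) ^ 3 <= 27 * (2 ^ k * (k + 1) ^ 18)" .
   obtain U where U: "2 ^ k * (k + 1) ^ 18 = U" by blast
   obtain u where u: "2 ^ k * (k + 1) ^ 15 * (snd y + 3) ^ 3 = u" by blast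
   show ?thesis using 1 unfolding bases(1) k_def[symmetric] U u by simp
  qed
  done
 let ?D2 = "%z. ?D1 (fst z) \<and> snd z = ?t (fst (fst z))"
 let ?k = "%z. fst (fst (fst z))" and ?P = "%z. snd (fst (fst z))" and ?jj = "%z. snd (fst z)"
 let ?arg = "%z. (2 ^ ?jj z :: nat, ?jj z, take (?k z - ?jj z) (tl (snd z)),
   map ((%c. start (fst c) (fst (snd c)) (snd (snd c))) (?k z, fst (snd (hd (snd z))), ?P z)) (snd (snd (hd (snd z)))))"
 have hd2: "snd z \<noteq> []" "hd (snd z) = (?k z, 2 ^ ?k z, levels (bases (?jj z) [False, True]) (?k z))" if "?D2 z" for z
  using that tower_hd[of "bases (?jj z) [False, True]" "?k z"] by auto
 have f3: "cmp ?D2 ?arg (%z. ?G (fst (fst z)))"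
  apply (rule cmp_le'[where K = 60])
  apply (rule cmp_map[OF cmp_start] cmp_intros | erule hd2(1))+
  subgoal for z e
  proof -
   assume a: "?D2 z" and e: "e \<in> set (snd (snd (hd (snd z))))"
   then show ?thesis using hd2[OF a] levels_entry[of "bases (?jj z) [False, True]" e "?k z"] v[of _ "?jj z"] by auto
  qed
  subgoal for z
  proof -
   assume a: "?D2 z"
   define k where "k = ?k z"
   have k4: "4 <= k" using a by (simp add: k_def)
   have j: "?jj z <= k" "2 ^ ?jj z <= 8 * k" using a depth_le(1,2)[OF k4] by (auto simp: k_def)
   have l: "length (levels (bases (?jj z) [False, True]) k) = ?jj z" using levels_ok[of "bases (?jj z) [False, True]" k] v by (simp add: bases)
   have "?jj z * (2 ^ ?jj z + 2 + 3) <= k * (8 * k + 5)" using j by (intro mult_le_mono) auto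
   also have "... <= k * (10 * k)" using k4 by (intro mult_le_mono2) simp
   finally have 1: "?jj z * (2 ^ ?jj z + 2 + 3) <= 10 * (k * k)" by simp
   define V where "V = 2 ^ k * (k + 1) ^ 15"
   have "1 <= V" by (simp add: V_def Suc_le_eq)
   then have "?jj z * (V + 1) <= (k + 1) * (2 * V)" using j by (intro mult_le_mono) auto
   also have "... = 2 * (2 ^ k * ((k + 1) * (k + 1) ^ 15))" by (simp only: V_def ac_simps)
   also have "(k + 1) * (k + 1) ^ 15 = (k + 1) ^ 16" by (simp only: power_Suc[symmetric]) simp
   finally have 2: "?jj z * (V + 1) <= 2 * (2 ^ k * (k + 1) ^ 16)" .
   obtain U where U: "2 ^ k * (k + 1) ^ 18 = U" by blast
   obtain U' where U': "2 ^ k * (k + 1) ^ 16 = U'" by blast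
   obtain u where u: "?jj z * (2 ^ ?jj z + 2 + 3) = u" by blast
   obtain w where w: "?jj z * (V + 1) = w" by blast
   have su: "(\<Sum>y\<leftarrow>levels (bases (?jj z) [False, True]) k. V + 1) = w" using l w by (simp add: sum_list_triv)
   show ?thesis using 1 2 G(1,2,4)[of k] j(1) unfolding hd2(2)[OF a] fst_conv snd_conv k_def[symmetric] V_def[symmetric] su u w U U' by simp
  qed
  done
 let ?E = "%x. 2 <= fst x \<and> table_ok (fst x) (fst (snd x)) (arg3 x) \<and> length (rst4 x) <= fst (snd x) \<and> fst (snd x) + 1 <= 2 ^ fst x \<and>
   (\<forall>w\<in>set (rst4 x). length (fst w) <= 2 * (fst x * 2 ^ length (arg3 x)) \<and> length (snd w) <= 2 * (fst x * 2 ^ length (arg3 x)))"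
 have ok: "?E (?arg z)" if a: "?D2 z" for z
 proof -
  define k where "k = ?k z"
  define j where "j = ?jj z"
  have k4: "4 <= k" using a by (simp add: k_def)
  have j: "j <= k" "4 <= j" using a depth_le(2,3)[OF k4] by (auto simp: k_def j_def)
  obtain t where t: "k = j + t" using j(1) le_Suc_ex by blast
  have sz: "snd z = tower (bases j [False, True]) k" using a by (simp add: j_def k_def)
  have lt: "length (take (k - j) (tl (snd z))) = t" by (simp add: sz length_tower t)
  have 1: "table_ok (2 ^ j) j (take (k - j) (tl (snd z)))" using table_ok_tower[of j t] by (simp add: sz t)
  have h: "hd (snd z) = (k, 2 ^ k, levels (bases j [False, True]) k)" using hd2(2)[OF a] by (simp add: k_def j_def)
  have l: "length (levels (bases j [False, True]) k) = j" using levels_ok[of "bases j [False, True]" k] v by (simp add: bases)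
  have "(2::nat) ^ 1 <= 2 ^ j" using j by (intro power_increasing) auto
  moreover have "j + 1 <= 2 ^ j" "2 ^ j + 1 <= (2::nat) ^ 2 ^ j" by (simp_all add: Suc_le_eq)
  then have "j + 1 <= 2 ^ 2 ^ j" by linarith
  moreover have "length (fst (start k (2 ^ k) (?P z) e)) <= 2 * 2 ^ k \<and> length (snd (start k (2 ^ k) (?P z) e)) <= 2 * 2 ^ k"
   if "e \<in> set (levels (bases j [False, True]) k)" for e
   using levels_entry[of "bases j [False, True]" e k] v[of _ j] that by (auto simp: start_def)
  moreover have "2 ^ j * 2 ^ t = (2::nat) ^ k" by (simp add: t power_add)
  ultimately show ?thesis unfolding fst_conv snd_conv k_def[symmetric] j_def[symmetric] h lt using 1 l by auto
 qed
 have cost: "2 ^ length tab * ((2 ^ lam) ^ 16 + 2 + length tab * ((j + 1) * lam * (lam + length tab + 4) ^ 15 + 2)) <= (8 * 13 ^ 15 + 5) * (2 ^ k * (k + 1) ^ 128)"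
  if "lam = 2 ^ j" "j = stages_depth k" "length tab = k - j" "4 <= k" for tab :: "(nat \<times> nat \<times> entry list) list" and lam j k :: nat
 proof -
  have j: "j <= k" "lam <= 8 * k" "lam <= 8 * mlog 2 k" using depth_le[OF that(4)] that by auto
  have "(2::nat) ^ lam <= 2 ^ (8 * mlog 2 k)" using j by (intro power_increasing) auto
  also have "... = (2 ^ mlog 2 k) ^ 8" by (simp only: power_mult[symmetric] mult.commute)
  also have "... <= (k + 1) ^ 8" using mlog_bounds[of 2 k] that(4) by (intro power_mono) auto
  finally have "(2 ^ lam) ^ 16 <= ((k + 1) ^ 8) ^ 16" by (rule power_mono) simp
  then have L: "(2 ^ lam) ^ 16 <= (k + 1) ^ 128" by (simp only: power_mult[symmetric]) simp
  have "(j + 1) * lam * (lam + length tab + 4) ^ 15 <= (k + 1) * (8 * (k + 1)) * (13 * (k + 1)) ^ 15"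
   using j that(3) by (intro mult_le_mono power_mono) auto
  also have "... = 8 * 13 ^ 15 * ((k + 1) * (k + 1) * (k + 1) ^ 15)" by (simp only: power_mult_distrib ac_simps)
  also have "(k + 1) * (k + 1) * (k + 1) ^ 15 = (k + 1) ^ 17" by (simp only: mult.assoc power_Suc[symmetric]) simp
  finally have Q: "(j + 1) * lam * (lam + length tab + 4) ^ 15 <= 8 * 13 ^ 15 * (k + 1) ^ 17" .
  have "1 <= (k + 1) ^ 17" by simp
  then have "(j + 1) * lam * (lam + length tab + 4) ^ 15 + 2 <= (8 * 13 ^ 15 + 2) * (k + 1) ^ 17" using Q unfolding add_mult_distrib by linarith
  then have "length tab * ((j + 1) * lam * (lam + length tab + 4) ^ 15 + 2) <= (k + 1) * ((8 * 13 ^ 15 + 2) * (k + 1) ^ 17)"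
   using that(3) by (intro mult_le_mono) auto
  also have "... = (8 * 13 ^ 15 + 2) * ((k + 1) * (k + 1) ^ 17)" by (simp only: ac_simps)
  also have "... <= (8 * 13 ^ 15 + 2) * (k + 1) ^ 128" unfolding power_Suc[symmetric] by (intro mult_le_mono2 power_increasing) auto
  finally have R: "length tab * ((j + 1) * lam * (lam + length tab + 4) ^ 15 + 2) <= (8 * 13 ^ 15 + 2) * (k + 1) ^ 128" .
  have o: "1 <= (k + 1) ^ 128" by simp
  have "(2 ^ lam) ^ 16 + 2 + length tab * ((j + 1) * lam * (lam + length tab + 4) ^ 15 + 2) <= (8 * 13 ^ 15 + 5) * (k + 1) ^ 128"
  proof -
   obtain X Y Z where X: "(2 ^ lam) ^ 16 = X" "length tab * ((j + 1) * lam * (lam + length tab + 4) ^ 15 + 2) = Y" "(k + 1) ^ 128 = Z" by blast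
   obtain c where c: "8 * 13 ^ 15 = (c::nat)" by blast
   have "(c + 5) * Z = (c + 2) * Z + 3 * Z" by (simp add: add_mult_distrib)
   then show ?thesis using L R o unfolding X c by linarith
  qed
  moreover have "(2::nat) ^ length tab <= 2 ^ k" using that(3) by (intro power_increasing) auto
  ultimately have "2 ^ length tab * ((2 ^ lam) ^ 16 + 2 + length tab * ((j + 1) * lam * (lam + length tab + 4) ^ 15 + 2)) <= 2 ^ k * ((8 * 13 ^ 15 + 5) * (k + 1) ^ 128)"
   by (intro mult_le_mono)
  then show ?thesis by (simp only: ac_simps)
 qed
 have GT: "?G x <= ?T x" for x :: "nat \<times> bool list" by (intro mult_le_mono2 power_increasing) auto
 have "cmp ?D1 (%y. ?arg (y, tower (bases (snd y) [False, True]) (fst (fst y)))) (%y. ?G (fst y) + ?G (fst y))"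
  using cmp_app[OF f3 f2] by simp
 from cmp_app[OF this f1]
 have f: "cmp ?D (%x. ?arg ((x, ?j x), ?t x)) (%x. ?G x + (?G x + ?G x))" by simp
 have "cmp ?D (%x. solve (fst (?arg ((x, ?j x), ?t x))) (arg3 (?arg ((x, ?j x), ?t x))) (rst4 (?arg ((x, ?j x), ?t x)))) ?T"
  apply (rule cmp_le'[where K = "8 * 13 ^ 15 + 8"])
  apply (rule cmp_app[OF cmp_solve f])
  subgoal for x by (rule ok) simp
  subgoal for x
  proof -
   assume D: "?D x"
   have l: "length (arg3 (?arg ((x, ?j x), ?t x))) = fst x - ?j x" by (simp add: length_tower)
   note c = cost[of _ "?j x" "fst x" "arg3 (?arg ((x, ?j x), ?t x))", OF refl refl l]
   obtain S where S: "2 ^ length (arg3 (?arg ((x, ?j x), ?t x))) * ((2 ^ fst (?arg ((x, ?j x), ?t x))) ^ 16 + 2 + length (arg3 (?arg ((x, ?j x), ?t x))) *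
    ((fst (snd (?arg ((x, ?j x), ?t x))) + 1) * fst (?arg ((x, ?j x), ?t x)) * (fst (?arg ((x, ?j x), ?t x)) + length (arg3 (?arg ((x, ?j x), ?t x))) + 4) ^ 15 + 2)) = S" by blast
   obtain T where T: "?T x = T" by blast
   obtain d where d: "8 * 13 ^ 15 = (d::nat)" by blast
   have "S <= (d + 5) * T" using c D unfolding S[symmetric] T[symmetric] d by simp
   moreover have "?G x <= T" using GT[of x] unfolding T .
   ultimately show ?thesis unfolding S T d by (simp add: algebra_simps)
  qed
  done
 then show ?thesis by (simp add: stage_def Let_def)
qed

section \<open>The main loop\<close>

text \<open>Prints the first bit and recurs on the tail. Since \<open>does\<close> describes code
  without output, the steps of this program are traced by hand.\<close>

definition out_head :: "ins list" where
 "out_head = [IPush, IHd, IOut, ISwap, ITl, ISwap, ICons, IHd, ICall]"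

definition out_body :: "ins list" where
 "out_body = [IPush, IBr out_head []]"

lemma goes_out_body:
 "\<exists>n \<le> 20 * (length xs + 1). goes n (mstate (enc_code out_body) (enc xs) (Nd (Nd q g) s) (enc_code out_body), u)
  (mstate q Lf s g, u @ (xs :: bool list))"
proof (induction xs arbitrary: q g s u)
 case Nil
 let ?f = "enc_code out_body"
 have "goes (1 + (1 + (1 + 1))) (mstate ?f Lf (Nd (Nd q g) s) ?f, u) (mstate q Lf s g, u)"
  unfolding out_body_def
  by (rule goes_trans goes_steps(4) goes_steps(7)[of out_head "[]" "[]" Lf, unfolded if_P[OF refl]] goes_steps(11))+
 then show ?case by (intro exI[of _ "1 + (1 + (1 + 1))"]) simp
next
 case (Cons x xs)
 let ?f = "enc_code out_body"
 let ?S = "Nd (Nd (enc_code []) ?f) (Nd (Nd q g) s)"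
 obtain n where n: "n <= 20 * (length xs + 1)"
  and IH: "goes n (mstate ?f (enc xs) (Nd (Nd (enc_code []) ?f) ?S) ?f, u @ [x]) (mstate (enc_code []) Lf ?S ?f, (u @ [x]) @ xs)"
  using Cons.IH by blast
 have 1: "goes (1 + 1) (mstate ?f (enc (x # xs)) (Nd (Nd q g) s) ?f, u) (mstate (enc_code out_head) (enc (x # xs)) ?S ?f, u)"
  using goes_trans[OF goes_steps(4)[of "[IBr out_head []]" "enc (x # xs)" "Nd (Nd q g) s" ?f u]
   goes_steps(7)[of out_head "[]" "[]" "enc (x # xs)" "enc (x # xs)" "Nd (Nd q g) s" ?f u]]
  by (simp add: out_body_def)
 have xe: "(enc x \<noteq> Lf) = x" by simp
 have 2: "goes (1 + (1 + (1 + (1 + (1 + (1 + (1 + (1 + 1)))))))) (mstate (enc_code out_head) (Nd (enc x) (enc xs)) ?S ?f, u)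
  (mstate ?f (enc xs) (Nd (Nd (enc_code []) ?f) ?S) ?f, u @ [x])"
  unfolding out_head_def
  apply (rule goes_trans, rule goes_steps(4))
  apply (rule goes_trans, rule goes_steps(1))
  unfolding tcar.simps
  apply (rule goes_trans, rule goes_steps(10))
  unfolding xe
  apply (rule goes_trans, rule goes_steps(5))
  apply (rule goes_trans, rule goes_steps(2))
  unfolding tcdr.simps
  apply (rule goes_trans, rule goes_steps(5))
  apply (rule goes_trans, rule goes_steps(6))
  apply (rule goes_trans, rule goes_steps(1))
  unfolding tcar.simps
  by (rule goes_steps(9))
 have 3: "goes (1 + 1) (mstate (enc_code []) Lf ?S ?f, u @ x # xs) (mstate q Lf s g, u @ x # xs)"
  by (rule goes_trans goes_steps(11))+
 have "goes (1 + 1 + ((1 + (1 + (1 + (1 + (1 + (1 + (1 + (1 + 1)))))))) + (n + (1 + 1)))) (mstate ?f (enc (x # xs)) (Nd (Nd q g) s) ?f, u) (mstate q Lf s g, u @ x # xs)"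
  by (rule goes_trans[OF 1], unfold enc_list.simps, rule goes_trans[OF 2], rule goes_trans[OF IH, unfolded append_assoc append.simps], rule 3)
 then show ?case using n by (intro exI[of _ "1 + 1 + ((1 + (1 + (1 + (1 + (1 + (1 + (1 + (1 + 1)))))))) + (n + (1 + 1)))"]) simp
qed

lemma goes_out:
 "\<exists>n \<le> 20 * (length xs + 2). goes n (mstate (enc_code (IFix out_body # r)) (enc xs) s f, u) (mstate (enc_code r) Lf s f, u @ (xs :: bool list))"
proof -
 obtain n where n: "n <= 20 * (length xs + 1)" and g: "goes n (mstate (enc_code out_body) (enc xs) (Nd (Nd (enc_code r) f) s) (enc_code out_body), u)
  (mstate (enc_code r) Lf s f, u @ xs)" using goes_out_body by blast
 from goes_trans[OF goes_steps(8) g] n show ?thesis by (intro exI[of _ "1 + n"]) simp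
qed

primrec chunk :: "nat => bool list" where
 "chunk 0 = prefix_bits 0"
| "chunk (Suc i) = stage (i + 4) (prefix_bits i)"

text \<open>Bits leave the machine most significant first, hence the reversal of each chunk.\<close>

primrec emitted :: "nat => bool list" where
 "emitted 0 = []"
| "emitted (Suc i) = emitted i @ rev (chunk i)"

lemma emitted_Suc: "emitted (Suc i) = rev (prefix_bits i)"
 by (induction i) auto

lemma length_chunk: "length (chunk i) <= 2 ^ (i + 4)"
 by (cases i) (auto simp: length_stage power_add)

text \<open>The program is an endless recursion: print the newest chunk, compute the next stage,
  call again. Its frames pile up on the stack, which does no harm. Stage costs at least double, so
  the last one bounds the sum up to a constant.\<close>

theorem machine_output:
 "\<exists>x0 K. \<forall>i. \<exists>N. snd ((mstep machine ^^ N) (evx x0 Lf, [])) = rev (prefix_bits i) \<and> N <= K * (2 ^ (i + 5) * (i + 6) ^ 128)"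
proof -
 let ?D = "%x::nat \<times> bool list \<times> bool list. 4 <= fst x \<and> length (arg2 x) = 2 ^ fst x \<and> length (rst3 x) <= 2 ^ fst x"
 let ?T = "%x::nat \<times> bool list \<times> bool list. 2 ^ fst x * (fst x + 1) ^ 128"
 have T: "2 ^ k <= 2 ^ k * (k + 1 :: nat) ^ 128" for k by simp
 have c1: "cmp ?D (%x. rev (rst3 x)) ?T"
  apply (rule cmp_le'[where K = 1])
  apply (rule cmp_intros)+
  subgoal for x
  proof -
   assume "?D x"
   then have a: "length (rst3 x) <= 2 ^ fst x" by simp
   from order_trans[OF a T] show ?thesis by simp
  qed
  done
 have sg: "cmp ?D (%x. (x, stage (fst x) (arg2 x))) ?T"
  apply (rule cmp_le'[where K = 1])
  apply (rule cmp_Pair[OF cmp_id])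
  apply (rule cmp_app[OF cmp_stage, of _ "%x. (fst x, arg2 x)", unfolded fst_conv snd_conv])
   apply (rule cmp_intros)+
  by auto
 have nx: "cmp (%y. ?D (fst y) \<and> length (snd y) = 2 ^ fst (fst y)) (%y. (Suc (fst (fst y)), snd y @ arg2 (fst y), snd y)) (%y. ?T (fst y))"
  apply (rule cmp_le'[where K = 1])
  apply (rule cmp_intros)+
  subgoal for y
  proof -
   assume "?D (fst y) \<and> length (snd y) = 2 ^ fst (fst y)"
   then have a: "length (snd y) <= 2 ^ fst (fst y)" by simp
   from order_trans[OF a T] show ?thesis by simp
  qed
  done
 have c2: "cmp ?D (%x. (Suc (fst x), stage (fst x) (arg2 x) @ arg2 x, stage (fst x) (arg2 x))) ?T"
  apply (rule cmp_le'[where K = 2])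
  apply (rule cmp_app[OF nx sg, unfolded fst_conv snd_conv])
  subgoal for x by (simp add: length_stage)
  by simp
 obtain d1 K1 where d1: "\<And>x f. ?D x ==> \<exists>n \<le> K1 * (?T x + 1). does f d1 (enc x) (enc (rev (rst3 x))) n" using c1 by (rule cmpE) blast
 obtain d2 K2 where d2: "\<And>x f. ?D x ==> \<exists>n \<le> K2 * (?T x + 1). does f d2 (enc x) (enc (Suc (fst x), stage (fst x) (arg2 x) @ arg2 x, stage (fst x) (arg2 x))) n"
  using c2 by (rule cmpE) blast
 \<comment> \<open>\<open>IPush\<close> keeps the state while \<open>d1\<close> extracts the chunk
   to be printed; \<open>ISwap\<close> brings it back, leaving a stray \<open>Lf\<close> on the
   stack, and \<open>d2\<close> computes the successor state.\<close>
 define body where "body = IPush # d1 @ (IFix out_body # (ISwap # d2 @ [ICall]))"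
 define F where "F = enc_code body"
 define K where "K = 2 * K1 + 2 * K2 + 100"
 have iter: "\<exists>n s'. n <= K * ?T x \<and> goes n (mstate F (enc x) s F, u) (mstate F (enc (Suc (fst x), stage (fst x) (arg2 x) @ arg2 x, stage (fst x) (arg2 x))) s' F, u @ rev (rst3 x))"
  if D: "?D x" for x s u
 proof -
  obtain n1 where n1: "n1 <= K1 * (?T x + 1)" "does F d1 (enc x) (enc (rev (rst3 x))) n1" using d1[OF D] by blast
  obtain n2 where n2: "n2 <= K2 * (?T x + 1)" "does F d2 (enc x) (enc (Suc (fst x), stage (fst x) (arg2 x) @ arg2 x, stage (fst x) (arg2 x))) n2" using d2[OF D] by blast
  let ?v = "enc (Suc (fst x), stage (fst x) (arg2 x) @ arg2 x, stage (fst x) (arg2 x))"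
  let ?s = "Nd (enc x) s"
  obtain n3 where n3: "n3 <= 20 * (length (rev (rst3 x)) + 2)"
   "goes n3 (mstate (enc_code (IFix out_body # (ISwap # d2 @ [ICall]))) (enc (rev (rst3 x))) ?s F, u) (mstate (enc_code (ISwap # d2 @ [ICall])) Lf ?s F, u @ rev (rst3 x))"
   using goes_out by blast
  have 1: "goes 1 (mstate F (enc x) s F, u) (mstate (enc_code (d1 @ (IFix out_body # (ISwap # d2 @ [ICall])))) (enc x) ?s F, u)"
   unfolding F_def body_def by (rule goes_steps(4))
  have 2: "goes n1 (mstate (enc_code (d1 @ (IFix out_body # (ISwap # d2 @ [ICall])))) (enc x) ?s F, u) (mstate (enc_code (IFix out_body # (ISwap # d2 @ [ICall]))) (enc (rev (rst3 x))) ?s F, u)"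
   using n1(2) unfolding does_def by blast
  have 4: "goes 1 (mstate (enc_code (ISwap # d2 @ [ICall])) Lf ?s F, u @ rev (rst3 x)) (mstate (enc_code (d2 @ [ICall])) (enc x) (Nd Lf s) F, u @ rev (rst3 x))"
   by (rule goes_steps(5))
  have 5: "goes n2 (mstate (enc_code (d2 @ [ICall])) (enc x) (Nd Lf s) F, u @ rev (rst3 x)) (mstate (enc_code [ICall]) ?v (Nd Lf s) F, u @ rev (rst3 x))"
   using n2(2) unfolding does_def by blast
  have 6: "goes 1 (mstate (enc_code [ICall]) ?v (Nd Lf s) F, u @ rev (rst3 x)) (mstate F ?v (Nd (Nd (enc_code []) F) (Nd Lf s)) F, u @ rev (rst3 x))"
   by (rule goes_steps(9))
  have g: "goes (1 + (n1 + (n3 + (1 + (n2 + 1))))) (mstate F (enc x) s F, u) (mstate F ?v (Nd (Nd (enc_code []) F) (Nd Lf s)) F, u @ rev (rst3 x))"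
   by (rule goes_trans[OF 1 goes_trans[OF 2 goes_trans[OF n3(2) goes_trans[OF 4 goes_trans[OF 5 6]]]]])
  obtain Tx where Tx: "?T x = Tx" by blast
  have T1: "1 <= Tx" unfolding Tx[symmetric] by (simp add: Suc_le_eq)
  have a: "length (rev (rst3 x)) <= 2 ^ fst x" using D by simp
  have l: "length (rev (rst3 x)) <= Tx" using order_trans[OF a T] unfolding Tx .
  have k: "K1 * 1 <= K1 * Tx" "K2 * 1 <= K2 * Tx" using T1 by (intro mult_le_mono2; simp)+
  have n: "n1 <= K1 * Tx + K1 * 1" "n2 <= K2 * Tx + K2 * 1" using n1(1) n2(1) unfolding Tx distrib_left by auto
  have n3': "n3 <= 20 * Tx + 40" using n3(1) l by simp
  have "1 + (n1 + (n3 + (1 + (n2 + 1)))) <= 2 * (K1 * Tx) + 2 * (K2 * Tx) + 100 * Tx"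
   using k n n3' T1 by linarith
  also have "... = K * Tx" by (simp add: K_def algebra_simps)
  finally show ?thesis using g unfolding Tx by blast
 qed
 define st0 where "st0 = mstate F (enc (4 :: nat, prefix_bits 0, chunk 0)) Lf F"
 have inv: "\<exists>N s. N <= K * (2 ^ (i + 4) * (i + 5) ^ 128) \<and> goes N (st0, []) (mstate F (enc (i + 4, prefix_bits i, chunk i)) s F, emitted i)" for i
 proof (induction i)
  case 0
  have "goes 0 (st0, []) (st0, [])" by (simp add: goes_def)
  then show ?case unfolding st0_def by (intro exI[of _ 0] exI[of _ Lf]) simp
 next
  case (Suc i)
  then obtain N s where N: "N <= K * (2 ^ (i + 4) * (i + 5) ^ 128)" "goes N (st0, []) (mstate F (enc (i + 4, prefix_bits i, chunk i)) s F, emitted i)" by blast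
  let ?x = "(i + 4, prefix_bits i, chunk i)"
  have D: "?D ?x" using length_chunk[of i] by (simp add: length_prefix_bits)
  obtain n s' where n: "n <= K * ?T ?x" "goes n (mstate F (enc ?x) s F, emitted i)
   (mstate F (enc (Suc (fst ?x), stage (fst ?x) (arg2 ?x) @ arg2 ?x, stage (fst ?x) (arg2 ?x))) s' F, emitted i @ rev (rst3 ?x))"
   using iter[OF D] by blast
  have g: "goes (N + n) (st0, []) (mstate F (enc (Suc i + 4, prefix_bits (Suc i), chunk (Suc i))) s' F, emitted (Suc i))"
   using goes_trans[OF N(2) n(2)] by simp
  have "N + n <= K * (2 ^ (i + 4) * (i + 5) ^ 128) + K * (2 ^ (i + 4) * (i + 5) ^ 128)"
   using N(1) n(1) by (simp add: add.commute)
  also have "... = K * (2 ^ (Suc i + 4) * (i + 5) ^ 128)" by (simp add: power_add)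
  also have "... <= K * (2 ^ (Suc i + 4) * (Suc i + 5) ^ 128)" by (intro mult_le_mono2 power_mono) auto
  finally show ?case using g by blast
 qed
 \<comment> \<open>The RAM starts with empty memory, so the initial machine state has to be built by
   a constant expression.\<close>
 have "\<exists>x. evx x Lf = t" for t
  by (induction t) (metis evx.simps(2), metis evx.simps(3))
 then obtain x0 where x0: "evx x0 Lf = st0" by blast
 have "\<exists>N. snd ((mstep machine ^^ N) (evx x0 Lf, [])) = rev (prefix_bits i) \<and> N <= K * (2 ^ (i + 5) * (i + 6) ^ 128)" for i
 proof -
  obtain N s where N: "N <= K * (2 ^ (Suc i + 4) * (Suc i + 5) ^ 128)" "goes N (st0, []) (mstate F (enc (Suc i + 4, prefix_bits (Suc i), chunk (Suc i))) s F, emitted (Suc i))"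
   using inv[of "Suc i"] by blast
  have "Suc i + 4 = i + 5" "Suc i + 5 = i + 6" by auto
  then have "N <= K * (2 ^ (i + 5) * (i + 6) ^ 128)" using N(1) by (simp only:)
  moreover have "snd ((mstep machine ^^ N) (st0, [])) = rev (prefix_bits i)" using N(2) unfolding goes_def emitted_Suc by simp
  ultimately show ?thesis unfolding x0 by blast
 qed
 then show ?thesis by blast
qed

lemma blen_power: "x < 2 ^ m ==> blen x <= m + 1"
proof (induction m arbitrary: x)
 case 0
 then show ?case by (simp add: blen.simps)
next
 case (Suc m)
 have "x div 2 < 2 ^ m" using Suc.prems by (simp add: less_mult_imp_div_less mult.commute)
 then show ?case using Suc.IH[of "x div 2"] by (subst blen.simps) auto
qed

text \<open>The exponent 129 is the 128 of the stages plus 1 for the logarithmic cost of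
  instructions. With L = ln (n + 2) >= 1/2, i <= 2 L and 6 <= 12 L give the factor 14.\<close>

lemma log_cost_bound:
 fixes n i K C T :: nat
 assumes i: "2 ^ i <= n + 2" and T: "T <= K * (2 ^ (i + 5) * (i + 6) ^ 128)"
 shows "real (C * (T + 1) * blen (C * (T + 1))) <= real (C * (K + 1) * 32 * (C + K + 130)) * 14 ^ 129 * real (n + 2) * ln (real (n + 2)) powr 129"
proof -
 define X where "X = 2 ^ (i + 5) * (i + 6) ^ 128"
 have X1: "1 <= X" by (simp add: X_def Suc_le_eq)
 have TX: "T + 1 <= (K + 1) * X" using T X1 unfolding X_def[symmetric] by simp
 have "i + 6 < 2 ^ (i + 6)" by (rule less_exp)
 then have "(i + 6) ^ 128 <= (2 ^ (i + 6)) ^ 128" by (intro power_mono) auto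
 then have "X <= 2 ^ (i + 5) * (2 ^ (i + 6)) ^ 128" unfolding X_def by (rule mult_le_mono2)
 also have "... = 2 ^ (i + 5 + (i + 6) * 128)" by (simp only: power_mult power_add)
 finally have X2: "X <= 2 ^ (i + 5 + (i + 6) * 128)" .
 have "C * (T + 1) <= C * ((K + 1) * X)" using TX by (rule mult_le_mono2)
 also have "... <= 2 ^ C * (2 ^ (K + 1) * 2 ^ (i + 5 + (i + 6) * 128))"
  by (intro mult_le_mono less_imp_le[OF less_exp] X2)
 also have "... = 2 ^ (C + (K + 1 + (i + 5 + (i + 6) * 128)))" by (simp only: power_add)
 also have "... < 2 ^ (C + K + 129 * (i + 6) + 1)" by (rule power_strict_increasing) auto
 finally have "blen (C * (T + 1)) <= C + K + 129 * (i + 6) + 1 + 1" by (rule blen_power)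
 also have "... <= (C + K + 130) * (i + 6)" by (simp add: algebra_simps)
 finally have bl: "blen (C * (T + 1)) <= (C + K + 130) * (i + 6)" .
 have "C * (T + 1) * blen (C * (T + 1)) <= C * ((K + 1) * X) * ((C + K + 130) * (i + 6))"
  using TX bl by (intro mult_le_mono) auto
 also have "... = C * (K + 1) * (C + K + 130) * (X * (i + 6))" by (simp only: ac_simps)
 also have "X * (i + 6) = 2 ^ (i + 5) * (i + 6) ^ 129" by (simp only: X_def mult.assoc power_Suc2[symmetric]) simp
 also have "... = 32 * 2 ^ i * (i + 6) ^ 129" by (simp add: power_add)
 also have "C * (K + 1) * (C + K + 130) * (32 * 2 ^ i * (i + 6) ^ 129) <= C * (K + 1) * (C + K + 130) * (32 * (n + 2) * (i + 6) ^ 129)"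
  using i by (intro mult_le_mono2 mult_le_mono1)
 also have "... = C * (K + 1) * 32 * (C + K + 130) * (n + 2) * (i + 6) ^ 129" by (simp only: ac_simps)
 finally have A: "real (C * (T + 1) * blen (C * (T + 1))) <= real (C * (K + 1) * 32 * (C + K + 130) * (n + 2) * (i + 6) ^ 129)"
  by (simp only: of_nat_le_iff)
 define L where "L = ln (real (n + 2))"
 \<comment> \<open>From ln x <= x - 1 at x = 1/2.\<close>
 have l2: "1 / 2 <= ln (2::real)" using ln_le_minus_one[of "1 / 2 :: real"] by (simp add: ln_div)
 have "ln 2 <= L" unfolding L_def by (subst ln_le_cancel_iff) auto
 then have L1: "1 / 2 <= L" using l2 by linarith
 have "real i * ln 2 = ln (2 ^ i)" by (simp add: ln_realpow)
 also have "... <= L" unfolding L_def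
 proof (subst ln_le_cancel_iff)
  have "real (2 ^ i) <= real (n + 2)" using i by (simp only: of_nat_le_iff)
  then show "(2::real) ^ i <= real (n + 2)" by simp
 qed auto
 finally have "real i * (1 / 2) <= L" using l2 mult_left_mono[OF l2, of "real i"] by linarith
 then have i6: "real (i + 6) <= 14 * L" using L1 by simp
 have "real (i + 6) ^ 129 <= (14 * L) ^ 129" using i6 by (rule power_mono) simp
 also have "... = 14 ^ 129 * L powr 129" using L1 by (simp add: power_mult_distrib powr_numeral)
 finally have B: "real (i + 6) ^ 129 <= 14 ^ 129 * L powr 129" .
 have "real (C * (K + 1) * 32 * (C + K + 130) * (n + 2) * (i + 6) ^ 129) = real (C * (K + 1) * 32 * (C + K + 130)) * real (n + 2) * real (i + 6) ^ 129"
  by (simp only: of_nat_mult of_nat_power)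
 also have "... <= real (C * (K + 1) * 32 * (C + K + 130)) * real (n + 2) * (14 ^ 129 * L powr 129)"
  using B by (intro mult_left_mono) auto
 finally show ?thesis using A unfolding L_def by (simp only: ac_simps)
qed

theorem mainTheorem11:
  shows "\<exists>(P :: instr list) (z :: real) (c :: real) (C :: real).
           0 \<le> z \<and> z < 1 \<and> absolutely_normal z \<and>
           (\<forall>n. \<exists>t. n < length (outp (run P t)) \<and>
                  outp (run P t) ! n = (digit 2 z n = 1) \<and>
                  real (cost P t) \<le> C * real (n + 2) * ln (real (n + 2)) powr c)"
proof -
 obtain z where z: "0 <= z" "z < 1" "encodes z" using encodes_exists by blast
 obtain x0 K where m: "\<And>i. \<exists>N. snd ((mstep machine ^^ N) (evx x0 Lf, [])) = rev (prefix_bits i) \<and> N <= K * (2 ^ (i + 5) * (i + 6) ^ 128)"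
  using machine_output by blast
 obtain P C where P: "\<And>T. \<exists>t. outp (run P t) = snd ((mstep machine ^^ T) (evx x0 Lf, [])) \<and> cost P t <= C * (T + 1) * blen (C * (T + 1))"
  using ram_simulation[of machine x0] by blast
 have "\<exists>t. n < length (outp (run P t)) \<and> outp (run P t) ! n = (digit 2 z n = 1) \<and>
  real (cost P t) <= real (C * (K + 1) * 32 * (C + K + 130)) * 14 ^ 129 * real (n + 2) * ln (real (n + 2)) powr 129" for n
 proof -
  \<comment> \<open>The prefix of index i has 2^(i+4) > n bits, so bit n has been printed; 2^i <= n
    + 2 keeps the running time nearly linear in n.\<close>
  define i where "i = mlog 2 (n + 2)"
  have i: "2 ^ i <= n + 2" "n + 2 < 2 ^ Suc i" using mlog_bounds[of 2 "n + 2"] by (auto simp: i_def)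
  have n: "n < 2 ^ (i + 4)" using i(2) by (simp add: power_add)
  obtain T where T: "snd ((mstep machine ^^ T) (evx x0 Lf, [])) = rev (prefix_bits i)" "T <= K * (2 ^ (i + 5) * (i + 6) ^ 128)" using m by blast
  obtain t where t: "outp (run P t) = rev (prefix_bits i)" "cost P t <= C * (T + 1) * blen (C * (T + 1))" using P[of T] T(1) by auto
  have "real (cost P t) <= real (C * (T + 1) * blen (C * (T + 1)))" using t(2) by (simp only: of_nat_le_iff)
  also note log_cost_bound[OF i(1) T(2)]
  finally show ?thesis using t(1) n encodes_digits[OF z(1,3) n] by (intro exI[of _ t]) (simp add: length_prefix_bits)
 qed
 then show ?thesis using z encodes_absolutely_normal by blast
qed

end
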